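(* There exist nonflat complete nonorientable minimal surfaces $\widehat{X}\colon\widehat{\Sigma}\to\mathbf{R}^{4}$ such that each of the components $\hat{g}_{1}$, $\hat{g}_{2}$ of the generalized Gauss map $\widehat{G}=(\hat{g}_{1},\hat{g}_{2})\colon\widehat{\Sigma}\to\mathbf{RP}^{2}\times\mathbf{RP}^{2}$ is nonconstant and omits $2$ distinct points in $\mathbf{RP}^{2}$.
   Context: A nonorientable minimal surface in $\mathbf{R}^4$ is a conformal minimal immersion $\widehat{X}\colon\widehat{\Sigma}\to\mathbf{R}^{4}$ of a (connected) nonorientable Riemann surface $\widehat{\Sigma}$. It is complete if the induced metric is complete, and nonflat if the Gaussian curvature of the induced metric is not identically zero. Let $\pi\colon\Sigma\to\widehat{\Sigma}$ be the orientable conformal double cover, with $\Sigma$ a Riemann surface, let $I\colon\Sigma\to\Sigma$ be the associated antiholomorphic deck transformation of order two (without fixed points), and let $X=(x^1,x^2,x^3,x^4):=\widehat{X}\circ\pi\colon\Sigma\to\mathbf{R}^4$, a conformal minimal immersion. For a local complex coordinate $z=u+\sqrt{-1}v$ put $\partial=(\partial/\partial u-\sqrt{-1}\,\partial/\partial v)/2$ and $\phi_i:=\partial x^{i}\,dz$ ($i=1,2,3,4$); these are holomorphic $1$-forms on $\Sigma$. Set $$\omega=\phi_1-\sqrt{-1}\phi_2,\qquad g_1=\frac{\phi_3+\sqrt{-1}\phi_4}{\phi_1-\sqrt{-1}\phi_2},\qquad g_2=\frac{-\phi_3+\sqrt{-1}\phi_4}{\phi_1-\sqrt{-1}\phi_2},$$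 where $g_1,g_2$ are meromorphic functions on $\Sigma$, i.e. holomorphic maps to the Riemann sphere $\overline{\mathbf{C}}=\mathbf{C}\cup\{\infty\}$. The induced metric of $X$ is $ds^2=(1+|g_1|^2)(1+|g_2|^2)|\omega|^2$. Since $I^{*}\phi_j=\overline{\phi_j}$, one has $g_k\circ I=-1/\overline{g_k}$ for $k=1,2$. Identify $\mathbf{RP}^2$ with $\overline{\mathbf{C}}/\langle I_0\rangle$, where $I_0(z)=-1/\bar z$ is the antipodal map, and let $\pi_0\colon\overline{\mathbf{C}}\to\mathbf{RP}^2$ be the natural projection. Then there are unique maps $\hat g_k\colon\widehat{\Sigma}\to\mathbf{RP}^2$ with $\hat g_k\circ\pi=\pi_0\circ g_k$ ($k=1,2$), and $\widehat G=(\hat g_1,\hat g_2)$ is called the generalized Gauss map of $\widehat X(\widehat\Sigma)$. A map omits a point if it never attains it. *)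

theory Defs
  imports "HOL-Complex_Analysis.Complex_Analysis"
begin

section \<open>Surfaces with charts\<close>

text \<open>
  Surfaces are abstract topologies with an atlas. A chart is a pair \<open>(U, \<psi>)\<close>, where \<open>\<psi>\<close> is
  relevant on \<open>U\<close> only.
\<close>

type_synonym 'a chart = "'a set \<times> ('a \<Rightarrow> complex)"

definition chart_on :: "'a topology \<Rightarrow> 'a chart \<Rightarrow> bool" where
  "chart_on T c \<longleftrightarrow>
     openin T (fst c) \<and> open (snd c ` fst c) \<and>
     homeomorphic_map (subtopology T (fst c)) (top_of_set (snd c ` fst c)) (snd c)"

definition chart_inv :: "'a chart \<Rightarrow> complex \<Rightarrow> 'a" where
  "chart_inv c = the_inv_into (fst c) (snd c)"

definition surface :: "'a topology \<Rightarrow> 'a chart set \<Rightarrow> bool" where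
  "surface T A \<longleftrightarrow>
     topspace T \<noteq> {} \<and> Hausdorff_space T \<and> second_countable T \<and> connected_space T \<and>
     (\<forall>c\<in>A. chart_on T c) \<and> (\<Union>c\<in>A. fst c) = topspace T"

definition antiholomorphic_on :: "(complex \<Rightarrow> complex) \<Rightarrow> complex set \<Rightarrow> bool" where
  "antiholomorphic_on f S \<longleftrightarrow> (\<lambda>z. cnj (f z)) holomorphic_on S"

definition dianalytic_on :: "(complex \<Rightarrow> complex) \<Rightarrow> complex set \<Rightarrow> bool" where
  "dianalytic_on f S \<longleftrightarrow>
     (\<forall>z\<in>S. \<exists>W. open W \<and> z \<in> W \<and> W \<subseteq> S \<and> (f holomorphic_on W \<or> antiholomorphic_on f W))"

text \<open>
  \<open>P\<close> holds for all coordinate representations of \<open>f\<close>, on the set where they make sense.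
  For \<open>f = id\<close> these are the coordinate changes.
\<close>

definition in_charts ::
  "((complex \<Rightarrow> complex) \<Rightarrow> complex set \<Rightarrow> bool) \<Rightarrow> 'a chart set \<Rightarrow> 'b chart set \<Rightarrow> ('a \<Rightarrow> 'b) \<Rightarrow> bool"
  where
  "in_charts P A B f \<longleftrightarrow>
     (\<forall>c\<in>A. \<forall>d\<in>B. P (snd d \<circ> f \<circ> chart_inv c) (snd c ` {p \<in> fst c. f p \<in> fst d}))"

definition Riemann_surface :: "'a topology \<Rightarrow> 'a chart set \<Rightarrow> bool" where
  "Riemann_surface T A \<longleftrightarrow> surface T A \<and> in_charts (\<lambda>f S. f holomorphic_on S) A A id"

definition dianalytic_surface :: "'a topology \<Rightarrow> 'a chart set \<Rightarrow> bool" where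
  "dianalytic_surface T A \<longleftrightarrow> surface T A \<and> in_charts dianalytic_on A A id"

text \<open>
  Nonorientable: the dianalytic (that is, conformal) structure is not induced by any
  holomorphic atlas.
\<close>

definition nonorientable_Riemann_surface :: "'a topology \<Rightarrow> 'a chart set \<Rightarrow> bool" where
  "nonorientable_Riemann_surface T A \<longleftrightarrow>
     dianalytic_surface T A \<and>
     \<not> (\<exists>B. Riemann_surface T B \<and> in_charts dianalytic_on A B id)"


section \<open>The orientable double cover\<close>

text \<open>The library's \<open>covering_space\<close> concerns subsets of topological type classes only.\<close>

definition covering_map :: "'a topology \<Rightarrow> 'b topology \<Rightarrow> ('a \<Rightarrow> 'b) \<Rightarrow> bool" where
  "covering_map T T' \<pi> \<longleftrightarrow>
     continuous_map T T' \<pi> \<and> \<pi> ` topspace T = topspace T' \<and>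
     (\<forall>q\<in>topspace T'. \<exists>V. openin T' V \<and> q \<in> V \<and>
        (\<exists>\<W>. \<Union>\<W> = {p \<in> topspace T. \<pi> p \<in> V} \<and> pairwise disjnt \<W> \<and>
             (\<forall>W\<in>\<W>. openin T W \<and>
                homeomorphic_map (subtopology T W) (subtopology T' V) \<pi>)))"

definition orientable_double_cover ::
  "'a topology \<Rightarrow> 'a chart set \<Rightarrow> 'b topology \<Rightarrow> 'b chart set \<Rightarrow> ('a \<Rightarrow> 'b) \<Rightarrow> ('a \<Rightarrow> 'a) \<Rightarrow> bool"
  where
  "orientable_double_cover T A T' A' \<pi> I \<longleftrightarrow>
     Riemann_surface T A \<and>
     covering_map T T' \<pi> \<and> in_charts dianalytic_on A A' \<pi> \<and>
     continuous_map T T I \<and> in_charts antiholomorphic_on A A I \<and>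
     (\<forall>p\<in>topspace T. I p \<noteq> p \<and> I (I p) = p \<and>
        {q \<in> topspace T. \<pi> q = \<pi> p} = {p, I p})"


section \<open>Conformal minimal immersions\<close>

definition pdu :: "(complex \<Rightarrow> 'b::real_normed_vector) \<Rightarrow> complex \<Rightarrow> 'b" where
  "pdu F z = vector_derivative (\<lambda>t. F (z + of_real t)) (at 0)"

definition pdv :: "(complex \<Rightarrow> 'b::real_normed_vector) \<Rightarrow> complex \<Rightarrow> 'b" where
  "pdv F z = vector_derivative (\<lambda>t. F (z + \<i> * of_real t)) (at 0)"

primrec Ck_on :: "nat \<Rightarrow> (complex \<Rightarrow> 'b::real_normed_vector) \<Rightarrow> complex set \<Rightarrow> bool" where
  "Ck_on 0 F S \<longleftrightarrow> continuous_on S F"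
| "Ck_on (Suc k) F S \<longleftrightarrow> F differentiable_on S \<and> Ck_on k (pdu F) S \<and> Ck_on k (pdv F) S"

definition smooth_on :: "(complex \<Rightarrow> 'b::real_normed_vector) \<Rightarrow> complex set \<Rightarrow> bool" where
  "smooth_on F S \<longleftrightarrow> (\<forall>k. Ck_on k F S)"

definition laplacian :: "(complex \<Rightarrow> 'b::real_normed_vector) \<Rightarrow> complex \<Rightarrow> 'b" where
  "laplacian F z = pdu (pdu F) z + pdv (pdv F) z"

definition conformal_immersion_on :: "(complex \<Rightarrow> real ^ 4) \<Rightarrow> complex set \<Rightarrow> bool" where
  "conformal_immersion_on F S \<longleftrightarrow>
     smooth_on F S \<and>
     (\<forall>z\<in>S. norm (pdu F z) = norm (pdv F z) \<and> pdu F z \<bullet> pdv F z = 0 \<and> pdu F z \<noteq> 0)"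

text \<open>
  The remaining notions are for conformal immersions \<open>F\<close>, whose induced metric is
  \<open>\<lambda>\<^sup>2 |dz|\<^sup>2\<close> with \<open>\<lambda> = conformal_factor F\<close>.
\<close>

definition conformal_factor :: "(complex \<Rightarrow> real ^ 4) \<Rightarrow> complex \<Rightarrow> real" where
  "conformal_factor F z = norm (pdu F z)"

definition normal_part :: "(complex \<Rightarrow> real ^ 4) \<Rightarrow> complex \<Rightarrow> real ^ 4 \<Rightarrow> real ^ 4" where
  "normal_part F z w =
     w - ((w \<bullet> pdu F z) / (conformal_factor F z)\<^sup>2) *\<^sub>R pdu F z
       - ((w \<bullet> pdv F z) / (conformal_factor F z)\<^sup>2) *\<^sub>R pdv F z"

text \<open>Half the trace, with respect to the induced metric, of the second fundamental form.\<close>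

definition mean_curvature_vector :: "(complex \<Rightarrow> real ^ 4) \<Rightarrow> complex \<Rightarrow> real ^ 4" where
  "mean_curvature_vector F z =
     (1 / (2 * (conformal_factor F z)\<^sup>2)) *\<^sub>R
       (normal_part F z (pdu (pdu F) z) + normal_part F z (pdv (pdv F) z))"

definition Gaussian_curvature :: "(complex \<Rightarrow> real ^ 4) \<Rightarrow> complex \<Rightarrow> real" where
  "Gaussian_curvature F z =
     - laplacian (\<lambda>w. ln (conformal_factor F w)) z / (conformal_factor F z)\<^sup>2"

definition conformal_minimal_immersion :: "'a chart set \<Rightarrow> ('a \<Rightarrow> real ^ 4) \<Rightarrow> bool" where
  "conformal_minimal_immersion A X \<longleftrightarrow>
     (\<forall>c\<in>A. conformal_immersion_on (X \<circ> chart_inv c) (snd c ` fst c) \<and>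
        (\<forall>z\<in>snd c ` fst c. mean_curvature_vector (X \<circ> chart_inv c) z = 0))"

definition nonflat :: "'a chart set \<Rightarrow> ('a \<Rightarrow> real ^ 4) \<Rightarrow> bool" where
  "nonflat A X \<longleftrightarrow> (\<exists>c\<in>A. \<exists>z\<in>snd c ` fst c. Gaussian_curvature (X \<circ> chart_inv c) z \<noteq> 0)"

definition nonorientable_minimal_surface ::
  "'a topology \<Rightarrow> 'a chart set \<Rightarrow> ('a \<Rightarrow> real ^ 4) \<Rightarrow> bool" where
  "nonorientable_minimal_surface T A X \<longleftrightarrow>
     nonorientable_Riemann_surface T A \<and> conformal_minimal_immersion A X"


section \<open>Completeness of the induced metric\<close>

definition piecewise_C1_curve :: "'a topology \<Rightarrow> 'a chart set \<Rightarrow> (real \<Rightarrow> 'a) \<Rightarrow> bool" where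
  "piecewise_C1_curve T A \<gamma> \<longleftrightarrow>
     pathin T \<gamma> \<and>
     (\<exists>S. finite S \<and>
        (\<forall>c\<in>A. (snd c \<circ> \<gamma>) C1_differentiable_on ({t \<in> {0..1}. \<gamma> t \<in> fst c} - S)))"

text \<open>
  The induced metric is the pull-back of the Euclidean one, so the induced norm of \<open>\<gamma>' t\<close> is the
  Euclidean norm of \<open>(X \<circ> \<gamma>)' t\<close>. Lengths are extended reals because \<open>\<gamma>'\<close> may be unbounded at
  the finitely many break points.
\<close>

definition induced_length :: "('a \<Rightarrow> real ^ 4) \<Rightarrow> (real \<Rightarrow> 'a) \<Rightarrow> ennreal" where
  "induced_length X \<gamma> =
     (\<integral>\<^sup>+t\<in>{0..1}. ennreal (norm (vector_derivative (X \<circ> \<gamma>) (at t))) \<partial>lborel)"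

definition induced_dist ::
  "'a topology \<Rightarrow> 'a chart set \<Rightarrow> ('a \<Rightarrow> real ^ 4) \<Rightarrow> 'a \<Rightarrow> 'a \<Rightarrow> ennreal" where
  "induced_dist T A X p q =
     (INF \<gamma>\<in>{\<gamma>. piecewise_C1_curve T A \<gamma> \<and> \<gamma> 0 = p \<and> \<gamma> 1 = q}. induced_length X \<gamma>)"

definition complete_induced_metric ::
  "'a topology \<Rightarrow> 'a chart set \<Rightarrow> ('a \<Rightarrow> real ^ 4) \<Rightarrow> bool" where
  "complete_induced_metric T A X \<longleftrightarrow>
     (\<forall>\<sigma> :: nat \<Rightarrow> 'a.
        range \<sigma> \<subseteq> topspace T \<and>
        (\<forall>e>0. \<exists>N. \<forall>m\<ge>N. \<forall>n\<ge>N. induced_dist T A X (\<sigma> m) (\<sigma> n) < e) \<longrightarrow>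
        (\<exists>p\<in>topspace T. (\<lambda>n. induced_dist T A X (\<sigma> n) p) \<longlonglongrightarrow> 0))"


section \<open>The Riemann sphere and the real projective plane\<close>

datatype csphere = Fin complex | Infty

primrec antipode :: "csphere \<Rightarrow> csphere" where
  "antipode (Fin z) = (if z = 0 then Infty else Fin (- 1 / cnj z))"
| "antipode Infty = Fin 0"

text \<open>Points of the projective plane are the orbits of the antipodal map.\<close>

definition RP2_proj :: "csphere \<Rightarrow> csphere set" where
  "RP2_proj x = {x, antipode x}"

definition RP2 :: "csphere set set" where
  "RP2 = range RP2_proj"


section \<open>The generalized Gauss map\<close>

text \<open>The value at \<open>z\<close> of a meromorphic function, removable singularities being removed.\<close>

definition sphere_value :: "(complex \<Rightarrow> complex) \<Rightarrow> complex \<Rightarrow> csphere" where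
  "sphere_value f z = (if is_pole f z then Infty else Fin (remove_sings f z))"

text \<open>The coefficient of \<open>dz\<close> in \<open>\<phi>\<^sub>i\<close>, in the chart \<open>c\<close>.\<close>

definition phi :: "('a \<Rightarrow> real ^ 4) \<Rightarrow> 'a chart \<Rightarrow> 4 \<Rightarrow> complex \<Rightarrow> complex" where
  "phi X c i z =
     (of_real (pdu (\<lambda>w. X (chart_inv c w) $ i) z)
        - \<i> * of_real (pdv (\<lambda>w. X (chart_inv c w) $ i) z)) / 2"

definition gauss1 :: "('a \<Rightarrow> real ^ 4) \<Rightarrow> 'a chart \<Rightarrow> 'a \<Rightarrow> csphere" where
  "gauss1 X c p =
     sphere_value (\<lambda>z. (phi X c 3 z + \<i> * phi X c 4 z) / (phi X c 1 z - \<i> * phi X c 2 z)) (snd c p)"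

definition gauss2 :: "('a \<Rightarrow> real ^ 4) \<Rightarrow> 'a chart \<Rightarrow> 'a \<Rightarrow> csphere" where
  "gauss2 X c p =
     sphere_value (\<lambda>z. (- phi X c 3 z + \<i> * phi X c 4 z) / (phi X c 1 z - \<i> * phi X c 2 z)) (snd c p)"

text \<open>
  \<open>(h1, h2)\<close> is the generalized Gauss map of \<open>X\<close>, where \<open>\<pi>\<close> is the orientable double cover, with
  atlas \<open>A\<close> of the total space. The values \<open>gauss1\<close>, \<open>gauss2\<close> do not depend on the chart.
\<close>

definition generalized_Gauss_map ::
  "'a chart set \<Rightarrow> ('a \<Rightarrow> 'b) \<Rightarrow> ('b \<Rightarrow> real ^ 4) \<Rightarrow>
     ('b \<Rightarrow> csphere set) \<times> ('b \<Rightarrow> csphere set) \<Rightarrow> bool" where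
  "generalized_Gauss_map A \<pi> X G \<longleftrightarrow>
     (\<forall>c\<in>A. \<forall>p\<in>fst c.
        fst G (\<pi> p) = RP2_proj (gauss1 (X \<circ> \<pi>) c p) \<and>
        snd G (\<pi> p) = RP2_proj (gauss2 (X \<circ> \<pi>) c p))"

definition omits_two_points :: "'a topology \<Rightarrow> ('a \<Rightarrow> csphere set) \<Rightarrow> bool" where
  "omits_two_points T h \<longleftrightarrow>
     (\<exists>a\<in>RP2. \<exists>b\<in>RP2. a \<noteq> b \<and> a \<notin> h ` topspace T \<and> b \<notin> h ` topspace T)"

end

theory Submission
  imports Defs
begin

text \<open>
  The surface lies in the hyperplane \<open>x3 = 0\<close>, and its two Gauss maps are one and the same
  function \<open>g\<close>. On the orientable cover the derivative of the null curve is the vector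
  \<open>((1 + g\<^sup>2) \<eta>, \<i> (1 - g\<^sup>2) \<eta>, 0, - 2 \<i> g \<eta>)\<close>, and the induced metric is \<open>(1 + |g|\<^sup>2) |\<eta>| |dw|\<close>. The cover
  is an annulus \<open>exp (- b) < |w| < exp b\<close>, the deck transformation is the glide \<open>w \<mapsto> - 1 / cnj w\<close>,
  and the quotient is a Moebius band. Three things have to be arranged: \<open>g\<close> commutes with the
  glide and omits \<open>0\<close>, \<open>\<infinity>\<close>, \<open>1\<close> and \<open>-1\<close>, that is, two antipodal pairs; the real parts of the primitives are
  single-valued and invariant under the glide; and the metric grows at least like the hyperbolic
  metric of the annulus, which is complete.

  The Gauss map comes from the theory of elliptic functions. Let \<open>a = e1 - e3\<close> and \<open>c = e2 - e3\<close> be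
  the differences of the values of the Weierstrass function at the half-periods of the lattice
  \<open>\<int> + \<tau> \<int>\<close>. They vanish nowhere on the upper half-plane, and neither does \<open>a - c\<close>
  (\<open>wp_diff_nonzero\<close>), so \<open>g = sqrt (a / c)\<close> omits the four points. With \<open>\<eta> = c d\<tau>\<close> the metric is
  \<open>(|a| + |c|) |d\<tau>|\<close>. Since \<open>a\<close> and \<open>c\<close> have weight two, \<open>Im \<tau> (|a| + |c| + |a - c|)\<close> is invariant under the modular
  group; it has a positive lower bound (\<open>modular_density_lower_bound\<close>), because \<open>a\<close> has a nonzero limit at the
  cusp. Thus \<open>(|a| + |c|) |d\<tau>|\<close> dominates a multiple of the hyperbolic metric \<open>|d\<tau>| / Im \<tau>\<close>. The glide reflection
  \<open>\<tau> \<mapsto> 1 / (cnj \<tau> + 2)\<close> of the half-plane exchanges \<open>a\<close> and \<open>c\<close>, up to conjugation and the weight, and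
  it reverses the sign of \<open>sqrt (a c)\<close> (\<open>sqrt_of_product_glide\<close>); hence it takes \<open>g\<close> to \<open>- 1 / cnj g\<close>.
  A Moebius map and an exponential turn this glide reflection into \<open>z \<mapsto> cnj z + \<pi>\<close> on a strip
  (\<open>strip_weierstrass_data\<close>), and \<open>w = exp (\<i> z)\<close> turns that into the glide of the annulus.

  The periods are closed by multiplying \<open>\<eta>\<close> by a function \<open>h\<close> without zeros that satisfies
  \<open>h (cnj z + \<pi>) = cnj (h z)\<close>. This changes neither \<open>g\<close> nor the symmetry, and \<open>|h|\<close> is bounded below, so the
  growth of the metric survives. By the symmetry, only the three numbers \<open>\<integral> Re (h \<phi>_j)\<close>, taken over
  the segment from \<open>0\<close> to \<open>\<pi>\<close>, have to vanish. For \<open>h = exp (\<Sum> u_j p_j + \<i> K cos)\<close> they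
  are the coordinates of the integral of the real vector \<open>V = Re (exp (\<i> K cos) \<phi>)\<close> with the positive weight
  \<open>exp (u \<cdot> p)\<close>. If \<open>K\<close> is large, the curve \<open>V\<close> enters every open half-space (\<open>rotation_spreads_directions\<close>). For
  \<open>p = V\<close> the weighted integral then points outwards at every \<open>u\<close> of large norm, so by Brouwer's theorem it
  vanishes for some \<open>u\<close> (\<open>exponential_weight_closes\<close>); Stone-Weierstrass replaces \<open>V\<close> by entire functions \<open>p_j\<close>.

  For completeness, three functions on the annulus that are invariant under the glide are used: the sum and the product of
  the two points of an orbit, and the exhaustion function \<open>- ln (b\<^sup>2 - ln\<^sup>2 |w|)\<close>. Along a curve each of them changes
  by at most a constant times the induced length. On a Cauchy sequence the last one stays bounded, which
  confines the sequence to a compact part, and the first two converge, which determines the limiting orbit. The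
  Moebius band is not orientable because an orienting atlas would split the annulus into the
  two open sets where the projection is holomorphic and where it is antiholomorphic, and the glide
  exchanges these.
\<close>

section \<open>Lattice sums\<close>

definition lattice_point :: "complex \<Rightarrow> int \<times> int \<Rightarrow> complex" where
  "lattice_point \<tau> p = of_int (fst p) + of_int (snd p) * \<tau>"

text \<open>
  A substitute for the modulus of the lattice point with coordinates \<open>p\<close> that does not depend on \<open>\<tau>\<close>; for \<open>\<tau>\<close> in
  a compact set and \<open>p\<close> away from the origin the two are comparable.
\<close>

definition lattice_weight :: "int \<times> int \<Rightarrow> real" where
  "lattice_weight p = 1 + \<bar>of_int (fst p)\<bar> + \<bar>of_int (snd p)\<bar>"

lemma lattice_weight_ge_1: "lattice_weight p \<ge> 1"
  by (simp add: lattice_weight_def)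

lemma summable_on_int_shift_powr: "(\<lambda>m::int. (1 + \<bar>of_int m\<bar>) powr (-(3/2)) :: real) summable_on UNIV"
proof -
  let ?f = "\<lambda>m::int. (1 + \<bar>of_int m\<bar>) powr (-(3/2)) :: real"
  have "summable (\<lambda>n. real n powr (-(3/2)))"
    by (subst summable_real_powr_iff) simp
  then have "summable (\<lambda>n. real (Suc n) powr (-(3/2)))"
    by (subst summable_Suc_iff)
  then have s: "summable (\<lambda>n. (1 + real n) powr (-(3/2)))"
    by (simp add: add.commute)
  have N: "(\<lambda>n::nat. (1 + real n) powr (-(3/2))) summable_on UNIV"
    using s by (subst summable_on_UNIV_nonneg_real_iff) auto
  have 1: "?f summable_on (range int)"
    by (subst summable_on_reindex) (use N in \<open>auto simp: o_def\<close>)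
  have 2: "?f summable_on (range (\<lambda>n. - int n))"
    by (subst summable_on_reindex) (use N in \<open>auto simp: o_def inj_on_def\<close>)
  have "UNIV = range int \<union> range (\<lambda>n. - int n)"
  proof (intro equalityI subsetI)
    fix m :: int
    show "m \<in> range int \<union> range (\<lambda>n. - int n)" by (cases m rule: int_cases2) auto
  qed auto
  then show ?thesis using summable_on_union[OF 1 2] by simp
qed

text \<open>
  The weight is at least each of \<open>1 + |m|\<close> and \<open>1 + |n|\<close>, so its third power is at least the product of their powers with exponent
  \<open>3/2\<close>; the double series reduces to a product of two simple ones.
\<close>

lemma summable_on_lattice_weight: "(\<lambda>p. 1 / lattice_weight p ^ 3) summable_on UNIV"
proof -
  define f :: "int \<Rightarrow> real" where "f m = (1 + \<bar>of_int m\<bar>) powr (-(3/2))" for m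
  have f: "f summable_on UNIV" "\<And>m. f m \<ge> 0"
    using summable_on_int_shift_powr by (auto simp: f_def[abs_def])
  have "(\<lambda>p. f (fst p) * f (snd p)) summable_on (UNIV \<times> UNIV)"
  proof (rule summable_on_SigmaI)
    fix x :: int
    show "((\<lambda>y. f (fst (x, y)) * f (snd (x, y))) has_sum f x * infsum f UNIV) UNIV"
      using has_sum_cmult_right[OF has_sum_infsum[OF f(1)]] by simp
  qed (use f in \<open>auto intro: summable_on_cmult_left\<close>)
  then have prod: "(\<lambda>p. f (fst p) * f (snd p)) summable_on UNIV" by simp
  have "1 / lattice_weight p ^ 3 \<le> f (fst p) * f (snd p)" for p
  proof -
    define x y where "x = 1 + \<bar>real_of_int (fst p)\<bar>" and "y = 1 + \<bar>real_of_int (snd p)\<bar>"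
    define w where "w = lattice_weight p"
    have w: "x \<le> w" "y \<le> w" "x \<ge> 1" "y \<ge> 1" by (auto simp: w_def x_def y_def lattice_weight_def)
    have "f (fst p) * f (snd p) = x powr (-(3/2)) * y powr (-(3/2))" by (simp add: f_def x_def y_def)
    also have "\<dots> \<ge> w powr (-(3/2)) * w powr (-(3/2))"
      using w by (intro mult_mono powr_mono2') auto
    also have "w powr (-(3/2)) * w powr (-(3/2)) = w powr (-3)" by (simp flip: powr_add)
    also have "\<dots> = 1 / w ^ 3" using w by (simp add: powr_minus_divide)
    finally show ?thesis by (simp add: w_def)
  qed
  then show ?thesis
    by (rule summable_on_comparison_test[OF prod]) (simp add: lattice_weight_def)
qed

lemma complex_lattice_lower_bound:
  assumes "Im \<tau> > 0"
  shows "\<bar>y\<bar> * Im \<tau> \<le> cmod (of_real x + of_real y * \<tau>)"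
    and "\<bar>x\<bar> * Im \<tau> \<le> cmod \<tau> * cmod (of_real x + of_real y * \<tau>)"
proof -
  define u where "u = of_real x + of_real y * \<tau>"
  have Re_u: "Re u = x + y * Re \<tau>" and Im_u: "Im u = y * Im \<tau>" by (simp_all add: u_def)
  have "Im (cnj \<tau> * u) = Re \<tau> * (y * Im \<tau>) - Im \<tau> * (x + y * Re \<tau>)"
    by (simp only: times_complex.simps Re_u Im_u cnj.simps)
  also have "\<dots> = - (x * Im \<tau>)" by algebra
  finally have Im_v: "Im (cnj \<tau> * u) = - (x * Im \<tau>)" .
  have "\<bar>Im u\<bar> = \<bar>y\<bar> * Im \<tau>" "\<bar>Im (cnj \<tau> * u)\<bar> = \<bar>x\<bar> * Im \<tau>"
    using assms by (simp_all only: Im_u Im_v abs_mult abs_minus_cancel abs_of_pos)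
  then show "\<bar>y\<bar> * Im \<tau> \<le> cmod (of_real x + of_real y * \<tau>)"
    "\<bar>x\<bar> * Im \<tau> \<le> cmod \<tau> * cmod (of_real x + of_real y * \<tau>)"
    using abs_Im_le_cmod[of u] abs_Im_le_cmod[of "cnj \<tau> * u"] unfolding u_def norm_mult complex_mod_cnj by linarith+
qed

text \<open>
  Outside a finite set of indices the modulus of the lattice point exceeds the bound of \<open>Z\<close>, and grows linearly with the weight; for
  each of the remaining indices the distance attains a positive minimum on \<open>K\<close>. Letting the lattice
  vary with \<open>t\<close> is what later gives holomorphy in \<open>\<tau>\<close>.
\<close>

lemma lattice_separation:
  fixes T Z :: "complex \<Rightarrow> complex"
  assumes K: "compact K" "K \<noteq> {}" and cont: "continuous_on K T" "continuous_on K Z"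
    and T: "\<And>t. t \<in> K \<Longrightarrow> Im (T t) > 0"
    and Z: "\<And>t p. t \<in> K \<Longrightarrow> p \<in> A \<Longrightarrow> Z t \<noteq> lattice_point (T t) p"
  shows "\<exists>\<eta>>0. \<forall>t\<in>K. \<forall>p\<in>A. \<eta> * lattice_weight p \<le> cmod (Z t - lattice_point (T t) p)"
proof -
  have "continuous_on K (\<lambda>t. Im (T t))" using cont by (intro continuous_intros)
  then obtain t0 where t0: "t0 \<in> K" "\<And>t. t \<in> K \<Longrightarrow> Im (T t0) \<le> Im (T t)"
    using continuous_attains_inf[OF K] by blast
  define y0 where "y0 = Im (T t0)"
  have y0: "y0 > 0" "\<And>t. t \<in> K \<Longrightarrow> y0 \<le> Im (T t)" using t0 T by (auto simp: y0_def)
  obtain B1 where B1: "\<And>t. t \<in> K \<Longrightarrow> cmod (T t) \<le> B1"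
    using compact_imp_bounded[OF compact_continuous_image[OF cont(1) K(1)]] by (auto simp: bounded_iff)
  obtain B2 where B2: "\<And>t. t \<in> K \<Longrightarrow> cmod (Z t) \<le> B2"
    using compact_imp_bounded[OF compact_continuous_image[OF cont(2) K(1)]] by (auto simp: bounded_iff)
  have B1p: "B1 > 0" using B1[OF t0(1)] T[OF t0(1)] abs_Im_le_cmod[of "T t0"] by linarith
  have B2p: "B2 \<ge> 0" using B2[OF t0(1)] norm_ge_zero order_trans by blast
  \<comment> \<open>the modulus of a lattice point is at least c times the sum of the moduli of its coordinates\<close>
  define c where "c = y0 / (1 + B1)"
  have c: "c > 0" using y0 B1p by (simp add: c_def)
  have low: "c * (lattice_weight p - 1) \<le> cmod (lattice_point (T t) p)" if "t \<in> K" for t p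
  proof -
    define l where "l = cmod (lattice_point (T t) p)"
    define x y where "x = real_of_int (fst p)" and "y = real_of_int (snd p)"
    have le: "lattice_point (T t) p = of_real x + of_real y * T t"
      by (simp add: lattice_point_def x_def y_def)
    have "\<bar>y\<bar> * y0 \<le> \<bar>y\<bar> * Im (T t)" using y0(2)[OF that] by (intro mult_left_mono) auto
    also have "\<dots> \<le> l" using complex_lattice_lower_bound(1)[OF T[OF that]] by (simp add: l_def le)
    finally have 1: "\<bar>y\<bar> * y0 \<le> l" .
    have "\<bar>x\<bar> * y0 \<le> \<bar>x\<bar> * Im (T t)" using y0(2)[OF that] by (intro mult_left_mono) auto
    also have "\<dots> \<le> cmod (T t) * l" using complex_lattice_lower_bound(2)[OF T[OF that]] by (simp add: l_def le)
    also have "\<dots> \<le> B1 * l" using B1[OF that] by (intro mult_right_mono) (auto simp: l_def)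
    finally have "(\<bar>x\<bar> + \<bar>y\<bar>) * y0 \<le> (1 + B1) * l" using 1 by (simp add: algebra_simps)
    then show ?thesis using B1p by (simp add: c_def lattice_weight_def x_def y_def l_def field_simps)
  qed
  \<comment> \<open>the indices for which the lower bound c (weight - 1) - B2 is not yet at least c weight / 2\<close>
  define F where "F = {p\<in>A. c * (lattice_weight p - 1) / 2 < B2 + c}"
  have "finite F"
  proof -
    define N where "N = \<lceil>2 * (B2 + c) / c\<rceil>"
    have "F \<subseteq> {-N..N} \<times> {-N..N}"
    proof
      fix p assume "p \<in> F"
      then have "\<bar>real_of_int (fst p)\<bar> + \<bar>real_of_int (snd p)\<bar> < 2 * (B2 + c) / c"
        using c by (simp add: F_def lattice_weight_def field_simps)
      also have "\<dots> \<le> of_int N" by (simp add: N_def)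
      finally show "p \<in> {-N..N} \<times> {-N..N}" by (cases p) auto
    qed
    then show ?thesis by (rule finite_subset) auto
  qed
  moreover have "\<exists>\<eta>>0. \<forall>t\<in>K. \<eta> * lattice_weight p \<le> cmod (Z t - lattice_point (T t) p)" if "p \<in> F" for p
  proof -
    have "continuous_on K (\<lambda>t. cmod (Z t - lattice_point (T t) p))"
      unfolding lattice_point_def using cont by (intro continuous_intros)
    then obtain t1 where t1: "t1 \<in> K" "\<And>t. t \<in> K \<Longrightarrow> cmod (Z t1 - lattice_point (T t1) p) \<le> cmod (Z t - lattice_point (T t) p)"
      using continuous_attains_inf[OF K] by blast
    have "cmod (Z t1 - lattice_point (T t1) p) > 0" using Z[OF t1(1)] that by (simp add: F_def)
    then show ?thesis using t1(2) lattice_weight_ge_1[of p]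
      by (intro exI[of _ "cmod (Z t1 - lattice_point (T t1) p) / lattice_weight p"]) (auto intro!: divide_pos_pos)
  qed
  ultimately have "\<exists>\<eta>>0. \<forall>p\<in>F. \<forall>t\<in>K. \<eta> * lattice_weight p \<le> cmod (Z t - lattice_point (T t) p)"
  proof (induction F rule: finite_induct)
    case (insert p F)
    then obtain e1 e2 where e: "e1 > 0" "e2 > 0" "\<forall>q\<in>F. \<forall>t\<in>K. e1 * lattice_weight q \<le> cmod (Z t - lattice_point (T t) q)"
      "\<forall>t\<in>K. e2 * lattice_weight p \<le> cmod (Z t - lattice_point (T t) p)" by (metis insertCI)
    have "min e1 e2 * lattice_weight q \<le> e1 * lattice_weight q" "min e1 e2 * lattice_weight q \<le> e2 * lattice_weight q" for q
      using lattice_weight_ge_1[of q] by (auto intro!: mult_right_mono)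
    then show ?case using e
      by (intro exI[of _ "min e1 e2"] conjI ballI) (simp, metis insertE order_trans)
  qed (auto intro: exI[of _ 1])
  then obtain \<eta> where \<eta>: "\<eta> > 0" "\<forall>p\<in>F. \<forall>t\<in>K. \<eta> * lattice_weight p \<le> cmod (Z t - lattice_point (T t) p)" by blast
  define \<eta>' where "\<eta>' = min \<eta> (c / 2)"
  have "\<eta>' * lattice_weight p \<le> cmod (Z t - lattice_point (T t) p)" if "t \<in> K" "p \<in> A" for t p
  proof (cases "p \<in> F")
    case True
    have "\<eta>' * lattice_weight p \<le> \<eta> * lattice_weight p" using lattice_weight_ge_1[of p]
      by (intro mult_right_mono) (auto simp: \<eta>'_def)
    then show ?thesis using \<eta>(2) True that by force
  next
    case False
    have "\<eta>' * lattice_weight p \<le> c / 2 * lattice_weight p" using lattice_weight_ge_1[of p]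
      by (intro mult_right_mono) (auto simp: \<eta>'_def)
    also have "\<dots> \<le> c * (lattice_weight p - 1) - B2" using False that c B2p by (simp add: F_def field_simps)
    also have "\<dots> \<le> cmod (lattice_point (T t) p) - cmod (Z t)" using low[OF that(1), of p] B2[OF that(1)] by simp
    also have "\<dots> \<le> cmod (Z t - lattice_point (T t) p)" by (metis norm_minus_commute norm_triangle_ineq2)
    finally show ?thesis .
  qed
  moreover have "\<eta>' > 0" using \<eta> c by (simp add: \<eta>'_def)
  ultimately show ?thesis by blast
qed

text \<open>
  The terms of the series for the difference of two values of the Weierstrass function. For differences
  the series converges absolutely without the usual correction terms.
\<close>

definition wp_term :: "complex \<Rightarrow> complex \<Rightarrow> complex \<Rightarrow> int \<times> int \<Rightarrow> complex" where
  "wp_term \<tau> z w p = 1 / (z - lattice_point \<tau> p)\<^sup>2 - 1 / (w - lattice_point \<tau> p)\<^sup>2"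

lemma norm_inverse_square_diff:
  fixes u v :: complex
  assumes "\<eta> \<le> cmod u" "\<eta> \<le> cmod v" "\<eta> > 0"
  shows "cmod (1 / u\<^sup>2 - 1 / v\<^sup>2) \<le> 2 * cmod (u - v) / \<eta> ^ 3"
proof -
  have nz: "u \<noteq> 0" "v \<noteq> 0" using assms by auto
  have "1 / u\<^sup>2 - 1 / v\<^sup>2 = (v - u) * (1 / (u * v\<^sup>2) + 1 / (u\<^sup>2 * v))"
    using nz by (simp add: field_simps power2_eq_square)
  then have "cmod (1 / u\<^sup>2 - 1 / v\<^sup>2) = cmod (u - v) * cmod (1 / (u * v\<^sup>2) + 1 / (u\<^sup>2 * v))"
    by (simp add: norm_mult norm_minus_commute)
  also have "\<dots> \<le> cmod (u - v) * (1 / \<eta> ^ 3 + 1 / \<eta> ^ 3)"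
  proof (intro mult_left_mono order.trans[OF norm_triangle_ineq] add_mono)
    have uv: "\<eta> * \<eta> \<le> cmod u * cmod v" using assms by (intro mult_mono) auto
    have "\<eta> * \<eta> * \<eta> \<le> cmod u * cmod v * cmod v" "\<eta> * \<eta> * \<eta> \<le> cmod u * cmod v * cmod u"
      using assms uv by (auto intro!: mult_mono)
    then have "\<eta> ^ 3 \<le> cmod u * (cmod v)\<^sup>2" "\<eta> ^ 3 \<le> (cmod u)\<^sup>2 * cmod v"
      by (simp_all add: power3_eq_cube power2_eq_square mult_ac)
    then show "cmod (1 / (u * v\<^sup>2)) \<le> 1 / \<eta> ^ 3" "cmod (1 / (u\<^sup>2 * v)) \<le> 1 / \<eta> ^ 3"
      using assms nz by (auto simp: norm_divide norm_mult norm_power intro!: frac_le)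
  qed auto
  finally show ?thesis by (simp add: mult.commute)
qed

text \<open>
  The Weierstrass M-test with the majorant \<open>lattice_weight p ^ -3\<close>, obtained from \<open>lattice_separation\<close>. The
  lattice and both points may depend on \<open>t\<close>, so this covers holomorphy in the argument and in \<open>\<tau>\<close>; the
  index set \<open>A\<close> permits leaving out the term with the pole.
\<close>

lemma wp_sum_holomorphic:
  assumes S: "open S" and hol: "T holomorphic_on S" "Z holomorphic_on S" "W holomorphic_on S"
    and T: "\<And>t. t \<in> S \<Longrightarrow> Im (T t) > 0"
    and Z: "\<And>t p. t \<in> S \<Longrightarrow> p \<in> A \<Longrightarrow> Z t \<noteq> lattice_point (T t) p"
    and W: "\<And>t p. t \<in> S \<Longrightarrow> p \<in> A \<Longrightarrow> W t \<noteq> lattice_point (T t) p"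
  shows "(\<lambda>t. \<Sum>\<^sub>\<infinity>p\<in>A. wp_term (T t) (Z t) (W t) p) holomorphic_on S"
    and "\<And>t. t \<in> S \<Longrightarrow> (\<lambda>p. cmod (wp_term (T t) (Z t) (W t) p)) summable_on A"
proof -
  have main: "\<exists>r>0. ball t0 r \<subseteq> S \<and> (\<lambda>t. \<Sum>\<^sub>\<infinity>p\<in>A. wp_term (T t) (Z t) (W t) p) holomorphic_on ball t0 r
     \<and> (\<lambda>p. cmod (wp_term (T t0) (Z t0) (W t0) p)) summable_on A" if t0: "t0 \<in> S" for t0
  proof -
    obtain r where r: "r > 0" "cball t0 r \<subseteq> S" using S t0 open_contains_cball by blast
    let ?K = "cball t0 r"
    have cont: "continuous_on ?K T" "continuous_on ?K Z" "continuous_on ?K W"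
      using hol r by (auto intro: holomorphic_on_imp_continuous_on continuous_on_subset)
    obtain e1 where e1: "e1 > 0" "\<forall>t\<in>?K. \<forall>p\<in>A. e1 * lattice_weight p \<le> cmod (Z t - lattice_point (T t) p)"
      using lattice_separation[OF compact_cball _ cont(1,2), of A] T Z r by force
    obtain e2 where e2: "e2 > 0" "\<forall>t\<in>?K. \<forall>p\<in>A. e2 * lattice_weight p \<le> cmod (W t - lattice_point (T t) p)"
      using lattice_separation[OF compact_cball _ cont(1,3), of A] T W r by force
    define e where "e = min e1 e2"
    have e: "e > 0" using e1 e2 by (simp add: e_def)
    have eZ: "e * lattice_weight p \<le> cmod (Z t - lattice_point (T t) p)" "e * lattice_weight p \<le> cmod (W t - lattice_point (T t) p)"
      if "t \<in> ?K" "p \<in> A" for t p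
    proof -
      have "e * lattice_weight p \<le> e1 * lattice_weight p" "e * lattice_weight p \<le> e2 * lattice_weight p"
        using lattice_weight_ge_1[of p] by (auto simp: e_def intro!: mult_right_mono)
      then show "e * lattice_weight p \<le> cmod (Z t - lattice_point (T t) p)" "e * lattice_weight p \<le> cmod (W t - lattice_point (T t) p)"
        using e1(2) e2(2) that by force+
    qed
    have "continuous_on ?K (\<lambda>t. Z t - W t)" using cont by (intro continuous_intros)
    then obtain B where B: "\<And>t. t \<in> ?K \<Longrightarrow> cmod (Z t - W t) \<le> B"
      using compact_imp_bounded[OF compact_continuous_image[OF _ compact_cball]] by (force simp: bounded_iff)
    define M where "M p = 2 * B / e ^ 3 * (1 / lattice_weight p ^ 3)" for p
    have bound: "norm (wp_term (T t) (Z t) (W t) p) \<le> M p" if "p \<in> A" "t \<in> ?K" for p t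
    proof -
      have "norm (wp_term (T t) (Z t) (W t) p) \<le> 2 * cmod (Z t - W t) / (e * lattice_weight p) ^ 3"
        unfolding wp_term_def using norm_inverse_square_diff[OF eZ[OF that(2,1)]] e lattice_weight_ge_1[of p] by simp
      also have "\<dots> \<le> 2 * B / (e * lattice_weight p) ^ 3"
        using B[OF that(2)] e lattice_weight_ge_1[of p] by (intro divide_right_mono) auto
      finally show ?thesis by (simp add: M_def power_mult_distrib)
    qed
    have sumM: "M summable_on A" unfolding M_def
      by (intro summable_on_cmult_right summable_on_subset[OF summable_on_lattice_weight]) auto
    have ul: "uniform_limit ?K (\<lambda>X t. \<Sum>p\<in>X. wp_term (T t) (Z t) (W t) p)
         (\<lambda>t. \<Sum>\<^sub>\<infinity>p\<in>A. wp_term (T t) (Z t) (W t) p) (finite_subsets_at_top A)"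
      by (rule Weierstrass_m_test_general[where f = "\<lambda>p t. wp_term (T t) (Z t) (W t) p", OF bound sumM])
    have ev: "\<forall>\<^sub>F X in finite_subsets_at_top A. continuous_on ?K (\<lambda>t. \<Sum>p\<in>X. wp_term (T t) (Z t) (W t) p) \<and>
         (\<lambda>t. \<Sum>p\<in>X. wp_term (T t) (Z t) (W t) p) holomorphic_on ball t0 r"
    proof (rule eventually_finite_subsets_at_top_weakI)
      fix X assume X: "finite X" "X \<subseteq> A"
      have "(\<lambda>t. \<Sum>p\<in>X. wp_term (T t) (Z t) (W t) p) holomorphic_on S"
        unfolding wp_term_def lattice_point_def
        by (intro holomorphic_intros hol) (use Z W X in \<open>auto simp: lattice_point_def\<close>)
      then show "continuous_on ?K (\<lambda>t. \<Sum>p\<in>X. wp_term (T t) (Z t) (W t) p) \<and>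
         (\<lambda>t. \<Sum>p\<in>X. wp_term (T t) (Z t) (W t) p) holomorphic_on ball t0 r"
        using r ball_subset_cball by (meson continuous_on_subset holomorphic_on_imp_continuous_on holomorphic_on_subset order_trans)
    qed
    have "(\<lambda>t. \<Sum>\<^sub>\<infinity>p\<in>A. wp_term (T t) (Z t) (W t) p) holomorphic_on ball t0 r"
      using holomorphic_uniform_limit[OF ev ul] by simp
    moreover have "(\<lambda>p. cmod (wp_term (T t0) (Z t0) (W t0) p)) summable_on A"
      by (rule Infinite_Sum.abs_summable_on_comparison_test'[OF sumM]) (use r bound in auto)
    ultimately show ?thesis using r ball_subset_cball by blast
  qed
  then show "\<And>t. t \<in> S \<Longrightarrow> (\<lambda>p. cmod (wp_term (T t) (Z t) (W t) p)) summable_on A" by blast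
  show "(\<lambda>t. \<Sum>\<^sub>\<infinity>p\<in>A. wp_term (T t) (Z t) (W t) p) holomorphic_on S"
  proof (rule holomorphic_onI)
    fix t assume "t \<in> S"
    then obtain r where "r > 0" "(\<lambda>t. \<Sum>\<^sub>\<infinity>p\<in>A. wp_term (T t) (Z t) (W t) p) holomorphic_on ball t r"
      using main by blast
    then have "(\<lambda>t. \<Sum>\<^sub>\<infinity>p\<in>A. wp_term (T t) (Z t) (W t) p) field_differentiable at t"
      by (intro holomorphic_on_imp_differentiable_at[of _ "ball t r"]) auto
    then show "(\<lambda>t. \<Sum>\<^sub>\<infinity>p\<in>A. wp_term (T t) (Z t) (W t) p) field_differentiable at t within S"
      by (rule field_differentiable_at_within)
  qed
qed

section \<open>Differences of values of the Weierstrass function\<close>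

definition wp_diff :: "complex \<Rightarrow> complex \<Rightarrow> complex \<Rightarrow> complex" where
  "wp_diff \<tau> z w = (\<Sum>\<^sub>\<infinity>p. wp_term \<tau> z w p)"

definition off_lattice :: "complex \<Rightarrow> complex \<Rightarrow> bool" where
  "off_lattice \<tau> z \<longleftrightarrow> (\<forall>p. z \<noteq> lattice_point \<tau> p)"

lemma lattice_point_add: "lattice_point \<tau> p + lattice_point \<tau> q = lattice_point \<tau> (fst p + fst q, snd p + snd q)"
  and lattice_point_minus: "- lattice_point \<tau> p = lattice_point \<tau> (- fst p, - snd p)"
  by (simp_all add: lattice_point_def algebra_simps)

lemma off_lattice_minus: "off_lattice \<tau> z \<Longrightarrow> off_lattice \<tau> (- z)"
  unfolding off_lattice_def by (metis lattice_point_minus add.inverse_inverse)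

lemma off_lattice_add: "off_lattice \<tau> z \<Longrightarrow> off_lattice \<tau> (z + lattice_point \<tau> q)"
  unfolding off_lattice_def
  by (metis add_diff_cancel_right' diff_conv_add_uminus lattice_point_add lattice_point_minus)

lemma off_lattice_1: "off_lattice \<tau> z \<Longrightarrow> off_lattice \<tau> (z + 1)"
  and off_lattice_\<tau>: "off_lattice \<tau> z \<Longrightarrow> off_lattice \<tau> (z + \<tau>)"
  using off_lattice_add[of \<tau> z "(1, 0)"] off_lattice_add[of \<tau> z "(0, 1)"]
  by (simp_all add: lattice_point_def)

lemma lattice_coordinates_unique:
  assumes "Im \<tau> > 0" "of_real x + of_real y * \<tau> = of_real x' + of_real y' * \<tau>"
  shows "x = x'" "y = y'"
proof -
  have "y * Im \<tau> = y' * Im \<tau>" using arg_cong[OF assms(2), of Im] by simp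
  then show "y = y'" using assms(1) by simp
  then show "x = x'" using assms(2) by simp
qed

lemma off_lattice_coordinates:
  assumes "Im \<tau> > 0" "x \<notin> \<int> \<or> y \<notin> \<int>"
  shows "off_lattice \<tau> (of_real x + of_real y * \<tau>)"
  unfolding off_lattice_def
proof (intro allI notI)
  fix p assume "of_real x + of_real y * \<tau> = lattice_point \<tau> p"
  then have "of_real x + of_real y * \<tau> = of_real (of_int (fst p)) + of_real (of_int (snd p)) * \<tau>"
    by (simp add: lattice_point_def)
  from lattice_coordinates_unique[OF assms(1) this] assms(2) show False by auto
qed

lemma half_notin_Ints: "(1/2 :: real) \<notin> \<int>"
proof
  assume "(1/2 :: real) \<in> \<int>"
  then obtain n :: int where n: "1/2 = real_of_int n" by (auto elim: Ints_cases)
  then have "real_of_int (2 * n) = of_int 1" by simp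
  then have "2 * n = 1" by (subst (asm) of_int_eq_iff)
  then show False by presburger
qed

lemma off_lattice_half:
  assumes "Im \<tau> > 0"
  shows "off_lattice \<tau> (1/2)" "off_lattice \<tau> (\<tau>/2)" "off_lattice \<tau> ((1 + \<tau>)/2)"
  using off_lattice_coordinates[OF assms, of "1/2" 0] off_lattice_coordinates[OF assms, of 0 "1/2"]
    off_lattice_coordinates[OF assms, of "1/2" "1/2"] half_notin_Ints
  by (simp_all add: add_divide_distrib)

lemma summable_wp_term:
  assumes "Im \<tau> > 0" "off_lattice \<tau> z" "off_lattice \<tau> w"
  shows "wp_term \<tau> z w summable_on A"
proof -
  have "(\<lambda>p. cmod (wp_term \<tau> z w p)) summable_on UNIV"
    using wp_sum_holomorphic(2)[of UNIV "\<lambda>_. \<tau>" "\<lambda>_. z" "\<lambda>_. w" UNIV 0] assms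
    by (auto simp: off_lattice_def)
  then have "wp_term \<tau> z w summable_on UNIV" by (rule abs_summable_summable)
  then show ?thesis by (rule summable_on_subset) auto
qed

lemma wp_diff_trans:
  assumes "Im \<tau> > 0" "off_lattice \<tau> z" "off_lattice \<tau> w" "off_lattice \<tau> v"
  shows "wp_diff \<tau> z w + wp_diff \<tau> w v = wp_diff \<tau> z v"
proof -
  have "wp_diff \<tau> z w + wp_diff \<tau> w v = (\<Sum>\<^sub>\<infinity>p. wp_term \<tau> z w p + wp_term \<tau> w v p)"
    unfolding wp_diff_def using assms by (intro infsum_add[symmetric] summable_wp_term)
  then show ?thesis by (simp add: wp_diff_def wp_term_def)
qed

lemma wp_diff_swap: "wp_diff \<tau> w z = - wp_diff \<tau> z w"
proof -
  have "wp_term \<tau> w z = (\<lambda>p. - wp_term \<tau> z w p)" by (rule ext) (simp add: wp_term_def)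
  then show ?thesis unfolding wp_diff_def by (simp add: infsum_uminus)
qed

lemma wp_diff_minus_self: "wp_diff \<tau> (- z) z = 0"
proof -
  have "wp_diff \<tau> (- z) z = (\<Sum>\<^sub>\<infinity>p. - wp_term \<tau> (- z) z p)"
    unfolding wp_diff_def
  proof (rule infsum_reindex_bij_witness[of _ "\<lambda>p. (- fst p, - snd p)" "\<lambda>p. (- fst p, - snd p)"])
    fix p :: "int \<times> int"
    have "lattice_point \<tau> (- fst p, - snd p) = - lattice_point \<tau> p" by (simp add: lattice_point_minus)
    moreover have "(- z - l)\<^sup>2 = (z + l)\<^sup>2" "(- z + l)\<^sup>2 = (z - l)\<^sup>2" for l
      by (simp_all add: power2_eq_square algebra_simps)
    ultimately show "- wp_term \<tau> (- z) z (- fst p, - snd p) = wp_term \<tau> (- z) z p"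
      by (simp add: wp_term_def)
  qed auto
  also have "\<dots> = - wp_diff \<tau> (- z) z" unfolding wp_diff_def by (rule infsum_uminus)
  finally show ?thesis by simp
qed

lemma wp_diff_even:
  assumes "Im \<tau> > 0" "off_lattice \<tau> z" "off_lattice \<tau> w"
  shows "wp_diff \<tau> (- z) w = wp_diff \<tau> z w"
  using wp_diff_trans[OF assms(1) off_lattice_minus[OF assms(2)] assms(2,3)] wp_diff_minus_self[of \<tau> z] by simp

lemma filterlim_symmetric_intervals:
  "filterlim (\<lambda>n. {- int n..int n}) (finite_subsets_at_top UNIV) sequentially"
  unfolding filterlim_finite_subsets_at_top
proof (intro allI impI)
  fix X :: "int set" assume X: "finite X \<and> X \<subseteq> UNIV"
  then obtain N where N: "\<And>x. x \<in> X \<Longrightarrow> \<bar>x\<bar> \<le> N"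
    by (metis finite_imageI finite_int_iff_bounded_le image_eqI atMost_iff subset_iff abs_ge_self)
  show "\<forall>\<^sub>F n in sequentially. finite {- int n..int n} \<and> X \<subseteq> {- int n..int n} \<and> {- int n..int n} \<subseteq> UNIV"
    using eventually_ge_at_top[of "nat N"]
  proof eventually_elim
    case (elim n)
    then have "N \<le> int n" by linarith
    then show ?case using N by fastforce
  qed
qed

lemma sum_int_telescope:
  fixes f :: "int \<Rightarrow> 'a::ab_group_add"
  shows "(\<Sum>m\<in>{- int n..int n}. f (m - 1) - f m) = f (- int n - 1) - f (int n)"
proof (induction n)
  case (Suc n)
  have "{- int (Suc n)..int (Suc n)} = insert (- int (Suc n)) (insert (int (Suc n)) {- int n..int n})" by auto
  moreover have "- int (Suc n) - 1 = - int n - 2" "- int (Suc n) = - int n - 1" "int (Suc n) - 1 = int n" by simp_all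
  ultimately show ?case using Suc by (simp only: sum.insert finite_insert finite_atLeastAtMost_int) (simp add: algebra_simps)
qed simp

text \<open>
  A summable family may be summed along the symmetric intervals, where this one telescopes.
\<close>

lemma infsum_int_telescope:
  fixes f :: "int \<Rightarrow> 'a::real_normed_vector"
  assumes "(\<lambda>m. f (m - 1) - f m) summable_on UNIV"
    and "(\<lambda>n. f (int n)) \<longlonglongrightarrow> 0" "(\<lambda>n. f (- int n - 1)) \<longlonglongrightarrow> 0"
  shows "((\<lambda>m. f (m - 1) - f m) has_sum 0) UNIV"
proof -
  obtain S where S: "((\<lambda>m. f (m - 1) - f m) has_sum S) UNIV" using assms(1) by (auto simp: summable_on_def)
  then have "(\<lambda>n. \<Sum>m\<in>{- int n..int n}. f (m - 1) - f m) \<longlonglongrightarrow> S"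
    unfolding has_sum_def by (rule filterlim_compose[OF _ filterlim_symmetric_intervals])
  then have "(\<lambda>n. f (- int n - 1) - f (int n)) \<longlonglongrightarrow> S" by (simp add: sum_int_telescope)
  moreover have "(\<lambda>n. f (- int n - 1) - f (int n)) \<longlonglongrightarrow> 0 - 0" by (intro tendsto_intros assms)
  ultimately have "S = 0" using LIMSEQ_unique by fastforce
  then show ?thesis using S by simp
qed

lemma tendsto_inverse_square_int:
  "(\<lambda>n. 1 / (z - of_int (int n))\<^sup>2) \<longlonglongrightarrow> (0::complex)" "(\<lambda>n. 1 / (z - of_int (- int n - 1))\<^sup>2) \<longlonglongrightarrow> (0::complex)"
proof -
  have sq: "(\<lambda>n. 1 / (c + of_nat n)\<^sup>2) \<longlonglongrightarrow> (0::complex)" for c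
  proof -
    have "filterlim (\<lambda>n. c + (of_nat n :: complex)) at_infinity sequentially"
      by (rule tendsto_add_filterlim_at_infinity[OF tendsto_const tendsto_of_nat])
    from Limits.filterlim_power_at_infinity[OF this, of 2]
    have "filterlim (\<lambda>n. (c + (of_nat n :: complex))\<^sup>2) at_infinity sequentially" by simp
    then show ?thesis by (rule tendsto_divide_0[OF tendsto_const])
  qed
  have "(z - of_int (int n))\<^sup>2 = (- z + of_nat n)\<^sup>2" "(z - of_int (- int n - 1))\<^sup>2 = (z + 1 + of_nat n)\<^sup>2" for n
    by (simp_all add: power2_eq_square algebra_simps)
  then show "(\<lambda>n. 1 / (z - of_int (int n))\<^sup>2) \<longlonglongrightarrow> 0" "(\<lambda>n. 1 / (z - of_int (- int n - 1))\<^sup>2) \<longlonglongrightarrow> 0"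
    using sq[of "- z"] sq[of "z + 1"] by (simp_all only:)
qed

text \<open>
  Summed along the rows parallel to the real axis, the series telescopes.
\<close>

lemma wp_diff_add_1_self:
  assumes "Im \<tau> > 0" "off_lattice \<tau> z"
  shows "wp_diff \<tau> (z + 1) z = 0"
proof -
  define h where "h n m = wp_term \<tau> (z + 1) z (m, n)" for n m
  have s: "wp_term \<tau> (z + 1) z summable_on UNIV" by (intro summable_wp_term assms off_lattice_1)
  have "(\<lambda>x. wp_term \<tau> (z + 1) z (prod.swap x)) summable_on UNIV"
    using s by (subst summable_on_reindex_bij_betw[where g = prod.swap and B = UNIV]) (auto simp: bij_betw_def)
  then have hs: "(\<lambda>(n, m). h n m) summable_on (UNIV \<times> UNIV)"
    by (simp add: h_def case_prod_unfold prod.swap_def)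
  have row: "((\<lambda>n m. h n m) n has_sum 0) UNIV" for n
  proof -
    define f where "f m = 1 / ((z - of_int n * \<tau>) - of_int m)\<^sup>2" for m
    have hf: "h n m = f (m - 1) - f m" for m
      by (simp add: h_def wp_term_def lattice_point_def f_def algebra_simps)
    have "h n summable_on UNIV" using summable_on_SigmaD1[OF hs, of n] by simp
    then show ?thesis
      unfolding hf using infsum_int_telescope[of f] tendsto_inverse_square_int[of "z - of_int n * \<tau>"]
      by (simp add: f_def hf[abs_def])
  qed
  have "infsum (h n) UNIV = 0" for n using infsumI[OF row[of n]] by simp
  then have "infsum (\<lambda>n. infsum (h n) UNIV) UNIV = 0" by simp
  then have "infsum (\<lambda>m. infsum (\<lambda>n. h n m) UNIV) UNIV = 0" using infsum_swap_banach[OF hs] by simp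
  moreover have "infsum (\<lambda>m. infsum (\<lambda>n. h n m) UNIV) UNIV = wp_diff \<tau> (z + 1) z"
    unfolding h_def wp_diff_def using infsum_Sigma_banach[of "wp_term \<tau> (z + 1) z" UNIV "\<lambda>_. UNIV"] s by simp
  ultimately show ?thesis by simp
qed

text \<open>
  Division by \<open>\<tau>\<close> maps the lattice \<open>\<int> + \<tau> \<int>\<close> onto the lattice of \<open>- 1 / \<tau>\<close>, and the terms have degree \<open>-2\<close>.
\<close>

lemma wp_diff_S:
  assumes "\<tau> \<noteq> 0"
  shows "wp_diff (- 1 / \<tau>) (z / \<tau>) (w / \<tau>) = \<tau>\<^sup>2 * wp_diff \<tau> z w"
proof -
  have "wp_diff (- 1 / \<tau>) (z / \<tau>) (w / \<tau>) = (\<Sum>\<^sub>\<infinity>p. \<tau>\<^sup>2 * wp_term \<tau> z w p)"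
    unfolding wp_diff_def
  proof (rule infsum_reindex_bij_witness[of _ "\<lambda>p. (snd p, - fst p)" "\<lambda>p. (- snd p, fst p)"])
    fix p :: "int \<times> int"
    have "u / \<tau> - lattice_point (- 1 / \<tau>) p = (u - lattice_point \<tau> (- snd p, fst p)) / \<tau>" for u
      using assms by (simp add: lattice_point_def field_simps)
    then show "\<tau>\<^sup>2 * wp_term \<tau> z w (- snd p, fst p) = wp_term (- 1 / \<tau>) (z / \<tau>) (w / \<tau>) p"
      by (simp add: wp_term_def power_divide right_diff_distrib)
  qed auto
  then show ?thesis by (simp add: wp_diff_def infsum_cmult_right')
qed

lemma wp_diff_T: "wp_diff (\<tau> + 1) z w = wp_diff \<tau> z w"
  unfolding wp_diff_def
proof (rule infsum_reindex_bij_witness[of _ "\<lambda>p. (fst p - snd p, snd p)" "\<lambda>p. (fst p + snd p, snd p)"])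
  fix p :: "int \<times> int"
  have "lattice_point (\<tau> + 1) p = lattice_point \<tau> (fst p + snd p, snd p)"
    by (simp add: lattice_point_def algebra_simps)
  then show "wp_term \<tau> z w (fst p + snd p, snd p) = wp_term (\<tau> + 1) z w p" by (simp add: wp_term_def)
qed auto

lemma wp_diff_cnj: "wp_diff (- cnj \<tau>) (cnj z) (cnj w) = cnj (wp_diff \<tau> z w)"
  unfolding wp_diff_def infsum_cnj[symmetric]
proof (rule infsum_reindex_bij_witness[of _ "\<lambda>p. (fst p, - snd p)" "\<lambda>p. (fst p, - snd p)"])
  fix p :: "int \<times> int"
  have "lattice_point (- cnj \<tau>) p = cnj (lattice_point \<tau> (fst p, - snd p))"
    by (simp add: lattice_point_def)
  then show "cnj (wp_term \<tau> z w (fst p, - snd p)) = wp_term (- cnj \<tau>) (cnj z) (cnj w) p"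
    by (simp add: wp_term_def)
qed auto

lemma wp_diff_add_1:
  assumes "Im \<tau> > 0" "off_lattice \<tau> z" "off_lattice \<tau> w"
  shows "wp_diff \<tau> (z + 1) w = wp_diff \<tau> z w"
  using wp_diff_trans[OF assms(1) off_lattice_1[OF assms(2)] assms(2,3)] wp_diff_add_1_self[OF assms(1,2)] by simp

lemma Im_S_pos: "Im \<tau> > 0 \<Longrightarrow> Im (- 1 / \<tau>) > 0"
proof -
  assume a: "Im \<tau> > 0"
  have "Im (- 1 / \<tau>) = Im \<tau> / ((Re \<tau>)\<^sup>2 + (Im \<tau>)\<^sup>2)" by (simp add: Im_divide)
  moreover have "(Re \<tau>)\<^sup>2 + (Im \<tau>)\<^sup>2 > 0" using a by (simp add: sum_power2_gt_zero_iff)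
  ultimately show ?thesis using a by simp
qed

lemma off_lattice_S:
  assumes "\<tau> \<noteq> 0" "off_lattice \<tau> z"
  shows "off_lattice (- 1 / \<tau>) (z / \<tau>)"
  unfolding off_lattice_def
proof (intro allI notI)
  fix p assume "z / \<tau> = lattice_point (- 1 / \<tau>) p"
  then have "z = lattice_point \<tau> (- snd p, fst p)"
    using assms(1) by (simp add: lattice_point_def field_simps)
  then show False using assms(2) by (auto simp: off_lattice_def)
qed

text \<open>
  For the lattice divided by \<open>\<tau>\<close> this is the period \<open>1\<close>, so that the inversion replaces a second telescoping argument.
\<close>

lemma wp_diff_add_\<tau>:
  assumes "Im \<tau> > 0" "off_lattice \<tau> z" "off_lattice \<tau> w"
  shows "wp_diff \<tau> (z + \<tau>) w = wp_diff \<tau> z w"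
proof -
  have t0: "\<tau> \<noteq> 0" using assms(1) by auto
  have "\<tau>\<^sup>2 * wp_diff \<tau> (z + \<tau>) w = wp_diff (- 1 / \<tau>) (z / \<tau> + 1) (w / \<tau>)"
    using wp_diff_S[OF t0, of "z + \<tau>" w] t0 by (simp add: add_divide_distrib)
  also have "\<dots> = wp_diff (- 1 / \<tau>) (z / \<tau>) (w / \<tau>)"
    by (intro wp_diff_add_1 Im_S_pos off_lattice_S t0 assms)
  also have "\<dots> = \<tau>\<^sup>2 * wp_diff \<tau> z w" by (rule wp_diff_S[OF t0])
  finally show ?thesis using t0 by simp
qed

section \<open>Half-period differences and the modular group\<close>

text \<open>
  If \<open>e1\<close>, \<open>e2\<close>, \<open>e3\<close> are the values of the Weierstrass function at \<open>1/2\<close>, \<open>\<tau>/2\<close>, \<open>(1 + \<tau>)/2\<close>, these are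
  \<open>e1 - e3\<close> and \<open>e2 - e3\<close>. Their quotient is a modular function that omits \<open>0\<close>, \<open>1\<close> and \<open>\<infinity>\<close>.
\<close>

definition e1_e3 :: "complex \<Rightarrow> complex" where "e1_e3 \<tau> = wp_diff \<tau> (1/2) ((1 + \<tau>)/2)"
definition e2_e3 :: "complex \<Rightarrow> complex" where "e2_e3 \<tau> = wp_diff \<tau> (\<tau>/2) ((1 + \<tau>)/2)"

lemma wp_diff_add_right:
  assumes "Im \<tau> > 0" "off_lattice \<tau> z" "off_lattice \<tau> w"
  shows "wp_diff \<tau> z (w + 1) = wp_diff \<tau> z w" "wp_diff \<tau> z (w + \<tau>) = wp_diff \<tau> z w"
  using wp_diff_add_1[OF assms(1,3,2)] wp_diff_add_\<tau>[OF assms(1,3,2)]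
  by (simp_all add: wp_diff_swap[of \<tau> z])

lemma e1_e2: "Im \<tau> > 0 \<Longrightarrow> wp_diff \<tau> (1/2) (\<tau>/2) = e1_e3 \<tau> - e2_e3 \<tau>"
  using wp_diff_trans[of \<tau> "1/2" "\<tau>/2" "(1+\<tau>)/2"] off_lattice_half[of \<tau>]
  by (simp add: e1_e3_def e2_e3_def algebra_simps)

text \<open>
  The translation fixes the lattice and the half-period \<open>1/2\<close> and exchanges the other two modulo periods.
\<close>

lemma half_period_differences_T:
  assumes "Im \<tau> > 0"
  shows "e1_e3 (\<tau> + 1) = e1_e3 \<tau> - e2_e3 \<tau>" "e2_e3 (\<tau> + 1) = - e2_e3 \<tau>"
proof -
  note off = off_lattice_half[OF assms]
  have eq: "(1 + (\<tau> + 1)) / 2 = \<tau>/2 + 1" "(\<tau> + 1)/2 = (1 + \<tau>)/2" by (simp_all add: field_simps)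
  show "e1_e3 (\<tau> + 1) = e1_e3 \<tau> - e2_e3 \<tau>"
    unfolding e1_e3_def[of "\<tau> + 1"] wp_diff_T eq wp_diff_add_right(1)[OF assms off(1,2)] by (rule e1_e2[OF assms])
  show "e2_e3 (\<tau> + 1) = - e2_e3 \<tau>"
    unfolding e2_e3_def wp_diff_T eq wp_diff_add_right(1)[OF assms off(3,2)] by (rule wp_diff_swap)
qed

text \<open>
  The inversion exchanges the half-periods \<open>1/2\<close> and \<open>\<tau>/2\<close> modulo periods and contributes the weight two.
\<close>

lemma half_period_differences_S:
  assumes "Im \<tau> > 0"
  shows "e1_e3 (- 1 / \<tau>) = \<tau>\<^sup>2 * e2_e3 \<tau>" "e2_e3 (- 1 / \<tau>) = \<tau>\<^sup>2 * e1_e3 \<tau>"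
proof -
  note off = off_lattice_half[OF assms]
  have t0: "\<tau> \<noteq> 0" using assms by auto
  have off3: "off_lattice \<tau> ((\<tau> - 1)/2)"
    using off_lattice_add[OF off(3), of "(-1, 0)"] by (simp add: lattice_point_def field_simps)
  have eq: "(\<tau> - 1)/2 + 1 = (1 + \<tau>)/2" "(1 + - 1 / \<tau>) / 2 = ((\<tau> - 1)/2) / \<tau>" "1/2 = (\<tau>/2)/\<tau>" "(- 1 / \<tau>)/2 = (- (1/2)) / \<tau>"
    using t0 by (simp_all add: field_simps)
  have r: "wp_diff \<tau> z ((\<tau> - 1)/2) = wp_diff \<tau> z ((1 + \<tau>)/2)" if "off_lattice \<tau> z" for z
    using wp_diff_add_right(1)[OF assms that off3] by (simp only: eq)
  show "e1_e3 (- 1 / \<tau>) = \<tau>\<^sup>2 * e2_e3 \<tau>"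
    unfolding e1_e3_def e2_e3_def eq(2) using wp_diff_S[OF t0, of "\<tau>/2" "(\<tau> - 1)/2"] r[OF off(2)] t0 by simp
  show "e2_e3 (- 1 / \<tau>) = \<tau>\<^sup>2 * e1_e3 \<tau>"
    unfolding e1_e3_def e2_e3_def eq(2,4) wp_diff_S[OF t0] wp_diff_even[OF assms off(1) off3] r[OF off(1)] ..
qed

text \<open>
  The lattice of \<open>- cnj \<tau>\<close> is the mirror image of the lattice of \<open>\<tau>\<close>, with the same half-periods modulo periods.
\<close>

lemma half_period_differences_cnj:
  assumes "Im \<tau> > 0"
  shows "e1_e3 (- cnj \<tau>) = cnj (e1_e3 \<tau>)" "e2_e3 (- cnj \<tau>) = cnj (e2_e3 \<tau>)"
proof -
  note off = off_lattice_half[OF assms]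
  have off3: "off_lattice \<tau> ((1 - \<tau>)/2)"
    using off_lattice_add[OF off(3), of "(0, -1)"] by (simp add: lattice_point_def field_simps)
  have eq: "(1 - \<tau>)/2 + \<tau> = (1 + \<tau>)/2" "(1 + - cnj \<tau>) / 2 = cnj ((1 - \<tau>)/2)" "- cnj \<tau>/2 = cnj (- (\<tau>/2))" "(1/2) = cnj (1/2)"
    by (simp_all add: field_simps)
  have r: "wp_diff \<tau> z ((1 - \<tau>)/2) = wp_diff \<tau> z ((1 + \<tau>)/2)" if "off_lattice \<tau> z" for z
    using wp_diff_add_right(2)[OF assms that off3] by (simp only: eq)
  show "e1_e3 (- cnj \<tau>) = cnj (e1_e3 \<tau>)"
    unfolding e1_e3_def eq(2) using wp_diff_cnj[of \<tau> "1/2" "(1 - \<tau>)/2"] r[OF off(1)] by simp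
  show "e2_e3 (- cnj \<tau>) = cnj (e2_e3 \<tau>)"
    unfolding e2_e3_def eq(2,3) wp_diff_cnj wp_diff_even[OF assms off(2) off3] r[OF off(2)] ..
qed

section \<open>Nonvanishing of the half-period differences\<close>

lemma wp_diff_add_lattice:
  assumes "Im \<tau> > 0" "off_lattice \<tau> z" "off_lattice \<tau> w"
  shows "wp_diff \<tau> (z + lattice_point \<tau> p) w = wp_diff \<tau> z w"
proof -
  have add_int: "wp_diff \<tau> (y + of_int n) w = wp_diff \<tau> y w" if "off_lattice \<tau> y" for y n
  proof (induction n rule: int_induct[where k = 0])
    case (step1 i)
    have "off_lattice \<tau> (y + of_int i)" using off_lattice_add[OF that, of "(i, 0)"] by (simp add: lattice_point_def)
    then show ?case using wp_diff_add_1[OF assms(1) _ assms(3)] step1 by (simp add: add.assoc[symmetric])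
  next
    case (step2 i)
    have "off_lattice \<tau> (y + of_int (i - 1))" using off_lattice_add[OF that, of "(i - 1, 0)"] by (simp add: lattice_point_def)
    from wp_diff_add_1[OF assms(1) this assms(3)] step2 show ?case by (simp add: algebra_simps)
  qed simp
  have add_\<tau>: "wp_diff \<tau> (z + of_int n * \<tau>) w = wp_diff \<tau> z w" for n
  proof (induction n rule: int_induct[where k = 0])
    case (step1 i)
    have "off_lattice \<tau> (z + of_int i * \<tau>)" using off_lattice_add[OF assms(2), of "(0, i)"] by (simp add: lattice_point_def)
    from wp_diff_add_\<tau>[OF assms(1) this assms(3)] step1 show ?case by (simp add: algebra_simps)
  next
    case (step2 i)
    have "off_lattice \<tau> (z + of_int (i - 1) * \<tau>)" using off_lattice_add[OF assms(2), of "(0, i - 1)"] by (simp add: lattice_point_def)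
    from wp_diff_add_\<tau>[OF assms(1) this assms(3)] step2 show ?case by (simp add: algebra_simps)
  qed simp
  have "off_lattice \<tau> (z + of_int (snd p) * \<tau>)" using off_lattice_add[OF assms(2), of "(0, snd p)"] by (simp add: lattice_point_def)
  from add_int[OF this, of "fst p"] add_\<tau>[of "snd p"] show ?thesis
    by (simp add: lattice_point_def add_ac)
qed

text \<open>
  \<open>lattice_separation\<close> for a constant family, applied to differences of lattice points.
\<close>

lemma lattice_points_apart:
  assumes "Im \<tau> > 0"
  obtains r where "r > 0" "\<And>p q. p \<noteq> q \<Longrightarrow> r \<le> dist (lattice_point \<tau> p) (lattice_point \<tau> q)"
proof -
  have "\<exists>\<eta>>0. \<forall>t\<in>{0::complex}. \<forall>p\<in>UNIV - {(0,0)}. \<eta> * lattice_weight p \<le> cmod (0 - lattice_point \<tau> p)"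
  proof (rule lattice_separation)
    fix t p assume "p \<in> UNIV - {(0::int,0::int)}"
    then have p: "p \<noteq> (0, 0)" by simp
    show "0 \<noteq> lattice_point \<tau> p"
    proof
      assume "0 = lattice_point \<tau> p"
      then have "of_real 0 + of_real 0 * \<tau> = of_real (of_int (fst p)) + of_real (of_int (snd p)) * \<tau>" by (simp add: lattice_point_def)
      from lattice_coordinates_unique[OF assms this] p show False by (cases p) simp
    qed
  qed (use assms in auto)
  then obtain \<eta> where \<eta>: "\<eta> > 0" "\<And>p. p \<noteq> (0,0) \<Longrightarrow> \<eta> * lattice_weight p \<le> cmod (lattice_point \<tau> p)" by auto
  have "\<eta> \<le> dist (lattice_point \<tau> p) (lattice_point \<tau> q)" if "p \<noteq> q" for p q
  proof -
    have "(fst p - fst q, snd p - snd q) \<noteq> (0, 0)" using that by (auto simp: prod_eq_iff)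
    from \<eta>(2)[OF this] have "\<eta> * lattice_weight (fst p - fst q, snd p - snd q) \<le> dist (lattice_point \<tau> p) (lattice_point \<tau> q)"
      by (simp add: dist_norm lattice_point_def algebra_simps)
    moreover have "\<eta> * 1 \<le> \<eta> * lattice_weight (fst p - fst q, snd p - snd q)"
      using \<eta>(1) lattice_weight_ge_1 by (intro mult_left_mono) auto
    ultimately show ?thesis by simp
  qed
  then show ?thesis using that \<eta>(1) by blast
qed

lemma open_off_lattice:
  assumes "Im \<tau> > 0" shows "open {z. off_lattice \<tau> z}"
proof -
  obtain r where r: "r > 0" "\<And>p q. p \<noteq> q \<Longrightarrow> r \<le> dist (lattice_point \<tau> p) (lattice_point \<tau> q)"
    using lattice_points_apart[OF assms] by blast
  have "closed (range (lattice_point \<tau>))"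
  proof (rule discrete_imp_closed[OF r(1)], intro ballI impI)
    fix x y assume "x \<in> range (lattice_point \<tau>)" "y \<in> range (lattice_point \<tau>)" "dist y x < r"
    then show "y = x" using r(2) by (metis not_less rangeE)
  qed
  moreover have "{z. off_lattice \<tau> z} = - range (lattice_point \<tau>)" by (auto simp: off_lattice_def)
  ultimately show ?thesis by (simp add: open_Compl)
qed

lemma connected_off_lattice: "connected {z. off_lattice \<tau> z}"
proof -
  have "{z. off_lattice \<tau> z} = - range (lattice_point \<tau>)" by (auto simp: off_lattice_def)
  moreover have "path_connected (- range (lattice_point \<tau>))"
    by (intro path_connected_complement_countable) auto
  ultimately show ?thesis by (simp add: path_connected_imp_connected)
qed

lemma wp_diff_holomorphic:
  assumes "Im \<tau> > 0" "off_lattice \<tau> w"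
  shows "(\<lambda>z. wp_diff \<tau> z w) holomorphic_on {z. off_lattice \<tau> z}"
  unfolding wp_diff_def
proof (rule wp_sum_holomorphic(1)[OF open_off_lattice[OF assms(1)]])
  fix t p assume "t \<in> {z. off_lattice \<tau> z}"
  then show "t \<noteq> lattice_point \<tau> p" "w \<noteq> lattice_point \<tau> p" using assms(2) unfolding off_lattice_def by blast+
qed (use assms(1) in \<open>auto intro!: holomorphic_intros\<close>)

lemma wp_diff_near_0:
  assumes "Im \<tau> > 0" "off_lattice \<tau> w"
  obtains r R where "r > 0" "R holomorphic_on ball 0 r" "\<And>z. z \<in> ball 0 r - {0} \<Longrightarrow> off_lattice \<tau> z"
    "\<And>z. z \<in> ball 0 r - {0} \<Longrightarrow> wp_diff \<tau> z w = 1 / z\<^sup>2 + R z"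
proof -
  obtain r where r: "r > 0" "\<And>p q. p \<noteq> q \<Longrightarrow> r \<le> dist (lattice_point \<tau> p) (lattice_point \<tau> q)"
    using lattice_points_apart[OF assms(1)] by blast
  define A where "A = UNIV - {(0::int, 0::int)}"
  define R where "R z = infsum (wp_term \<tau> z w) A - 1 / w\<^sup>2" for z
  have l0: "lattice_point \<tau> (0, 0) = 0" by (simp add: lattice_point_def)
  have far: "z \<noteq> lattice_point \<tau> p" if "z \<in> ball 0 r" "p \<in> A" for z p
    using r(2)[of "(0,0)" p] that by (auto simp: A_def l0)
  have off: "off_lattice \<tau> z" if "z \<in> ball 0 r - {0}" for z
    unfolding off_lattice_def using that far[of z] l0 by (metis A_def DiffE DiffI UNIV_I singletonD singletonI)
  have "(\<lambda>z. infsum (wp_term \<tau> z w) A) holomorphic_on ball 0 r"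
    by (rule wp_sum_holomorphic(1)) (use assms far in \<open>auto simp: off_lattice_def intro!: holomorphic_intros\<close>)
  then have hol: "R holomorphic_on ball 0 r" unfolding R_def by (intro holomorphic_intros)
  have eq: "wp_diff \<tau> z w = 1 / z\<^sup>2 + R z" if "z \<in> ball 0 r - {0}" for z
  proof -
    have "wp_diff \<tau> z w = infsum (wp_term \<tau> z w) (insert (0, 0) A)"
      unfolding wp_diff_def by (rule arg_cong[of _ _ "infsum _"]) (auto simp: A_def)
    also have "\<dots> = wp_term \<tau> z w (0, 0) + infsum (wp_term \<tau> z w) A"
      by (rule infsum_insert) (use summable_wp_term[OF assms(1) off[OF that] assms(2)] in \<open>auto simp: A_def\<close>)
    finally show ?thesis by (simp add: R_def wp_term_def l0)
  qed
  show ?thesis by (rule that[OF r(1) hol off eq])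
qed

text \<open>
  The derivative of an even function vanishes at \<open>0\<close>, so two factors \<open>z\<close> can be split off.
\<close>

lemma even_double_zero:
  assumes "E holomorphic_on ball 0 r" "r > 0" "\<And>z. z \<in> ball 0 r \<Longrightarrow> E (- z) = E z" "E 0 = 0"
  obtains E2 where "E2 holomorphic_on ball 0 r" "\<And>z. z \<in> ball 0 r \<Longrightarrow> E z = z\<^sup>2 * E2 z"
proof -
  have d: "(E has_field_derivative deriv E 0) (at 0)"
    using holomorphic_derivI[OF assms(1), of 0] assms(2) by simp
  have "((\<lambda>z. E (- z)) has_field_derivative (deriv E 0 * (- 1))) (at 0)"
    by (rule DERIV_chain2[of E]) (use d in \<open>auto intro!: derivative_eq_intros\<close>)
  moreover have "\<forall>\<^sub>F z in nhds 0. E (- z) = E z"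
    using eventually_nhds_in_open[of "ball 0 r" 0] assms(2,3) by (auto elim!: eventually_mono)
  ultimately have "(E has_field_derivative (deriv E 0 * (- 1))) (at 0)"
    using DERIV_cong_ev[of 0 0 "\<lambda>z. E (- z)" E] by blast
  then have "deriv E 0 * (- 1) = deriv E 0" using DERIV_unique[OF _ d] by blast
  then have d0: "deriv E 0 = 0" by simp
  define E1 where "E1 z = (if z = 0 then deriv E 0 else (E z - E 0) / (z - 0))" for z
  have E1: "E1 holomorphic_on ball 0 r" unfolding E1_def
    by (rule pole_lemma[OF assms(1)]) (use assms(2) in auto)
  define E2 where "E2 z = (if z = 0 then deriv E1 0 else (E1 z - E1 0) / (z - 0))" for z
  have "E2 holomorphic_on ball 0 r" unfolding E2_def
    by (rule pole_lemma[OF E1]) (use assms(2) in auto)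
  moreover have "E z = z\<^sup>2 * E2 z" for z
    using d0 assms(4) by (auto simp: E2_def E1_def power2_eq_square)
  ultimately show ?thesis using that by blast
qed

lemma reduce_to_period_parallelogram:
  assumes "Im \<tau> > 0"
  obtains p x y where "z = of_real x + of_real y * \<tau> + lattice_point \<tau> p" "x \<in> {0..1}" "y \<in> {0..1}"
proof -
  define Y where "Y = Im z / Im \<tau>"
  define X where "X = Re z - Y * Re \<tau>"
  have "z = of_real X + of_real Y * \<tau>" using assms by (simp add: complex_eq_iff X_def Y_def)
  then have "z = of_real (frac X) + of_real (frac Y) * \<tau> + lattice_point \<tau> (\<lfloor>X\<rfloor>, \<lfloor>Y\<rfloor>)"
    by (simp add: frac_def lattice_point_def algebra_simps)
  moreover have "frac X \<in> {0..1}" "frac Y \<in> {0..1}" using frac_lt_1[of X] frac_lt_1[of Y] by (auto simp: less_imp_le)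
  ultimately show ?thesis using that by blast
qed

text \<open>
  The difference \<open>P z\<close> of the values at \<open>z\<close> and at the half-period \<open>s\<close> is even about \<open>s\<close>, so its zero at \<open>s\<close> is
  at least double and cancels the double pole of \<open>z \<mapsto> P (z + s)\<close>. Hence
  \<open>P z * P (z + s)\<close> extends to an entire function with two periods, which is constant by Liouville's theorem. A further
  zero \<open>z1\<close> of \<open>P\<close> would make the constant zero, and \<open>P\<close> would vanish identically in spite of its
  pole. This takes the place of counting zeros with the argument principle.
\<close>

theorem wp_diff_nonzero:
  assumes \<tau>: "Im \<tau> > 0" and s: "off_lattice \<tau> s" "2 * s = lattice_point \<tau> p0"
    and z1: "off_lattice \<tau> z1" "off_lattice \<tau> (z1 - s)"
  shows "wp_diff \<tau> z1 s \<noteq> 0"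
proof
  assume zero: "wp_diff \<tau> z1 s = 0"
  define P where "P z = wp_diff \<tau> z s" for z
  let ?O = "\<lambda>z. off_lattice \<tau> z"
  have oadd: "?O (z + lattice_point \<tau> q) \<longleftrightarrow> ?O z" for z q
    using off_lattice_add[of \<tau> z q] off_lattice_add[of \<tau> "z + lattice_point \<tau> q" "(- fst q, - snd q)"]
    by (auto simp: lattice_point_minus[symmetric])
  have Padd: "P (z + lattice_point \<tau> q) = P z" if "?O z" for z q
    unfolding P_def by (rule wp_diff_add_lattice[OF \<tau> that s(1)])
  have Peven: "P (- z) = P z" if "?O z" for z
    unfolding P_def by (rule wp_diff_even[OF \<tau> that s(1)])
  have holP: "P holomorphic_on {z. ?O z}" unfolding P_def by (rule wp_diff_holomorphic[OF \<tau> s(1)])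
  have os: "?O (z + s) \<longleftrightarrow> ?O (z - s)" for z
  proof -
    have "z - s + lattice_point \<tau> p0 = z + s" by (simp flip: s(2))
    then show ?thesis using oadd[of "z - s" p0] by (simp only:)
  qed
  define D where "D = {z. ?O z \<and> ?O (z + s)}"
  have openD: "open D"
  proof -
    have "D = {z. ?O z} \<inter> (\<lambda>z. z + s) -` {z. ?O z}" by (auto simp: D_def)
    moreover have "open ((\<lambda>z. z + s) -` {z. ?O z})"
      by (intro open_vimage open_off_lattice[OF \<tau>] continuous_intros)
    ultimately show ?thesis using open_off_lattice[OF \<tau>] by (simp add: open_Int)
  qed
  \<comment> \<open>near 0 the pole of P is split off; near s the double zero of P is split off, as a function E of z - s\<close>
  obtain r1 R where r1: "r1 > 0" and R: "R holomorphic_on ball 0 r1"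
    and off1: "\<And>z. z \<in> ball 0 r1 - {0} \<Longrightarrow> ?O z"
    and P0: "\<And>z. z \<in> ball 0 r1 - {0} \<Longrightarrow> P z = 1 / z\<^sup>2 + R z"
    unfolding P_def using wp_diff_near_0[OF \<tau> s(1)] by blast
  obtain r2 where r2: "r2 > 0" "ball s r2 \<subseteq> {z. ?O z}"
    using open_off_lattice[OF \<tau>] s(1) open_contains_ball by blast
  define r where "r = min r1 r2"
  have r: "r > 0" "r \<le> r1" "r \<le> r2" using r1 r2 by (auto simp: r_def)
  have offs: "?O (z + s)" if "z \<in> ball 0 r" for z
    using r2(2) r that by (auto simp: subset_iff dist_norm norm_minus_commute)
  define E where "E z = P (z + s)" for z
  have holE: "E holomorphic_on ball 0 r" unfolding E_def
    by (rule holomorphic_on_compose_gen[OF _ holP, unfolded o_def]) (use offs in \<open>auto intro!: holomorphic_intros\<close>)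
  have Eeven: "E (- z) = E z" if "z \<in> ball 0 r" for z
  proof -
    have o1: "?O (z + s)" using offs that by simp
    then have o2: "?O (z - s)" using os by simp
    have "E (- z) = P (- (z - s))" by (simp add: E_def)
    also have "\<dots> = P (z - s)" using Peven[OF o2] .
    also have "\<dots> = P (z - s + lattice_point \<tau> p0)" using Padd[OF o2] by simp
    also have "z - s + lattice_point \<tau> p0 = z + s" using s(2) by (simp add: algebra_simps flip: s(2))
    finally show ?thesis by (simp add: E_def)
  qed
  have "E 0 = 0" by (simp add: E_def P_def wp_diff_def wp_term_def)
  then obtain E2 where E2: "E2 holomorphic_on ball 0 r" "\<And>z. z \<in> ball 0 r \<Longrightarrow> E z = z\<^sup>2 * E2 z"
    using even_double_zero[OF holE r(1) Eeven] by blast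
  define L where "L z = (1 + z\<^sup>2 * R z) * E2 z" for z
  have holL: "L holomorphic_on ball 0 r" unfolding L_def
    using R r E2 by (auto intro!: holomorphic_intros intro: holomorphic_on_subset)
  define Q where "Q z = (if z \<in> D then P z * P (z + s) else L 0)" for z
  have D0: "z \<in> D" if "z \<in> ball 0 r - {0}" for z
    using off1[of z] offs[of z] that r by (auto simp: D_def)
  have "0 \<notin> D" by (auto simp: D_def off_lattice_def lattice_point_def intro!: exI[of _ 0])
  have QL: "Q z = L z" if "z \<in> ball 0 r" for z
  proof (cases "z = 0")
    case False
    then have "Q z = (1 / z\<^sup>2 + R z) * (z\<^sup>2 * E2 z)"
      using D0[of z] P0[of z] E2(2)[of z] that r by (simp add: Q_def E_def)
    also have "\<dots> = (1 / z\<^sup>2 * z\<^sup>2) * E2 z + z\<^sup>2 * R z * E2 z" by (simp only: ring_distribs mult_ac)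
    also have "\<dots> = L z" using False by (simp add: L_def distrib_right)
    finally show ?thesis .
  qed (use \<open>0 \<notin> D\<close> in \<open>simp add: Q_def\<close>)
  have Dadd: "z + lattice_point \<tau> q \<in> D \<longleftrightarrow> z \<in> D" for z q
    using oadd[of z q] oadd[of "z + s" q] by (simp add: D_def add_ac)
  have Qadd: "Q (z + lattice_point \<tau> q) = Q z" for z q
    using Dadd[of z q] Padd[of z q] Padd[of "z + s" q] by (auto simp: Q_def D_def add_ac)
  have s2: "z + s + s = z + lattice_point \<tau> p0" for z by (simp flip: s(2))
  have Ds: "z + s \<in> D \<longleftrightarrow> z \<in> D" for z using oadd[of z p0] by (auto simp: D_def s2)
  have Qs: "Q (z + s) = Q z" for z
    using Ds[of z] Padd[of z p0] by (auto simp: Q_def s2 D_def)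
  have diff0: "Q field_differentiable at 0"
    using holomorphic_on_imp_differentiable_at[OF holomorphic_transform[OF holL QL[symmetric]]] r by simp
  \<comment> \<open>all exceptional points are translates of 0 by periods of Q, so differentiability at 0 suffices\<close>
  have shift: "Q field_differentiable at c" if "\<And>z. Q (z + c) = Q z" for c
  proof -
    have "Q = Q \<circ> (\<lambda>z. z - c)" using that[of "_ - c"] by (auto simp: fun_eq_iff)
    moreover have "(Q \<circ> (\<lambda>z. z - c)) field_differentiable at c"
      by (rule field_differentiable_compose) (use diff0 in \<open>auto intro!: derivative_intros\<close>)
    ultimately show ?thesis by simp
  qed
  have "Q field_differentiable at z" for z
  proof (cases "z \<in> D")
    case True
    have "(\<lambda>z. P z * P (z + s)) holomorphic_on D"
      by (intro holomorphic_on_mult holomorphic_on_compose_gen[OF _ holP, of "\<lambda>z. z + s" D, unfolded o_def] holomorphic_on_subset[OF holP])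
         (auto simp: D_def intro!: holomorphic_intros)
    then have "Q holomorphic_on D" by (rule holomorphic_transform) (simp add: Q_def)
    then show ?thesis using openD True by (rule holomorphic_on_imp_differentiable_at)
  next
    case False
    then consider q where "z = lattice_point \<tau> q" | q where "z + s = lattice_point \<tau> q"
      by (auto simp: D_def off_lattice_def)
    then show ?thesis
    proof cases
      case 1
      then show ?thesis using shift[of z] Qadd by simp
    next
      case 2
      show ?thesis
      proof (rule shift)
        fix y
        have "Q (y + z) = Q (y + z + s)" by (rule Qs[symmetric])
        also have "y + z + s = y + lattice_point \<tau> q" using 2 by (simp add: add.assoc)
        finally show "Q (y + z) = Q y" by (simp add: Qadd)
      qed
    qed
  qed
  then have entire: "Q holomorphic_on UNIV" by (simp add: holomorphic_on_def)
  define K where "K = (\<lambda>(x, y). of_real x + of_real y * \<tau>) ` ({0..1::real} \<times> {0..1::real})"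
  have "compact K" unfolding K_def
    by (intro compact_continuous_image compact_Times compact_Icc) (auto intro!: continuous_intros simp: case_prod_unfold)
  then have "bounded (Q ` K)"
    using entire by (intro compact_imp_bounded compact_continuous_image) (auto intro: holomorphic_on_imp_continuous_on holomorphic_on_subset)
  moreover have "range Q \<subseteq> Q ` K"
  proof clarify
    fix z
    obtain p x y where "z = of_real x + of_real y * \<tau> + lattice_point \<tau> p" "x \<in> {0..1}" "y \<in> {0..1}"
      using reduce_to_period_parallelogram[OF \<tau>] by metis
    then have "Q z = Q (of_real x + of_real y * \<tau>)" and "(x, y) \<in> {0..1} \<times> {0..1}" using Qadd by simp_all
    moreover from this(2) have "of_real x + of_real y * \<tau> \<in> K" unfolding K_def by force
    ultimately show "Q z \<in> Q ` K" by simp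
  qed
  ultimately have "Q constant_on UNIV"
    using Liouville_theorem[OF entire] bounded_subset by blast
  then obtain k where k: "\<And>z. Q z = k" by (auto simp: constant_on_def)
  have "z1 \<in> D" using z1 os by (simp add: D_def)
  then have "k = 0" using k[of z1] zero by (simp add: Q_def P_def)
  then have Q0: "Q z = 0" for z using k by simp
  have "isCont (\<lambda>z. 1 + z\<^sup>2 * R z) 0"
    using R r1 by (intro continuous_intros) (auto intro: holomorphic_on_imp_continuous_on continuous_on_interior)
  then have "(\<lambda>z. 1 + z\<^sup>2 * R z) \<midarrow>0\<rightarrow> 1 + 0\<^sup>2 * R 0" by (simp only: isCont_def)
  then have "\<forall>\<^sub>F z in at 0. 1 + z\<^sup>2 * R z \<noteq> 0" by (intro tendsto_imp_eventually_ne[of _ 1]) auto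
  then obtain d where d: "d > 0" "\<And>z. z \<noteq> 0 \<Longrightarrow> dist z 0 < d \<Longrightarrow> 1 + z\<^sup>2 * R z \<noteq> 0"
    by (auto simp: eventually_at)
  have Pzero: "P z = 0" if "z \<in> ball s (min r d)" for z
  proof -
    have zb: "z - s \<in> ball 0 r" "dist (z - s) 0 < d" using that by (auto simp: dist_norm norm_minus_commute)
    have "E (z - s) = 0"
    proof (cases "z - s = 0")
      case False
      then have "E2 (z - s) = 0" using QL[OF zb(1)] Q0 d(2)[OF False zb(2)] by (simp add: L_def)
      then show ?thesis using E2(2)[OF zb(1)] by simp
    qed (use \<open>E 0 = 0\<close> in simp)
    then show ?thesis by (simp add: E_def)
  qed
  have Pall: "P z = 0" if "?O z" for z
    using analytic_continuation[OF holP open_off_lattice[OF \<tau>] connected_off_lattice, of "{z. ?O z} \<inter> ball s (min r d)" s z]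
      Pzero that s(1) r(1) d(1) open_off_lattice[OF \<tau>]
    by (auto simp: islimpt_ball interior_limit_point interior_open)
  \<comment> \<open>P vanishes identically, but near 0 it equals (1 + z^2 R z) / z^2 with a nonzero numerator\<close>
  define z0 :: complex where "z0 = of_real (min r1 d / 2)"
  have "z0 \<in> ball 0 r1 - {0}" "dist z0 0 < d" "z0 \<noteq> 0" using r1 d(1) by (auto simp: z0_def)
  then have "0 = 1 / z0\<^sup>2 + R z0" "1 + z0\<^sup>2 * R z0 \<noteq> 0"
    using P0[of z0] Pall[OF off1[of z0]] d(2) by auto
  then show False using \<open>z0 \<noteq> 0\<close> by (simp add: field_simps)
qed

lemma half_period_differences_nonzero:
  assumes "Im \<tau> > 0"
  shows "e1_e3 \<tau> \<noteq> 0" "e2_e3 \<tau> \<noteq> 0" "e1_e3 \<tau> \<noteq> e2_e3 \<tau>"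
proof -
  note off = off_lattice_half[OF assms]
  have o: "off_lattice \<tau> (1/2 - (1 + \<tau>)/2)" "off_lattice \<tau> (\<tau>/2 - (1 + \<tau>)/2)" "off_lattice \<tau> (1/2 - \<tau>/2)"
    using off_lattice_minus[OF off(2)] off_lattice_minus[OF off(1)] off_lattice_add[OF off(3), of "(0,-1)"]
    by (simp_all add: diff_divide_distrib add_divide_distrib lattice_point_def)
  have l: "2 * ((1 + \<tau>)/2) = lattice_point \<tau> (1, 1)" "2 * (\<tau>/2) = lattice_point \<tau> (0, 1)"
    by (simp_all add: lattice_point_def)
  show "e1_e3 \<tau> \<noteq> 0" unfolding e1_e3_def by (rule wp_diff_nonzero[OF assms off(3) l(1) off(1) o(1)])
  show "e2_e3 \<tau> \<noteq> 0" unfolding e2_e3_def by (rule wp_diff_nonzero[OF assms off(3) l(1) off(2) o(2)])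
  show "e1_e3 \<tau> \<noteq> e2_e3 \<tau>"
    using e1_e2[OF assms] wp_diff_nonzero[OF assms off(2) l(2) off(1) o(3)] by auto
qed

lemma half_period_differences_holomorphic:
  "e1_e3 holomorphic_on {\<tau>. Im \<tau> > 0}" "e2_e3 holomorphic_on {\<tau>. Im \<tau> > 0}"
  unfolding e1_e3_def[abs_def] e2_e3_def[abs_def] wp_diff_def
  by (rule wp_sum_holomorphic(1);
      use off_lattice_half in \<open>auto simp: off_lattice_def open_halfspace_Im_gt intro!: holomorphic_intros\<close>)+

section \<open>The limit at the cusp\<close>

text \<open>
  This is the function \<open>(\<pi> / sin (\<pi> x))\<^sup>2\<close>, the part of the lattice series that belongs to one row.
\<close>

definition row_sum :: "complex \<Rightarrow> complex" where
  "row_sum x = (\<Sum>\<^sub>\<infinity>m. 1 / (x - of_int m)\<^sup>2)"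

lemma has_sum_diff':
  fixes f g :: "'a \<Rightarrow> complex"
  assumes "(f has_sum a) A" "(g has_sum b) A"
  shows "((\<lambda>x. f x - g x) has_sum (a - b)) A"
  using has_sum_add[OF assms(1) has_sum_uminusI[OF assms(2)]] by simp

definition row_weight :: "int \<Rightarrow> real" where "row_weight m = (1 + \<bar>of_int m\<bar>) powr (-(3/2))"

lemma row_weight_pos: "row_weight m > 0" by (simp add: row_weight_def)

lemma summable_row_weight: "row_weight summable_on A"
  unfolding row_weight_def[abs_def]
  by (rule summable_on_subset[OF summable_on_int_shift_powr]) simp

text \<open>
  An interpolation: a fraction of the quadratic decay is spent on the height \<open>Y\<close> of the row, the rest on summability over \<open>j\<close>.
\<close>

lemma row_term_bound:
  assumes Y: "\<bar>Im x\<bar> = Y" "Y \<ge> 1" and m: "m = \<lfloor>Re x\<rfloor> + j"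
  shows "1 / (cmod (x - of_int m))\<^sup>2 \<le> 9 * Y powr (-(1/2)) * row_weight j"
proof -
  define d where "d = cmod (x - of_int m)"
  have d1: "d \<ge> Y" using abs_Im_le_cmod[of "x - of_int m"] Y by (simp add: d_def)
  have "\<bar>Re x - of_int m\<bar> \<ge> \<bar>of_int j\<bar> - 1"
    unfolding m by simp linarith
  then have d2: "d \<ge> \<bar>of_int j\<bar> - 1" using abs_Re_le_cmod[of "x - of_int m"] by (simp add: d_def)
  have "1 + \<bar>of_int j\<bar> \<le> d + 2" using d2 by simp
  also have "\<dots> \<le> 3 * d" using d1 Y by simp
  finally have d3: "(1 + \<bar>of_int j\<bar>) / 3 \<le> d" by simp
  have "d > 0" using d1 Y by linarith
  have "Y powr (1/2) * ((1 + \<bar>of_int j\<bar>) / 3) powr (3/2) \<le> d powr (1/2) * d powr (3/2)"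
    using d1 d3 Y by (intro mult_mono powr_mono2) auto
  also have "\<dots> = d\<^sup>2" using \<open>d > 0\<close> by (simp flip: powr_add)
  finally have le: "Y powr (1/2) * ((1 + \<bar>of_int j\<bar>) / 3) powr (3/2) \<le> d\<^sup>2" .
  have "1 / d\<^sup>2 \<le> 1 / (Y powr (1/2) * ((1 + \<bar>of_int j\<bar>) / 3) powr (3/2))"
    using Y \<open>d > 0\<close> by (intro divide_left_mono[OF le] mult_pos_pos) auto
  also have "\<dots> = 3 powr (3/2) * Y powr (-(1/2)) * row_weight j"
    using Y by (simp add: powr_minus_divide powr_divide row_weight_def)
  also have "\<dots> \<le> 9 * Y powr (-(1/2)) * row_weight j"
  proof (intro mult_right_mono)
    have "(3::real) powr (3/2) \<le> 3 powr 2" by (intro powr_mono) auto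
    then show "(3::real) powr (3/2) \<le> 9" by simp
  qed (use row_weight_pos in \<open>auto intro: less_imp_le\<close>)
  finally show ?thesis by (simp add: d_def)
qed

text \<open>
  The terms by themselves only give the order \<open>Y powr (-1/2)\<close>, which is not summable over the rows. Adding the telescoping
  series with terms \<open>1 / (y - j + 1) - 1 / (y - j)\<close>, whose sum is zero, improves each term by a factor \<open>1 / Y\<close>.
\<close>

lemma row_sum_bound:
  assumes Y: "\<bar>Im x\<bar> = Y" "Y \<ge> 1"
  shows "(\<lambda>m. 1 / (x - of_int m)\<^sup>2) summable_on UNIV"
    and "cmod (row_sum x) \<le> 9 * infsum row_weight UNIV * Y powr (-(3/2))"
proof -
  define k where "k = \<lfloor>Re x\<rfloor>"
  define y where "y = x - of_int k"
  define f where "f j = 1 / (y - of_int j)" for j :: int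
  define g where "g j = 1 / ((y - of_int j)\<^sup>2 * (y - of_int (j - 1)))" for j :: int
  have yim: "Im y \<noteq> 0" using Y by (auto simp: y_def)
  have nz: "y - of_int j \<noteq> 0" for j using yim by (auto simp: complex_eq_iff)
  have bnd: "1 / (cmod (y - of_int j))\<^sup>2 \<le> 9 * Y powr (-(1/2)) * row_weight j" for j
    using row_term_bound[OF Y, of "k + j" j] by (simp add: k_def y_def algebra_simps)
  have sq: "1 / (y - of_int j)\<^sup>2 = - (f (j - 1) - f j) + (1 / (y - of_int j)\<^sup>2 + (f (j - 1) - f j))" for j by simp
  have g: "1 / (y - of_int j)\<^sup>2 + (f (j - 1) - f j) = g j" for j
  proof -
    define u where "u = y - of_int j"
    have u: "u \<noteq> 0" "u + 1 \<noteq> 0" "y - of_int (j - 1) = u + 1" using nz[of j] nz[of "j - 1"] by (auto simp: u_def algebra_simps)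
    define v where "v = u + 1"
    have "v \<noteq> 0" using u(2) by (simp add: v_def)
    have "1 / u\<^sup>2 + (1 / v - 1 / u) = (v + u * u - u * v) / (u\<^sup>2 * v)"
      using u(1) \<open>v \<noteq> 0\<close> by (simp add: field_simps power2_eq_square)
    also have "v + u * u - u * v = 1" by (simp add: v_def algebra_simps)
    finally show ?thesis unfolding f_def g_def u(3) u_def[symmetric] v_def .
  qed
  have sb: "(\<lambda>j. 9 * Y powr (-(1/2)) * row_weight j) summable_on UNIV"
    by (intro summable_on_cmult_right summable_row_weight)
  have s1: "(\<lambda>j. 1 / (y - of_int j)\<^sup>2) summable_on UNIV"
    by (rule abs_summable_summable, rule Infinite_Sum.abs_summable_on_comparison_test'[OF sb])
       (use bnd in \<open>simp add: norm_divide norm_power\<close>)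
  have gb: "norm (g j) \<le> 9 * Y powr (-(3/2)) * row_weight j" for j
  proof -
    have "norm (g j) = 1 / (cmod (y - of_int j))\<^sup>2 * (1 / cmod (y - of_int (j - 1)))"
      by (simp add: g_def norm_divide norm_mult norm_power)
    also have "\<dots> \<le> (9 * Y powr (-(1/2)) * row_weight j) * (1 / Y)"
    proof (intro mult_mono bnd)
      have "Y \<le> cmod (y - of_int (j - 1))" using abs_Im_le_cmod[of "y - of_int (j - 1)"] Y by (simp add: y_def)
      then show "1 / cmod (y - of_int (j - 1)) \<le> 1 / Y"
        using Y(2) by (intro divide_left_mono mult_pos_pos) (auto intro: less_le_trans[of 0 Y])
    qed (use Y row_weight_pos in \<open>auto intro!: mult_nonneg_nonneg less_imp_le\<close>)
    also have "\<dots> = 9 * Y powr (-(3/2)) * row_weight j"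
    proof -
      have "Y powr (-(3/2)) = Y powr (-(1/2)) * Y powr (-1)" using powr_add[of Y "-(1/2)" "-1"] by simp
      also have "Y powr (-1) = 1 / Y" using Y by (simp add: powr_minus_divide)
      finally show ?thesis by simp
    qed
    finally show ?thesis .
  qed
  have sb2: "(\<lambda>j. 9 * Y powr (-(3/2)) * row_weight j) summable_on UNIV"
    by (intro summable_on_cmult_right summable_row_weight)
  have gabs: "(\<lambda>j. norm (g j)) summable_on UNIV"
    by (rule Infinite_Sum.abs_summable_on_comparison_test'[OF sb2 gb])
  have sg: "g summable_on UNIV" by (rule abs_summable_summable[OF gabs])
  have sf: "(\<lambda>j. f (j - 1) - f j) summable_on UNIV"
  proof -
    have "(\<lambda>j. g j + - (1 / (y - of_int j)\<^sup>2)) summable_on UNIV"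
      using sg s1 by (intro summable_on_add) (auto simp: summable_on_uminus)
    moreover have "g j + - (1 / (y - of_int j)\<^sup>2) = f (j - 1) - f j" for j unfolding g[symmetric] by simp
    ultimately show ?thesis by simp
  qed
  have lim: "(\<lambda>n. 1 / (c + of_nat n)) \<longlonglongrightarrow> (0::complex)" for c
    by (rule tendsto_divide_0[OF tendsto_const tendsto_add_filterlim_at_infinity[OF tendsto_const tendsto_of_nat]])
  have "f (int n) = - (1 / (- y + of_nat n))" "f (- int n - 1) = 1 / (y + 1 + of_nat n)" for n
    using nz[of "int n"] by (auto simp: f_def field_simps add_eq_0_iff)
  then have tel: "((\<lambda>j. f (j - 1) - f j) has_sum 0) UNIV"
    using infsum_int_telescope[OF sf] tendsto_minus[OF lim[of "- y"]] lim[of "y + 1"] by simp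
  have "((\<lambda>j. - (f (j - 1) - f j) + g j) has_sum (- 0 + infsum g UNIV)) UNIV"
    by (intro has_sum_add has_sum_uminusI tel has_sum_infsum sg)
  then have "infsum (\<lambda>j. 1 / (y - of_int j)\<^sup>2) UNIV = infsum g UNIV"
    using sq g by (simp add: infsumI)
  moreover have "row_sum x = infsum (\<lambda>j. 1 / (y - of_int j)\<^sup>2) UNIV"
    unfolding row_sum_def
    by (rule infsum_reindex_bij_witness[of _ "\<lambda>j. j + k" "\<lambda>j. j - k"]) (auto simp: y_def algebra_simps)
  ultimately have "row_sum x = infsum g UNIV" by simp
  also have "norm \<dots> \<le> infsum (\<lambda>j. norm (g j)) UNIV" by (rule norm_infsum_bound[OF gabs])
  also have "\<dots> \<le> infsum (\<lambda>j. 9 * Y powr (-(3/2)) * row_weight j) UNIV"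
    by (rule infsum_mono[OF gabs sb2]) (use gb in auto)
  also have "\<dots> = 9 * infsum row_weight UNIV * Y powr (-(3/2))" by (simp add: infsum_cmult_right')
  finally show "cmod (row_sum x) \<le> 9 * infsum row_weight UNIV * Y powr (-(3/2))" .
  have "(\<lambda>m. 1 / (x - of_int m)\<^sup>2) summable_on UNIV \<longleftrightarrow> (\<lambda>j. 1 / (y - of_int j)\<^sup>2) summable_on UNIV"
    by (rule summable_on_reindex_bij_witness[of _ "\<lambda>j. j + k" "\<lambda>j. j - k"]) (auto simp: y_def algebra_simps)
  then show "(\<lambda>m. 1 / (x - of_int m)\<^sup>2) summable_on UNIV" using s1 by simp
qed

lemma row_half_summable: "(\<lambda>m. 1 / ((1/2::complex) - of_int m)\<^sup>2) summable_on UNIV"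
  and row_half_nonzero: "row_sum (1/2) \<noteq> 0"
proof -
  define f where "f m = 1 / ((1/2::real) - of_int m)\<^sup>2" for m
  have "f m \<le> 16 * row_weight m" for m
  proof -
    define t where "t = 1 + \<bar>real_of_int m\<bar>"
    have t: "t \<ge> 1" by (simp add: t_def)
    have "t / 4 \<le> \<bar>1/2 - real_of_int m\<bar>" unfolding t_def by (cases "m \<le> 0") (auto simp: abs_if)
    then have "(t / 4)\<^sup>2 \<le> \<bar>1/2 - real_of_int m\<bar>\<^sup>2" using t by (intro power_mono) auto
    then have le: "t\<^sup>2 / 16 \<le> (1/2 - real_of_int m)\<^sup>2" by (simp add: power2_eq_square)
    have "f m \<le> 1 / (t\<^sup>2 / 16)" unfolding f_def using t le by (intro divide_left_mono) (auto intro!: mult_pos_pos order.strict_trans2[OF _ le])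
    also have "\<dots> = 16 * t powr (-2)" using t by (simp add: powr_minus_divide)
    also have "\<dots> \<le> 16 * t powr (-(3/2))" using t by (intro mult_left_mono powr_mono) auto
    finally show ?thesis by (simp add: row_weight_def t_def)
  qed
  moreover have "f m \<ge> 0" for m by (simp add: f_def)
  ultimately have sf: "f summable_on UNIV"
    by (intro summable_on_comparison_test[OF summable_on_cmult_right[OF summable_row_weight]]) auto
  have fc: "complex_of_real (f m) = 1 / ((1/2::complex) - of_int m)\<^sup>2" for m by (simp add: f_def)
  have hs: "((\<lambda>m. 1 / ((1/2::complex) - of_int m)\<^sup>2) has_sum of_real (infsum f UNIV)) UNIV"
    unfolding fc[symmetric] by (rule has_sum_of_real[OF has_sum_infsum[OF sf]])
  then show "(\<lambda>m. 1 / ((1/2::complex) - of_int m)\<^sup>2) summable_on UNIV" by (auto simp: summable_on_def)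
  have "infsum f {0} \<le> infsum f UNIV"
    by (rule infsum_mono2) (use sf in \<open>auto simp: f_def\<close>)
  moreover have "infsum f {0} = 4" by (simp add: f_def power2_eq_square)
  ultimately have "infsum f UNIV > 0" by simp
  then show "row_sum (1/2) \<noteq> 0" using infsumI[OF hs] by (simp add: row_sum_def)
qed

text \<open>
  Summing the absolutely convergent double series by rows. Only one of these rows, that of \<open>1/2\<close> for \<open>n = 0\<close>, meets the real axis.
\<close>

lemma e1_e3_row_expansion:
  assumes "Im \<tau> \<ge> 4"
  shows "((\<lambda>n. row_sum (1/2 - of_int n * \<tau>) - row_sum ((1 + \<tau>)/2 - of_int n * \<tau>)) has_sum e1_e3 \<tau>) UNIV"
proof -
  have pos: "Im \<tau> > 0" using assms by simp
  define F where "F p = wp_term \<tau> (1/2) ((1 + \<tau>)/2) (prod.swap p)" for p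
  have "wp_term \<tau> (1/2) ((1 + \<tau>)/2) summable_on UNIV" by (intro summable_wp_term off_lattice_half pos)
  then have "(wp_term \<tau> (1/2) ((1 + \<tau>)/2) has_sum e1_e3 \<tau>) UNIV" by (simp add: e1_e3_def wp_diff_def)
  then have hs: "(F has_sum e1_e3 \<tau>) (Sigma UNIV (\<lambda>_. UNIV))"
    unfolding F_def by (subst has_sum_reindex_bij_betw[where g = prod.swap and B = UNIV]) (auto simp: bij_betw_def)
  show ?thesis
  proof (rule has_sum_SigmaD[OF hs])
    fix n :: int
    have sr: "(\<lambda>m. 1 / (x - of_int m)\<^sup>2) summable_on UNIV" if "x = 1/2 - of_int n * \<tau> \<or> x = (1 + \<tau>)/2 - of_int n * \<tau>" for x
    proof (cases "x = 1/2")
      case True show ?thesis unfolding True by (rule row_half_summable)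
    next
      case False
      have "\<bar>Im x\<bar> \<ge> 1"
        using that
      proof
        assume x: "x = 1/2 - of_int n * \<tau>"
        then have "n \<noteq> 0" using False by auto
        then have "\<bar>real_of_int n\<bar> \<ge> 1" by linarith
        then have "1 * 4 \<le> \<bar>real_of_int n\<bar> * Im \<tau>" using assms by (intro mult_mono) auto
        moreover have "\<bar>Im x\<bar> = \<bar>real_of_int n\<bar> * Im \<tau>" using x pos by (simp add: abs_mult)
        ultimately show ?thesis by simp
      next
        assume x: "x = (1 + \<tau>)/2 - of_int n * \<tau>"
        have "\<bar>1/2 - real_of_int n\<bar> \<ge> 1/2" by (cases "n \<le> 0") (auto simp: abs_if)
        then have "1/2 * 4 \<le> \<bar>1/2 - real_of_int n\<bar> * Im \<tau>" using assms by (intro mult_mono) auto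
        moreover have "Im x = (1/2 - real_of_int n) * Im \<tau>" unfolding x by (simp add: algebra_simps)
        ultimately show ?thesis using pos by (simp add: abs_mult)
      qed
      then show ?thesis using row_sum_bound(1) by blast
    qed
    have Fe: "F (n, m) = 1 / ((1/2 - of_int n * \<tau>) - of_int m)\<^sup>2 - 1 / (((1 + \<tau>)/2 - of_int n * \<tau>) - of_int m)\<^sup>2" for m
      by (simp add: F_def wp_term_def lattice_point_def algebra_simps)
    show "((\<lambda>m. F (n, m)) has_sum row_sum (1/2 - of_int n * \<tau>) - row_sum ((1 + \<tau>)/2 - of_int n * \<tau>)) UNIV"
      unfolding Fe row_sum_def by (intro has_sum_diff' has_sum_infsum sr) auto
  qed
qed

text \<open>
  As \<open>Im \<tau>\<close> tends to infinity, all rows move away except the one through \<open>1/2\<close>, so its sum is the limit.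
\<close>

lemma e1_e3_near_cusp:
  obtains Y0 where "Y0 \<ge> 4" "\<And>\<tau>. Im \<tau> \<ge> Y0 \<Longrightarrow> cmod (e1_e3 \<tau> - row_sum (1/2)) \<le> cmod (row_sum (1/2)) / 2"
proof -
  define L where "L = row_sum (1/2)"
  define S where "S = infsum row_weight UNIV"
  have S: "S \<ge> 0" unfolding S_def by (rule infsum_nonneg) (use row_weight_pos in \<open>auto intro: less_imp_le\<close>)
  define C where "C = 18 * S * S"
  have bound: "cmod (e1_e3 \<tau> - L) \<le> C * (Im \<tau> / 4) powr (-(3/2))" if Y: "Im \<tau> \<ge> 4" for \<tau>
  proof -
    define Y where "Y = Im \<tau> / 4"
    have Y1: "Y \<ge> 1" using that by (simp add: Y_def)
    have rb: "cmod (row_sum x) \<le> 9 * S * (Y powr (-(3/2)) * row_weight n)" if x: "(1 + \<bar>of_int n\<bar>) * Y \<le> \<bar>Im x\<bar>" for x n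
    proof -
      have "1 * 1 \<le> (1 + \<bar>of_int n\<bar>) * Y" using Y1 by (intro mult_mono) auto
      then have "cmod (row_sum x) \<le> 9 * S * \<bar>Im x\<bar> powr (-(3/2))" using row_sum_bound(2)[OF refl] x by (simp add: S_def)
      also have "\<dots> \<le> 9 * S * ((1 + \<bar>of_int n\<bar>) * Y) powr (-(3/2))"
        using x Y1 S by (intro mult_left_mono powr_mono2') (auto intro!: mult_pos_pos)
      also have "((1 + \<bar>of_int n\<bar>) * Y) powr (-(3/2)) = Y powr (-(3/2)) * row_weight n"
        using Y1 by (simp add: powr_mult row_weight_def)
      finally show ?thesis .
    qed
    define D where "D n = (if n = 0 then 0 else row_sum (1/2 - of_int n * \<tau>)) - row_sum ((1 + \<tau>)/2 - of_int n * \<tau>)" for n :: int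
    have bD: "norm (D n) \<le> 18 * S * Y powr (-(3/2)) * row_weight n" for n
    proof -
      have 1: "cmod (if n = 0 then 0 else row_sum (1/2 - of_int n * \<tau>)) \<le> 9 * S * (Y powr (-(3/2)) * row_weight n)"
      proof (cases "n = 0")
        case True then show ?thesis using S row_weight_pos[of n] by (simp add: less_imp_le)
      next
        case False
        then have "\<bar>real_of_int n\<bar> \<ge> 1" by linarith
        then have "(1 + \<bar>of_int n\<bar>) * Y \<le> (\<bar>real_of_int n\<bar> * 4) * Y" using Y1 by (intro mult_right_mono) auto
        also have "\<dots> = \<bar>Im (1/2 - of_int n * \<tau>)\<bar>" using that by (simp add: Y_def abs_mult)
        finally show ?thesis using rb False by auto
      qed
      have "1 + \<bar>real_of_int n\<bar> \<le> \<bar>1/2 - real_of_int n\<bar> * 4" by (cases "n \<le> 0") (auto simp: abs_if)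
      then have "(1 + \<bar>of_int n\<bar>) * Y \<le> (\<bar>1/2 - real_of_int n\<bar> * 4) * Y" using Y1 by (intro mult_right_mono) auto
      also have "\<dots> = \<bar>(1/2 - real_of_int n) * Im \<tau>\<bar>" using that by (simp add: Y_def abs_mult)
      also have "(1/2 - real_of_int n) * Im \<tau> = Im ((1 + \<tau>)/2 - of_int n * \<tau>)" by (simp add: algebra_simps)
      finally have 2: "cmod (row_sum ((1 + \<tau>)/2 - of_int n * \<tau>)) \<le> 9 * S * (Y powr (-(3/2)) * row_weight n)" by (rule rb)
      have "norm (D n) \<le> 9 * S * (Y powr (-(3/2)) * row_weight n) + 9 * S * (Y powr (-(3/2)) * row_weight n)"
        unfolding D_def by (rule order.trans[OF norm_triangle_ineq4 add_mono[OF 1 2]])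
      then show ?thesis by (simp add: algebra_simps)
    qed
    have "((\<lambda>n. (row_sum (1/2 - of_int n * \<tau>) - row_sum ((1 + \<tau>)/2 - of_int n * \<tau>)) - (if n \<in> {0} then L else 0)) has_sum (e1_e3 \<tau> - L)) UNIV"
    proof (intro has_sum_diff' e1_e3_row_expansion that)
      show "((\<lambda>n::int. if n \<in> {0} then L else 0) has_sum L) UNIV"
        by (rule has_sum_finite_neutralI[of "{0}"]) auto
    qed
    moreover have "(row_sum (1/2 - of_int n * \<tau>) - row_sum ((1 + \<tau>)/2 - of_int n * \<tau>)) - (if n \<in> {0} then L else 0) = D n" for n :: int
      by (simp add: D_def L_def)
    ultimately have hsD: "(D has_sum (e1_e3 \<tau> - L)) UNIV" by simp
    have sb: "(\<lambda>n. 18 * S * Y powr (-(3/2)) * row_weight n) summable_on UNIV"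
      by (intro summable_on_cmult_right summable_row_weight)
    have "cmod (e1_e3 \<tau> - L) \<le> infsum (\<lambda>n. 18 * S * Y powr (-(3/2)) * row_weight n) UNIV"
      by (rule norm_infsum_le[OF hsD has_sum_infsum[OF sb]]) (use bD in auto)
    also have "\<dots> = C * Y powr (-(3/2))" by (simp add: infsum_cmult_right' C_def S_def)
    finally show ?thesis by (simp add: Y_def)
  qed
  have "((\<lambda>y. C * (y / 4) powr (-(3/2))) \<longlongrightarrow> C * 0) at_top"
    by (intro tendsto_mult tendsto_const tendsto_neg_powr filterlim_at_top_mult_tendsto_pos[where c = "1/4", of "\<lambda>_. 1/4", simplified] filterlim_ident) auto
  moreover have Lpos: "cmod L / 2 > 0" using row_half_nonzero by (simp add: L_def)
  ultimately have "\<forall>\<^sub>F y in at_top. C * (y / 4) powr (-(3/2)) < cmod L / 2"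
    by (intro order_tendstoD(2)[of _ "C * 0"]) auto
  then obtain Y0 where "\<And>y. y \<ge> Y0 \<Longrightarrow> C * (y / 4) powr (-(3/2)) < cmod L / 2" by (auto simp: eventually_at_top_linorder)
  then have "cmod (e1_e3 \<tau> - L) \<le> cmod L / 2" if "Im \<tau> \<ge> max 4 Y0" for \<tau>
    using bound[of \<tau>] that by force
  then show ?thesis using that[of "max 4 Y0"] by (auto simp: L_def)
qed

section \<open>A lower bound relative to the hyperbolic metric\<close>

text \<open>
  The density of \<open>(|a| + |c| + |a - c|) |d\<tau>|\<close> with respect to the hyperbolic metric. All three differences occur because the modular group
  permutes them up to sign and weight.
\<close>

definition modular_density :: "complex \<Rightarrow> real" where
  "modular_density \<tau> = Im \<tau> * (cmod (e1_e3 \<tau>) + cmod (e2_e3 \<tau>) + cmod (e1_e3 \<tau> - e2_e3 \<tau>))"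

lemma modular_density_T: "Im \<tau> > 0 \<Longrightarrow> modular_density (\<tau> + 1) = modular_density \<tau>"
  by (simp add: modular_density_def half_period_differences_T)

lemma modular_density_translate:
  assumes "Im \<tau> > 0" shows "modular_density (\<tau> + of_int n) = modular_density \<tau>"
proof (induction n rule: int_induct[where k = 0])
  case (step1 i) then show ?case using modular_density_T[of "\<tau> + of_int i"] assms by (simp add: algebra_simps)
next
  case (step2 i) then show ?case using modular_density_T[of "\<tau> + of_int (i - 1)"] assms by (simp add: algebra_simps)
qed simp

lemma Im_S: "Im (- 1 / \<tau>) = Im \<tau> / (cmod \<tau>)\<^sup>2"
  by (simp add: Im_divide cmod_power2)

lemma modular_density_S:
  assumes "Im \<tau> > 0" shows "modular_density (- 1 / \<tau>) = modular_density \<tau>"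
proof -
  have "\<tau> \<noteq> 0" using assms by auto
  have "cmod (\<tau>\<^sup>2 * e2_e3 \<tau> - \<tau>\<^sup>2 * e1_e3 \<tau>) = (cmod \<tau>)\<^sup>2 * cmod (e1_e3 \<tau> - e2_e3 \<tau>)"
    by (simp add: right_diff_distrib[symmetric] norm_mult norm_power norm_minus_commute)
  then show ?thesis using \<open>\<tau> \<noteq> 0\<close>
    unfolding modular_density_def half_period_differences_S[OF assms] Im_S
    by (simp add: norm_mult norm_power field_simps)
qed

text \<open>
  By translation invariance one may assume \<open>|Re \<tau>| \<le> 1/2\<close>, and then the inversion at least doubles an imaginary part below
  \<open>1/2\<close>. Finitely many steps reach \<open>Im \<tau> \<ge> 1/2\<close>, where the bound comes from compactness and, high up,
  from the limit at the cusp.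
\<close>

lemma modular_density_lower_bound:
  obtains c where "c > 0" "\<And>\<tau>. Im \<tau> > 0 \<Longrightarrow> c \<le> modular_density \<tau>"
proof -
  obtain Y0 where Y0: "Y0 \<ge> 4" "\<And>\<tau>. Im \<tau> \<ge> Y0 \<Longrightarrow> cmod (e1_e3 \<tau> - row_sum (1/2)) \<le> cmod (row_sum (1/2)) / 2"
    using e1_e3_near_cusp by blast
  define K where "K = cbox (Complex (-1/2) (1/2)) (Complex (1/2) Y0)"
  have KH: "Im \<tau> > 0" if "\<tau> \<in> K" for \<tau> using that by (auto simp: K_def in_cbox_complex_iff)
  have "continuous_on K modular_density"
    unfolding modular_density_def
    by (intro continuous_intros holomorphic_on_imp_continuous_on holomorphic_on_subset[OF half_period_differences_holomorphic(1)]
        holomorphic_on_subset[OF half_period_differences_holomorphic(2)]) (use KH in auto)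
  moreover have "compact K" unfolding K_def by (rule compact_cbox)
  moreover have "\<i> \<in> K" using Y0(1) by (auto simp: K_def in_cbox_complex_iff)
  then have "K \<noteq> {}" by blast
  ultimately obtain \<tau>0 where \<tau>0: "\<tau>0 \<in> K" "\<And>\<tau>. \<tau> \<in> K \<Longrightarrow> modular_density \<tau>0 \<le> modular_density \<tau>"
    using continuous_attains_inf by metis
  have pos0: "modular_density \<tau>0 > 0"
    using KH[OF \<tau>0(1)] half_period_differences_nonzero(1)[of \<tau>0] unfolding modular_density_def
    by (intro mult_pos_pos add_pos_nonneg) auto
  \<comment> \<open>the minimum on the compact rectangle, and a bound above it, where Im is at least 4 and a is at least half its limit\<close>
  define c where "c = min (modular_density \<tau>0) (4 * (cmod (row_sum (1/2)) / 2))"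
  have c: "c > 0" using pos0 row_half_nonzero by (simp add: c_def)
  have norm_Re: "\<exists>n::int. \<bar>Re (\<tau> + of_int n)\<bar> \<le> 1/2" for \<tau>
  proof -
    define k where "k = \<lfloor>Re \<tau> + 1/2\<rfloor>"
    have "of_int k \<le> Re \<tau> + 1/2" "Re \<tau> + 1/2 < of_int k + 1" unfolding k_def by linarith+
    moreover have "Re (\<tau> + of_int (- k)) = Re \<tau> - of_int k" by simp
    ultimately have "\<bar>Re (\<tau> + of_int (- k))\<bar> \<le> 1/2" by linarith
    then show ?thesis by blast
  qed
  have base: "c \<le> modular_density \<tau>" if "Im \<tau> \<ge> 1/2" for \<tau>
  proof (cases "Im \<tau> \<ge> Y0")
    case True
    have "cmod (row_sum (1/2)) - cmod (e1_e3 \<tau>) \<le> cmod (e1_e3 \<tau> - row_sum (1/2))"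
      by (metis norm_minus_commute norm_triangle_ineq2)
    then have "cmod (row_sum (1/2)) / 2 \<le> cmod (e1_e3 \<tau>)" using Y0(2)[OF True] by simp
    also have "\<dots> \<le> cmod (e1_e3 \<tau>) + cmod (e2_e3 \<tau>) + cmod (e1_e3 \<tau> - e2_e3 \<tau>)" by simp
    finally have "4 * (cmod (row_sum (1/2)) / 2) \<le> modular_density \<tau>"
      unfolding modular_density_def using True Y0(1) by (intro mult_mono) auto
    then show ?thesis by (simp add: c_def)
  next
    case False
    obtain n :: int where n: "\<bar>Re (\<tau> + of_int n)\<bar> \<le> 1/2" using norm_Re by blast
    then have "- (1/2) \<le> Re (\<tau> + of_int n)" "Re (\<tau> + of_int n) \<le> 1/2" by linarith+
    then have "\<tau> + of_int n \<in> K" using that False by (simp add: K_def in_cbox_complex_iff)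
    from \<tau>0(2)[OF this] show ?thesis using modular_density_translate[of \<tau> n] that by (simp add: c_def)
  qed
  have "c \<le> modular_density \<tau>" if "Im \<tau> > 0" "Im \<tau> \<ge> (1/2) ^ Suc n" for n \<tau>
    using that
  proof (induction n arbitrary: \<tau>)
    case 0 then show ?case using base by simp
  next
    case (Suc n)
    obtain m :: int where m: "\<bar>Re (\<tau> + of_int m)\<bar> \<le> 1/2" using norm_Re by blast
    define t where "t = \<tau> + of_int m"
    have t: "Im t = Im \<tau>" "\<bar>Re t\<bar> \<le> 1/2" "modular_density t = modular_density \<tau>"
      using m modular_density_translate[OF Suc.prems(1)] by (simp_all add: t_def)
    show ?case
    proof (cases "Im \<tau> \<ge> 1/2")
      case False
      have "(Re t)\<^sup>2 \<le> (1/2)\<^sup>2" using t(2) abs_le_square_iff[of "Re t" "1/2"] by simp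
      moreover have "(Im t)\<^sup>2 \<le> (1/2)\<^sup>2" using False Suc.prems(1) t(1) by (intro power_mono) auto
      ultimately have t2: "(cmod t)\<^sup>2 \<le> 1/2" using cmod_power2[of t] by (simp add: power_divide)
      have "t \<noteq> 0" using t(1) Suc.prems(1) by auto
      then have "Im t / (1/2) \<le> Im t / (cmod t)\<^sup>2" using t2 t(1) Suc.prems(1) by (intro divide_left_mono) auto
      then have S: "2 * Im t \<le> Im (- 1 / t)" unfolding Im_S by simp
      have "(1/2) ^ Suc n \<le> Im (- 1 / t)" using S Suc.prems(2) t(1) by simp
      then have "c \<le> modular_density (- 1 / t)" using Suc.IH[of "- 1 / t"] S Suc.prems(1) t(1) by simp
      then show ?thesis using modular_density_S[of t] t Suc.prems(1) by simp
    qed (use base in simp)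
  qed
  moreover have "\<exists>n. (1/2::real) ^ Suc n \<le> y" if "y > 0" for y
  proof -
    obtain n where "(1/2::real) ^ n < y" using real_arch_pow_inv[OF \<open>y > 0\<close>, of "1/2"] by auto
    moreover have "(1/2::real) ^ Suc n \<le> (1/2) ^ n" by simp
    ultimately show ?thesis by (intro exI[of _ n]) linarith
  qed
  ultimately show ?thesis using that[OF c] by blast
qed

section \<open>The square root and its symmetry\<close>

lemma square_constant_imp_constant_on:
  fixes q :: "complex \<Rightarrow> complex"
  assumes "connected S" "continuous_on S q" "\<And>x. x \<in> S \<Longrightarrow> (q x)\<^sup>2 = d"
  shows "q constant_on S"
proof -
  have "q ` S \<subseteq> {csqrt d, - csqrt d}"
  proof (rule image_subsetI)
    fix x assume x: "x \<in> S"
    have "(q x)\<^sup>2 = (csqrt d)\<^sup>2" using assms(3)[OF x] by simp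
    then have "q x = csqrt d \<or> q x = - csqrt d" by (simp only: power2_eq_iff)
    then show "q x \<in> {csqrt d, - csqrt d}" by blast
  qed
  then have "finite (q ` S)" by (rule finite_subset) simp
  then show ?thesis using continuous_finite_range_constant[OF assms(1,2)] by blast
qed

lemma square_constant_imp_constant:
  fixes q :: "complex \<Rightarrow> complex"
  assumes "connected S" "continuous_on S q" "\<And>x. x \<in> S \<Longrightarrow> (q x)\<^sup>2 = d"
  obtains k where "k\<^sup>2 = d \<or> S = {}" "\<And>x. x \<in> S \<Longrightarrow> q x = k"
proof -
  have "q constant_on S" by (rule square_constant_imp_constant_on[OF assms])
  then obtain k where k: "\<And>x. x \<in> S \<Longrightarrow> q x = k" by (auto simp: constant_on_def)
  then show ?thesis using that[of k] assms(3) by (cases "S = {}") auto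
qed

abbreviation upper_half :: "complex set" where "upper_half \<equiv> {\<tau>. Im \<tau> > 0}"

lemma upper_half_basic: "open upper_half" "convex upper_half" "connected upper_half" "contractible upper_half"
proof -
  show o: "open upper_half" by (rule open_halfspace_Im_gt)
  show c: "convex upper_half" by (rule convex_halfspace_Im_gt)
  show "connected upper_half" using c by (rule convex_connected)
  show "contractible upper_half" using c by (rule convex_imp_contractible)
qed

lemma half_period_differences_T2:
  assumes "Im \<tau> > 0" shows "e1_e3 (\<tau> + 2) = e1_e3 \<tau>" "e2_e3 (\<tau> + 2) = e2_e3 \<tau>"
  using half_period_differences_T[of "\<tau> + 1"] half_period_differences_T[of \<tau>] assms
  by (simp_all add: add.assoc)

lemma half_period_differences_inversion:
  assumes "Im \<tau> > 0"
  shows "e1_e3 (1 / cnj \<tau>) = (cnj \<tau>)\<^sup>2 * cnj (e2_e3 \<tau>)" "e2_e3 (1 / cnj \<tau>) = (cnj \<tau>)\<^sup>2 * cnj (e1_e3 \<tau>)"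
  using half_period_differences_S[of "- cnj \<tau>"] half_period_differences_cnj[OF assms] assms by simp_all

text \<open>
  The root is a product of roots \<open>ra\<close> of \<open>a\<close> and \<open>rc\<close> of \<open>c\<close>. Since \<open>c (\<tau> + 1) = - c \<tau>\<close>, each unit step multiplies \<open>rc\<close> by the same square root
  of \<open>-1\<close>, and two steps give the sign. The root \<open>ra\<close> keeps its sign, because near the cusp
  \<open>a\<close> is close to a nonzero limit and \<open>ra\<close> is there a multiple of the principal root.
\<close>

lemma sqrt_of_product:
  obtains s where "s holomorphic_on upper_half" "\<And>\<tau>. Im \<tau> > 0 \<Longrightarrow> (s \<tau>)\<^sup>2 = e1_e3 \<tau> * e2_e3 \<tau>"
    "\<And>\<tau>. Im \<tau> > 0 \<Longrightarrow> s (\<tau> + 2) = - s \<tau>"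
proof -
  obtain ra where ra: "ra holomorphic_on upper_half" "\<And>\<tau>. \<tau> \<in> upper_half \<Longrightarrow> e1_e3 \<tau> = (ra \<tau>)\<^sup>2"
    using contractible_imp_holomorphic_sqrt[OF half_period_differences_holomorphic(1) upper_half_basic(4)]
      half_period_differences_nonzero(1) by (metis mem_Collect_eq)
  obtain rc where rc: "rc holomorphic_on upper_half" "\<And>\<tau>. \<tau> \<in> upper_half \<Longrightarrow> e2_e3 \<tau> = (rc \<tau>)\<^sup>2"
    using contractible_imp_holomorphic_sqrt[OF half_period_differences_holomorphic(2) upper_half_basic(4)]
      half_period_differences_nonzero(2) by (metis mem_Collect_eq)
  have nz: "ra \<tau> \<noteq> 0" "rc \<tau> \<noteq> 0" if "Im \<tau> > 0" for \<tau>
    using ra(2)[of \<tau>] rc(2)[of \<tau>] half_period_differences_nonzero[OF that] that by auto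
  have shift: "continuous_on upper_half (\<lambda>\<tau>. f (\<tau> + of_real c))" if "f holomorphic_on upper_half" for f :: "complex \<Rightarrow> complex" and c
    by (rule continuous_on_compose2[OF holomorphic_on_imp_continuous_on[OF that]]) (auto intro!: continuous_intros)
  have "continuous_on upper_half (\<lambda>\<tau>. rc (\<tau> + of_real 1) / rc \<tau>)"
    using nz(2) by (intro continuous_on_divide shift rc holomorphic_on_imp_continuous_on) auto
  moreover have "(rc (\<tau> + of_real 1) / rc \<tau>)\<^sup>2 = -1" if "\<tau> \<in> upper_half" for \<tau>
  proof -
    have "(rc (\<tau> + 1))\<^sup>2 = - (rc \<tau>)\<^sup>2"
      using rc(2)[of "\<tau> + 1"] rc(2)[of \<tau>] half_period_differences_T(2)[of \<tau>] that by simp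
    then show ?thesis using nz(2)[of \<tau>] that by (simp add: power_divide)
  qed
  ultimately obtain k where k: "k\<^sup>2 = -1 \<or> upper_half = {}" "\<And>\<tau>. \<tau> \<in> upper_half \<Longrightarrow> rc (\<tau> + of_real 1) / rc \<tau> = k"
    using square_constant_imp_constant[OF upper_half_basic(3)] by blast
  have "\<i> \<in> upper_half" by simp
  then have "k\<^sup>2 = -1" using k(1) by blast
  have rc1: "rc (\<tau> + 1) = k * rc \<tau>" if "Im \<tau> > 0" for \<tau>
    using k(2)[of \<tau>] nz(2)[of \<tau>] that by (simp add: field_simps)
  have rc2: "rc (\<tau> + 2) = - rc \<tau>" if "Im \<tau> > 0" for \<tau>
  proof -
    have "rc (\<tau> + 2) = k\<^sup>2 * rc \<tau>"
      using rc1[of "\<tau> + 1"] rc1[OF that] that by (simp add: add.assoc power2_eq_square)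
    then show ?thesis by (simp add: \<open>k\<^sup>2 = -1\<close>)
  qed
  have "continuous_on upper_half (\<lambda>\<tau>. ra (\<tau> + of_real 2) / ra \<tau>)"
    using nz(1) by (intro continuous_on_divide shift ra holomorphic_on_imp_continuous_on) auto
  moreover have "(ra (\<tau> + of_real 2) / ra \<tau>)\<^sup>2 = 1" if "\<tau> \<in> upper_half" for \<tau>
  proof -
    have "(ra (\<tau> + 2))\<^sup>2 = (ra \<tau>)\<^sup>2"
      using ra(2)[of "\<tau> + 2"] ra(2)[of \<tau>] half_period_differences_T2(1)[of \<tau>] that by simp
    then show ?thesis using nz(1)[of \<tau>] that by (simp add: power_divide)
  qed
  ultimately obtain l where l: "\<And>\<tau>. \<tau> \<in> upper_half \<Longrightarrow> ra (\<tau> + of_real 2) / ra \<tau> = l"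
    using square_constant_imp_constant[OF upper_half_basic(3)] by blast
  obtain Y0 where Y0: "Y0 \<ge> 4" "\<And>\<tau>. Im \<tau> \<ge> Y0 \<Longrightarrow> cmod (e1_e3 \<tau> - row_sum (1/2)) \<le> cmod (row_sum (1/2)) / 2"
    using e1_e3_near_cusp by blast
  define L where "L = row_sum (1/2)"
  have L: "L \<noteq> 0" using row_half_nonzero by (simp add: L_def)
  define S where "S = {\<tau>. Im \<tau> > Y0}"
  have Ssub: "S \<subseteq> upper_half" using Y0(1) by (auto simp: S_def)
  have "connected S" unfolding S_def by (intro convex_connected convex_halfspace_Im_gt)
  have right: "Re (e1_e3 \<tau> / L) > 0" if "\<tau> \<in> S" for \<tau>
  proof -
    have "cmod (e1_e3 \<tau> / L - 1) = cmod (e1_e3 \<tau> - L) / cmod L" using L by (simp add: diff_divide_distrib flip: norm_divide)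
    also have "\<dots> \<le> 1/2" using Y0(2)[of \<tau>] that L by (simp add: S_def L_def field_simps)
    finally show ?thesis using abs_Re_le_cmod[of "e1_e3 \<tau> / L - 1"] by simp
  qed
  \<comment> \<open>near the cusp e1_e3 / L lies in the right half-plane, where the principal root is continuous\<close>
  define b where "b \<tau> = csqrt (e1_e3 \<tau> / L)" for \<tau>
  have bnz: "b \<tau> \<noteq> 0" if "\<tau> \<in> S" for \<tau> using right[OF that] by (auto simp: b_def)
  have contS: "continuous_on S e1_e3" "continuous_on S ra"
    using half_period_differences_holomorphic(1) ra(1) Ssub by (auto intro: holomorphic_on_imp_continuous_on holomorphic_on_subset)
  have "continuous_on {z. Re z > 0} csqrt"
    by (intro continuous_at_imp_continuous_on ballI continuous_at_csqrt) (auto simp: complex_nonpos_Reals_iff)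
  then have "continuous_on S b" unfolding b_def
    by (rule continuous_on_compose2) (use right L contS in \<open>auto intro!: continuous_intros\<close>)
  then have contq: "continuous_on S (\<lambda>\<tau>. ra \<tau> / b \<tau>)" using bnz contS by (intro continuous_intros) auto
  have sqq: "(ra \<tau> / b \<tau>)\<^sup>2 = L" if "\<tau> \<in> S" for \<tau>
  proof -
    have "\<tau> \<in> upper_half" using that Ssub by blast
    then have "e1_e3 \<tau> \<noteq> 0" "(ra \<tau>)\<^sup>2 = e1_e3 \<tau>"
      using half_period_differences_nonzero(1)[of \<tau>] ra(2)[of \<tau>] by simp_all
    moreover have "(b \<tau>)\<^sup>2 = e1_e3 \<tau> / L" by (simp add: b_def)
    ultimately show ?thesis using L by (simp only: power_divide) simp
  qed
  have "(\<lambda>\<tau>. ra \<tau> / b \<tau>) constant_on S"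
    by (rule square_constant_imp_constant_on[OF \<open>connected S\<close> contq sqq])
  then obtain m where m: "\<And>\<tau>. \<tau> \<in> S \<Longrightarrow> ra \<tau> / b \<tau> = m" unfolding constant_on_def by blast
  define t0 where "t0 = Complex 0 (Y0 + 1)"
  have t0: "t0 \<in> S" "t0 + 2 \<in> S" "Im t0 > 0" using Y0(1) by (auto simp: t0_def S_def)
  have "b (t0 + 2) = b t0" using half_period_differences_T2(1)[OF t0(3)] by (simp add: b_def)
  moreover have "ra t0 = m * b t0" "ra (t0 + 2) = m * b (t0 + 2)"
    using m[OF t0(1)] m[OF t0(2)] bnz[OF t0(1)] bnz[OF t0(2)] by (auto simp: divide_eq_eq)
  ultimately have "ra (t0 + 2) = ra t0" by simp
  then have "l = 1" using l[of t0] t0(3) nz(1)[OF t0(3)] by simp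
  then have ra2: "ra (\<tau> + 2) = ra \<tau>" if "Im \<tau> > 0" for \<tau>
    using l[of \<tau>] nz(1)[OF that] that by simp
  show ?thesis
  proof (rule that[of "\<lambda>\<tau>. ra \<tau> * rc \<tau>"])
    show "(\<lambda>\<tau>. ra \<tau> * rc \<tau>) holomorphic_on upper_half" by (intro holomorphic_intros ra rc)
    show "(ra \<tau> * rc \<tau>)\<^sup>2 = e1_e3 \<tau> * e2_e3 \<tau>" if "Im \<tau> > 0" for \<tau>
      using ra(2)[of \<tau>] rc(2)[of \<tau>] that by (simp add: power_mult_distrib)
    show "ra (\<tau> + 2) * rc (\<tau> + 2) = - (ra \<tau> * rc \<tau>)" if "Im \<tau> > 0" for \<tau>
      using ra2 rc2 that by simp
  qed
qed

text \<open>
  Up to a sign this follows from the symmetry of \<open>a c\<close> under \<open>\<tau> \<mapsto> 1 / cnj \<tau>\<close>. The sign is constant and can be read off at the fixed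
  point \<open>\<i>\<close>, where it is \<open>+\<close>; the translation by \<open>2\<close> then reverses it. Without this reversal
  the Gauss map would turn the glide into the reflection in the unit circle and not into the antipodal map.
\<close>

lemma sqrt_of_product_glide:
  assumes "s holomorphic_on upper_half" "\<And>\<tau>. Im \<tau> > 0 \<Longrightarrow> (s \<tau>)\<^sup>2 = e1_e3 \<tau> * e2_e3 \<tau>"
    "\<And>\<tau>. Im \<tau> > 0 \<Longrightarrow> s (\<tau> + 2) = - s \<tau>" "Im \<tau> > 0"
  shows "s (1 / (cnj \<tau> + 2)) = - (cnj \<tau> + 2)\<^sup>2 * cnj (s \<tau>)"
proof -
  have nz: "s \<tau> \<noteq> 0" if "Im \<tau> > 0" for \<tau>
    using assms(2)[OF that] half_period_differences_nonzero[OF that] by auto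
  have inv: "Im (1 / cnj \<tau>) > 0" if "Im \<tau> > 0" for \<tau>
    using Im_S_pos[of "- cnj \<tau>"] that by simp
  define q where "q \<tau> = s (1 / cnj \<tau>) / ((cnj \<tau>)\<^sup>2 * cnj (s \<tau>))" for \<tau>
  have cs: "continuous_on upper_half s" using assms(1) by (rule holomorphic_on_imp_continuous_on)
  have "continuous_on upper_half q"
    unfolding q_def
  proof (intro continuous_on_divide continuous_on_mult continuous_intros cs)
    show "continuous_on upper_half (\<lambda>x. s (1 / cnj x))"
      by (rule continuous_on_compose2[OF cs]) (use inv in \<open>auto intro!: continuous_intros\<close>)
  qed (use nz in auto)
  moreover have "(q \<tau>)\<^sup>2 = 1" if "\<tau> \<in> upper_half" for \<tau>
  proof -
    have t: "Im \<tau> > 0" "\<tau> \<noteq> 0" using that by auto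
    have "(s (1 / cnj \<tau>))\<^sup>2 = ((cnj \<tau>)\<^sup>2 * cnj (s \<tau>))\<^sup>2"
      unfolding assms(2)[OF inv[OF t(1)]] half_period_differences_inversion[OF t(1)] power_mult_distrib
      using arg_cong[OF assms(2)[OF t(1)], of cnj] by (simp add: power2_eq_square)
    then show ?thesis using t nz[OF t(1)] by (simp add: q_def power_divide)
  qed
  ultimately obtain k where k: "\<And>\<tau>. \<tau> \<in> upper_half \<Longrightarrow> q \<tau> = k"
    using square_constant_imp_constant[OF upper_half_basic(3)] by blast
  have "k = 1"
  proof -
    have i: "Im \<i> > 0" by simp
    have e: "e1_e3 \<i> = - cnj (e2_e3 \<i>)" using half_period_differences_inversion(1)[OF i] by simp
    have "(s \<i>)\<^sup>2 = - (cnj (e2_e3 \<i>) * e2_e3 \<i>)" using assms(2)[OF i] e by simp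
    also have "cnj (e2_e3 \<i>) * e2_e3 \<i> = of_real ((cmod (e2_e3 \<i>))\<^sup>2)" by (simp only: complex_norm_square mult.commute)
    finally have "(s \<i>)\<^sup>2 = (\<i> * of_real (cmod (e2_e3 \<i>)))\<^sup>2" by (simp add: power_mult_distrib)
    then have "s \<i> = \<i> * of_real (cmod (e2_e3 \<i>)) \<or> s \<i> = - (\<i> * of_real (cmod (e2_e3 \<i>)))" by (simp only: power2_eq_iff)
    then have "cnj (s \<i>) = - s \<i>" by auto
    then have "q \<i> = 1" using nz[OF i] by (simp add: q_def)
    then show ?thesis using k[of \<i>] by simp
  qed
  have t2: "Im (\<tau> + 2) > 0" "\<tau> + 2 \<noteq> 0" using assms(4) by (auto simp: complex_eq_iff)
  have "q (\<tau> + 2) = 1" using k[of "\<tau> + 2"] t2 \<open>k = 1\<close> by simp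
  then have "s (1 / cnj (\<tau> + 2)) = (cnj (\<tau> + 2))\<^sup>2 * cnj (s (\<tau> + 2))"
    using t2 nz[OF t2(1)] by (simp add: q_def)
  then show ?thesis using assms(3)[OF assms(4)] by simp
qed

section \<open>Weierstrass data on a strip\<close>

text \<open>
  The glide reflection \<open>\<tau> \<mapsto> 1 / (cnj \<tau> + 2)\<close> moves along the geodesic that joins its fixed points \<open>-1 + sqrt 2\<close> and
  \<open>-1 - sqrt 2\<close> on the real line. The map \<open>M\<close> sends the strip onto the half-plane, its two ends to these
  points, and conjugates \<open>z \<mapsto> cnj z + \<pi>\<close> to the glide reflection. The three functions are the pull-backs of
  \<open>a d\<tau>\<close>, \<open>c d\<tau>\<close> and \<open>sqrt (a c) d\<tau>\<close>; the factor \<open>\<i>\<close> in them compensates for the sign in the derivative of the glide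
  reflection. The growth is the lower bound for the modular density, because the hyperbolic density of the strip is
  at least the reciprocal of the distance to the boundary.
\<close>

theorem strip_weierstrass_data:
  obtains b c :: real and \<alpha> \<gamma> \<sigma> :: "complex \<Rightarrow> complex"
  where "b > 0" "c > 0"
    "\<alpha> holomorphic_on {z. \<bar>Im z\<bar> < b}" "\<gamma> holomorphic_on {z. \<bar>Im z\<bar> < b}" "\<sigma> holomorphic_on {z. \<bar>Im z\<bar> < b}"
    "\<And>z. \<bar>Im z\<bar> < b \<Longrightarrow> \<alpha> z \<noteq> 0 \<and> \<gamma> z \<noteq> 0 \<and> \<alpha> z \<noteq> \<gamma> z \<and> (\<sigma> z)\<^sup>2 = \<alpha> z * \<gamma> z"
    "\<And>z. \<bar>Im z\<bar> < b \<Longrightarrow> \<alpha> (cnj z + of_real pi) = cnj (\<gamma> z) \<and> \<gamma> (cnj z + of_real pi) = cnj (\<alpha> z) \<and>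
        \<sigma> (cnj z + of_real pi) = - cnj (\<sigma> z)"
    "\<And>z. \<bar>Im z\<bar> < b \<Longrightarrow> c / (b - \<bar>Im z\<bar>) \<le> cmod (\<alpha> z) + cmod (\<gamma> z)"
proof -
  obtain s where s: "s holomorphic_on upper_half" "\<And>\<tau>. Im \<tau> > 0 \<Longrightarrow> (s \<tau>)\<^sup>2 = e1_e3 \<tau> * e2_e3 \<tau>"
    "\<And>\<tau>. Im \<tau> > 0 \<Longrightarrow> s (\<tau> + 2) = - s \<tau>" using sqrt_of_product by blast
  obtain c0 where c0: "c0 > 0" "\<And>\<tau>. Im \<tau> > 0 \<Longrightarrow> c0 \<le> modular_density \<tau>" using modular_density_lower_bound by blast
  \<comment> \<open>p and pm are the fixed points of t -> 1 / (t + 2)\<close>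
  define p where "p = sqrt (2::real) - 1"
  define pm where "pm = - 1 - sqrt (2::real)"
  have pp: "p * pm = -1" "p + 2 = - pm" "pm + 2 = - p" "p > 0" "p < 1"
  proof -
    have "sqrt (2::real) * sqrt 2 = 2" "1 < sqrt (2::real)" "sqrt (2::real) < 2"
      by (simp_all add: real_less_lsqrt)
    then show "p * pm = -1" "p + 2 = - pm" "pm + 2 = - p" "p > 0" "p < 1"
      unfolding p_def pm_def by (simp_all add: algebra_simps)
  qed
  \<comment> \<open>the glide reflection is multiplication by - \<rho>, followed by conjugation, in the coordinate that sends p to 0 and pm to infinity\<close>
  define \<rho> where "\<rho> = p\<^sup>2"
  have \<rho>: "0 < \<rho>" "\<rho> < 1" using pp(4,5) by (auto simp: \<rho>_def power_less_one_iff)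
  define \<kappa> where "\<kappa> = - ln \<rho> / pi"
  have \<kappa>: "\<kappa> > 0" "exp (- \<kappa> * pi) = \<rho>" using \<rho> by (auto simp: \<kappa>_def divide_neg_pos)
  \<comment> \<open>half the width for which w maps the strip onto the upper half-plane\<close>
  define b where "b = pi / (2 * \<kappa>)"
  have b: "b > 0" "\<kappa> * b = pi / 2" using \<kappa> by (auto simp: b_def)
  let ?S = "{z. \<bar>Im z\<bar> < b}"
  define w where "w z = \<i> * exp (- of_real \<kappa> * z)" for z
  define M where "M z = (of_real p - of_real pm * w z) / (1 - w z)" for z
  define M' where "M' z = of_real (p - pm) * (- of_real \<kappa> * w z) / (1 - w z)\<^sup>2" for z
  have Imw: "Im (w z) = cmod (w z) * cos (\<kappa> * Im z)" for z
    by (simp add: w_def norm_mult Re_exp)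
  have cospos: "cos (\<kappa> * Im z) > 0" "cos (\<kappa> * Im z) \<le> \<kappa> * (b - \<bar>Im z\<bar>)" if "\<bar>Im z\<bar> < b" for z
  proof -
    have lt: "\<kappa> * \<bar>Im z\<bar> < pi / 2" using that \<kappa> b(2) by (metis mult_less_cancel_left_pos)
    have "cos (\<kappa> * Im z) = cos (\<kappa> * \<bar>Im z\<bar>)" by (cases "Im z \<ge> 0") auto
    moreover have "cos (\<kappa> * \<bar>Im z\<bar>) > 0" using lt \<kappa> by (intro cos_gt_zero_pi) (auto intro: less_le_trans[of _ 0] simp: mult_nonneg_nonneg)
    moreover have "cos (\<kappa> * \<bar>Im z\<bar>) = sin (\<kappa> * (b - \<bar>Im z\<bar>))"
      by (simp add: right_diff_distrib b(2) cos_sin_eq)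
    moreover have "sin (\<kappa> * (b - \<bar>Im z\<bar>)) \<le> \<kappa> * (b - \<bar>Im z\<bar>)" using that \<kappa> by (intro sin_x_le_x) auto
    ultimately show "cos (\<kappa> * Im z) > 0" "cos (\<kappa> * Im z) \<le> \<kappa> * (b - \<bar>Im z\<bar>)" by auto
  qed
  have wpos: "Im (w z) > 0" "w z \<noteq> 1" if "\<bar>Im z\<bar> < b" for z
  proof -
    show "Im (w z) > 0" unfolding Imw using cospos(1)[OF that] by (simp add: w_def)
    then show "w z \<noteq> 1" by auto
  qed
  have ImM: "Im (M z) = (p - pm) * Im (w z) / (cmod (1 - w z))\<^sup>2" if "\<bar>Im z\<bar> < b" for z
  proof -
    have "Im (M z) = Im ((of_real p - of_real pm * w z) * cnj (1 - w z)) / (cmod (1 - w z))\<^sup>2"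
      unfolding M_def by (simp add: complex_div_cnj[of _ "1 - w z"] Im_divide_of_real flip: of_real_power)
    also have "Im ((of_real p - of_real pm * w z) * cnj (1 - w z)) = (p - pm) * Im (w z)"
      by (simp add: algebra_simps)
    finally show ?thesis .
  qed
  have ppm: "p - pm > 0" by (simp add: p_def pm_def)
  have Mpos: "Im (M z) > 0" if "\<bar>Im z\<bar> < b" for z
    unfolding ImM[OF that] using wpos[OF that] ppm by simp
  have holw: "w holomorphic_on A" for A unfolding w_def by (intro holomorphic_intros)
  have holM: "M holomorphic_on ?S" and holM': "M' holomorphic_on ?S"
    unfolding M_def M'_def using wpos(2) by (auto intro!: holomorphic_intros holw)
  have wI: "w (cnj z + of_real pi) = - of_real \<rho> * cnj (w z)" for z
  proof -
    have "exp (- of_real \<kappa> * (cnj z + of_real pi)) = exp (of_real (- \<kappa> * pi)) * cnj (exp (- of_real \<kappa> * z))"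
    proof -
      have "- of_real \<kappa> * (cnj z + of_real pi) = of_real (- \<kappa> * pi) + cnj (- of_real \<kappa> * z)" by (simp add: algebra_simps)
      then show ?thesis by (simp only: exp_add exp_cnj)
    qed
    also have "exp (of_real (- \<kappa> * pi)) = complex_of_real \<rho>" by (simp only: exp_of_real \<kappa>(2))
    finally show ?thesis by (simp add: w_def)
  qed
  have MI: "M (cnj z + of_real pi) = 1 / (cnj (M z) + 2)"
    and M'I: "M' (cnj z + of_real pi) = - cnj (M' z) / (cnj (M z) + 2)\<^sup>2" if z: "\<bar>Im z\<bar> < b" for z
  proof -
    define v where "v = cnj (w z)"
    define P where "P = complex_of_real p"
    define Q where "Q = complex_of_real pm"
    have PQ: "P * Q = -1" "P + 2 = - Q" "Q + 2 = - P" "P \<noteq> 0"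
      using pp unfolding P_def Q_def by (metis of_real_mult of_real_1 of_real_minus, metis of_real_add of_real_numeral of_real_minus, metis of_real_add of_real_numeral of_real_minus, simp)
    have v1: "1 - v \<noteq> 0" using wpos(2)[OF z] unfolding v_def by (metis complex_cnj_cancel_iff complex_cnj_one right_minus_eq)
    have zI: "\<bar>Im (cnj z + of_real pi)\<bar> < b" using z by simp
    have v2: "1 + P\<^sup>2 * v \<noteq> 0" using wpos(2)[OF zI] unfolding wI v_def[symmetric] P_def \<rho>_def by (auto simp: add_eq_0_iff)
    have cM: "cnj (M z) + 2 = (1 + P\<^sup>2 * v) / (P * (1 - v))"
    proof -
      have "cnj (M z) = (P - Q * v) / (1 - v)" by (simp add: M_def v_def P_def Q_def)
      then have "cnj (M z) + 2 = ((P + 2) - (Q + 2) * v) / (1 - v)" using v1 by (simp add: field_simps)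
      also have "\<dots> = (- Q + P * v) / (1 - v)" unfolding PQ by simp
      also have "- Q = 1 / P" using PQ(1,4) by (simp add: field_simps) 
      finally show ?thesis using v1 PQ(4) by (simp add: field_simps power2_eq_square)
    qed
    have wv: "w (cnj z + of_real pi) = - (P\<^sup>2 * v)" by (simp add: wI v_def P_def \<rho>_def)
    have QP: "Q * P\<^sup>2 = - P" using PQ(1) by (simp add: power2_eq_square algebra_simps flip: mult.assoc)
    have "M (cnj z + of_real pi) = (P + Q * P\<^sup>2 * v) / (1 + P\<^sup>2 * v)" unfolding M_def wv by (simp add: P_def Q_def)
    also have "\<dots> = P * (1 - v) / (1 + P\<^sup>2 * v)" unfolding QP by (simp add: algebra_simps)
    finally show "M (cnj z + of_real pi) = 1 / (cnj (M z) + 2)" unfolding cM by simp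
    have "M' (cnj z + of_real pi) = (P - Q) * (of_real \<kappa> * P\<^sup>2 * v) / (1 + P\<^sup>2 * v)\<^sup>2"
      unfolding M'_def wv by (simp add: P_def Q_def)
    moreover have "cnj (M' z) = (P - Q) * (- of_real \<kappa> * v) / (1 - v)\<^sup>2" by (simp add: M'_def P_def Q_def v_def)
    moreover have "X * (k * P\<^sup>2 * v) / D\<^sup>2 = - (X * (- k * v) / A\<^sup>2) / (D / (P * A))\<^sup>2" if "A \<noteq> 0" "D \<noteq> 0" for X k A D
      using that PQ(4) by (simp add: field_simps power2_eq_square)
    ultimately show "M' (cnj z + of_real pi) = - cnj (M' z) / (cnj (M z) + 2)\<^sup>2"
      unfolding cM using v1 v2 by (simp only: refl)
  qed
  have Mim: "M ` ?S \<subseteq> upper_half" using Mpos by auto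
  define \<alpha> where "\<alpha> z = \<i> * e1_e3 (M z) * M' z" for z
  define \<gamma> where "\<gamma> z = \<i> * e2_e3 (M z) * M' z" for z
  define \<sigma> where "\<sigma> z = \<i> * s (M z) * M' z" for z
  have comp: "(\<lambda>z. f (M z)) holomorphic_on ?S" if "f holomorphic_on upper_half" for f
    using holomorphic_on_compose_gen[OF holM that Mim] by (simp add: o_def)
  have M'nz: "M' z \<noteq> 0" if "\<bar>Im z\<bar> < b" for z
    using wpos[OF that] ppm \<kappa> by (auto simp: M'_def w_def)
  show ?thesis
  proof (rule that[of b "c0 / 2" \<alpha> \<gamma> \<sigma>])
    show "\<alpha> holomorphic_on ?S" "\<gamma> holomorphic_on ?S" "\<sigma> holomorphic_on ?S"
      unfolding \<alpha>_def \<gamma>_def \<sigma>_def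
      by (intro holomorphic_intros comp holM' half_period_differences_holomorphic s)+
  next
    fix z assume z: "\<bar>Im z\<bar> < b"
    note m = Mpos[OF z]
    show "\<alpha> z \<noteq> 0 \<and> \<gamma> z \<noteq> 0 \<and> \<alpha> z \<noteq> \<gamma> z \<and> (\<sigma> z)\<^sup>2 = \<alpha> z * \<gamma> z"
      using half_period_differences_nonzero[OF m] M'nz[OF z] s(2)[OF m]
      by (auto simp: \<alpha>_def \<gamma>_def \<sigma>_def power_mult_distrib power2_eq_square)
    have m2: "Im (M z + 2) > 0" "cnj (M z) + 2 \<noteq> 0" using m by (auto simp: complex_eq_iff)
    have e: "e1_e3 (1 / (cnj (M z) + 2)) = (cnj (M z) + 2)\<^sup>2 * cnj (e2_e3 (M z))"
      "e2_e3 (1 / (cnj (M z) + 2)) = (cnj (M z) + 2)\<^sup>2 * cnj (e1_e3 (M z))"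
      using half_period_differences_inversion[OF m2(1)] half_period_differences_T2[OF m] by simp_all
    have sg: "s (1 / (cnj (M z) + 2)) = - (cnj (M z) + 2)\<^sup>2 * cnj (s (M z))"
      using sqrt_of_product_glide[of s "M z"] s m by blast
    show "\<alpha> (cnj z + of_real pi) = cnj (\<gamma> z) \<and> \<gamma> (cnj z + of_real pi) = cnj (\<alpha> z) \<and> \<sigma> (cnj z + of_real pi) = - cnj (\<sigma> z)"
      unfolding \<alpha>_def \<gamma>_def \<sigma>_def MI[OF z] M'I[OF z] e sg using m2(2) by (simp add: sg)
    have "cmod (M' z) = (p - pm) * \<kappa> * cmod (w z) / (cmod (1 - w z))\<^sup>2"
      using ppm \<kappa> by (simp add: M'_def norm_mult norm_divide norm_power del: of_real_diff)
    moreover have "(a * k * W / N\<^sup>2) / (a * (W * C) / N\<^sup>2) = k / C" if "a \<noteq> 0" "N \<noteq> 0" "W \<noteq> 0" for a k W N C :: real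
      using that by (simp add: field_simps)
    ultimately have "cmod (M' z) / Im (M z) = \<kappa> / cos (\<kappa> * Im z)"
      unfolding ImM[OF z] Imw using ppm wpos(2)[OF z] by (simp add: w_def)
    also have "\<dots> \<ge> \<kappa> / (\<kappa> * (b - \<bar>Im z\<bar>))"
      using cospos[OF z] \<kappa> z by (intro divide_left_mono) auto
    finally have dens: "1 / (b - \<bar>Im z\<bar>) \<le> cmod (M' z) / Im (M z)" using \<kappa> by simp
    have tri: "cmod (e1_e3 (M z) - e2_e3 (M z)) \<le> cmod (e1_e3 (M z)) + cmod (e2_e3 (M z))" by (rule norm_triangle_ineq4)
    have "c0 \<le> Im (M z) * (cmod (e1_e3 (M z)) + cmod (e2_e3 (M z)) + cmod (e1_e3 (M z) - e2_e3 (M z)))"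
      using c0(2)[OF m] by (simp add: modular_density_def)
    also have "\<dots> \<le> Im (M z) * (2 * (cmod (e1_e3 (M z)) + cmod (e2_e3 (M z))))"
      using m tri by (intro mult_left_mono) auto
    finally have c2: "c0 / 2 \<le> Im (M z) * (cmod (e1_e3 (M z)) + cmod (e2_e3 (M z)))" by (simp add: algebra_simps)
    have "c0 / 2 / (b - \<bar>Im z\<bar>) = c0 / 2 * (1 / (b - \<bar>Im z\<bar>))" by simp
    also have "\<dots> \<le> (Im (M z) * (cmod (e1_e3 (M z)) + cmod (e2_e3 (M z)))) * (cmod (M' z) / Im (M z))"
      using c2 dens m z c0(1) by (intro mult_mono) auto
    also have "\<dots> = cmod (\<alpha> z) + cmod (\<gamma> z)"
      using m by (simp add: \<alpha>_def \<gamma>_def norm_mult field_simps)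
    finally show "c0 / 2 / (b - \<bar>Im z\<bar>) \<le> cmod (\<alpha> z) + cmod (\<gamma> z)" .
  qed (use b c0 in auto)
qed

section \<open>Closing the real periods\<close>

text \<open>
  If there were no zero, \<open>u \<mapsto> - R \<Psi> u / |\<Psi> u|\<close> would have a fixed point by Brouwer's theorem. It would lie on the sphere, and the field would
  point inwards there.
\<close>

lemma outward_field_has_zero:
  fixes \<Psi> :: "'a::euclidean_space \<Rightarrow> 'a"
  assumes R: "R > 0" and cont: "continuous_on (cball 0 R) \<Psi>"
    and out: "\<And>u. norm u = R \<Longrightarrow> u \<bullet> \<Psi> u > 0"
  shows "\<exists>u\<in>cball 0 R. \<Psi> u = 0"
proof (rule ccontr)
  assume "\<not> ?thesis"
  then have nz: "\<And>u. u \<in> cball 0 R \<Longrightarrow> \<Psi> u \<noteq> 0" by blast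
  define f where "f u = (- R / norm (\<Psi> u)) *\<^sub>R \<Psi> u" for u
  have "continuous_on (cball 0 R) f"
    unfolding f_def using nz cont by (intro continuous_intros) auto
  moreover have fim: "norm (f u) = R" if "u \<in> cball 0 R" for u
    using nz[OF that] R by (simp add: f_def)
  then have "f \<in> cball 0 R \<rightarrow> cball 0 R" by (simp add: Pi_iff)
  ultimately obtain u where u: "u \<in> cball 0 R" "f u = u"
    using brouwer[OF compact_cball convex_cball _ _ , of 0 R f] R by (metis cball_eq_empty less_asym)
  then have "norm u = R" using fim[OF u(1)] by simp
  then have "u \<bullet> \<Psi> u > 0" by (rule out)
  moreover have "\<Psi> u \<bullet> u = - R * norm (\<Psi> u)"
  proof -
    have "\<Psi> u \<bullet> f u = - R / norm (\<Psi> u) * (norm (\<Psi> u))\<^sup>2" by (simp add: f_def power2_norm_eq_inner)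
    then show ?thesis using u nz[OF u(1)] by (simp add: power2_eq_square)
  qed
  ultimately show False using R nz[OF u(1)] by (simp add: inner_commute mult_less_0_iff)
qed

text \<open>
  Compactness of the unit sphere; note that \<open>x\<close> may depend on \<open>\<nu>\<close>.
\<close>

lemma uniformly_positive_directions:
  fixes V :: "real \<Rightarrow> 'a::euclidean_space"
  assumes pos: "\<And>\<nu>. norm \<nu> = 1 \<Longrightarrow> \<exists>x\<in>{0..L}. \<nu> \<bullet> V x > 0"
  shows "\<exists>c>0. \<forall>\<nu>. norm \<nu> = 1 \<longrightarrow> (\<exists>x\<in>{0..L}. \<nu> \<bullet> V x \<ge> c)"
proof (rule ccontr)
  assume "\<not> ?thesis"
  then have "\<exists>\<nu>. norm \<nu> = 1 \<and> (\<forall>x\<in>{0..L}. \<nu> \<bullet> V x < 1 / real (Suc n))" for n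
    by (meson not_le of_nat_0_less_iff zero_less_Suc zero_less_divide_1_iff)
  then obtain \<nu> where \<nu>: "\<And>n. norm (\<nu> n) = 1" "\<And>n x. x \<in> {0..L} \<Longrightarrow> \<nu> n \<bullet> V x < 1 / real (Suc n)"
    by metis
  have "\<forall>n. \<nu> n \<in> sphere 0 1" using \<nu> by simp
  then obtain l r where l: "l \<in> sphere 0 1" "strict_mono r" "(\<nu> \<circ> r) \<longlonglongrightarrow> l"
    using compact_sphere[of "0::'a" 1] unfolding compact_def by metis
  then obtain x where x: "x \<in> {0..L}" "l \<bullet> V x > 0" using pos[of l] by auto
  have "(\<lambda>n. (\<nu> \<circ> r) n \<bullet> V x) \<longlonglongrightarrow> l \<bullet> V x" by (intro tendsto_intros l)
  moreover have "(\<lambda>n. 1 / real (Suc (r n))) \<longlonglongrightarrow> 0"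
    using LIMSEQ_subseq_LIMSEQ[OF LIMSEQ_Suc[OF lim_inverse_n'] l(2)] by (simp add: o_def)
  ultimately have "l \<bullet> V x \<le> 0"
    by (rule LIMSEQ_le) (use \<nu>(2)[OF x(1)] in \<open>auto intro: less_imp_le\<close>)
  then show False using x by simp
qed

lemma exp_times_self_ge: "exp t * t \<ge> (-1::real)"
proof (cases "t \<ge> 0")
  case False
  have "- t \<le> exp (- t)" using exp_ge_add_one_self[of "- t"] by linarith
  then have "exp t * (- t) \<le> exp t * exp (- t)" by (intro mult_left_mono) auto
  then show ?thesis by (simp flip: exp_add)
qed (auto intro: order_trans[of _ 0])

lemma exp_diff_le: "\<bar>exp a - exp b\<bar> \<le> exp (max a b) * \<bar>a - b\<bar>" for a b :: real
proof -
  have *: "exp y - exp x \<le> exp y * (y - x)" for x y :: real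
  proof -
    have "exp y * (1 + (x - y)) \<le> exp y * exp (x - y)" using exp_ge_add_one_self[of "x - y"] by (intro mult_left_mono) auto
    then show ?thesis by (simp flip: exp_add add: algebra_simps)
  qed
  show ?thesis using *[of a b] *[of b a] by (cases "a \<le> b") (auto simp: max_def abs_if)
qed

text \<open>
  In a direction \<open>u\<close> of large norm the weight makes the part of the curve with \<open>u \<cdot> V\<close> positive outweigh the rest, so
  \<open>u \<mapsto> \<integral> exp (u \<cdot> V) V\<close> points outwards on a large sphere and has a zero inside. This remains true
  if the exponent uses a curve \<open>W\<close> that is uniformly close to \<open>V\<close>.
\<close>

lemma exponential_weight_closes:
  fixes V :: "real \<Rightarrow> 'a::euclidean_space"
  assumes L: "L > 0" and cont: "continuous_on {0..L} V"
    and pos: "\<And>\<nu>. norm \<nu> = 1 \<Longrightarrow> \<exists>x\<in>{0..L}. \<nu> \<bullet> V x > 0"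
  shows "\<exists>\<delta>>0. \<forall>W. continuous_on {0..L} W \<and> (\<forall>x\<in>{0..L}. norm (W x - V x) \<le> \<delta>) \<longrightarrow>
     (\<exists>u. integral {0..L} (\<lambda>x. exp (u \<bullet> W x) *\<^sub>R V x) = 0)"
proof -
  obtain c where c: "c > 0" "\<And>\<nu>. norm \<nu> = 1 \<Longrightarrow> \<exists>x\<in>{0..L}. \<nu> \<bullet> V x \<ge> c"
    using uniformly_positive_directions[OF pos] by blast
  have "uniformly_continuous_on {0..L} V" using cont by (intro compact_uniformly_continuous) auto
  then obtain \<eta>0 where \<eta>0: "\<eta>0 > 0" "\<And>x y. \<lbrakk>x \<in> {0..L}; y \<in> {0..L}; dist y x < \<eta>0\<rbrakk> \<Longrightarrow> dist (V y) (V x) < c / 2"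
    using c(1) unfolding uniformly_continuous_on_def by (metis half_gt_zero)
  define \<eta> where "\<eta> = min (\<eta>0 / 2) L"
  have \<eta>: "\<eta> > 0" "\<eta> < \<eta>0" "\<eta> \<le> L" using \<eta>0 L by (auto simp: \<eta>_def)
  \<comment> \<open>on an interval of length \<eta> the integrand is at least R c / 2; elsewhere it is at least -1 by the inequality exp t * t >= -1\<close>
  define R where "R = 2 * (L + 1) / (\<eta> * c)"
  have R: "R > 0" using L \<eta> c by (simp add: R_def)
  have D: "integral {0..L} (\<lambda>x. exp (u \<bullet> V x) * (u \<bullet> V x)) \<ge> 1" if u: "norm u = R" for u
  proof -
    define \<nu> where "\<nu> = (1/R) *\<^sub>R u"
    have "norm \<nu> = 1" using u R by (simp add: \<nu>_def)
    then obtain x0 where x0: "x0 \<in> {0..L}" "\<nu> \<bullet> V x0 \<ge> c" using c(2) by blast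
    define a where "a = min x0 (L - \<eta>)"
    have a: "0 \<le> a" "a + \<eta> \<le> L" "\<And>x. x \<in> {a..a+\<eta>} \<Longrightarrow> \<bar>x - x0\<bar> \<le> \<eta>"
      using x0(1) \<eta> by (auto simp: a_def min_def split: if_splits)
    have t: "u \<bullet> V x \<ge> R * c / 2" if "x \<in> {a..a+\<eta>}" for x
    proof -
      have "dist (V x) (V x0) < c / 2" using \<eta>0(2)[of x0 x] a(3)[OF that] a(1,2) that x0 \<eta> by (auto simp: dist_real_def)
      then have "\<bar>\<nu> \<bullet> (V x - V x0)\<bar> \<le> c / 2"
        using Cauchy_Schwarz_ineq2[of \<nu> "V x - V x0"] \<open>norm \<nu> = 1\<close> by (simp add: dist_norm)
      then have "\<nu> \<bullet> V x \<ge> c / 2" using x0(2) unfolding inner_diff_right by linarith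
      then have "R * (\<nu> \<bullet> V x) \<ge> R * (c / 2)" using R by (intro mult_left_mono) auto
      then show ?thesis using R by (simp add: \<nu>_def)
    qed
    define g where "g x = (if x \<in> {a..a+\<eta>} then R * c / 2 + 1 else 0) - 1" for x
    have g: "(g has_integral \<eta> * (R * c / 2 + 1) - L) {0..L}"
      unfolding g_def
    proof (rule has_integral_diff)
      have "((\<lambda>x. R * c / 2 + 1) has_integral \<eta> * (R * c / 2 + 1)) {a..a+\<eta>}"
        using has_integral_const_real[of "R * c / 2 + 1" a "a + \<eta>"] \<eta> by simp
      then show "((\<lambda>x. if x \<in> {a..a+\<eta>} then R * c / 2 + 1 else 0) has_integral \<eta> * (R * c / 2 + 1)) {0..L}"
        by (subst has_integral_restrict) (use a in auto)
      show "((\<lambda>x. 1) has_integral L) {0..L}" using has_integral_const_real[of "1::real" 0 L] L by simp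
    qed
    have "g x \<le> exp (u \<bullet> V x) * (u \<bullet> V x)" if "x \<in> {0..L}" for x
    proof (cases "x \<in> {a..a+\<eta>}")
      case True
      have p: "R * c / 2 > 0" using R c by simp
      have "1 * (u \<bullet> V x) \<le> exp (u \<bullet> V x) * (u \<bullet> V x)" using t[OF True] p by (intro mult_right_mono) auto
      then show ?thesis using t[OF True] True by (simp add: g_def)
    qed (use exp_times_self_ge[of "u \<bullet> V x"] in \<open>auto simp: g_def\<close>)
    moreover have "(\<lambda>x. exp (u \<bullet> V x) * (u \<bullet> V x)) integrable_on {0..L}"
      using cont by (intro integrable_continuous_real continuous_intros)
    ultimately have "\<eta> * (R * c / 2 + 1) - L \<le> integral {0..L} (\<lambda>x. exp (u \<bullet> V x) * (u \<bullet> V x))"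
      using has_integral_le[OF g integrable_integral] by blast
    moreover have "\<eta> * (R * c / 2 + 1) - L = 1 + \<eta>" using \<eta> c by (simp add: R_def field_simps)
    ultimately show ?thesis using \<eta> by simp
  qed
  obtain B where B: "B > 0" "\<And>x. x \<in> {0..L} \<Longrightarrow> norm (V x) \<le> B"
    using compact_imp_bounded[OF compact_continuous_image[OF cont compact_Icc]] by (auto simp: bounded_pos)
  define C where "C = exp (R * (B + 1)) * R * (R * B)"
  have C: "C > 0" using R B by (simp add: C_def)
  define \<delta> where "\<delta> = min 1 (1 / (2 * L * C))"
  have \<delta>: "\<delta> > 0" "\<delta> \<le> 1" "L * (C * \<delta>) \<le> 1/2" using L C by (auto simp: \<delta>_def min_def field_simps)
  have "\<exists>u. integral {0..L} (\<lambda>x. exp (u \<bullet> W x) *\<^sub>R V x) = 0"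
    if W: "continuous_on {0..L} W" "\<forall>x\<in>{0..L}. norm (W x - V x) \<le> \<delta>" for W
  proof -
    define \<Psi> where "\<Psi> u = integral {0..L} (\<lambda>x. exp (u \<bullet> W x) *\<^sub>R V x)" for u
    have int: "(\<lambda>x. exp (u \<bullet> W x) *\<^sub>R V x) integrable_on {0..L}" for u
      using cont W by (intro integrable_continuous_real continuous_intros)
    have "continuous_on (cball 0 R) (\<lambda>u. integral (cbox 0 L) (\<lambda>x. exp (u \<bullet> W x) *\<^sub>R V x))"
    proof (rule integral_continuous_on_param)
      have "continuous_on (cball 0 R \<times> cbox 0 L) (\<lambda>p. W (snd p))" "continuous_on (cball 0 R \<times> cbox 0 L) (\<lambda>p. V (snd p))"
        by (auto intro!: continuous_on_compose2[OF W(1)] continuous_on_compose2[OF cont] continuous_intros)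
      then show "continuous_on (cball 0 R \<times> cbox 0 L) (\<lambda>(u, x). exp (u \<bullet> W x) *\<^sub>R V x)"
        unfolding case_prod_unfold by (intro continuous_intros)
    qed
    then have contP: "continuous_on (cball 0 R) \<Psi>" by (simp add: \<Psi>_def[abs_def])
    have "u \<bullet> \<Psi> u > 0" if u: "norm u = R" for u
    proof -
      have eq: "u \<bullet> \<Psi> u = integral {0..L} (\<lambda>x. exp (u \<bullet> W x) * (u \<bullet> V x))"
      proof -
        have "integral {0..L} ((\<lambda>y. u \<bullet> y) \<circ> (\<lambda>x. exp (u \<bullet> W x) *\<^sub>R V x)) = u \<bullet> \<Psi> u"
          unfolding \<Psi>_def by (rule integral_linear[OF int bounded_linear_inner_right])
        then show ?thesis by (simp add: o_def)
      qed
      have i1: "(\<lambda>x. exp (u \<bullet> W x) * (u \<bullet> V x)) integrable_on {0..L}" "(\<lambda>x. exp (u \<bullet> V x) * (u \<bullet> V x)) integrable_on {0..L}"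
        using cont W by (auto intro!: integrable_continuous_real continuous_intros)
      have "exp (u \<bullet> V x) * (u \<bullet> V x) - C * \<delta> \<le> exp (u \<bullet> W x) * (u \<bullet> V x)" if x: "x \<in> {0..L}" for x
      proof -
        have nV: "norm (V x) \<le> B" and nWV: "norm (W x - V x) \<le> \<delta>" using B W(2) x by auto
        have nW: "norm (W x) \<le> B + 1" using nV nWV \<delta>(2) norm_triangle_sub[of "W x" "V x"] by simp
        have cs: "\<bar>u \<bullet> y\<bar> \<le> R * b" if "norm y \<le> b" for y b
          using order_trans[OF Cauchy_Schwarz_ineq2[of u y]] mult_left_mono[OF that, of R] R unfolding u by simp
        have uV: "\<bar>u \<bullet> V x\<bar> \<le> R * B" and uW: "\<bar>u \<bullet> W x\<bar> \<le> R * (B + 1)" by (rule cs[OF nV], rule cs[OF nW])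
        have uWV: "\<bar>u \<bullet> V x - u \<bullet> W x\<bar> \<le> R * \<delta>"
          using cs[OF nWV] by (simp only: inner_diff_right abs_minus_commute)
        have "\<bar>exp (u \<bullet> V x) - exp (u \<bullet> W x)\<bar> \<le> exp (max (u \<bullet> V x) (u \<bullet> W x)) * \<bar>u \<bullet> V x - u \<bullet> W x\<bar>"
          by (rule exp_diff_le)
        also have "\<dots> \<le> exp (R * (B + 1)) * (R * \<delta>)"
        proof (intro mult_mono uWV)
          have "R * B \<le> R * (B + 1)" using R by simp
          then show "exp (max (u \<bullet> V x) (u \<bullet> W x)) \<le> exp (R * (B + 1))" using uV uW by (auto simp: abs_le_iff)
        qed auto
        finally have "\<bar>exp (u \<bullet> V x) - exp (u \<bullet> W x)\<bar> * \<bar>u \<bullet> V x\<bar> \<le> exp (R * (B + 1)) * (R * \<delta>) * (R * B)"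
          using uV R \<delta> by (intro mult_mono) auto
        also have "\<dots> = C * \<delta>" by (simp add: C_def)
        finally have "\<bar>(exp (u \<bullet> V x) - exp (u \<bullet> W x)) * (u \<bullet> V x)\<bar> \<le> C * \<delta>" by (simp add: abs_mult)
        then show ?thesis by (simp add: left_diff_distrib abs_le_iff)
      qed
      then have "integral {0..L} (\<lambda>x. exp (u \<bullet> V x) * (u \<bullet> V x) - C * \<delta>) \<le> integral {0..L} (\<lambda>x. exp (u \<bullet> W x) * (u \<bullet> V x))"
        using i1 by (intro integral_le integrable_diff integrable_const_ivl) auto
      moreover have "integral {0..L} (\<lambda>x. exp (u \<bullet> V x) * (u \<bullet> V x) - C * \<delta>) = integral {0..L} (\<lambda>x. exp (u \<bullet> V x) * (u \<bullet> V x)) - L * (C * \<delta>)"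
        using i1 L by (subst integral_diff) (auto intro: integrable_const_ivl)
      ultimately show ?thesis using D[OF u] \<delta>(3) eq by linarith
    qed
    then show ?thesis using outward_field_has_zero[OF R contP] by (auto simp: \<Psi>_def)
  qed
  then show ?thesis using \<delta>(1) by blast
qed

lemma periodic_continuous_on_circle:
  fixes f :: "real \<Rightarrow> real"
  assumes "continuous_on UNIV f" "\<And>x. f (x + pi) = f x"
  obtains F where "continuous_on (sphere (0::complex) 1) F" "\<And>x. F (cis (2 * x)) = f x"
proof -
  define F where "F w = f (Arg w / 2)" for w
  have per: "f (x + of_int n * pi) = f x" for x n
  proof (induction n rule: int_induct[where k = 0])
    case (step1 i) then show ?case using assms(2)[of "x + of_int i * pi"] by (simp add: algebra_simps)
  next
    case (step2 i) then show ?case using assms(2)[of "x + of_int (i - 1) * pi"] by (simp add: algebra_simps)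
  qed simp
  have Fx: "F (cis (2 * x)) = f x" for x
  proof -
    have "cis (Arg (cis (2 * x))) = cis (2 * x)" by (subst cis_Arg) (auto simp: sgn_eq)
    then have "exp (\<i> * of_real (Arg (cis (2 * x)))) = exp (\<i> * of_real (2 * x))" by (simp only: cis_conv_exp)
    then obtain n :: int where "\<i> * of_real (Arg (cis (2 * x))) = \<i> * of_real (2 * x) + of_real (of_int (2 * n) * pi) * \<i>"
      by (auto simp: exp_eq)
    then have "of_real (Arg (cis (2 * x))) = (of_real (2 * x + 2 * pi * of_int n) :: complex)"
      by (simp add: complex_eq_iff algebra_simps)
    then have "Arg (cis (2 * x)) = 2 * x + 2 * pi * of_int n" by (simp only: of_real_eq_iff)
    then show ?thesis using per[of x n] by (simp add: F_def add_divide_distrib mult.commute)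
  qed
  have cf: "isCont f x" for x using assms(1) by (simp add: continuous_on_eq_continuous_at)
  have "isCont F w \<or> continuous (at w within sphere 0 1) F" if w: "w \<in> sphere 0 1" for w
  proof (cases "w \<in> \<real>\<^sub>\<le>\<^sub>0")
    case False
    then have "isCont (\<lambda>w. Arg w / 2) w" by (intro continuous_intros continuous_at_Arg) auto
    then show ?thesis unfolding F_def using isCont_o2[OF _ cf] by blast
  next
    case True
    \<comment> \<open>a branch of the argument that is continuous at the negative axis\<close>
    define G where "G w = f ((Arg (- w) + pi) / 2)" for w
    have "w \<noteq> 0" using w by auto
    then have "- w \<notin> \<real>\<^sub>\<le>\<^sub>0" using True by (auto simp: complex_nonpos_Reals_iff complex_eq_iff)
    then have "isCont (\<lambda>w. (Arg (- w) + pi) / 2) w"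
      by (intro continuous_intros isCont_o2[OF _ continuous_at_Arg]) auto
    then have "isCont G w" unfolding G_def using isCont_o2[OF _ cf] by blast
    moreover have "F v = G v" if "v \<in> sphere 0 1" for v
    proof -
      have "cis (Arg (- v)) = - v" using that by (subst cis_Arg) (auto simp: sgn_eq)
      then have "v = cis (Arg (- v)) * cis pi" by simp
      moreover have "2 * ((Arg (- v) + pi) / 2) = Arg (- v) + pi" by simp
      ultimately have "v = cis (2 * ((Arg (- v) + pi) / 2))" by (simp only: cis_mult)
      then show ?thesis using Fx[of "(Arg (- v) + pi) / 2"] by (simp add: G_def)
    qed
    ultimately have "continuous (at w within sphere 0 1) F"
      using continuous_transform_within[OF continuous_at_imp_continuous_at_within[OF \<open>isCont G w\<close>] zero_less_one w] by simp
    then show ?thesis by simp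
  qed
  then have "continuous_on (sphere 0 1) F"
    unfolding continuous_on_eq_continuous_within using continuous_at_imp_continuous_at_within by blast
  then show ?thesis using that Fx by blast
qed

text \<open>
  Equivalently \<open>p (cnj z + \<pi>) = cnj (p z)\<close> together with reality on the real axis: a real combination of such functions is an admissible
  exponent for a factor that respects the glide.
\<close>

definition real_periodic_entire :: "(complex \<Rightarrow> complex) \<Rightarrow> bool" where
  "real_periodic_entire p \<longleftrightarrow> p holomorphic_on UNIV \<and> (\<forall>z. p (z + of_real pi) = p z) \<and> (\<forall>z. p (cnj z) = cnj (p z))"

text \<open>
  The Stone-Weierstrass theorem on the circle. The coordinates of \<open>cis (2 x)\<close> are the restrictions of
  \<open>cos (2 z)\<close> and \<open>sin (2 z)\<close>, so the approximants extend to entire functions.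
\<close>

lemma periodic_approximation:
  fixes f :: "real \<Rightarrow> real"
  assumes "continuous_on UNIV f" "\<And>x. f (x + pi) = f x" "\<delta> > 0"
  obtains p where "real_periodic_entire p" "\<And>x. cmod (p (of_real x) - of_real (f x)) < \<delta>"
proof -
  obtain F where F: "continuous_on (sphere (0::complex) 1) F" "\<And>x. F (cis (2 * x)) = f x"
    using periodic_continuous_on_circle[OF assms(1,2)] by metis
  define P where "P G \<longleftrightarrow> continuous_on (sphere 0 1) G \<and>
     (\<exists>p. real_periodic_entire p \<and> (\<forall>x. p (of_real x) = of_real (G (cis (2 * x)))))" for G :: "complex \<Rightarrow> real"
  have per: "cos (2 * (z + of_real pi)) = cos (2 * z)" "sin (2 * (z + of_real pi)) = sin (2 * z)" for z :: complex
  proof -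
    have "cos (2 * z + of_real (2 * pi)) = cos (2 * z)" "sin (2 * z + of_real (2 * pi)) = sin (2 * z)"
      by (simp_all only: cos_add sin_add cos_of_real sin_of_real) simp_all
    then show "cos (2 * (z + of_real pi)) = cos (2 * z)" "sin (2 * (z + of_real pi)) = sin (2 * z)"
      by (simp_all add: distrib_left)
  qed
  have PRe: "P Re"
    unfolding P_def real_periodic_entire_def using per
    by (intro conjI exI[of _ "\<lambda>z. cos (2 * z)"]) (auto intro!: continuous_intros holomorphic_intros simp: cos_of_real[symmetric] cnj_cos)
  have PIm: "P Im"
    unfolding P_def real_periodic_entire_def using per
    by (intro conjI exI[of _ "\<lambda>z. sin (2 * z)"]) (auto intro!: continuous_intros holomorphic_intros simp: sin_of_real[symmetric] cnj_sin)
  have "\<exists>G. P G \<and> (\<forall>x\<in>sphere 0 1. \<bar>F x - G x\<bar> < \<delta>)"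
  proof (rule Stone_Weierstrass_HOL)
    show "P (\<lambda>x. c)" for c unfolding P_def real_periodic_entire_def
      by (intro conjI exI[of _ "\<lambda>_. of_real c"]) auto
    show "P (\<lambda>x. f x + g x)" if PQ: "P f \<and> P g" for f g
    proof -
      obtain p q where "real_periodic_entire p" "real_periodic_entire q"
        "\<And>x. p (of_real x) = of_real (f (cis (2 * x)))" "\<And>x. q (of_real x) = of_real (g (cis (2 * x)))"
        using PQ unfolding P_def by metis
      then show ?thesis using PQ unfolding P_def real_periodic_entire_def
        by (intro conjI exI[of _ "\<lambda>z. p z + q z"]) (auto intro!: continuous_intros holomorphic_intros)
    qed
    show "P (\<lambda>x. f x * g x)" if PQ: "P f \<and> P g" for f g
    proof -
      obtain p q where "real_periodic_entire p" "real_periodic_entire q"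
        "\<And>x. p (of_real x) = of_real (f (cis (2 * x)))" "\<And>x. q (of_real x) = of_real (g (cis (2 * x)))"
        using PQ unfolding P_def by metis
      then show ?thesis using PQ unfolding P_def real_periodic_entire_def
        by (intro conjI exI[of _ "\<lambda>z. p z * q z"]) (auto intro!: continuous_intros holomorphic_intros)
    qed
    show "\<exists>f. P f \<and> f x \<noteq> f y" if "x \<in> sphere 0 1 \<and> y \<in> sphere 0 1 \<and> x \<noteq> y" for x y
      using PRe PIm that by (metis complex_eqI)
  qed (use F assms(3) in \<open>auto simp: P_def\<close>)
  then obtain G p where G: "\<And>x. x \<in> sphere 0 1 \<Longrightarrow> \<bar>F x - G x\<bar> < \<delta>"
    and p: "real_periodic_entire p" "\<And>x. p (of_real x) = of_real (G (cis (2 * x)))"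
    unfolding P_def by metis
  have "cmod (p (of_real x) - of_real (f x)) < \<delta>" for x
    using G[of "cis (2 * x)"] F(2)[of x] p(2)[of x] by (simp flip: of_real_diff add: abs_minus_commute)
  then show ?thesis using that p(1) by blast
qed

lemma periodic_entire_bounded_on_strip:
  assumes "f holomorphic_on UNIV" "\<And>z. f (z + of_real T) = f z" "T > 0"
  obtains M where "\<And>z. \<bar>Im z\<bar> \<le> B \<Longrightarrow> cmod (f z) \<le> M"
proof -
  let ?K = "cbox (Complex 0 (- B)) (Complex T B)"
  have "bounded (f ` ?K)"
    using assms(1) by (intro compact_imp_bounded compact_continuous_image compact_cbox) (auto intro: holomorphic_on_imp_continuous_on holomorphic_on_subset)
  then obtain M where M: "\<And>z. z \<in> ?K \<Longrightarrow> cmod (f z) \<le> M" by (auto simp: bounded_iff)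
  have per: "f (z + of_int n * of_real T) = f z" for z n
  proof (induction n rule: int_induct[where k = 0])
    case (step1 i) then show ?case using assms(2)[of "z + of_int i * of_real T"] by (simp add: algebra_simps)
  next
    case (step2 i) then show ?case using assms(2)[of "z + of_int (i - 1) * of_real T"] by (simp add: algebra_simps)
  qed simp
  have "cmod (f z) \<le> M" if "\<bar>Im z\<bar> \<le> B" for z
  proof -
    define n where "n = \<lfloor>Re z / T\<rfloor>"
    have "of_int n \<le> Re z / T" "Re z / T < of_int n + 1" unfolding n_def by linarith+
    then have "of_int n * T \<le> Re z" "Re z \<le> (of_int n + 1) * T" using assms(3) by (auto simp: field_simps)
    then have "z + of_int (- n) * of_real T \<in> ?K" using that by (auto simp: in_cbox_complex_iff algebra_simps)
    from M[OF this] show ?thesis by (simp only: per)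
  qed
  then show ?thesis using that by blast
qed

lemma cis_in_long_interval:
  assumes "cmod w = 1" "a + 2 * pi \<le> b"
  obtains y where "a \<le> y" "y \<le> b" "cis y = w"
proof -
  define k where "k = \<lceil>(a - Arg w) / (2 * pi)\<rceil>"
  define y where "y = Arg w + 2 * pi * of_int k"
  have "(a - Arg w) / (2 * pi) \<le> of_int k" "of_int k < (a - Arg w) / (2 * pi) + 1" unfolding k_def by linarith+
  then have "a \<le> y" "y < a + 2 * pi" by (auto simp: y_def field_simps)
  moreover have "cis y = w"
  proof -
    have "cis y = cis (Arg w)" unfolding y_def by (simp add: cis_mult[symmetric] cis_multiple_2pi)
    also have "\<dots> = w" using assms(1) by (subst cis_Arg) (auto simp: sgn_eq)
    finally show ?thesis .
  qed
  ultimately show ?thesis using that assms(2) by force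
qed

text \<open>
  Wherever \<open>\<Sum> \<nu>_j \<phi>_j\<close> does not vanish it is nearly constant on a short interval, while for large \<open>K\<close> the phase \<open>K cos x\<close> runs through
  a full turn there and at some point rotates the value onto the positive axis. Compactness of the sphere yields one
  \<open>K\<close> for all \<open>\<nu>\<close>.
\<close>

lemma rotation_spreads_directions:
  fixes \<phi> :: "'n::finite \<Rightarrow> real \<Rightarrow> complex"
  assumes cont: "\<And>j. continuous_on UNIV (\<phi> j)"
    and nondeg: "\<And>\<nu>::real^'n. norm \<nu> = 1 \<Longrightarrow> \<exists>x. 0 < x \<and> x < pi \<and> (\<Sum>j\<in>UNIV. of_real (\<nu> $ j) * \<phi> j x) \<noteq> 0"
  shows "\<exists>K>0. \<forall>\<nu>::real^'n. norm \<nu> = 1 \<longrightarrow> (\<exists>x\<in>{0..pi}. \<nu> \<bullet> (\<chi> j. Re (cis (K * cos x) * \<phi> j x)) > 0)"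
proof (rule ccontr)
  define V where "V K x = (\<chi> j. Re (cis (K * cos x) * \<phi> j x))" for K x
  define f where "f \<nu> x = (\<Sum>j\<in>UNIV. of_real (\<nu> $ j) * \<phi> j x)" for \<nu> :: "real^'n" and x
  have Vf: "\<nu> \<bullet> V K x = Re (cis (K * cos x) * f \<nu> x)" for \<nu> K x
  proof -
    have "cis (K * cos x) * f \<nu> x = (\<Sum>j\<in>UNIV. of_real (\<nu> $ j) * (cis (K * cos x) * \<phi> j x))"
      by (simp add: f_def sum_distrib_left mult_ac)
    then have "Re (cis (K * cos x) * f \<nu> x) = (\<Sum>j\<in>UNIV. \<nu> $ j * Re (cis (K * cos x) * \<phi> j x))"
      by (simp only: Re_sum Re_complex_of_real Im_complex_of_real times_complex.simps) simp
    then show ?thesis by (simp add: V_def inner_vec_def)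
  qed
  assume "\<not> ?thesis"
  then have "\<exists>\<nu>::real^'n. norm \<nu> = 1 \<and> (\<forall>x\<in>{0..pi}. \<nu> \<bullet> V (real (Suc n)) x \<le> 0)" for n
    unfolding V_def by (meson not_le of_nat_0_less_iff zero_less_Suc)
  then obtain \<nu> where \<nu>: "\<And>n. norm (\<nu> n) = 1" "\<And>n x. x \<in> {0..pi} \<Longrightarrow> (\<nu> n :: real^'n) \<bullet> V (real (Suc n)) x \<le> 0"
    by metis
  have "\<forall>n. \<nu> n \<in> sphere 0 1" using \<nu> by simp
  then obtain l r where l: "l \<in> sphere 0 1" "strict_mono r" "(\<nu> \<circ> r) \<longlonglongrightarrow> l"
    using compact_sphere[of "0::real^'n" 1] unfolding compact_def by metis
  then obtain x0 where x0: "0 < x0" "x0 < pi" "f l x0 \<noteq> 0" using nondeg[of l] by (auto simp: f_def)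
  define z0 where "z0 = f l x0"
  have z0: "cmod z0 > 0" using x0 by (simp add: z0_def)
  have contf: "continuous_on UNIV (f l)" unfolding f_def by (intro continuous_intros cont)
  then obtain d where d: "d > 0" "\<And>x. dist x x0 < d \<Longrightarrow> dist (f l x) (f l x0) < cmod z0 / 4"
    using z0 unfolding continuous_on_iff by (metis UNIV_I divide_pos_pos zero_less_numeral)
  define \<eta> where "\<eta> = min (d / 2) (min (x0 / 2) ((pi - x0) / 2))"
  have \<eta>: "\<eta> > 0" "\<eta> < d" "0 < x0 - \<eta>" "x0 + \<eta> < pi" using d x0 by (auto simp: \<eta>_def min_def field_simps)
  have "continuous_on {0..pi} (\<lambda>x. \<Sum>j\<in>UNIV. cmod (\<phi> j x))"
    by (intro continuous_intros) (use cont in \<open>auto intro: continuous_on_subset\<close>)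
  from compact_imp_bounded[OF compact_continuous_image[OF this compact_Icc]]
  obtain B where "B > 0" "\<forall>y\<in>(\<lambda>x. \<Sum>j\<in>UNIV. cmod (\<phi> j x)) ` {0..pi}. norm y \<le> B"
    unfolding bounded_pos by blast
  then have B: "B > 0" "\<And>x. x \<in> {0..pi} \<Longrightarrow> \<bar>\<Sum>j\<in>UNIV. cmod (\<phi> j x)\<bar> \<le> B" by auto
  have close: "cmod (f v x - f w x) \<le> norm (v - w) * B" if "x \<in> {0..pi}" for v w x
  proof -
    have "f v x - f w x = (\<Sum>j\<in>UNIV. of_real ((v - w) $ j) * \<phi> j x)"
      by (simp add: f_def sum_subtractf[symmetric] left_diff_distrib)
    also have "cmod \<dots> \<le> (\<Sum>j\<in>UNIV. norm (v - w) * cmod (\<phi> j x))"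
      by (intro sum_norm_le) (auto simp: norm_mult simp del: vector_minus_component intro!: mult_right_mono component_le_norm_cart)
    also have "\<dots> = norm (v - w) * (\<Sum>j\<in>UNIV. cmod (\<phi> j x))" by (simp add: sum_distrib_left)
    also have "\<dots> \<le> norm (v - w) * B" using B(2)[OF that] by (intro mult_left_mono) auto
    finally show ?thesis .
  qed
  \<comment> \<open>once K \<Delta> is at least 2 pi, the phase K cos x takes every value modulo 2 pi on the interval around x0\<close>
  define \<Delta> where "\<Delta> = cos (x0 - \<eta>) - cos (x0 + \<eta>)"
  have \<Delta>: "\<Delta> > 0" using cos_monotone_0_pi[of "x0 - \<eta>" "x0 + \<eta>"] \<eta> by (simp add: \<Delta>_def)
  have "\<forall>\<^sub>F n in sequentially. dist ((\<nu> \<circ> r) n) l < cmod z0 / (4 * B)"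
    using tendstoD[OF l(3)] z0 B by simp
  moreover have "\<forall>\<^sub>F n in sequentially. n \<ge> nat \<lceil>2 * pi / \<Delta>\<rceil>" by (rule eventually_ge_at_top)
  ultimately obtain n where n: "dist ((\<nu> \<circ> r) n) l < cmod z0 / (4 * B)" "n \<ge> nat \<lceil>2 * pi / \<Delta>\<rceil>"
    by (metis (mono_tags, lifting) eventually_conj eventually_happens' sequentially_bot)
  define K where "K = real (Suc (r n))"
  have "K \<ge> 2 * pi / \<Delta>"
  proof -
    have "n \<le> r n" using seq_suble[OF l(2)] .
    then show ?thesis using n(2) by (simp add: K_def)
  qed
  then have long: "K * cos (x0 + \<eta>) + 2 * pi \<le> K * cos (x0 - \<eta>)" using \<Delta> by (simp add: \<Delta>_def field_simps)
  have "cmod (cnj z0 / of_real (cmod z0)) = 1" using z0 by (simp add: norm_divide)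
  then obtain y where y: "K * cos (x0 + \<eta>) \<le> y" "y \<le> K * cos (x0 - \<eta>)" "cis y = cnj z0 / of_real (cmod z0)"
    using cis_in_long_interval[OF _ long] by metis
  obtain x where x: "x0 - \<eta> \<le> x" "x \<le> x0 + \<eta>" "K * cos x = y"
  proof -
    have "continuous_on {x0 - \<eta>..x0 + \<eta>} (\<lambda>x. K * cos x)" by (intro continuous_intros)
    with IVT2'[of "\<lambda>x. K * cos x" "x0 + \<eta>" y "x0 - \<eta>"] y(1,2) \<eta>(1) that show ?thesis by force
  qed
  have xp: "x \<in> {0..pi}" using x \<eta> by auto
  have 1: "cmod (f l x - z0) < cmod z0 / 4" using d(2)[of x] x \<eta> by (auto simp: dist_norm z0_def abs_le_iff abs_less_iff)
  have "cmod (f (\<nu> (r n)) x - f l x) \<le> norm (\<nu> (r n) - l) * B" by (rule close[OF xp])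
  also have "\<dots> \<le> cmod z0 / (4 * B) * B" using n(1) B by (intro mult_right_mono) (auto simp: dist_norm)
  finally have 2: "cmod (f (\<nu> (r n)) x - f l x) \<le> cmod z0 / 4" using B by simp
  have 3: "cmod (f (\<nu> (r n)) x - z0) < cmod z0 / 2"
    using 1 2 norm_triangle_ineq[of "f (\<nu> (r n)) x - f l x" "f l x - z0"] by simp
  have "cis y * z0 = of_real ((cmod z0)\<^sup>2) / of_real (cmod z0)"
    unfolding y(3) complex_norm_square by (simp add: mult.commute)
  also have "\<dots> = of_real (cmod z0)" using z0 by (simp add: power2_eq_square)
  finally have "cis y * z0 = of_real (cmod z0)" .
  then have "cis y * f (\<nu> (r n)) x = of_real (cmod z0) + cis y * (f (\<nu> (r n)) x - z0)" by (simp add: algebra_simps)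
  then have "Re (cis y * f (\<nu> (r n)) x) = cmod z0 + Re (cis y * (f (\<nu> (r n)) x - z0))" by simp
  moreover have "\<bar>Re (cis y * (f (\<nu> (r n)) x - z0))\<bar> < cmod z0 / 2"
    using abs_Re_le_cmod[of "cis y * (f (\<nu> (r n)) x - z0)"] 3 by (simp add: norm_mult)
  ultimately have "Re (cis y * f (\<nu> (r n)) x) > 0" using z0 by linarith
  then have "\<nu> (r n) \<bullet> V K x > 0" using x(3) by (simp add: Vf)
  then show False using \<nu>(2)[OF xp, of "r n"] by (simp add: K_def)
qed

text \<open>
  The factor is \<open>exp (\<Sum> u_j p_j + \<i> K cos)\<close>. On the real axis its first part is a positive weight and its second
  part a rotation. Since \<open>cos\<close> changes sign under \<open>z \<mapsto> z + \<pi>\<close>, the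
  factor \<open>\<i>\<close> fits the symmetry. The lower bound holds because the exponent is periodic with period \<open>2 \<pi>\<close>.
\<close>

theorem period_closing_factor:
  fixes \<phi> :: "'n::finite \<Rightarrow> real \<Rightarrow> complex"
  assumes cont: "\<And>j. continuous_on UNIV (\<phi> j)"
    and symm: "\<And>j x. \<phi> j (x + pi) = cnj (\<phi> j x)"
    and nondeg: "\<And>\<nu>::real^'n. norm \<nu> = 1 \<Longrightarrow> \<exists>x. 0 < x \<and> x < pi \<and> (\<Sum>j\<in>UNIV. of_real (\<nu> $ j) * \<phi> j x) \<noteq> 0"
  obtains h where "h holomorphic_on UNIV" "\<And>z. h (cnj z + of_real pi) = cnj (h z)"
    "\<And>B. \<exists>\<epsilon>>0. \<forall>z. \<bar>Im z\<bar> \<le> B \<longrightarrow> \<epsilon> \<le> cmod (h z)"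
    "\<And>j. integral {0..pi} (\<lambda>x. Re (h (of_real x) * \<phi> j x)) = 0"
proof -
  obtain K where K: "K > 0" "\<And>\<nu>::real^'n. norm \<nu> = 1 \<Longrightarrow> \<exists>x\<in>{0..pi}. \<nu> \<bullet> (\<chi> j. Re (cis (K * cos x) * \<phi> j x)) > 0"
    using rotation_spreads_directions[of \<phi>, OF cont nondeg] by blast
  define V where "V x = (\<chi> j. Re (cis (K * cos x) * \<phi> j x))" for x
  have contV: "continuous_on UNIV V"
    unfolding V_def by (intro continuous_intros cont)
  have symV: "V (x + pi) = V x" for x
  proof -
    have "cis (K * cos (x + pi)) = cnj (cis (K * cos x))" by (simp add: cis_cnj)
    then have "cis (K * cos (x + pi)) * \<phi> j (x + pi) = cnj (cis (K * cos x) * \<phi> j x)" for j by (simp add: symm)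
    then show ?thesis by (simp only: V_def complex_cnj(1) cnj.simps)
  qed
  have contV': "continuous_on {0..pi} V" using contV continuous_on_subset by blast
  have posV: "\<exists>x\<in>{0..pi}. \<nu> \<bullet> V x > 0" if "norm \<nu> = 1" for \<nu>
    using K(2)[OF that] by (simp add: V_def)
  obtain \<delta> where \<delta>: "\<delta> > 0" "\<And>W. continuous_on {0..pi} W \<Longrightarrow> (\<forall>x\<in>{0..pi}. norm (W x - V x) \<le> \<delta>) \<Longrightarrow>
     \<exists>u. integral {0..pi} (\<lambda>x. exp (u \<bullet> W x) *\<^sub>R V x) = 0"
    using exponential_weight_closes[OF pi_gt_zero contV' posV] by blast
  have "\<exists>p. real_periodic_entire p \<and> (\<forall>x. cmod (p (of_real x) - of_real (V x $ j)) < \<delta> / CARD('n))" for j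
  proof (rule periodic_approximation[of "\<lambda>x. V x $ j" "\<delta> / CARD('n)"])
    show "continuous_on UNIV (\<lambda>x. V x $ j)" using contV by (intro continuous_intros)
  qed (use symV \<delta> in auto)
  then obtain p where p: "\<And>j. real_periodic_entire (p j)" "\<And>j x. cmod (p j (of_real x) - of_real (V x $ j)) < \<delta> / CARD('n)"
    by metis
  define W where "W x = (\<chi> j. Re (p j (of_real x)))" for x
  have hp: "p j holomorphic_on A" for j A using p(1) by (auto simp: real_periodic_entire_def intro: holomorphic_on_subset)
  have contp: "continuous_on UNIV (\<lambda>x::real. p j (of_real x))" for j
    by (intro continuous_on_compose2[OF holomorphic_on_imp_continuous_on[OF hp[of j UNIV]]] continuous_intros) auto
  have "continuous_on {0..pi} W"
    unfolding W_def by (intro continuous_intros continuous_on_subset[OF contp]) auto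
  moreover have "norm (W x - V x) \<le> \<delta>" for x
  proof -
    have "norm (W x - V x) \<le> (\<Sum>j\<in>UNIV. \<bar>(W x - V x) $ j\<bar>)" by (rule norm_le_l1_cart)
    also have "\<dots> \<le> (\<Sum>j\<in>(UNIV::'n set). \<delta> / CARD('n))"
    proof (rule sum_mono)
      fix j
      have "\<bar>(W x - V x) $ j\<bar> = \<bar>Re (p j (of_real x) - of_real (V x $ j))\<bar>" by (simp add: W_def)
      also have "\<dots> \<le> cmod (p j (of_real x) - of_real (V x $ j))" by (rule abs_Re_le_cmod)
      finally show "\<bar>(W x - V x) $ j\<bar> \<le> \<delta> / CARD('n)" using p(2)[of j x] by linarith
    qed
    also have "\<dots> = \<delta>" by simp
    finally show ?thesis .
  qed
  ultimately obtain u where u: "integral {0..pi} (\<lambda>x. exp (u \<bullet> W x) *\<^sub>R V x) = 0" using \<delta>(2) by blast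
  define G where "G z = (\<Sum>j\<in>UNIV. of_real (u $ j) * p j z) + \<i> * of_real K * cos z" for z
  have holG: "G holomorphic_on UNIV" unfolding G_def by (intro holomorphic_intros hp)
  have Gpi: "G (cnj z + of_real pi) = cnj (G z)" for z
  proof -
    have "cos (cnj z + of_real pi) = - cnj (cos z)"
      by (simp only: cos_add cos_of_real sin_of_real) (simp add: cnj_cos)
    moreover have "p j (cnj z + of_real pi) = cnj (p j z)" for j
      using p(1)[of j] by (simp add: real_periodic_entire_def)
    ultimately show ?thesis by (simp add: G_def)
  qed
  have G2pi: "G (z + of_real (2 * pi)) = G z" for z
    using Gpi[of "cnj z + of_real pi"] Gpi[of z] by (simp add: algebra_simps)
  define h where "h z = exp (G z)" for z
  have "h holomorphic_on UNIV" unfolding h_def by (intro holomorphic_intros holG)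
  moreover have "h (cnj z + of_real pi) = cnj (h z)" for z by (simp add: h_def Gpi exp_cnj)
  moreover have "\<exists>\<epsilon>>0. \<forall>z. \<bar>Im z\<bar> \<le> B \<longrightarrow> \<epsilon> \<le> cmod (h z)" for B
  proof -
    have "2 * pi > 0" by simp
    then obtain M where M: "\<And>z. \<bar>Im z\<bar> \<le> B \<Longrightarrow> cmod (G z) \<le> M"
      using periodic_entire_bounded_on_strip[OF holG G2pi] by blast
    have "exp (- M) \<le> cmod (h z)" if "\<bar>Im z\<bar> \<le> B" for z
      using M[OF that] abs_Re_le_cmod[of "G z"] by (simp add: h_def)
    then show ?thesis by (intro exI[of _ "exp (- M)"]) auto
  qed
  moreover have "integral {0..pi} (\<lambda>x. Re (h (of_real x) * \<phi> j x)) = 0" for j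
  proof -
    have eq: "Re (h (of_real x) * \<phi> j x) = (exp (u \<bullet> W x) *\<^sub>R V x) $ j" for x
    proof -
      have "p j (of_real x) = of_real (Re (p j (of_real x)))" for j
      proof -
        have "p j (cnj (of_real x)) = cnj (p j (of_real x))" using p(1) unfolding real_periodic_entire_def by blast
        then show ?thesis by (simp add: complex_eq_iff)
      qed
      then have "(\<Sum>j\<in>UNIV. of_real (u $ j) * p j (of_real x)) = (\<Sum>j\<in>UNIV. of_real (u $ j) * of_real (Re (p j (of_real x))))"
        by metis
      also have "\<dots> = of_real (u \<bullet> W x)" by (simp add: inner_vec_def W_def)
      finally have "G (of_real x) = of_real (u \<bullet> W x) + \<i> * of_real (K * cos x)" by (simp add: G_def cos_of_real)
      then have "h (of_real x) = of_real (exp (u \<bullet> W x)) * cis (K * cos x)" by (simp add: h_def exp_add exp_of_real cis_conv_exp)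
      then have "h (of_real x) * \<phi> j x = of_real (exp (u \<bullet> W x)) * (cis (K * cos x) * \<phi> j x)" by simp
      then have "Re (h (of_real x) * \<phi> j x) = exp (u \<bullet> W x) * Re (cis (K * cos x) * \<phi> j x)" by (simp only: Re_complex_of_real Im_complex_of_real times_complex.simps)
      then show ?thesis by (simp add: V_def)
    qed
    have "(\<lambda>x. exp (u \<bullet> W x) *\<^sub>R V x) integrable_on {0..pi}"
      using contV' \<open>continuous_on {0..pi} W\<close> by (intro integrable_continuous_real continuous_intros)
    from integral_linear[OF this bounded_linear_vec_nth[of j]] u
    show ?thesis unfolding eq by (simp add: o_def)
  qed
  ultimately show ?thesis using that by blast
qed

section \<open>Weierstrass data on an annulus\<close>

lemma convex_strip: "convex {z::complex. \<bar>Im z\<bar> < b}" "open {z::complex. \<bar>Im z\<bar> < b}"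
proof -
  have e: "{z::complex. \<bar>Im z\<bar> < b} = {z. Im z < b} \<inter> {z. Im z > - b}" by auto
  show "convex {z::complex. \<bar>Im z\<bar> < b}" unfolding e
    by (intro convex_Int convex_halfspace_Im_lt convex_halfspace_Im_gt)
  show "open {z::complex. \<bar>Im z\<bar> < b}" unfolding e
    by (intro open_Int open_halfspace_Im_lt open_halfspace_Im_gt)
qed

definition annulus :: "real \<Rightarrow> complex set" where
  "annulus b = {w. w \<noteq> 0 \<and> \<bar>ln (cmod w)\<bar> < b}"

definition glide :: "complex \<Rightarrow> complex" where "glide w = - 1 / cnj w"

lemma open_annulus: "open (annulus b)"
proof -
  have "continuous_on (- {0::complex}) (\<lambda>w. \<bar>ln (cmod w)\<bar>)" by (intro continuous_intros) auto
  then have "open (- {0} \<inter> (\<lambda>w::complex. \<bar>ln (cmod w)\<bar>) -` {..<b})" by (intro continuous_open_preimage) auto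
  moreover have "annulus b = - {0} \<inter> (\<lambda>w::complex. \<bar>ln (cmod w)\<bar>) -` {..<b}" by (auto simp: annulus_def)
  ultimately show ?thesis by simp
qed

lemma glide_annulus: "w \<in> annulus b \<Longrightarrow> glide w \<in> annulus b"
  by (auto simp: annulus_def glide_def norm_divide ln_div)

lemma glide_glide: "w \<noteq> 0 \<Longrightarrow> glide (glide w) = w"
  by (simp add: glide_def)

lemma periodic_int:
  assumes "\<And>z. \<bar>Im z\<bar> < b \<Longrightarrow> f (z + of_real (2 * pi)) = f z" "\<bar>Im z\<bar> < b"
  shows "f (z + of_int n * of_real (2 * pi)) = (f z :: complex)"
proof (induction n rule: int_induct[where k = 0])
  case (step1 i) then show ?case using assms(1)[of "z + of_int i * of_real (2 * pi)"] assms(2) by (simp add: algebra_simps)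
next
  case (step2 i) then show ?case using assms(1)[of "z + of_int (i - 1) * of_real (2 * pi)"] assms(2) by (simp add: algebra_simps)
qed simp

text \<open>
  For a function with period \<open>2 \<pi>\<close> the branch of the logarithm is immaterial.
\<close>

lemma push_down_exp:
  assumes "\<And>z. \<bar>Im z\<bar> < b \<Longrightarrow> f (z + of_real (2 * pi)) = (f z :: complex)" "\<bar>Im z\<bar> < b"
  shows "f (- \<i> * Ln (exp (\<i> * z))) = f z"
proof -
  have "exp (Ln (exp (\<i> * z))) = exp (\<i> * z)" by simp
  then obtain n :: int where n: "Ln (exp (\<i> * z)) = \<i> * z + of_real (of_int (2 * n) * pi) * \<i>"
    unfolding exp_eq by blast
  have "- \<i> * Ln (exp (\<i> * z)) = z + of_int n * of_real (2 * pi)" unfolding n by (simp add: algebra_simps)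
  then show ?thesis using periodic_int[of b f z n, OF assms] by simp
qed

text \<open>
  Across the negative axis the principal branch is discontinuous; there another branch of the logarithm gives the same function.
\<close>

lemma push_down_derivative:
  assumes der: "\<And>z. \<bar>Im z\<bar> < b \<Longrightarrow> (f has_field_derivative f' z) (at z)"
    and per: "\<And>z. \<bar>Im z\<bar> < b \<Longrightarrow> f (z + of_real (2 * pi)) = f z"
    and per': "\<And>z. \<bar>Im z\<bar> < b \<Longrightarrow> f' (z + of_real (2 * pi)) = (f' z :: complex)"
    and w: "w \<in> annulus b"
  shows "((\<lambda>w. f (- \<i> * Ln w)) has_field_derivative f' (- \<i> * Ln w) * (- \<i> / w)) (at w)"
proof (cases "w \<in> \<real>\<^sub>\<le>\<^sub>0")
  case False
  have "\<bar>Im (- \<i> * Ln w)\<bar> < b" using w by (simp add: annulus_def)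
  then show ?thesis
    by (rule DERIV_chain2[where f = f and g = "\<lambda>w. - \<i> * Ln w" and x = w, OF der])
       (use False in \<open>auto intro!: derivative_eq_intros simp: divide_inverse\<close>)
next
  case True
  have shift: "q (- \<i> * Ln (- v) + of_real pi) = q (- \<i> * Ln v)"
    if q: "\<And>z. \<bar>Im z\<bar> < b \<Longrightarrow> q (z + of_real (2 * pi)) = (q z :: complex)" and v: "v \<in> annulus b" for q v
  proof -
    have v0: "v \<noteq> 0" using v by (simp add: annulus_def)
    have strip: "\<bar>Im (- \<i> * Ln v)\<bar> < b" "\<bar>Im (- \<i> * Ln v + of_int n * of_real (2 * pi))\<bar> < b" for n using v by (simp_all add: annulus_def)
    have "exp (Ln (- v)) = exp (Ln v + \<i> * of_real pi)" using v0 by (simp add: exp_add)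
    then obtain n :: int where n: "Ln (- v) = Ln v + \<i> * of_real pi + of_real (of_int (2 * n) * pi) * \<i>"
      unfolding exp_eq by blast
    have "- \<i> * Ln (- v) + of_real pi = - \<i> * Ln v + of_int (n + 1) * of_real (2 * pi)"
      unfolding n by (simp add: algebra_simps)
    then show ?thesis using periodic_int[of b q "- \<i> * Ln v" "n + 1", OF q strip(1)] by (simp only:)
  qed
  have w0: "w \<noteq> 0" "- w \<notin> \<real>\<^sub>\<le>\<^sub>0" using True w by (auto simp: annulus_def complex_nonpos_Reals_iff complex_eq_iff)
  have "\<bar>Im (- \<i> * Ln (- w) + of_real pi)\<bar> < b" using w by (simp add: annulus_def)
  note d = DERIV_chain2[where f = f and g = "\<lambda>w. - \<i> * Ln (- w) + of_real pi" and x = w, OF der[OF this]]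
  have "((\<lambda>w. f (- \<i> * Ln (- w) + of_real pi)) has_field_derivative f' (- \<i> * Ln (- w) + of_real pi) * (- \<i> / w)) (at w)"
    by (rule d) (use w0 in \<open>auto intro!: derivative_eq_intros simp: divide_inverse\<close>)
  then have "((\<lambda>w. f (- \<i> * Ln (- w) + of_real pi)) has_field_derivative f' (- \<i> * Ln w) * (- \<i> / w)) (at w)"
    using shift[of f', OF per' w] by simp
  then show ?thesis
    by (rule has_field_derivative_transform_within_open[OF _ open_annulus w]) (rule shift[of f, OF per])
qed

text \<open>
  With \<open>g\<^sup>2 = \<alpha> / \<gamma>\<close> and \<open>w = exp (\<i> z)\<close> the data on the strip become data on the annulus, once they are multiplied by
  the factor \<open>h\<close> of \<open>period_closing_factor\<close>. Its hypothesis holds because a real linear relation between the three forms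
  would make \<open>g\<close> a root of a fixed polynomial, hence constant, and no number equals its own antipode.
  The primitives satisfy \<open>\<Phi> (cnj z + \<pi>) = e + cnj (\<Phi> z)\<close> with a constant \<open>e\<close>; the choice of \<open>h\<close> makes \<open>e\<close> purely imaginary, and then
  applying the relation twice shows that \<open>\<Phi>\<close> itself has period \<open>2 \<pi>\<close>.
\<close>

theorem annulus_weierstrass_data:
  obtains b c :: real and F1 F2 F4 g \<eta> :: "complex \<Rightarrow> complex"
  where "b > 0" "c > 0" "g holomorphic_on annulus b" "\<eta> holomorphic_on annulus b"
    "\<And>w. w \<in> annulus b \<Longrightarrow> \<eta> w \<noteq> 0 \<and> g w \<noteq> 0 \<and> (g w)\<^sup>2 \<noteq> 1"
    "\<And>w. w \<in> annulus b \<Longrightarrow> (F1 has_field_derivative (1 + (g w)\<^sup>2) * \<eta> w) (at w)"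
    "\<And>w. w \<in> annulus b \<Longrightarrow> (F2 has_field_derivative \<i> * (1 - (g w)\<^sup>2) * \<eta> w) (at w)"
    "\<And>w. w \<in> annulus b \<Longrightarrow> (F4 has_field_derivative - 2 * \<i> * g w * \<eta> w) (at w)"
    "\<And>w. w \<in> annulus b \<Longrightarrow> Re (F1 (glide w)) = Re (F1 w) \<and> Re (F2 (glide w)) = Re (F2 w) \<and> Re (F4 (glide w)) = Re (F4 w)"
    "\<And>w. w \<in> annulus b \<Longrightarrow> g (glide w) = glide (g w)"
    "\<And>w. w \<in> annulus b \<Longrightarrow> c / (b - \<bar>ln (cmod w)\<bar>) \<le> (1 + (cmod (g w))\<^sup>2) * cmod (\<eta> w)"
proof -
  obtain b c0 :: real and \<alpha> \<gamma> \<sigma> :: "complex \<Rightarrow> complex"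
  where b: "b > 0" and c0: "c0 > 0"
    and hol: "\<alpha> holomorphic_on {z. \<bar>Im z\<bar> < b}" "\<gamma> holomorphic_on {z. \<bar>Im z\<bar> < b}" "\<sigma> holomorphic_on {z. \<bar>Im z\<bar> < b}"
    and nz: "\<And>z. \<bar>Im z\<bar> < b \<Longrightarrow> \<alpha> z \<noteq> 0 \<and> \<gamma> z \<noteq> 0 \<and> \<alpha> z \<noteq> \<gamma> z \<and> (\<sigma> z)\<^sup>2 = \<alpha> z * \<gamma> z"
    and sym: "\<And>z. \<bar>Im z\<bar> < b \<Longrightarrow> \<alpha> (cnj z + of_real pi) = cnj (\<gamma> z) \<and> \<gamma> (cnj z + of_real pi) = cnj (\<alpha> z) \<and>
        \<sigma> (cnj z + of_real pi) = - cnj (\<sigma> z)"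
    and grow: "\<And>z. \<bar>Im z\<bar> < b \<Longrightarrow> c0 / (b - \<bar>Im z\<bar>) \<le> cmod (\<alpha> z) + cmod (\<gamma> z)"
    using strip_weierstrass_data by blast
  let ?S = "{z. \<bar>Im z\<bar> < b}"
  have two_pi: "f (z + of_real (2 * pi)) = f z"
    if I: "\<And>z. \<bar>Im z\<bar> < b \<Longrightarrow> f (cnj z + of_real pi) = \<epsilon> * cnj (f' z)" "\<And>z. \<bar>Im z\<bar> < b \<Longrightarrow> f' (cnj z + of_real pi) = \<epsilon> * cnj (f z)"
      and e: "\<epsilon> * cnj \<epsilon> = 1" and z: "\<bar>Im z\<bar> < b" for f f' :: "complex \<Rightarrow> complex" and z \<epsilon>
  proof -
    have "f (cnj (cnj z + of_real pi) + of_real pi) = \<epsilon> * cnj (\<epsilon> * cnj (f z))"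
      using I(1)[of "cnj z + of_real pi"] I(2)[OF z] z by simp
    also have "\<dots> = \<epsilon> * cnj \<epsilon> * f z" by simp
    finally show ?thesis using e by (simp add: algebra_simps)
  qed
  define \<phi> :: "3 \<Rightarrow> complex \<Rightarrow> complex" where
    "\<phi> j z = (if j = 1 then \<alpha> z + \<gamma> z else if j = 2 then \<i> * (\<gamma> z - \<alpha> z) else - 2 * \<i> * \<sigma> z)" for j z
  have hol\<phi>: "\<phi> j holomorphic_on ?S" for j
    unfolding \<phi>_def using hol by (cases "j = 1"; cases "j = 2") (auto intro!: holomorphic_intros)
  have sym\<phi>: "\<phi> j (cnj z + of_real pi) = cnj (\<phi> j z)" if "\<bar>Im z\<bar> < b" for j z
    using sym[OF that] by (simp add: \<phi>_def algebra_simps)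
  have real_in: "complex_of_real x \<in> ?S" for x using b by simp
  have cont\<phi>: "continuous_on UNIV (\<lambda>x. \<phi> j (of_real x))" for j
    by (rule continuous_on_compose2[OF holomorphic_on_imp_continuous_on[OF hol\<phi>]]) (use real_in in \<open>auto intro!: continuous_intros\<close>)
  define G where "G z = \<sigma> z / \<gamma> z" for z
  have holG: "G holomorphic_on ?S" unfolding G_def using hol nz by (intro holomorphic_intros) auto
  have G2: "(G z)\<^sup>2 = \<alpha> z / \<gamma> z" "G z \<noteq> 0" "(G z)\<^sup>2 \<noteq> 1" if "\<bar>Im z\<bar> < b" for z
  proof -
    show e: "(G z)\<^sup>2 = \<alpha> z / \<gamma> z" using nz[OF that] by (simp add: G_def power_divide power2_eq_square)
    show "(G z)\<^sup>2 \<noteq> 1" unfolding e using nz[OF that] by simp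
    show "G z \<noteq> 0" using e nz[OF that] by auto
  qed
  have GI: "G (cnj z + of_real pi) = - 1 / cnj (G z)" if "\<bar>Im z\<bar> < b" for z
  proof -
    have "G (cnj z + of_real pi) = - cnj (\<sigma> z) / cnj (\<alpha> z)" using sym[OF that] by (simp add: G_def)
    also have "\<dots> = - cnj (\<sigma> z / \<alpha> z)" by simp
    also have "\<sigma> z / \<alpha> z = 1 / G z"
      using nz[OF that] G2(2)[OF that] by (simp add: G_def field_simps power2_eq_square)
    finally show ?thesis by simp
  qed
  have nondeg: "\<exists>x. 0 < x \<and> x < pi \<and> (\<Sum>j\<in>UNIV. of_real (\<nu> $ j) * \<phi> j (of_real x)) \<noteq> 0" if \<nu>: "norm \<nu> = 1" for \<nu> :: "real^3"
  proof (rule ccontr)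
    assume "\<not> ?thesis"
    then have zero: "(\<Sum>j\<in>UNIV. of_real (\<nu> $ j) * \<phi> j (of_real x)) = 0" if "0 < x" "x < pi" for x using that by blast
    define f where "f z = (\<Sum>j\<in>UNIV. of_real (\<nu> $ j) * \<phi> j z)" for z
    have holf: "f holomorphic_on ?S" unfolding f_def by (intro holomorphic_intros hol\<phi>)
    have lim: "complex_of_real (pi/2) islimpt (of_real ` {0<..<pi})"
    proof (rule islimpt_isCont_image)
      show "(pi/2) islimpt {0<..<pi}" by (simp add: islimpt_greaterThanLessThan1 interior_limit_point)
      show "isCont complex_of_real (pi/2)" by (intro continuous_intros)
      show "\<forall>\<^sub>F y in at (pi/2). complex_of_real y \<noteq> of_real (pi/2)"
        by (rule eventually_mono[OF eventually_neq_at_within]) (simp only: of_real_eq_iff simp_thms)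
    qed
    have sub: "complex_of_real ` {0<..<pi} \<subseteq> ?S" using b by auto
    have fz: "f y = 0" if "y \<in> complex_of_real ` {0<..<pi}" for y using that zero by (auto simp: f_def)
    have f0: "f z = 0" if "\<bar>Im z\<bar> < b" for z
      using analytic_continuation[OF holf convex_strip(2) convex_connected[OF convex_strip(1)] sub real_in lim fz, of z] that by simp
    \<comment> \<open>the linear combination of the forms equals \<gamma> times this polynomial in G\<close>
    define P where "P = [:Complex (\<nu> $ 1) (\<nu> $ 2), - 2 * \<i> * of_real (\<nu> $ 3), Complex (\<nu> $ 1) (- (\<nu> $ 2)):]"
    have Pnz: "P \<noteq> 0"
    proof
      assume "P = 0"
      then have "\<nu> $ 1 = 0" "\<nu> $ 2 = 0" "\<nu> $ 3 = 0" by (simp_all add: P_def complex_eq_iff)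
      then have "\<nu> = 0" by (simp add: vec_eq_iff forall_3)
      then show False using \<nu> by simp
    qed
    have "poly P (G z) = 0" if z: "\<bar>Im z\<bar> < b" for z
    proof -
      have "f z = of_real (\<nu> $ 1) * (\<alpha> z + \<gamma> z) + of_real (\<nu> $ 2) * (\<i> * (\<gamma> z - \<alpha> z)) + of_real (\<nu> $ 3) * (- 2 * \<i> * \<sigma> z)"
        by (simp add: f_def sum_3 \<phi>_def)
      moreover have "\<alpha> z = (G z)\<^sup>2 * \<gamma> z" "\<sigma> z = G z * \<gamma> z" using G2(1)[OF z] nz[OF z] by (simp_all add: G_def)
      ultimately have "f z = \<gamma> z * poly P (G z)"
        by (simp add: P_def complex_eq_iff[of "Complex _ _"] Complex_eq algebra_simps power2_eq_square)
      then show ?thesis using f0[OF z] nz[OF z] by simp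
    qed
    then have "(\<lambda>x::real. G (of_real x)) ` {0..pi} \<subseteq> {x. poly P x = 0}" using b by auto
    then have "finite ((\<lambda>x::real. G (of_real x)) ` {0..pi})" using poly_roots_finite[OF Pnz] finite_subset by blast
    moreover have "continuous_on {0..pi} (\<lambda>x::real. G (of_real x))"
      by (rule continuous_on_compose2[OF holomorphic_on_imp_continuous_on[OF holG]]) (use real_in in \<open>auto intro!: continuous_intros\<close>)
    ultimately have "(\<lambda>x::real. G (of_real x)) constant_on {0..pi}"
      using continuous_finite_range_constant[of "{0..pi}"] by (simp add: convex_connected)
    then obtain k where k: "\<And>x. x \<in> {0..pi} \<Longrightarrow> G (of_real x) = k" unfolding constant_on_def by blast
    have "k = - 1 / cnj k" using GI[of 0] k[of 0] k[of pi] b by simp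
    moreover have "k \<noteq> 0" using k[of 0] G2(2)[of 0] b by auto
    ultimately have "k * cnj k = -1" by (simp add: field_simps)
    then have "complex_of_real ((cmod k)\<^sup>2) = of_real (-1)" by (simp only: complex_norm_square) simp
    then have "(cmod k)\<^sup>2 = -1" by (simp only: of_real_eq_iff)
    then show False using zero_le_power2[of "cmod k"] by linarith
  qed
  have sym\<phi>r: "\<phi> j (of_real (x + pi)) = cnj (\<phi> j (of_real x))" for j x
    using sym\<phi>[of "of_real x" j] b by simp
  obtain h where h: "h holomorphic_on UNIV" "\<And>z. h (cnj z + of_real pi) = cnj (h z)"
    "\<And>B. \<exists>\<epsilon>>0. \<forall>z. \<bar>Im z\<bar> \<le> B \<longrightarrow> \<epsilon> \<le> cmod (h z)"
    "\<And>j. integral {0..pi} (\<lambda>x. Re (h (of_real x) * \<phi> j (of_real x))) = 0"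
    using period_closing_factor[of "\<lambda>j x. \<phi> j (of_real x)", OF cont\<phi> sym\<phi>r nondeg] by blast
  obtain \<epsilon> where \<epsilon>: "\<epsilon> > 0" "\<And>z. \<bar>Im z\<bar> \<le> b \<Longrightarrow> \<epsilon> \<le> cmod (h z)" using h(3) by blast
  have hol\<psi>: "(\<lambda>z. h z * \<phi> j z) holomorphic_on ?S" for j
    by (intro holomorphic_intros hol\<phi>) (use h(1) in \<open>auto intro: holomorphic_on_subset\<close>)
  have "\<exists>\<Phi>. \<forall>z\<in>?S. (\<Phi> has_field_derivative h z * \<phi> j z) (at z)" for j
  proof -
    obtain \<Phi> where "\<And>z. z \<in> ?S \<Longrightarrow> (\<Phi> has_field_derivative h z * \<phi> j z) (at z within ?S)"
      using holomorphic_convex_primitive'[OF convex_strip hol\<psi>] by blast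
    then show ?thesis using at_within_open[OF _ convex_strip(2)] by (metis (no_types, lifting))
  qed
  then obtain \<Phi> where \<Phi>: "\<And>j z. \<bar>Im z\<bar> < b \<Longrightarrow> (\<Phi> j has_field_derivative h z * \<phi> j z) (at z)" by (metis mem_Collect_eq)
  \<comment> \<open>the constant e is the value of the relation at 0, and its real part is the integral that the factor h makes vanish\<close>
  have glideR: "\<exists>e. Re e = 0 \<and> (\<forall>z. \<bar>Im z\<bar> < b \<longrightarrow> \<Phi> j (cnj z + of_real pi) = e + cnj (\<Phi> j z))" for j
  proof -
    define E where "E z = \<Phi> j (z + of_real pi) - cnj (\<Phi> j (cnj z))" for z
    have dE: "(E has_field_derivative 0) (at z)" if z: "\<bar>Im z\<bar> < b" for z
    proof -
      have "((\<lambda>z. \<Phi> j (z + of_real pi)) has_field_derivative h (z + of_real pi) * \<phi> j (z + of_real pi) * 1) (at z)"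
        by (rule DERIV_chain2[OF \<Phi>]) (use z in \<open>auto intro!: derivative_eq_intros\<close>)
      moreover have "((cnj \<circ> \<Phi> j \<circ> cnj) has_field_derivative cnj (h (cnj z) * \<phi> j (cnj z))) (at z)"
        using has_field_derivative_cnj_cnj[OF \<Phi>[of "cnj z" j]] z by simp
      moreover have "h (z + of_real pi) * \<phi> j (z + of_real pi) = cnj (h (cnj z) * \<phi> j (cnj z))"
        using h(2)[of "cnj z"] sym\<phi>[of "cnj z" j] z by simp
      ultimately have "((\<lambda>z. \<Phi> j (z + of_real pi) - (cnj \<circ> \<Phi> j \<circ> cnj) z) has_field_derivative 0) (at z)"
        using DERIV_diff by fastforce
      then show ?thesis by (simp add: E_def[abs_def] o_def)
    qed
    obtain e where e: "\<And>z. z \<in> ?S \<Longrightarrow> E z = e"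
      using has_field_derivative_zero_constant[OF convex_strip(1), of b E] dE has_field_derivative_at_within by blast
    have "((\<lambda>x. h (of_real x) * \<phi> j (of_real x)) has_integral (\<Phi> j (of_real pi) - \<Phi> j (of_real 0))) {0..pi}"
    proof (rule fundamental_theorem_of_calculus)
      fix x :: real
      have "((\<lambda>x. \<Phi> j (of_real x)) has_vector_derivative h (of_real x) * \<phi> j (of_real x)) (at x)"
        by (rule has_vector_derivative_real_field) (use \<Phi> b in auto)
      then show "((\<lambda>x. \<Phi> j (of_real x)) has_vector_derivative h (of_real x) * \<phi> j (of_real x)) (at x within {0..pi})"
        by (rule has_vector_derivative_at_within)
    qed simp
    from has_integral_linear[OF this bounded_linear_Re]
    have "((\<lambda>x. Re (h (of_real x) * \<phi> j (of_real x))) has_integral Re (\<Phi> j (of_real pi) - \<Phi> j (of_real 0))) {0..pi}"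
      by (simp only: o_def)
    then have "Re (\<Phi> j (of_real pi) - \<Phi> j 0) = 0" using h(4)[of j] by (metis integral_unique of_real_0)
    moreover have "e = \<Phi> j (of_real pi) - cnj (\<Phi> j 0)" using e[of 0] b by (simp add: E_def)
    ultimately have "Re e = 0" by simp
    moreover have "\<Phi> j (cnj z + of_real pi) = e + cnj (\<Phi> j z)" if "\<bar>Im z\<bar> < b" for z
      using e[of "cnj z"] that by (simp add: E_def algebra_simps)
    ultimately show ?thesis by blast
  qed
  have per\<Phi>: "\<Phi> j (z + of_real (2 * pi)) = \<Phi> j z" if z: "\<bar>Im z\<bar> < b" for j z
  proof -
    obtain e where e: "Re e = 0" "\<And>z. \<bar>Im z\<bar> < b \<Longrightarrow> \<Phi> j (cnj z + of_real pi) = e + cnj (\<Phi> j z)" using glideR by blast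
    have "\<Phi> j (cnj (cnj z + of_real pi) + of_real pi) = e + cnj (e + cnj (\<Phi> j z))"
      using e(2)[of "cnj z + of_real pi"] e(2)[OF z] z by simp
    also have "\<dots> = \<Phi> j z" using e(1) by (simp add: complex_eq_iff)
    finally show ?thesis by (simp add: algebra_simps)
  qed
  have per\<alpha>: "\<alpha> (z + of_real (2 * pi)) = \<alpha> z" "\<gamma> (z + of_real (2 * pi)) = \<gamma> z" "\<sigma> (z + of_real (2 * pi)) = \<sigma> z"
    "h (z + of_real (2 * pi)) = h z" if "\<bar>Im z\<bar> < b" for z
    using two_pi[of \<alpha> 1 \<gamma> z] two_pi[of \<gamma> 1 \<alpha> z] two_pi[of \<sigma> "-1" \<sigma> z] two_pi[of h 1 h z] sym that h(2) by simp_all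
  have per\<psi>: "h (z + of_real (2 * pi)) * \<phi> j (z + of_real (2 * pi)) = h z * \<phi> j z" if "\<bar>Im z\<bar> < b" for z j
    using per\<alpha>[OF that] by (simp add: \<phi>_def)
  have perG: "G (z + of_real (2 * pi)) = G z" if "\<bar>Im z\<bar> < b" for z
    using per\<alpha>[OF that] by (simp add: G_def)
  define g where "g w = G (- \<i> * Ln w)" for w
  define \<eta> where "\<eta> w = h (- \<i> * Ln w) * \<gamma> (- \<i> * Ln w) * (- \<i> / w)" for w
  have inS: "\<bar>Im (- \<i> * Ln w)\<bar> < b" if "w \<in> annulus b" for w using that by (simp add: annulus_def)
  have hol_push: "(\<lambda>w. f (- \<i> * Ln w)) holomorphic_on annulus b"
    if f: "f holomorphic_on ?S" and p: "\<And>z. \<bar>Im z\<bar> < b \<Longrightarrow> f (z + of_real (2 * pi)) = f z" for f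
  proof -
    have d: "(f has_field_derivative deriv f z) (at z)" if "\<bar>Im z\<bar> < b" for z
      using holomorphic_derivI[OF f convex_strip(2)] that by simp
    have p': "deriv f (z + of_real (2 * pi)) = deriv f z" if z: "\<bar>Im z\<bar> < b" for z
    proof -
      have "((\<lambda>z. f (z + of_real (2 * pi))) has_field_derivative deriv f (z + of_real (2 * pi)) * 1) (at z)"
        by (rule DERIV_chain2[OF d]) (use z in \<open>auto intro!: derivative_eq_intros\<close>)
      then have "(f has_field_derivative deriv f (z + of_real (2 * pi)) * 1) (at z)"
        by (rule has_field_derivative_transform_within_open[OF _ convex_strip(2)[of b]]) (use z p in auto)
      then show ?thesis using DERIV_unique[OF _ d[OF z]] by force
    qed
    show ?thesis
      unfolding holomorphic_on_open[OF open_annulus]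
      using push_down_derivative[OF d p p'] by blast
  qed
  have u0: "w \<noteq> 0" if "w \<in> annulus b" for w using that by (simp add: annulus_def)
  have holg: "g holomorphic_on annulus b" unfolding g_def by (rule hol_push[OF holG perG])
  have "(\<lambda>z. h z * \<gamma> z) holomorphic_on ?S" by (intro holomorphic_intros hol) (use h(1) in \<open>auto intro: holomorphic_on_subset\<close>)
  from hol_push[OF this] have "(\<lambda>w. h (- \<i> * Ln w) * \<gamma> (- \<i> * Ln w)) holomorphic_on annulus b" using per\<alpha> by simp
  then have hol\<eta>: "\<eta> holomorphic_on annulus b"
    unfolding \<eta>_def by (rule holomorphic_on_mult) (use u0 in \<open>auto intro!: holomorphic_intros\<close>)
  have hnz: "h z \<noteq> 0" if "\<bar>Im z\<bar> < b" for z using \<epsilon>(1) \<epsilon>(2)[of z] that by auto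
  have dF: "((\<lambda>w. \<Phi> j (- \<i> * Ln w)) has_field_derivative h (- \<i> * Ln w) * \<phi> j (- \<i> * Ln w) * (- \<i> / w)) (at w)"
    if "w \<in> annulus b" for j w
    by (rule push_down_derivative[OF \<Phi> per\<Phi> per\<psi> that])
  have \<alpha>G: "\<alpha> z = (G z)\<^sup>2 * \<gamma> z" "\<sigma> z = G z * \<gamma> z" if "\<bar>Im z\<bar> < b" for z using G2(1)[OF that] nz[OF that] by (simp_all add: G_def)
  have expLn: "glide w = exp (\<i> * (cnj (- \<i> * Ln w) + of_real pi))" if "w \<in> annulus b" for w
  proof -
    have "exp (\<i> * (cnj (- \<i> * Ln w) + of_real pi)) = exp (- cnj (Ln w)) * exp (\<i> * of_real pi)"
    proof -
      have "\<i> * (cnj (- \<i> * Ln w) + of_real pi) = - cnj (Ln w) + \<i> * of_real pi" by (simp add: algebra_simps)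
      then show ?thesis by (simp only: exp_add)
    qed
    also have "\<dots> = - inverse (cnj (exp (Ln w)))" by (simp add: exp_minus exp_cnj)
    also have "\<dots> = glide w" using u0[OF that] by (simp add: glide_def field_simps)
    finally show ?thesis by simp
  qed
  have inS': "\<bar>Im (cnj (- \<i> * Ln w) + of_real pi)\<bar> < b" if "w \<in> annulus b" for w using inS[OF that] by simp
  show ?thesis
  proof (rule that[of b "\<epsilon> * c0 * exp (- b)" g \<eta> "\<lambda>w. \<Phi> 1 (- \<i> * Ln w)" "\<lambda>w. \<Phi> 2 (- \<i> * Ln w)" "\<lambda>w. \<Phi> 3 (- \<i> * Ln w)"])
    fix w assume w: "w \<in> annulus b"
    let ?z = "- \<i> * Ln w"
    note z = inS[OF w]
    show "\<eta> w \<noteq> 0 \<and> g w \<noteq> 0 \<and> (g w)\<^sup>2 \<noteq> 1"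
      using hnz[OF z] nz[OF z] G2[OF z] u0[OF w] by (simp add: \<eta>_def g_def)
    have "h ?z * \<phi> 1 ?z * (- \<i> / w) = (1 + (g w)\<^sup>2) * \<eta> w"
      using \<alpha>G[OF z] by (simp add: \<phi>_def g_def \<eta>_def algebra_simps add_divide_distrib diff_divide_distrib)
    then show "((\<lambda>w. \<Phi> 1 (- \<i> * Ln w)) has_field_derivative (1 + (g w)\<^sup>2) * \<eta> w) (at w)" using dF[OF w, of 1] by simp
    have "h ?z * \<phi> 2 ?z * (- \<i> / w) = \<i> * (1 - (g w)\<^sup>2) * \<eta> w"
      using \<alpha>G[OF z] by (simp add: \<phi>_def g_def \<eta>_def algebra_simps add_divide_distrib diff_divide_distrib)
    then show "((\<lambda>w. \<Phi> 2 (- \<i> * Ln w)) has_field_derivative \<i> * (1 - (g w)\<^sup>2) * \<eta> w) (at w)" using dF[OF w, of 2] by simp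
    have "h ?z * \<phi> 3 ?z * (- \<i> / w) = - 2 * \<i> * g w * \<eta> w"
      using \<alpha>G[OF z] by (simp add: \<phi>_def g_def \<eta>_def algebra_simps add_divide_distrib diff_divide_distrib)
    then show "((\<lambda>w. \<Phi> 3 (- \<i> * Ln w)) has_field_derivative - 2 * \<i> * g w * \<eta> w) (at w)" using dF[OF w, of 3] by simp
    have "Re (\<Phi> j (- \<i> * Ln (glide w))) = Re (\<Phi> j ?z)" for j
    proof -
      have "\<Phi> j (- \<i> * Ln (glide w)) = \<Phi> j (cnj ?z + of_real pi)"
        unfolding expLn[OF w] by (rule push_down_exp[where f = "\<Phi> j", OF per\<Phi> inS'[OF w]])
      moreover obtain e where e: "Re e = 0" "\<Phi> j (cnj ?z + of_real pi) = e + cnj (\<Phi> j ?z)" using glideR[of j] z by blast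
      ultimately show ?thesis by (simp only: e plus_complex.simps cnj.simps)
    qed
    then show "Re (\<Phi> 1 (- \<i> * Ln (glide w))) = Re (\<Phi> 1 ?z) \<and> Re (\<Phi> 2 (- \<i> * Ln (glide w))) = Re (\<Phi> 2 ?z) \<and>
       Re (\<Phi> 3 (- \<i> * Ln (glide w))) = Re (\<Phi> 3 ?z)" by blast
    have "g (glide w) = G (cnj ?z + of_real pi)"
      unfolding g_def expLn[OF w] by (rule push_down_exp[where f = G, OF perG inS'[OF w]])
    then show "g (glide w) = glide (g w)" using GI[OF z] by (simp add: g_def glide_def)
    have ew: "exp (- b) \<le> 1 / cmod w"
    proof -
      have "ln (cmod w) \<le> b" using w by (auto simp: annulus_def)
      then have "cmod w \<le> exp b" using u0[OF w] by (metis exp_le_cancel_iff exp_ln zero_less_norm_iff)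
      then show ?thesis using u0[OF w] by (simp add: exp_minus field_simps)
    qed
    have lnz: "\<bar>ln (cmod w)\<bar> = \<bar>Im ?z\<bar>" using u0[OF w] by simp
    have "\<epsilon> * c0 * exp (- b) / (b - \<bar>ln (cmod w)\<bar>) = \<epsilon> * (c0 / (b - \<bar>Im ?z\<bar>)) * exp (- b)" unfolding lnz by simp
    also have "\<dots> \<le> cmod (h ?z) * (cmod (\<alpha> ?z) + cmod (\<gamma> ?z)) * (1 / cmod w)"
      using \<epsilon> c0 z grow[OF z] ew by (intro mult_mono) (auto intro!: mult_nonneg_nonneg divide_nonneg_pos)
    also have "\<dots> = (1 + (cmod (g w))\<^sup>2) * cmod (\<eta> w)"
      using \<alpha>G(1)[OF z] by (simp add: \<eta>_def g_def norm_mult norm_divide norm_power algebra_simps add_divide_distrib)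
    finally show "\<epsilon> * c0 * exp (- b) / (b - \<bar>ln (cmod w)\<bar>) \<le> (1 + (cmod (g w))\<^sup>2) * cmod (\<eta> w)" .
  qed (use b \<epsilon> c0 holg hol\<eta> in auto)
qed

section \<open>Quotients of plane domains\<close>

lemma second_countable_euclidean: "second_countable (euclidean :: 'a::second_countable_topology topology)"
proof -
  obtain B :: "'a set set" where "countable B" "topological_basis B" using ex_countable_basis by blast
  then show ?thesis unfolding second_countable_def topological_basis_iff
    by (metis open_openin topological_basisE topological_basis_open \<open>topological_basis B\<close>)
qed

text \<open>
  The quotient topology on the image of \<open>U\<close> under \<open>p\<close>. Points of the quotient are the values of \<open>p\<close>.
\<close>

definition orbit_topology :: "complex set \<Rightarrow> (complex \<Rightarrow> 'a) \<Rightarrow> 'a topology" where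
  "orbit_topology U p = topology (\<lambda>S. S \<subseteq> p ` U \<and> open (U \<inter> p -` S))"

definition orbit_chart :: "(complex \<Rightarrow> 'a) \<Rightarrow> complex set \<Rightarrow> 'a chart" where
  "orbit_chart p V = (p ` V, the_inv_into V p)"

definition orbit_atlas :: "complex set \<Rightarrow> (complex \<Rightarrow> 'a) \<Rightarrow> 'a chart set" where
  "orbit_atlas U p = {orbit_chart p V |V. open V \<and> V \<subseteq> U \<and> inj_on p V}"

locale orbit_space =
  fixes U :: "complex set" and p :: "complex \<Rightarrow> 'a"
  assumes open_U: "open U"
    and open_saturation: "\<And>V. open V \<Longrightarrow> V \<subseteq> U \<Longrightarrow> open (U \<inter> p -` (p ` V))"
    and locally_injective: "\<And>w. w \<in> U \<Longrightarrow> \<exists>V. open V \<and> w \<in> V \<and> V \<subseteq> U \<and> inj_on p V"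
begin

abbreviation "T \<equiv> orbit_topology U p"

lemma openin_orbit: "openin T S \<longleftrightarrow> S \<subseteq> p ` U \<and> open (U \<inter> p -` S)"
proof -
  have "istopology (\<lambda>S. S \<subseteq> p ` U \<and> open (U \<inter> p -` S))"
    unfolding istopology_def
  proof (intro conjI allI impI)
    fix S S' assume *: "S \<subseteq> p ` U \<and> open (U \<inter> p -` S)" "S' \<subseteq> p ` U \<and> open (U \<inter> p -` S')"
    show "S \<inter> S' \<subseteq> p ` U" using * by blast
    have "U \<inter> p -` (S \<inter> S') = (U \<inter> p -` S) \<inter> (U \<inter> p -` S')" by blast
    then show "open (U \<inter> p -` (S \<inter> S'))" using * by (simp add: open_Int)
  next
    fix K assume *: "\<forall>S\<in>K. S \<subseteq> p ` U \<and> open (U \<inter> p -` S)"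
    show "\<Union>K \<subseteq> p ` U" using * by blast
    have "U \<inter> p -` \<Union>K = (\<Union>S\<in>K. U \<inter> p -` S)" by blast
    moreover have "open (\<Union>S\<in>K. U \<inter> p -` S)" using * by (intro open_UN ballI) blast
    ultimately show "open (U \<inter> p -` \<Union>K)" by (simp only:)
  qed
  then show ?thesis unfolding orbit_topology_def by (simp add: topology_inverse')
qed

lemma topspace_orbit: "topspace T = p ` U"
proof -
  have "openin T (p ` U)" unfolding openin_orbit using open_saturation[OF open_U] by simp
  then show ?thesis by (metis openin_orbit openin_subset openin_topspace subset_antisym)
qed

lemma openin_image: "open V \<Longrightarrow> V \<subseteq> U \<Longrightarrow> openin T (p ` V)"
  using open_saturation by (auto simp: openin_orbit)

lemma continuous_map_projection: "continuous_map (top_of_set U) T p"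
  unfolding continuous_map
  using open_U by (auto simp: topspace_orbit openin_orbit openin_open_eq vimage_def Collect_conj_eq)

lemma open_map_projection: "open_map (top_of_set U) T p"
  unfolding open_map_def using open_U by (auto simp: openin_open_eq openin_image)

lemma chart_simps:
  assumes "inj_on p V"
  shows "fst (orbit_chart p V) = p ` V" "\<And>w. w \<in> V \<Longrightarrow> snd (orbit_chart p V) (p w) = w"
    "snd (orbit_chart p V) ` fst (orbit_chart p V) = V"
    "\<And>w. w \<in> V \<Longrightarrow> chart_inv (orbit_chart p V) w = p w"
proof -
  show fs: "fst (orbit_chart p V) = p ` V" by (simp add: orbit_chart_def)
  show sn: "\<And>w. w \<in> V \<Longrightarrow> snd (orbit_chart p V) (p w) = w"
    by (simp add: orbit_chart_def the_inv_into_f_f[OF assms])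
  show "snd (orbit_chart p V) ` fst (orbit_chart p V) = V" using fs sn by force
  show "chart_inv (orbit_chart p V) w = p w" if "w \<in> V" for w
  proof -
    have "inj_on (snd (orbit_chart p V)) (p ` V)" using sn by (auto simp: inj_on_def)
    from the_inv_into_f_f[OF this, of "p w"] show ?thesis using that sn fs by (simp add: chart_inv_def)
  qed
qed

lemma homeomorphic_maps_chart:
  assumes V: "open V" "V \<subseteq> U" "inj_on p V"
  shows "homeomorphic_maps (subtopology T (p ` V)) (top_of_set V) (snd (orbit_chart p V)) p"
  unfolding homeomorphic_maps_def
proof (intro conjI ballI)
  have ts: "topspace (subtopology T (p ` V)) = p ` V" using V by (auto simp: topspace_orbit)
  show "continuous_map (top_of_set V) (subtopology T (p ` V)) p"
    using continuous_map_projection V by (auto simp: continuous_map_in_subtopology intro: continuous_map_from_subtopology_mono)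
  show "continuous_map (subtopology T (p ` V)) (top_of_set V) (snd (orbit_chart p V))"
    unfolding continuous_map ts
  proof (intro conjI allI impI)
    show "snd (orbit_chart p V) ` p ` V \<subseteq> topspace (top_of_set V)" using chart_simps(2)[OF V(3)] by auto
    fix W assume W: "openin (top_of_set V) W"
    then have W': "open W" "W \<subseteq> V" using V(1) by (auto simp: openin_open_eq)
    have "{x \<in> p ` V. snd (orbit_chart p V) x \<in> W} = p ` W" using chart_simps(2)[OF V(3)] W'(2) by force
    moreover have "openin T (p ` W)" using W' V(2) by (intro openin_image) auto
    ultimately show "openin (subtopology T (p ` V)) {x \<in> p ` V. snd (orbit_chart p V) x \<in> W}"
      unfolding openin_subtopology using W'(2) by (intro exI[of _ "p ` W"]) auto
  qed
qed (use chart_simps[OF V(3)] V in \<open>auto simp: topspace_orbit\<close>)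

lemma chart_on_orbit_chart:
  assumes V: "open V" "V \<subseteq> U" "inj_on p V"
  shows "chart_on T (orbit_chart p V)"
proof -
  have "snd (orbit_chart p V) ` p ` V = V" using chart_simps(1,3)[OF V(3)] by simp
  then show ?thesis
    unfolding chart_on_def chart_simps(1)[OF V(3)]
    using homeomorphic_maps_imp_map[OF homeomorphic_maps_chart[OF V]] openin_image V by simp
qed

lemma orbit_atlasE:
  assumes "c \<in> orbit_atlas U p"
  obtains V where "c = orbit_chart p V" "open V" "V \<subseteq> U" "inj_on p V"
  using assms by (auto simp: orbit_atlas_def)

lemma surface_orbit:
  assumes "U \<noteq> {}" "connected U" "Hausdorff_space T"
  shows "surface T (orbit_atlas U p)"
  unfolding surface_def
proof (intro conjI ballI)
  show "topspace T \<noteq> {}" using assms by (simp add: topspace_orbit)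
  show "Hausdorff_space T" by fact
  show "second_countable T"
  proof (rule second_countable_open_map_image)
    show "continuous_map (top_of_set U) T p" by (rule continuous_map_projection)
    show "open_map (top_of_set U) T p" by (rule open_map_projection)
    show "p ` topspace (top_of_set U) = topspace T" by (simp add: topspace_orbit)
    show "second_countable (top_of_set U)" by (intro second_countable_subtopology second_countable_euclidean)
  qed
  show "connected_space T"
  proof -
    have "connectedin T (p ` U)"
      by (rule connectedin_continuous_map_image[OF continuous_map_projection]) (use assms in \<open>simp add: connectedin_subtopology\<close>)
    then show ?thesis by (simp add: connectedin_topspace flip: topspace_orbit)
  qed
  show "chart_on T c" if "c \<in> orbit_atlas U p" for c
    using that chart_on_orbit_chart by (auto simp: orbit_atlas_def)
  have "p w \<in> (\<Union>c\<in>orbit_atlas U p. fst c)" if w: "w \<in> U" for w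
  proof -
    obtain V where V: "open V" "w \<in> V" "V \<subseteq> U" "inj_on p V" using locally_injective[OF w] by blast
    then have "orbit_chart p V \<in> orbit_atlas U p" "p w \<in> fst (orbit_chart p V)"
      by (auto simp: orbit_atlas_def orbit_chart_def)
    then show ?thesis by blast
  qed
  then show "(\<Union>c\<in>orbit_atlas U p. fst c) = topspace T"
    unfolding topspace_orbit
  proof (intro equalityI subsetI)
    fix x assume "x \<in> (\<Union>c\<in>orbit_atlas U p. fst c)"
    then show "x \<in> p ` U" unfolding orbit_atlas_def orbit_chart_def by fastforce
  qed blast
qed

end

text \<open>
  A coordinate representation of \<open>F\<close> is a local lift \<open>f\<close> of \<open>F\<close> through the two projections, so it suffices to verify the property for lifts.
\<close>

lemma in_charts_orbit_atlas:
  assumes "orbit_space U p" "orbit_space U q"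
    and P: "\<And>V V' f. \<lbrakk>open V; V \<subseteq> U; open V'; V' \<subseteq> U; inj_on q V';
          \<And>w. w \<in> V \<Longrightarrow> F (p w) \<in> q ` V' \<Longrightarrow> f w \<in> V' \<and> q (f w) = F (p w)\<rbrakk>
        \<Longrightarrow> P f {w \<in> V. F (p w) \<in> q ` V'}"
  shows "in_charts P (orbit_atlas U p) (orbit_atlas U q) F"
  unfolding in_charts_def
proof (intro ballI)
  interpret p: orbit_space U p by fact
  interpret q: orbit_space U q by fact
  fix c d assume "c \<in> orbit_atlas U p" "d \<in> orbit_atlas U q"
  then obtain V V' where c: "c = orbit_chart p V" and V: "open V" "V \<subseteq> U" "inj_on p V"
    and d: "d = orbit_chart q V'" and V': "open V'" "V' \<subseteq> U" "inj_on q V'" by (metis p.orbit_atlasE q.orbit_atlasE)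
  have "snd c ` {x \<in> fst c. F x \<in> fst d} = {w \<in> V. F (p w) \<in> q ` V'}"
    unfolding c d p.chart_simps(1)[OF V(3)] q.chart_simps(1)[OF V'(3)] using p.chart_simps(2)[OF V(3)] by force
  moreover have "P (snd d \<circ> F \<circ> chart_inv c) {w \<in> V. F (p w) \<in> q ` V'}"
  proof (rule P[OF V(1,2) V'])
    fix w assume w: "w \<in> V" "F (p w) \<in> q ` V'"
    then obtain v where v: "v \<in> V'" "F (p w) = q v" by blast
    then show "(snd d \<circ> F \<circ> chart_inv c) w \<in> V' \<and> q ((snd d \<circ> F \<circ> chart_inv c) w) = F (p w)"
      using w by (simp add: c d p.chart_simps(4)[OF V(3)] q.chart_simps(2)[OF V'(3)])
  qed
  ultimately show "P (snd d \<circ> F \<circ> chart_inv c) (snd c ` {x \<in> fst c. F x \<in> fst d})" by simp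
qed

section \<open>The annulus and the Moebius band\<close>

text \<open>
  The annulus and its quotient are both represented by sets of complex numbers: by the orbits of the
  trivial group and of the group generated by the glide.
\<close>

definition cover_point :: "complex \<Rightarrow> complex set" where "cover_point w = {w}"
definition moebius_point :: "complex \<Rightarrow> complex set" where "moebius_point w = {w, glide w}"
definition cover_projection :: "complex set \<Rightarrow> complex set" where "cover_projection s = s \<union> glide ` s"
definition deck_involution :: "complex set \<Rightarrow> complex set" where "deck_involution s = glide ` s"

lemma cover_maps [simp]:
  "cover_projection (cover_point w) = moebius_point w"
  "deck_involution (cover_point w) = cover_point (glide w)"
  by (auto simp: cover_projection_def cover_point_def moebius_point_def deck_involution_def)

lemma cover_point_eq_iff [simp]: "cover_point v = cover_point w \<longleftrightarrow> v = w"
  by (simp add: cover_point_def)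

lemma annulus_nonzero: "w \<in> annulus b \<Longrightarrow> w \<noteq> 0"
  by (simp add: annulus_def)

lemma glide_neq: "w \<noteq> 0 \<Longrightarrow> glide w \<noteq> w"
proof
  assume "w \<noteq> 0" "glide w = w"
  then have "w * cnj w = -1" by (simp add: glide_def field_simps)
  then have "complex_of_real ((cmod w)\<^sup>2) = of_real (-1)" by (simp only: complex_norm_square) simp
  then have "(cmod w)\<^sup>2 = -1" by (simp only: of_real_eq_iff)
  then show False using zero_le_power2[of "cmod w"] by linarith
qed

lemma moebius_point_eq_iff:
  assumes "v \<noteq> 0" "w \<noteq> 0"
  shows "moebius_point v = moebius_point w \<longleftrightarrow> v = w \<or> v = glide w"
  using glide_glide[OF assms(1)] glide_glide[OF assms(2)] glide_neq[OF assms(1)] glide_neq[OF assms(2)]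
  by (auto simp: moebius_point_def doubleton_eq_iff)

lemma moebius_point_glide: "w \<noteq> 0 \<Longrightarrow> moebius_point (glide w) = moebius_point w"
  by (auto simp: moebius_point_def glide_glide)

lemma continuous_on_glide: "0 \<notin> S \<Longrightarrow> continuous_on S glide"
  unfolding glide_def by (intro continuous_intros) auto

lemma cnj_glide_holomorphic: "0 \<notin> S \<Longrightarrow> (\<lambda>w. cnj (glide w)) holomorphic_on S"
  unfolding glide_def by (auto intro!: holomorphic_intros)

lemma open_image_cnj:
  assumes "open S"
  shows "open (cnj ` S)"
proof -
  have "cnj ` S = cnj -` S"
  proof (intro equalityI subsetI)
    fix x assume "x \<in> cnj -` S"
    then have "cnj (cnj x) \<in> cnj ` S" by (intro imageI) simp
    then show "x \<in> cnj ` S" by simp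
  qed auto
  then show ?thesis using open_vimage[OF assms, of cnj] by (simp add: continuous_on_cnj continuous_on_id)
qed

locale band =
  fixes b :: real
  assumes b_pos: "b > 0"
begin

abbreviation "U \<equiv> annulus b"

lemma open_vimage_glide: "open V \<Longrightarrow> open (U \<inter> glide -` V)"
  by (rule continuous_open_preimage[OF continuous_on_glide open_annulus]) (auto simp: annulus_def)

lemma one_in_annulus: "1 \<in> U" using b_pos by (simp add: annulus_def)

lemma connected_annulus: "connected U"
proof -
  have "connected ((\<lambda>z. exp (\<i> * z)) ` {z::complex. \<bar>Im z\<bar> < b})"
    by (intro connected_continuous_image convex_connected convex_strip continuous_intros)
  moreover have "(\<lambda>z. exp (\<i> * z)) ` {z::complex. \<bar>Im z\<bar> < b} = U"
  proof (intro equalityI subsetI)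
    fix w assume w: "w \<in> U"
    then have "w = exp (\<i> * (- \<i> * Ln w))" "\<bar>Im (- \<i> * Ln w)\<bar> < b" by (auto simp: annulus_def)
    then show "w \<in> (\<lambda>z. exp (\<i> * z)) ` {z::complex. \<bar>Im z\<bar> < b}" by blast
  qed (auto simp: annulus_def)
  ultimately show ?thesis by simp
qed

sublocale cover: orbit_space "annulus b" cover_point
proof
  show "open U" by (rule open_annulus)
  fix V :: "complex set" assume V: "open V" "V \<subseteq> U"
  then have "U \<inter> cover_point -` (cover_point ` V) = V" by (auto simp: cover_point_def)
  then show "open (U \<inter> cover_point -` (cover_point ` V))" using V by simp
next
  fix w assume "w \<in> U"
  then show "\<exists>V. open V \<and> w \<in> V \<and> V \<subseteq> U \<and> inj_on cover_point V"
    by (intro exI[of _ U]) (auto simp: open_annulus inj_on_def)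
qed

text \<open>
  The points identified with points of \<open>V\<close> are those of \<open>V\<close> and of its image under the glide.
\<close>

lemma moebius_saturation: "V \<subseteq> U \<Longrightarrow> U \<inter> moebius_point -` (moebius_point ` V) = V \<union> (U \<inter> glide -` V)"
proof (intro equalityI subsetI)
  fix x assume V: "V \<subseteq> U" and "x \<in> U \<inter> moebius_point -` (moebius_point ` V)"
  then obtain v where v: "v \<in> V" "moebius_point x = moebius_point v" "x \<in> U" by auto
  then have nz: "x \<noteq> 0" "v \<noteq> 0" using V annulus_nonzero by blast+
  then have "x = v \<or> x = glide v" using v(2) moebius_point_eq_iff by blast
  then show "x \<in> V \<union> (U \<inter> glide -` V)" using v(1,3) glide_glide[OF nz(2)] by auto
next
  fix x assume V: "V \<subseteq> U" and x: "x \<in> V \<union> (U \<inter> glide -` V)"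
  then have "x \<in> U" by blast
  moreover from this have "moebius_point (glide x) = moebius_point x" using annulus_nonzero moebius_point_glide by blast
  ultimately show "x \<in> U \<inter> moebius_point -` (moebius_point ` V)" using x by (metis IntI UnE imageI vimageE vimageI IntD2)
qed

text \<open>
  The glide has no fixed points, so small neighbourhoods are disjoint from their images and embed into the quotient.
\<close>

lemma separated_neighbourhood:
  assumes "w \<in> U"
  obtains V where "open V" "w \<in> V" "V \<subseteq> U" "inj_on moebius_point V" "V \<inter> glide ` V = {}"
proof -
  have "w \<noteq> 0" using assms by (rule annulus_nonzero)
  then obtain A B where AB: "open A" "open B" "w \<in> A" "glide w \<in> B" "A \<inter> B = {}"
    using hausdorff[of w "glide w"] glide_neq[of w] by metis
  define V where "V = A \<inter> (U \<inter> glide -` B)"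
  have V: "open V" "w \<in> V" "V \<subseteq> U" using AB assms open_vimage_glide[of B] by (auto simp: V_def)
  have disj: "V \<inter> glide ` V = {}" using AB(5) by (auto simp: V_def)
  have "inj_on moebius_point V"
  proof (rule inj_onI)
    fix x y assume xy: "x \<in> V" "y \<in> V" "moebius_point x = moebius_point y"
    then have "x = y \<or> x = glide y" using moebius_point_eq_iff V(3) annulus_nonzero by (metis subsetD)
    then show "x = y" using xy disj by blast
  qed
  then show ?thesis using that V disj by blast
qed

sublocale moebius: orbit_space "annulus b" moebius_point
proof
  show "open U" by (rule open_annulus)
  fix V :: "complex set" assume V: "open V" "V \<subseteq> U"
  then show "open (U \<inter> moebius_point -` (moebius_point ` V))"
    unfolding moebius_saturation[OF V(2)] using open_vimage_glide by (simp add: open_Un)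
next
  fix w assume "w \<in> U"
  then show "\<exists>V. open V \<and> w \<in> V \<and> V \<subseteq> U \<and> inj_on moebius_point V" using separated_neighbourhood by metis
qed

abbreviation "TC \<equiv> orbit_topology U cover_point"
abbreviation "AC \<equiv> orbit_atlas U cover_point"
abbreviation "TM \<equiv> orbit_topology U moebius_point"
abbreviation "AM \<equiv> orbit_atlas U moebius_point"

lemma Hausdorff_cover: "Hausdorff_space TC"
  unfolding Hausdorff_space_def cover.topspace_orbit
proof (intro allI impI, elim conjE)
  fix x y assume "x \<in> cover_point ` U" "y \<in> cover_point ` U" "x \<noteq> y"
  then obtain v w where vw: "v \<in> U" "w \<in> U" "x = cover_point v" "y = cover_point w" "v \<noteq> w" by auto
  then obtain A B where AB: "open A" "open B" "v \<in> A" "w \<in> B" "A \<inter> B = {}" using hausdorff[of v w] by metis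
  have "openin TC (cover_point ` (A \<inter> U))" "openin TC (cover_point ` (B \<inter> U))"
    using AB open_annulus by (auto intro!: cover.openin_image)
  moreover have "disjnt (cover_point ` (A \<inter> U)) (cover_point ` (B \<inter> U))"
    using AB(5) by (auto simp: disjnt_def)
  ultimately show "\<exists>A B. openin TC A \<and> openin TC B \<and> x \<in> A \<and> y \<in> B \<and> disjnt A B"
    using AB(3,4) vw by blast
qed

lemma Hausdorff_moebius: "Hausdorff_space TM"
  unfolding Hausdorff_space_def moebius.topspace_orbit
proof (intro allI impI, elim conjE)
  fix x y assume "x \<in> moebius_point ` U" "y \<in> moebius_point ` U" "x \<noteq> y"
  then obtain v w where vw: "v \<in> U" "w \<in> U" "x = moebius_point v" "y = moebius_point w" by auto
  have nz: "v \<noteq> 0" "w \<noteq> 0" using vw annulus_nonzero by auto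
  then have ne: "v \<noteq> w" "v \<noteq> glide w" using \<open>x \<noteq> y\<close> vw moebius_point_eq_iff by auto
  obtain A B where AB: "open A" "open B" "v \<in> A" "w \<in> B" "A \<inter> B = {}" using hausdorff[OF ne(1)] by metis
  obtain A' B' where AB': "open A'" "open B'" "v \<in> A'" "glide w \<in> B'" "A' \<inter> B' = {}" using hausdorff[OF ne(2)] by metis
  define M where "M = A \<inter> A' \<inter> U"
  define N where "N = B \<inter> (U \<inter> glide -` B')"
  have M: "open M" "v \<in> M" "M \<subseteq> U" using AB AB' vw by (auto simp: M_def open_annulus)
  have N: "open N" "w \<in> N" "N \<subseteq> U" using AB AB' vw open_vimage_glide[of B'] by (auto simp: N_def)
  have "moebius_point m \<noteq> moebius_point n" if "m \<in> M" "n \<in> N" for m n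
  proof -
    have "m \<noteq> n" "m \<noteq> glide n" using that AB(5) AB'(5) by (auto simp: M_def N_def)
    moreover have "m \<noteq> 0" "n \<noteq> 0" using that M N annulus_nonzero by auto
    ultimately show ?thesis by (simp add: moebius_point_eq_iff)
  qed
  then have "disjnt (moebius_point ` M) (moebius_point ` N)" by (auto simp: disjnt_def)
  then show "\<exists>A B. openin TM A \<and> openin TM B \<and> x \<in> A \<and> y \<in> B \<and> disjnt A B"
    using M N vw moebius.openin_image by blast
qed

lemma surfaces: "surface TC AC" "surface TM AM"
proof -
  have "U \<noteq> {}" using one_in_annulus by blast
  then show "surface TC AC" "surface TM AM"
    by (rule cover.surface_orbit[OF _ connected_annulus Hausdorff_cover], rule moebius.surface_orbit[OF _ connected_annulus Hausdorff_moebius])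
qed

lemma cover_Riemann_surface: "Riemann_surface TC AC"
  unfolding Riemann_surface_def
proof (intro conjI surfaces)
  show "in_charts (\<lambda>f S. f holomorphic_on S) AC AC id"
  proof (rule in_charts_orbit_atlas[OF cover.orbit_space_axioms cover.orbit_space_axioms])
    fix V V' :: "complex set" and f
    assume "\<And>w. w \<in> V \<Longrightarrow> id (cover_point w) \<in> cover_point ` V' \<Longrightarrow> f w \<in> V' \<and> cover_point (f w) = id (cover_point w)"
    then have "w = f w" if "w \<in> {w \<in> V. id (cover_point w) \<in> cover_point ` V'}" for w using that by simp
    then show "f holomorphic_on {w \<in> V. id (cover_point w) \<in> cover_point ` V'}"
      by (rule holomorphic_transform[OF holomorphic_on_ident])
  qed
qed

lemma deck_antiholomorphic: "in_charts antiholomorphic_on AC AC deck_involution"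
proof (rule in_charts_orbit_atlas[OF cover.orbit_space_axioms cover.orbit_space_axioms])
  fix V V' :: "complex set" and f
  assume V: "V \<subseteq> U" and *: "\<And>w. w \<in> V \<Longrightarrow> deck_involution (cover_point w) \<in> cover_point ` V' \<Longrightarrow>
      f w \<in> V' \<and> cover_point (f w) = deck_involution (cover_point w)"
  have eq: "cnj (glide w) = cnj (f w)" if "w \<in> {w \<in> V. deck_involution (cover_point w) \<in> cover_point ` V'}" for w
    using *[of w] that by simp
  have "(\<lambda>w. cnj (glide w)) holomorphic_on {w \<in> V. deck_involution (cover_point w) \<in> cover_point ` V'}"
    using V annulus_nonzero by (intro cnj_glide_holomorphic) auto
  then show "antiholomorphic_on f {w \<in> V. deck_involution (cover_point w) \<in> cover_point ` V'}"
    unfolding antiholomorphic_on_def by (rule holomorphic_transform) (rule eq)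
qed

text \<open>
  Near each point a lift of the identity of the quotient is either the identity or the glide. The set where it is the one or the other may be
  disconnected, which is why the notion is local.
\<close>

lemma dianalytic_transitions:
  assumes V: "open V" "V \<subseteq> U" "open V'" "V' \<subseteq> U" "inj_on moebius_point V'"
    and f: "\<And>w. w \<in> V \<Longrightarrow> moebius_point w \<in> moebius_point ` V' \<Longrightarrow> f w \<in> V' \<and> moebius_point (f w) = moebius_point w"
  shows "dianalytic_on f {w \<in> V. moebius_point w \<in> moebius_point ` V'}"
  unfolding dianalytic_on_def
proof
  fix z assume z: "z \<in> {w \<in> V. moebius_point w \<in> moebius_point ` V'}"
  have z0: "z \<noteq> 0" using z V annulus_nonzero by auto
  have val: "f z = z \<or> f z = glide z" "f z \<in> V'"
    using f[of z] z moebius_point_eq_iff[of "f z" z] z0 V annulus_nonzero by (blast, blast)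
  show "\<exists>W. open W \<and> z \<in> W \<and> W \<subseteq> {w \<in> V. moebius_point w \<in> moebius_point ` V'} \<and> (f holomorphic_on W \<or> antiholomorphic_on f W)"
    using val(1)
  proof
    assume e: "f z = z"
    define W where "W = V \<inter> V'"
    have "w = f w" if "w \<in> W" for w
      using f[of w] that inj_onD[OF V(5), of "f w" w] by (auto simp: W_def)
    then have "f holomorphic_on W" by (rule holomorphic_transform[OF holomorphic_on_ident])
    moreover have "open W" "z \<in> W" "W \<subseteq> {w \<in> V. moebius_point w \<in> moebius_point ` V'}"
      using V z val e by (auto simp: W_def open_Int)
    ultimately show ?thesis by blast
  next
    assume e: "f z = glide z"
    \<comment> \<open>where the lift is the glide\<close>
    define W where "W = V \<inter> (U \<inter> glide -` V')"
    have W: "open W" "W \<subseteq> V" "0 \<notin> W" using V open_vimage_glide[OF V(3)] by (auto simp: W_def open_Int annulus_def)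
    have sub: "moebius_point w \<in> moebius_point ` V'" if "w \<in> W" for w
      using that moebius_point_glide[of w] annulus_nonzero[of w b] by (auto simp: W_def intro: image_eqI[of _ _ "glide w"])
    have "cnj (glide w) = cnj (f w)" if "w \<in> W" for w
      using f[of w] sub[OF that] that inj_onD[OF V(5), of "f w" "glide w"] moebius_point_glide[of w] annulus_nonzero[of w b] by (auto simp: W_def)
    then have "(\<lambda>w. cnj (f w)) holomorphic_on W"
      by (rule holomorphic_transform[OF cnj_glide_holomorphic[OF W(3)]])
    moreover have "z \<in> W" using z V val e by (auto simp: W_def)
    ultimately show ?thesis using W sub unfolding antiholomorphic_on_def by blast
  qed
qed

lemma moebius_dianalytic_surface: "dianalytic_surface TM AM"
  unfolding dianalytic_surface_def
proof (intro conjI surfaces)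
  show "in_charts dianalytic_on AM AM id"
    by (rule in_charts_orbit_atlas[OF moebius.orbit_space_axioms moebius.orbit_space_axioms])
       (use dianalytic_transitions in simp)
qed

lemma projection_dianalytic: "in_charts dianalytic_on AC AM cover_projection"
  by (rule in_charts_orbit_atlas[OF cover.orbit_space_axioms moebius.orbit_space_axioms])
     (use dianalytic_transitions in simp)

lemma projection_homeomorphic:
  assumes V: "open V" "V \<subseteq> U" "inj_on moebius_point V"
  shows "homeomorphic_map (subtopology TC (cover_point ` V)) (subtopology TM (moebius_point ` V)) cover_projection"
proof -
  have "inj_on cover_point V" by (simp add: inj_on_def)
  note mc = cover.homeomorphic_maps_chart[OF V(1,2) this] and sc = cover.chart_simps[OF this]
  have "homeomorphic_map (subtopology TC (cover_point ` V)) (top_of_set V) (snd (orbit_chart cover_point V))"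
    by (rule homeomorphic_maps_imp_map[OF mc])
  moreover have "homeomorphic_map (top_of_set V) (subtopology TM (moebius_point ` V)) moebius_point"
    by (rule homeomorphic_maps_imp_map[OF homeomorphic_maps_sym[THEN iffD1, OF moebius.homeomorphic_maps_chart[OF V]]])
  ultimately have "homeomorphic_map (subtopology TC (cover_point ` V)) (subtopology TM (moebius_point ` V))
      (moebius_point \<circ> snd (orbit_chart cover_point V))"
    by (rule homeomorphic_map_compose)
  then show ?thesis
    by (rule homeomorphic_map_eq) (use sc(2) in auto)
qed

text \<open>
  Over the image of a separated neighbourhood \<open>V\<close> the two sheets are \<open>V\<close> and its image under the glide.
\<close>

lemma projection_covering: "covering_map TC TM cover_projection"
  unfolding covering_map_def cover.topspace_orbit moebius.topspace_orbit
proof (intro conjI ballI)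
  show "continuous_map TC TM cover_projection"
    unfolding continuous_map cover.topspace_orbit moebius.topspace_orbit
  proof (intro conjI allI impI)
    show "cover_projection ` cover_point ` U \<subseteq> moebius_point ` U" by (auto simp: image_image)
    fix S assume "openin TM S"
    then have S: "S \<subseteq> moebius_point ` U" "open (U \<inter> moebius_point -` S)" by (simp_all add: moebius.openin_orbit)
    have "U \<inter> cover_point -` {x \<in> cover_point ` U. cover_projection x \<in> S} = U \<inter> moebius_point -` S" by auto
    then show "openin TC {x \<in> cover_point ` U. cover_projection x \<in> S}" using S by (auto simp: cover.openin_orbit)
  qed
  show "cover_projection ` cover_point ` U = moebius_point ` U" by (simp add: image_image)
  fix q assume "q \<in> moebius_point ` U"
  then obtain w where w: "w \<in> U" "q = moebius_point w" by blast
  obtain V where V: "open V" "w \<in> V" "V \<subseteq> U" "inj_on moebius_point V" "V \<inter> glide ` V = {}"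
    using separated_neighbourhood[OF w(1)] by blast
  define V' where "V' = U \<inter> glide -` V"
  have V'eq: "V' = glide ` V"
  proof (intro equalityI subsetI)
    fix x assume "x \<in> V'"
    then have "x = glide (glide x)" "glide x \<in> V" using annulus_nonzero by (auto simp: V'_def glide_glide)
    then show "x \<in> glide ` V" by blast
  next
    fix x assume "x \<in> glide ` V"
    then show "x \<in> V'" using V(3) glide_annulus annulus_nonzero by (auto simp: V'_def glide_glide subset_iff)
  qed
  have V': "open V'" "V' \<subseteq> U" using open_vimage_glide[OF V(1)] by (auto simp: V'_def)
  have pV': "moebius_point ` V' = moebius_point ` V"
    unfolding V'eq image_image using V(3) annulus_nonzero moebius_point_glide by (intro image_cong) auto
  have injV': "inj_on moebius_point V'"
  proof (rule inj_onI)
    fix x y assume xy: "x \<in> V'" "y \<in> V'" "moebius_point x = moebius_point y"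
    then obtain x' y' where x': "x = glide x'" "x' \<in> V" "y = glide y'" "y' \<in> V" unfolding V'eq by blast
    then have "moebius_point x' = moebius_point y'" using xy(3) V(3) annulus_nonzero moebius_point_glide by (metis subsetD)
    then show "x = y" using x' inj_onD[OF V(4)] by blast
  qed
  define \<W> where "\<W> = {cover_point ` V, cover_point ` V'}"
  have "U \<inter> moebius_point -` (moebius_point ` V) = V \<union> V'" unfolding V'_def by (rule moebius_saturation[OF V(3)])
  moreover have "{p \<in> cover_point ` U. cover_projection p \<in> moebius_point ` V} = cover_point ` (U \<inter> moebius_point -` (moebius_point ` V))"
    by auto
  ultimately have union: "\<Union>\<W> = {p \<in> cover_point ` U. cover_projection p \<in> moebius_point ` V}"
    unfolding \<W>_def by (simp only: image_Un) simp
  have "disjnt (cover_point ` V) (cover_point ` V')" using V(5) unfolding V'eq disjnt_def by auto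
  then have disj: "pairwise disjnt \<W>" unfolding \<W>_def by (simp add: pairwise_insert disjnt_sym)
  have sheet: "openin TC W \<and> homeomorphic_map (subtopology TC W) (subtopology TM (moebius_point ` V)) cover_projection" if W: "W \<in> \<W>" for W
  proof -
    consider "W = cover_point ` V" | "W = cover_point ` V'" using W unfolding \<W>_def by blast
    then show ?thesis
    proof cases
      case 1
      show ?thesis unfolding 1 using cover.openin_image[OF V(1,3)] projection_homeomorphic[OF V(1,3,4)] by blast
    next
      case 2
      show ?thesis unfolding 2 using cover.openin_image[OF V'] projection_homeomorphic[OF V' injV'] unfolding pV' by blast
    qed
  qed
  have op: "openin TM (moebius_point ` V)" by (rule moebius.openin_image[OF V(1,3)])
  have qV: "q \<in> moebius_point ` V" unfolding w(2) using V(2) by (rule imageI)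
  have "\<Union>\<W> = {p \<in> cover_point ` U. cover_projection p \<in> moebius_point ` V} \<and> pairwise disjnt \<W> \<and>
             (\<forall>W\<in>\<W>. openin TC W \<and> homeomorphic_map (subtopology TC W) (subtopology TM (moebius_point ` V)) cover_projection)"
    by (rule conjI[OF union conjI[OF disj ballI[OF sheet]]])
  then have ex: "\<exists>\<W>. \<Union>\<W> = {p \<in> cover_point ` U. cover_projection p \<in> moebius_point ` V} \<and> pairwise disjnt \<W> \<and>
             (\<forall>W\<in>\<W>. openin TC W \<and> homeomorphic_map (subtopology TC W) (subtopology TM (moebius_point ` V)) cover_projection)"
    by (rule exI)
  show "\<exists>W. openin TM W \<and> q \<in> W \<and> (\<exists>\<W>. \<Union>\<W> = {p \<in> cover_point ` U. cover_projection p \<in> W} \<and> pairwise disjnt \<W> \<and>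
             (\<forall>Wa\<in>\<W>. openin TC Wa \<and> homeomorphic_map (subtopology TC Wa) (subtopology TM W) cover_projection))"
    by (rule exI[of _ "moebius_point ` V"], rule conjI[OF op conjI[OF qV ex]])
qed

lemma projection_fibre:
  assumes "w \<in> U"
  shows "{q \<in> cover_point ` U. cover_projection q = moebius_point w} = {cover_point w, cover_point (glide w)}"
proof (intro equalityI subsetI)
  note w0 = annulus_nonzero[OF assms]
  fix y assume "y \<in> {q \<in> cover_point ` U. cover_projection q = moebius_point w}"
  then obtain v where v: "v \<in> U" "y = cover_point v" "moebius_point v = moebius_point w" by auto
  then have "v = w \<or> v = glide w" using moebius_point_eq_iff[OF annulus_nonzero[OF v(1)] w0] by simp
  then show "y \<in> {cover_point w, cover_point (glide w)}" using v(2) by auto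
next
  note w0 = annulus_nonzero[OF assms]
  have "cover_point w \<in> cover_point ` U" "cover_point (glide w) \<in> cover_point ` U"
    by (rule imageI[OF assms], rule imageI[OF glide_annulus[OF assms]])
  moreover fix y assume "y \<in> {cover_point w, cover_point (glide w)}"
  then have "y = cover_point w \<or> y = cover_point (glide w)" by simp
  ultimately show "y \<in> {q \<in> cover_point ` U. cover_projection q = moebius_point w}"
    using moebius_point_glide[OF w0] by (elim disjE) simp_all
qed

lemma orientable_double_cover_band:
  "orientable_double_cover TC AC TM AM cover_projection deck_involution"
  unfolding orientable_double_cover_def
proof (intro conjI ballI cover_Riemann_surface projection_covering projection_dianalytic deck_antiholomorphic)
  show "continuous_map TC TC deck_involution"
    unfolding continuous_map cover.topspace_orbit
  proof (intro conjI allI impI)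
    show "deck_involution ` cover_point ` U \<subseteq> cover_point ` U"
      unfolding image_image cover_maps using glide_annulus by blast
    fix S assume "openin TC S"
    then have S: "S \<subseteq> cover_point ` U" "open (U \<inter> cover_point -` S)" by (simp_all add: cover.openin_orbit)
    have "U \<inter> cover_point -` {x \<in> cover_point ` U. deck_involution x \<in> S} = U \<inter> glide -` (U \<inter> cover_point -` S)"
      using glide_annulus by auto
    then show "openin TC {x \<in> cover_point ` U. deck_involution x \<in> S}"
      using open_vimage_glide[OF S(2)] by (auto simp: cover.openin_orbit)
  qed
  fix x assume "x \<in> topspace TC"
  then obtain w where w: "w \<in> U" "x = cover_point w" unfolding cover.topspace_orbit by blast
  note w0 = annulus_nonzero[OF w(1)]
  show "deck_involution x \<noteq> x" "deck_involution (deck_involution x) = x"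
    using glide_neq[OF w0] glide_glide[OF w0] by (simp_all add: w)
  show "{q \<in> topspace TC. cover_projection q = cover_projection x} = {x, deck_involution x}"
    unfolding cover.topspace_orbit w(2) cover_maps by (rule projection_fibre[OF w(1)])
qed

text \<open>
  The derivative would be complex linear and conjugate linear, hence zero, whereas that of an injective holomorphic function is not.
\<close>

lemma holomorphic_and_antiholomorphic_not_inj:
  assumes "open N" "w \<in> N" "f holomorphic_on N" "antiholomorphic_on f N"
  shows "\<not> inj_on f N"
proof
  assume inj: "inj_on f N"
  have h2: "(\<lambda>z. cnj (f z)) holomorphic_on N" using assms(4) unfolding antiholomorphic_on_def .
  have "deriv f w = 0"
  proof -
    have d1: "(f has_derivative (\<lambda>h. deriv f w * h)) (at w)"
      using holomorphic_derivI[OF assms(3,1,2)] unfolding has_field_derivative_def .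
    have d2: "((\<lambda>z. cnj (f z)) has_derivative (\<lambda>h. deriv (\<lambda>z. cnj (f z)) w * h)) (at w)"
      using holomorphic_derivI[OF h2 assms(1,2)] unfolding has_field_derivative_def .
    have d3: "((\<lambda>z. cnj (f z)) has_derivative (\<lambda>h. cnj (deriv f w * h))) (at w)"
      by (rule bounded_linear.has_derivative[OF bounded_linear_cnj d1])
    have eq: "cnj (deriv f w * h) = deriv (\<lambda>z. cnj (f z)) w * h" for h
      by (rule fun_cong[OF has_derivative_unique[OF d3 d2]])
    have "cnj (deriv f w) = deriv (\<lambda>z. cnj (f z)) w" using eq[of 1] by (simp only: mult_1_right)
    moreover have "cnj (deriv f w) * - \<i> = deriv (\<lambda>z. cnj (f z)) w * \<i>" using eq[of \<i>] by (simp only: complex_cnj_mult complex_cnj_i)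
    ultimately have "cnj (deriv f w) * (2 * \<i>) = 0" by (simp add: algebra_simps)
    then show ?thesis by simp
  qed
  moreover have "deriv f w \<noteq> 0" using holomorphic_injective_imp_regular[OF assms(3,1) inj assms(2)] .
  ultimately show False by simp
qed

text \<open>
  Given an orienting atlas \<open>B\<close>, let \<open>H\<close> and \<open>K\<close> be the sets of points of the annulus near which the projection, read in the charts of \<open>B\<close>, is holomorphic and
  antiholomorphic. Both are open, they are disjoint and cover the annulus. The glide is antiholomorphic and
  does not change the projection, so it exchanges them and neither is empty. The annulus is connected, a contradiction.
\<close>

lemma not_orientable: "\<not> (\<exists>B. Riemann_surface TM B \<and> in_charts dianalytic_on AM B id)"
proof
  assume "\<exists>B. Riemann_surface TM B \<and> in_charts dianalytic_on AM B id"
  then obtain B where sB: "surface TM B" and hB: "in_charts (\<lambda>f S. f holomorphic_on S) B B id"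
    and dB: "in_charts dianalytic_on AM B id" by (auto simp: Riemann_surface_def)
  define good where "good Q w \<longleftrightarrow> (\<exists>d\<in>B. \<exists>N. open N \<and> w \<in> N \<and> N \<subseteq> U \<and> inj_on moebius_point N \<and>
      moebius_point ` N \<subseteq> fst d \<and> Q (snd d \<circ> moebius_point) N)" for Q :: "(complex \<Rightarrow> complex) \<Rightarrow> complex set \<Rightarrow> bool" and w
  define H where "H = {w. good (\<lambda>f S. f holomorphic_on S) w}"
  define K where "K = {w. good antiholomorphic_on w}"
  have chartB: "chart_on TM d" if "d \<in> B" for d using sB that by (simp add: surface_def)
  have injd: "inj_on (snd d) (fst d)" "openin TM (fst d)" "fst d \<subseteq> moebius_point ` U" if "d \<in> B" for d
  proof -
    have c: "openin TM (fst d)" "homeomorphic_map (subtopology TM (fst d)) (top_of_set (snd d ` fst d)) (snd d)"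
      using chartB[OF that] by (auto simp: chart_on_def)
    show "openin TM (fst d)" by fact
    then show sub: "fst d \<subseteq> moebius_point ` U" using openin_subset moebius.topspace_orbit by metis
    have "topspace (subtopology TM (fst d)) = fst d" using sub by (auto simp: moebius.topspace_orbit)
    then show "inj_on (snd d) (fst d)" using c(2) homeomorphic_imp_injective_map by metis
  qed
  have openHK: "open {w. good Q w}" for Q
  proof -
    have "{w. good Q w} = \<Union>{N. open N \<and> N \<subseteq> {w. good Q w}}"
    proof (intro equalityI subsetI)
      fix w assume "w \<in> {w. good Q w}"
      then obtain d N where N: "d \<in> B" "open N" "w \<in> N" "N \<subseteq> U" "inj_on moebius_point N" "moebius_point ` N \<subseteq> fst d" "Q (snd d \<circ> moebius_point) N"
        unfolding good_def by blast
      then have "N \<subseteq> {w. good Q w}" unfolding good_def by blast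
      then show "w \<in> \<Union>{N. open N \<and> N \<subseteq> {w. good Q w}}" using N by blast
    qed blast
    moreover have "open (\<Union>{N. open N \<and> N \<subseteq> {w. good Q w}})" by (rule open_Union) blast
    ultimately show ?thesis by simp
  qed
  have sub: "H \<subseteq> U" "K \<subseteq> U" by (auto simp: H_def K_def good_def)
  have cover: "U \<subseteq> H \<union> K"
  proof
    fix w assume w: "w \<in> U"
    have "moebius_point w \<in> topspace TM" using w by (simp add: moebius.topspace_orbit)
    then have "moebius_point w \<in> (\<Union>c\<in>B. fst c)" using sB unfolding surface_def by simp
    then obtain d where d: "d \<in> B" "moebius_point w \<in> fst d" by blast
    obtain V where V: "open V" "w \<in> V" "V \<subseteq> U" "inj_on moebius_point V" using separated_neighbourhood[OF w] by metis
    define c where "c = orbit_chart moebius_point V"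
    have cA: "c \<in> AM" using V by (auto simp: c_def orbit_atlas_def)
    note cs = moebius.chart_simps[OF V(4), folded c_def]
    have set: "snd c ` {p \<in> fst c. id p \<in> fst d} = {v \<in> V. moebius_point v \<in> fst d}"
      unfolding cs(1) using cs(2) by force
    have "dianalytic_on (snd d \<circ> id \<circ> chart_inv c) (snd c ` {p \<in> fst c. id p \<in> fst d})"
      using dB cA d(1) unfolding in_charts_def by blast
    then have "dianalytic_on (snd d \<circ> id \<circ> chart_inv c) {v \<in> V. moebius_point v \<in> fst d}" unfolding set .
    then obtain W where W: "open W" "w \<in> W" "W \<subseteq> {v \<in> V. moebius_point v \<in> fst d}"
      "(snd d \<circ> id \<circ> chart_inv c) holomorphic_on W \<or> antiholomorphic_on (snd d \<circ> id \<circ> chart_inv c) W"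
      using V(2) d(2) unfolding dianalytic_on_def by blast
    have eq: "(snd d \<circ> id \<circ> chart_inv c) v = (snd d \<circ> moebius_point) v" if "v \<in> W" for v
      using cs(4) W(3) that by auto
    have "(snd d \<circ> moebius_point) holomorphic_on W \<or> antiholomorphic_on (snd d \<circ> moebius_point) W"
      using W(4)
    proof
      assume "(snd d \<circ> id \<circ> chart_inv c) holomorphic_on W"
      then have "(snd d \<circ> moebius_point) holomorphic_on W" by (rule holomorphic_transform) (rule eq)
      then show ?thesis ..
    next
      assume "antiholomorphic_on (snd d \<circ> id \<circ> chart_inv c) W"
      then have "(\<lambda>z. cnj ((snd d \<circ> moebius_point) z)) holomorphic_on W"
        unfolding antiholomorphic_on_def by (rule holomorphic_transform) (simp only: eq)
      then show ?thesis unfolding antiholomorphic_on_def by blast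
    qed
    moreover have "inj_on moebius_point W" using V(4) W(3) by (auto intro: inj_on_subset)
    moreover have "W \<subseteq> U" "moebius_point ` W \<subseteq> fst d" using W(3) V(3) by auto
    moreover have "good Q w" if "Q (snd d \<circ> moebius_point) W" "W \<subseteq> U" "moebius_point ` W \<subseteq> fst d" "inj_on moebius_point W" for Q
      unfolding good_def by (intro bexI[of _ d] exI[of _ W] conjI that W d)
    ultimately have "good (\<lambda>f S. f holomorphic_on S) w \<or> good antiholomorphic_on w" by blast
    then show "w \<in> H \<union> K" by (simp add: H_def K_def)
  qed
  have disj: "H \<inter> K = {}"
  proof (rule ccontr)
    assume "H \<inter> K \<noteq> {}"
    then obtain w where "good (\<lambda>f S. f holomorphic_on S) w" "good antiholomorphic_on w" by (auto simp: H_def K_def)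
    then obtain d N d' N' where d: "d \<in> B" "open N" "w \<in> N" "N \<subseteq> U" "inj_on moebius_point N" "moebius_point ` N \<subseteq> fst d" "(snd d \<circ> moebius_point) holomorphic_on N"
      and d': "d' \<in> B" "open N'" "w \<in> N'" "N' \<subseteq> U" "moebius_point ` N' \<subseteq> fst d'" "antiholomorphic_on (snd d' \<circ> moebius_point) N'"
      unfolding good_def by metis
    define M where "M = N \<inter> N'"
    have M: "open M" "w \<in> M" "M \<subseteq> N" "M \<subseteq> N'" using d d' by (auto simp: M_def)
    have tr: "(snd d' \<circ> id \<circ> chart_inv d) holomorphic_on (snd d ` {p \<in> fst d. id p \<in> fst d'})"
      using hB d(1) d'(1) unfolding in_charts_def by blast
    have "((snd d' \<circ> id \<circ> chart_inv d) \<circ> (snd d \<circ> moebius_point)) holomorphic_on M"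
    proof (rule holomorphic_on_compose_gen[OF holomorphic_on_subset[OF d(7) M(3)] tr])
      show "(snd d \<circ> moebius_point) ` M \<subseteq> snd d ` {p \<in> fst d. id p \<in> fst d'}"
      proof (rule image_subsetI)
        fix v assume "v \<in> M"
        then have "v \<in> N" "v \<in> N'" using M(3,4) by auto
        then have "moebius_point v \<in> {p \<in> fst d. id p \<in> fst d'}"
          using subsetD[OF d(6) imageI] subsetD[OF d'(5) imageI] by simp
        then show "(snd d \<circ> moebius_point) v \<in> snd d ` {p \<in> fst d. id p \<in> fst d'}"
          unfolding o_apply by (rule imageI)
      qed
    qed
    then have "(snd d' \<circ> moebius_point) holomorphic_on M"
    proof (rule holomorphic_transform)
      show "((snd d' \<circ> id \<circ> chart_inv d) \<circ> (snd d \<circ> moebius_point)) v = (snd d' \<circ> moebius_point) v" if "v \<in> M" for v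
      proof -
        have "moebius_point v \<in> fst d" using subsetD[OF d(6) imageI[OF subsetD[OF M(3) that]]] .
        then show ?thesis by (simp add: chart_inv_def the_inv_into_f_f[OF injd(1)[OF d(1)]])
      qed
    qed
    moreover have "antiholomorphic_on (snd d' \<circ> moebius_point) M"
      using d'(6) M(4) unfolding antiholomorphic_on_def by (rule holomorphic_on_subset)
    moreover have "inj_on (snd d' \<circ> moebius_point) M"
    proof (rule comp_inj_on)
      show "inj_on moebius_point M" using d(5) M(3) by (rule inj_on_subset)
      show "inj_on (snd d') (moebius_point ` M)"
        by (rule inj_on_subset[OF injd(1)[OF d'(1)] order_trans[OF image_mono[OF M(4)] d'(5)]])
    qed
    ultimately show False using holomorphic_and_antiholomorphic_not_inj[OF M(1,2)] by blast
  qed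
  have flip: "good Q' (glide w)"
    if w: "good Q w" and Q: "\<And>f S. open S \<Longrightarrow> S \<subseteq> U \<Longrightarrow> Q f S \<Longrightarrow> Q' (f \<circ> glide) (U \<inter> glide -` S)"
      and Q': "\<And>f f' S. Q' f S \<Longrightarrow> (\<And>x. x \<in> S \<Longrightarrow> f x = f' x) \<Longrightarrow> Q' f' S" for w Q Q'
  proof -
    obtain d N where N: "d \<in> B" "open N" "w \<in> N" "N \<subseteq> U" "inj_on moebius_point N" "moebius_point ` N \<subseteq> fst d" "Q (snd d \<circ> moebius_point) N"
      using w unfolding good_def by blast
    define N' where "N' = U \<inter> glide -` N"
    have w0: "w \<in> U" "w \<noteq> 0" using N annulus_nonzero by auto
    have mp: "moebius_point (glide v) = moebius_point v" if "v \<in> N'" for v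
      using that annulus_nonzero by (intro moebius_point_glide) (auto simp: N'_def)
    have "Q' ((snd d \<circ> moebius_point) \<circ> glide) N'" unfolding N'_def by (rule Q[OF N(2,4,7)])
    then have "Q' (snd d \<circ> moebius_point) N'" by (rule Q') (use mp in simp)
    moreover have "open N'" "glide w \<in> N'" "N' \<subseteq> U"
      using open_vimage_glide[OF N(2)] N(3) w0 glide_annulus glide_glide by (auto simp: N'_def)
    moreover have "moebius_point ` N' \<subseteq> fst d"
    proof clarify
      fix v assume v: "v \<in> N'"
      then have "moebius_point v = moebius_point (glide v)" "glide v \<in> N" using mp by (auto simp: N'_def)
      then show "moebius_point v \<in> fst d" using N(6) by auto
    qed
    moreover have "inj_on moebius_point N'"
    proof (rule inj_onI)
      fix x y assume xy: "x \<in> N'" "y \<in> N'" "moebius_point x = moebius_point y"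
      then have "moebius_point (glide x) = moebius_point (glide y)" using mp by simp
      then have "glide x = glide y" using inj_onD[OF N(5)] xy by (auto simp: N'_def)
      then have "glide (glide x) = glide (glide y)" by simp
      then show "x = y" using xy annulus_nonzero glide_glide by (auto simp: N'_def)
    qed
    ultimately show ?thesis unfolding good_def using N(1) by blast
  qed
  have z0: "0 \<notin> U \<inter> X" for X by (simp add: annulus_def)
  have HK: "glide w \<in> K" if "w \<in> H" for w
    unfolding K_def mem_Collect_eq
  proof (rule flip[of "\<lambda>f S. f holomorphic_on S"])
    show "good (\<lambda>f S. f holomorphic_on S) w" using that by (simp add: H_def)
    fix f and S :: "complex set" assume S: "open S" "S \<subseteq> U" "f holomorphic_on S"
    have "(cnj \<circ> f \<circ> cnj) holomorphic_on (cnj ` S)" by (rule holomorphic_on_compose_cnj_cnj) (use S open_image_cnj in \<open>simp_all add: image_image\<close>)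
    from holomorphic_on_compose_gen[OF cnj_glide_holomorphic[OF z0[of "glide -` S"]] this]
    show "antiholomorphic_on (f \<circ> glide) (U \<inter> glide -` S)"
      unfolding antiholomorphic_on_def by (simp add: o_def image_subset_iff)
  qed (auto simp: antiholomorphic_on_def intro: holomorphic_transform)
  have KH: "glide w \<in> H" if "w \<in> K" for w
    unfolding H_def mem_Collect_eq
  proof (rule flip[of antiholomorphic_on])
    show "good antiholomorphic_on w" using that by (simp add: K_def)
    fix f and S :: "complex set" assume S: "open S" "S \<subseteq> U" "antiholomorphic_on f S"
    have "(cnj \<circ> (\<lambda>z. cnj (f z)) \<circ> cnj) holomorphic_on (cnj ` S)"
      by (rule holomorphic_on_compose_cnj_cnj) (use S open_image_cnj in \<open>simp_all add: image_image antiholomorphic_on_def\<close>)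
    from holomorphic_on_compose_gen[OF cnj_glide_holomorphic[OF z0[of "glide -` S"]] this]
    show "(f \<circ> glide) holomorphic_on (U \<inter> glide -` S)" by (simp add: o_def image_subset_iff)
  qed (auto intro: holomorphic_transform)
  have "H \<noteq> {}" "K \<noteq> {}" using cover one_in_annulus HK KH by blast+
  moreover have "open H" "open K" unfolding H_def K_def by (rule openHK)+
  ultimately show False
    using connectedD[OF connected_annulus, of H K] cover disj sub by (auto simp: Int_absorb1)
qed

lemma nonorientable_band: "nonorientable_Riemann_surface TM AM"
  unfolding nonorientable_Riemann_surface_def using moebius_dianalytic_surface not_orientable by blast

end

section \<open>Immersions from null curves\<close>

definition Re_vec :: "('n \<Rightarrow> complex \<Rightarrow> complex) \<Rightarrow> complex \<Rightarrow> real ^ 'n::finite" where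
  "Re_vec f z = (\<chi> i. Re (f i z))"

lemma has_derivative_Re_vec:
  fixes f :: "'n::finite \<Rightarrow> complex \<Rightarrow> complex"
  assumes "\<And>i. (f i has_field_derivative f' i) (at z)"
  shows "(Re_vec f has_derivative (\<lambda>h. \<chi> i. Re (f' i * h))) (at z)"
proof -
  have "((\<lambda>z. \<Sum>i\<in>UNIV. Re (f i z) *\<^sub>R axis i (1::real)) has_derivative (\<lambda>h. \<Sum>i\<in>UNIV. Re (f' i * h) *\<^sub>R axis i 1)) (at z)"
    using assms unfolding has_field_derivative_def
    by (intro has_derivative_sum has_derivative_scaleR_left bounded_linear.has_derivative[OF bounded_linear_Re]) auto
  moreover have "Re_vec f = (\<lambda>z. \<Sum>i\<in>UNIV. Re (f i z) *\<^sub>R axis i (1::real))"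
    by (auto simp: Re_vec_def vec_eq_iff fun_eq_iff axis_def sum.delta' if_distrib cong: if_cong)
  moreover have "(\<lambda>h. \<Sum>i\<in>UNIV. Re (f' i * h) *\<^sub>R axis i (1::real)) = (\<lambda>h. \<chi> i. Re (f' i * h))"
    by (auto simp: vec_eq_iff fun_eq_iff axis_def sum.delta' if_distrib cong: if_cong)
  ultimately show ?thesis by simp
qed

lemma pdu_pdv_from_derivative:
  fixes F :: "complex \<Rightarrow> 'b::real_normed_vector"
  assumes "(F has_derivative F') (at z)"
  shows "pdu F z = F' 1" "pdv F z = F' \<i>"
proof -
  interpret F': bounded_linear F' using assms by (rule has_derivative_bounded_linear)
  have *: "((\<lambda>t. F (z + c * of_real t)) has_vector_derivative F' c) (at 0)" for c
  proof -
    have "((\<lambda>t::real. z + c * of_real t) has_derivative (\<lambda>t. c * of_real t)) (at 0)"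
      by (auto intro!: derivative_eq_intros)
    moreover have "(F has_derivative F') (at (z + c * of_real 0))" using assms by simp
    ultimately have "((\<lambda>t. F (z + c * of_real t)) has_derivative (\<lambda>t. F' (c * of_real t))) (at 0)"
      by (rule has_derivative_compose)
    moreover have "F' (c * of_real t) = t *\<^sub>R F' c" for t
      using F'.scaleR[of t c] by (simp add: scaleR_conv_of_real mult.commute)
    ultimately show ?thesis by (simp add: has_vector_derivative_def)
  qed
  show "pdu F z = F' 1" unfolding pdu_def using *[of 1] by (simp add: vector_derivative_at)
  show "pdv F z = F' \<i>" unfolding pdv_def using *[of \<i>] by (simp add: vector_derivative_at)
qed

lemma partials_Re_vec:
  fixes f :: "'n::finite \<Rightarrow> complex \<Rightarrow> complex"
  assumes "\<And>i. (f i has_field_derivative f' i z) (at z)"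
  shows "pdu (Re_vec f) z = Re_vec f' z" "pdv (Re_vec f) z = Re_vec (\<lambda>i z. \<i> * f' i z) z"
  using pdu_pdv_from_derivative[OF has_derivative_Re_vec[OF assms]] by (simp_all add: Re_vec_def vec_eq_iff)

lemma partials_cong:
  fixes F G :: "complex \<Rightarrow> 'b::real_normed_vector"
  assumes "open S" "z \<in> S" "\<And>w. w \<in> S \<Longrightarrow> F w = G w"
  shows "pdu F z = pdu G z" "pdv F z = pdv G z"
proof -
  have *: "vector_derivative (\<lambda>t. F (z + c * of_real t)) (at 0) = vector_derivative (\<lambda>t. G (z + c * of_real t)) (at 0)" for c
  proof (rule vector_derivative_cong_eq)
    have "open ((\<lambda>t::real. z + c * of_real t) -` S)"
      by (rule open_vimage[OF assms(1)]) (intro continuous_intros)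
    from eventually_nhds_in_open[OF this, of 0] have "\<forall>\<^sub>F t in nhds 0. z + c * of_real t \<in> S"
      using assms(2) by simp
    then show "\<forall>\<^sub>F t in nhds 0. t \<in> UNIV \<longrightarrow> F (z + c * of_real t) = G (z + c * of_real t)"
      by eventually_elim (use assms(3) in auto)
  qed auto
  show "pdu F z = pdu G z" unfolding pdu_def using *[of 1] by simp
  show "pdv F z = pdv G z" unfolding pdv_def using *[of \<i>] by simp
qed

lemma Ck_on_cong:
  fixes F G :: "complex \<Rightarrow> 'b::real_normed_vector"
  assumes "open S" "\<And>w. w \<in> S \<Longrightarrow> F w = G w"
  shows "Ck_on k F S \<longleftrightarrow> Ck_on k G S"
  using assms(2)
proof (induction k arbitrary: F G)
  case 0
  then show ?case using continuous_on_cong[OF refl, of S F G] by simp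
next
  case (Suc k)
  have p: "pdu F w = pdu G w" "pdv F w = pdv G w" if "w \<in> S" for w
    by (rule partials_cong[OF assms(1) that], rule Suc.prems, assumption)+
  have "F differentiable_on S \<longleftrightarrow> G differentiable_on S"
    unfolding differentiable_on_def
    by (intro ball_cong refl iffI; erule differentiable_transform_within[OF _ zero_less_one]; use Suc.prems in simp)
  moreover have "Ck_on k (pdu F) S \<longleftrightarrow> Ck_on k (pdu G) S" by (rule Suc.IH) (rule p(1))
  moreover have "Ck_on k (pdv F) S \<longleftrightarrow> Ck_on k (pdv G) S" by (rule Suc.IH) (rule p(2))
  ultimately show ?case by simp
qed

lemma Ck_on_Re_vec:
  fixes f :: "'n::finite \<Rightarrow> complex \<Rightarrow> complex"
  assumes "open S" "\<And>i. f i holomorphic_on S"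
  shows "Ck_on k (Re_vec f) S"
  using assms(2)
proof (induction k arbitrary: f)
  case 0
  have "continuous_on S (f i)" for i using 0 by (rule holomorphic_on_imp_continuous_on)
  then show ?case unfolding Re_vec_def Ck_on.simps by (intro continuous_intros)
next
  case (Suc k)
  have d: "(f i has_field_derivative deriv (f i) z) (at z)" if "z \<in> S" for i z
    using holomorphic_derivI[OF Suc.prems assms(1) that] .
  have "Re_vec f differentiable_on S"
    unfolding differentiable_on_def differentiable_def
    by (intro ballI exI, rule has_derivative_at_withinI, rule has_derivative_Re_vec, erule d)
  moreover have "Ck_on k (pdu (Re_vec f)) S"
  proof -
    have "Ck_on k (Re_vec (\<lambda>i. deriv (f i))) S" by (rule Suc.IH) (rule holomorphic_deriv[OF Suc.prems assms(1)])
    moreover have "pdu (Re_vec f) w = Re_vec (\<lambda>i. deriv (f i)) w" if "w \<in> S" for w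
      by (rule partials_Re_vec(1)) (rule d[OF that])
    then have "Ck_on k (pdu (Re_vec f)) S \<longleftrightarrow> Ck_on k (Re_vec (\<lambda>i. deriv (f i))) S" by (rule Ck_on_cong[OF assms(1)])
    ultimately show ?thesis by (rule iffD2[rotated])
  qed
  moreover have "Ck_on k (pdv (Re_vec f)) S"
  proof -
    have "Ck_on k (Re_vec (\<lambda>i z. \<i> * deriv (f i) z)) S"
      by (rule Suc.IH) (intro holomorphic_on_mult holomorphic_on_const holomorphic_deriv[OF Suc.prems assms(1)])
    moreover have "pdv (Re_vec f) w = Re_vec (\<lambda>i z. \<i> * deriv (f i) z) w" if "w \<in> S" for w
      by (rule partials_Re_vec(2)[where f' = "\<lambda>i. deriv (f i)"]) (rule d[OF that])
    then have "Ck_on k (pdv (Re_vec f)) S \<longleftrightarrow> Ck_on k (Re_vec (\<lambda>i z. \<i> * deriv (f i) z)) S" by (rule Ck_on_cong[OF assms(1)])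
    ultimately show ?thesis by (rule iffD2[rotated])
  qed
  ultimately show ?case by simp
qed

lemma second_partials_cong:
  fixes F G :: "complex \<Rightarrow> 'b::real_normed_vector"
  assumes "open S" "z \<in> S" "\<And>w. w \<in> S \<Longrightarrow> F w = G w"
  shows "pdu (pdu F) z = pdu (pdu G) z" "pdv (pdv F) z = pdv (pdv G) z"
proof -
  have p: "pdu F w = pdu G w" "pdv F w = pdv G w" if "w \<in> S" for w
    by (rule partials_cong[OF assms(1) that], rule assms(3), assumption)+
  show "pdu (pdu F) z = pdu (pdu G) z" by (rule partials_cong(1)[OF assms(1,2)]) (rule p(1))
  show "pdv (pdv F) z = pdv (pdv G) z" by (rule partials_cong(2)[OF assms(1,2)]) (rule p(2))
qed

lemma second_partials_Re_vec:
  fixes f :: "'n::finite \<Rightarrow> complex \<Rightarrow> complex"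
  assumes S: "open S" "z \<in> S" and d: "\<And>i z. z \<in> S \<Longrightarrow> (f i has_field_derivative f' i z) (at z)"
    and d': "\<And>i. (f' i has_field_derivative f'' i) (at z)"
  shows "pdu (pdu (Re_vec f)) z = (\<chi> i. Re (f'' i))" "pdv (pdv (Re_vec f)) z = - (\<chi> i. Re (f'' i))"
proof -
  have "pdu (pdu (Re_vec f)) z = pdu (Re_vec f') z"
    by (rule partials_cong(1)[OF S]) (rule partials_Re_vec(1)[OF d])
  also have "\<dots> = (\<chi> i. Re (f'' i))"
    using partials_Re_vec(1)[of f' "\<lambda>i _. f'' i" z] d' by (simp add: Re_vec_def)
  finally show "pdu (pdu (Re_vec f)) z = (\<chi> i. Re (f'' i))" .
  have "pdv (pdv (Re_vec f)) z = pdv (Re_vec (\<lambda>i z. \<i> * f' i z)) z"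
    by (rule partials_cong(2)[OF S]) (rule partials_Re_vec(2)[OF d])
  also have "\<dots> = Re_vec (\<lambda>i z. \<i> * (\<i> * f'' i)) z"
    by (rule partials_Re_vec(2)) (rule DERIV_cmult[OF d'])
  also have "\<dots> = - (\<chi> i. Re (f'' i))" by (simp add: Re_vec_def vec_eq_iff)
  finally show "pdv (pdv (Re_vec f)) z = - (\<chi> i. Re (f'' i))" .
qed

text \<open>
  For a null vector the real and the imaginary part are orthogonal and have the same length.
\<close>

lemma norm_Re_null:
  fixes a :: "4 \<Rightarrow> complex"
  assumes "(\<Sum>i\<in>UNIV. (a i)\<^sup>2) = 0"
  shows "norm (\<chi> i. Re (a i)) = norm (\<chi> i. Re (\<i> * a i))" "(\<chi> i. Re (a i)) \<bullet> (\<chi> i. Re (\<i> * a i)) = 0"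
    "(norm (\<chi> i. Re (a i)))\<^sup>2 = (\<Sum>i\<in>UNIV. (cmod (a i))\<^sup>2) / 2"
proof -
  have n: "(norm ((\<chi> i. x i) :: real ^ 4))\<^sup>2 = (\<Sum>i\<in>UNIV. (x i)\<^sup>2)" for x :: "4 \<Rightarrow> real"
    unfolding power2_norm_eq_inner by (simp add: inner_vec_def power2_eq_square)
  have re: "(\<Sum>i\<in>UNIV. (Re (a i))\<^sup>2) - (\<Sum>i\<in>UNIV. (Im (a i))\<^sup>2) = 0"
    using arg_cong[OF assms, of Re] by (simp add: sum_subtractf[symmetric] power2_eq_square)
  have im: "(\<Sum>i\<in>UNIV. Re (a i) * Im (a i)) = 0"
    using arg_cong[OF assms, of Im] by (simp add: power2_eq_square sum_distrib_left[symmetric] mult.commute[of "Im _"] flip: mult_2)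
  have sum: "(\<Sum>i\<in>UNIV. (cmod (a i))\<^sup>2) = (\<Sum>i\<in>UNIV. (Re (a i))\<^sup>2) + (\<Sum>i\<in>UNIV. (Im (a i))\<^sup>2)"
    by (simp add: cmod_power2 sum.distrib)
  have "(norm (\<chi> i. Re (a i)))\<^sup>2 = (norm (\<chi> i. Re (\<i> * a i)))\<^sup>2" unfolding n using re by simp
  then show "norm (\<chi> i. Re (a i)) = norm (\<chi> i. Re (\<i> * a i))" by (simp add: power2_eq_iff_nonneg)
  show "(\<chi> i. Re (a i)) \<bullet> (\<chi> i. Re (\<i> * a i)) = 0" using im by (simp add: inner_vec_def sum_negf)
  show "(norm (\<chi> i. Re (a i)))\<^sup>2 = (\<Sum>i\<in>UNIV. (cmod (a i))\<^sup>2) / 2" unfolding n sum using re by simp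
qed

text \<open>
  The Weierstrass parametrisation of the null vectors with vanishing third coordinate.
\<close>

definition null_vector :: "complex \<Rightarrow> complex \<Rightarrow> 4 \<Rightarrow> complex" where
  "null_vector g \<eta> i = (if i = 1 then (1 + g\<^sup>2) * \<eta> else if i = 2 then \<i> * (1 - g\<^sup>2) * \<eta> else if i = 3 then 0 else - 2 * \<i> * g * \<eta>)"

lemma null_vector_simps [simp]:
  "null_vector g \<eta> 1 = (1 + g\<^sup>2) * \<eta>" "null_vector g \<eta> 2 = \<i> * (1 - g\<^sup>2) * \<eta>"
  "null_vector g \<eta> 3 = 0" "null_vector g \<eta> 4 = - 2 * \<i> * g * \<eta>"
  by (simp_all add: null_vector_def)

lemma null_vector_null: "(\<Sum>i\<in>UNIV. (null_vector g \<eta> i)\<^sup>2) = 0"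
  by (simp add: sum_4 power_mult_distrib) algebra

lemma null_vector_norm: "(\<Sum>i\<in>UNIV. (cmod (null_vector g \<eta> i))\<^sup>2) = 2 * ((1 + (cmod g)\<^sup>2) * cmod \<eta>)\<^sup>2"
proof -
  have "(cmod (1 + g\<^sup>2))\<^sup>2 + (cmod (1 - g\<^sup>2))\<^sup>2 = 2 + 2 * (cmod (g\<^sup>2))\<^sup>2"
    by (simp add: cmod_power2) (simp add: power2_eq_square algebra_simps)
  then have e: "(cmod (1 + g\<^sup>2))\<^sup>2 + (cmod (1 - g\<^sup>2))\<^sup>2 = 2 + 2 * ((cmod g)\<^sup>2)\<^sup>2" by (simp add: norm_power)
  have "(\<Sum>i\<in>UNIV. (cmod (null_vector g \<eta> i))\<^sup>2) = ((cmod (1 + g\<^sup>2))\<^sup>2 + (cmod (1 - g\<^sup>2))\<^sup>2 + 4 * (cmod g)\<^sup>2) * (cmod \<eta>)\<^sup>2"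
    by (simp add: sum_4 norm_mult power_mult_distrib) (simp add: distrib_right)
  then show ?thesis unfolding e by (simp add: power2_eq_square algebra_simps)
qed

lemma metric_factor:
  "norm (\<chi> i. Re (null_vector g \<eta> i)) = (1 + (cmod g)\<^sup>2) * cmod \<eta>"
proof -
  have "(norm (\<chi> i. Re (null_vector g \<eta> i)))\<^sup>2 = ((1 + (cmod g)\<^sup>2) * cmod \<eta>)\<^sup>2"
    unfolding norm_Re_null(3)[OF null_vector_null] null_vector_norm by simp
  then show ?thesis by (simp add: power2_eq_iff_nonneg add_nonneg_nonneg)
qed

text \<open>
  The real part of a null curve is conformal because its derivative is a null vector, and minimal because it is harmonic.
\<close>

lemma minimal_immersion_of_null_curve:
  fixes f :: "4 \<Rightarrow> complex \<Rightarrow> complex"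
  assumes S: "open S" and hol: "g holomorphic_on S" "\<eta> holomorphic_on S"
    and d: "\<And>i z. z \<in> S \<Longrightarrow> (f i has_field_derivative null_vector (g z) (\<eta> z) i) (at z)"
    and nz: "\<And>z. z \<in> S \<Longrightarrow> \<eta> z \<noteq> 0"
    and F: "\<And>z. z \<in> S \<Longrightarrow> F z = Re_vec f z"
  shows "conformal_immersion_on F S" "\<And>z. z \<in> S \<Longrightarrow> mean_curvature_vector F z = 0"
    "\<And>z. z \<in> S \<Longrightarrow> conformal_factor F z = (1 + (cmod (g z))\<^sup>2) * cmod (\<eta> z)"
proof -
  have holf: "f i holomorphic_on S" for i using d S by (auto simp: holomorphic_on_open)
  have pu: "pdu F z = (\<chi> i. Re (null_vector (g z) (\<eta> z) i))" and pv: "pdv F z = (\<chi> i. Re (\<i> * null_vector (g z) (\<eta> z) i))" if "z \<in> S" for z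
  proof -
    have "pdu F z = pdu (Re_vec f) z" "pdv F z = pdv (Re_vec f) z"
      by (rule partials_cong[OF S that], rule F, assumption)+
    then show "pdu F z = (\<chi> i. Re (null_vector (g z) (\<eta> z) i))" "pdv F z = (\<chi> i. Re (\<i> * null_vector (g z) (\<eta> z) i))"
      using partials_Re_vec[of f "\<lambda>i z. null_vector (g z) (\<eta> z) i" z, OF d[OF that]] by (simp_all only: Re_vec_def)
  qed
  have fac: "norm (pdu F z) = (1 + (cmod (g z))\<^sup>2) * cmod (\<eta> z)" if "z \<in> S" for z
    unfolding pu[OF that] by (rule metric_factor)
  then show "\<And>z. z \<in> S \<Longrightarrow> conformal_factor F z = (1 + (cmod (g z))\<^sup>2) * cmod (\<eta> z)" by (simp add: conformal_factor_def)
  have pos: "norm (pdu F z) > 0" if "z \<in> S" for z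
    unfolding fac[OF that] using nz[OF that] by (intro mult_pos_pos) (auto intro: add_pos_nonneg)
  show "conformal_immersion_on F S"
    unfolding conformal_immersion_on_def smooth_on_def
  proof (intro conjI allI ballI)
    show "Ck_on k F S" for k
      by (rule Ck_on_cong[OF S, THEN iffD2, OF _ Ck_on_Re_vec[OF S holf]]) (rule F)
    fix z assume z: "z \<in> S"
    show "norm (pdu F z) = norm (pdv F z)" "pdu F z \<bullet> pdv F z = 0"
      unfolding pu[OF z] pv[OF z] by (rule norm_Re_null[OF null_vector_null])+
    show "pdu F z \<noteq> 0" using pos[OF z] by auto
  qed
  show "mean_curvature_vector F z = 0" if z: "z \<in> S" for z
  proof -
    have hold: "(\<lambda>z. null_vector (g z) (\<eta> z) i) holomorphic_on S" for i
      unfolding null_vector_def using hol by (cases "i = 1"; cases "i = 2"; cases "i = 3") (auto intro!: holomorphic_intros)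
    have d2: "((\<lambda>z. null_vector (g z) (\<eta> z) i) has_field_derivative deriv (\<lambda>z. null_vector (g z) (\<eta> z) i) z) (at z)" for i
      using holomorphic_derivI[OF hold S z] .
    have "pdv (pdv F) z = - pdu (pdu F) z"
    proof -
      have "pdu (pdu F) z = pdu (pdu (Re_vec f)) z" "pdv (pdv F) z = pdv (pdv (Re_vec f)) z"
        by (rule second_partials_cong[OF S z], rule F, assumption)+
      moreover note second_partials_Re_vec[of S z f "\<lambda>i z. null_vector (g z) (\<eta> z) i", OF S z d d2]
      ultimately show ?thesis by simp
    qed
    then show ?thesis by (simp add: mean_curvature_vector_def normal_part_def)
  qed
qed

lemma laplacian_cong:
  assumes "open S" "z \<in> S" "\<And>w. w \<in> S \<Longrightarrow> F w = (G w :: real)"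
  shows "laplacian F z = laplacian G z"
  unfolding laplacian_def using second_partials_cong[OF assms] by simp

text \<open>
  The real part of \<open>L\<close> is harmonic. The Laplacian of \<open>ln D\<close> with \<open>D = 1 + |g|\<^sup>2\<close> is the quotient of
  \<open>4 |g'|\<^sup>2 D - 4 |g'|\<^sup>2 (D - 1)\<close> by \<open>D\<^sup>2\<close>.
\<close>

lemma laplacian_log_metric:
  assumes S: "open S" "z0 \<in> S" and hol: "L holomorphic_on S" "g holomorphic_on S"
  shows "laplacian (\<lambda>z. ln (1 + (cmod (g z))\<^sup>2) + Re (L z)) z0 = 4 * (cmod (deriv g z0))\<^sup>2 / (1 + (cmod (g z0))\<^sup>2)\<^sup>2"
proof -
  define D where "D z = 1 + (Re (g z))\<^sup>2 + (Im (g z))\<^sup>2" for z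
  have Dpos: "D z > 0" for z unfolding D_def by (intro add_pos_nonneg) auto
  have D: "1 + (cmod (g z))\<^sup>2 = D z" for z by (simp add: D_def cmod_power2)
  define q where "q z = ln (D z) + Re (L z)" for z
  have dg: "(g has_derivative (\<lambda>h. deriv g z * h)) (at z)" "(L has_derivative (\<lambda>h. deriv L z * h)) (at z)" if "z \<in> S" for z
    using holomorphic_derivI[OF hol(2) S(1) that] holomorphic_derivI[OF hol(1) S(1) that] by (simp_all add: has_field_derivative_def)
  have dg': "(deriv g has_derivative (\<lambda>h. deriv (deriv g) z * h)) (at z)" "(deriv L has_derivative (\<lambda>h. deriv (deriv L) z * h)) (at z)" if "z \<in> S" for z
    using holomorphic_derivI[OF holomorphic_deriv[OF hol(2) S(1)] S(1) that] holomorphic_derivI[OF holomorphic_deriv[OF hol(1) S(1)] S(1) that]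
    by (simp_all add: has_field_derivative_def)
  define qd where "qd c z = (2 * Re (g z) * Re (deriv g z * c) + 2 * Im (g z) * Im (deriv g z * c)) / D z + Re (deriv L z * c)" for c z
  have dD: "(D has_derivative (\<lambda>h. 2 * Re (g z) * Re (deriv g z * h) + 2 * Im (g z) * Im (deriv g z * h))) (at z)" if "z \<in> S" for z
    unfolding D_def by (auto intro!: derivative_eq_intros dg[OF that] simp: algebra_simps)
  have dq: "(q has_derivative (\<lambda>h. qd h z)) (at z)" if "z \<in> S" for z
    unfolding q_def qd_def using Dpos[of z] by (auto intro!: derivative_eq_intros dg[OF that] dD[OF that] simp: field_simps)
  have pq: "pdu q z = qd 1 z" "pdv q z = qd \<i> z" if "z \<in> S" for z
    using pdu_pdv_from_derivative[OF dq[OF that]] by auto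
  define N where "N c z = 2 * Re (g z) * Re (deriv g z * c) + 2 * Im (g z) * Im (deriv g z * c)" for c z
  define N' where "N' c h z = 2 * (Re (deriv g z * h) * Re (deriv g z * c) + Re (g z) * Re (deriv (deriv g) z * h * c))
     + 2 * (Im (deriv g z * h) * Im (deriv g z * c) + Im (g z) * Im (deriv (deriv g) z * h * c))" for c h z
  have dN: "(N c has_derivative (\<lambda>h. N' c h z)) (at z)" if "z \<in> S" for c z
    unfolding N_def N'_def by (auto intro!: derivative_eq_intros dg[OF that] dg'[OF that] simp: algebra_simps)
  have dqd: "(qd c has_derivative (\<lambda>h. (N' c h z * D z - N c z * N h z) / (D z)\<^sup>2 + Re (deriv (deriv L) z * h * c))) (at z)" if "z \<in> S" for c z
  proof -
    have "((\<lambda>z. N c z / D z) has_derivative (\<lambda>h. - N c z * (inverse (D z) * N h z * inverse (D z)) + N' c h z / D z)) (at z)"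
      by (rule has_derivative_divide[OF dN[OF that]]) (use dD[OF that] Dpos[of z] in \<open>simp_all add: N_def\<close>)
    moreover have "((\<lambda>z. Re (deriv L z * c)) has_derivative (\<lambda>h. Re (deriv (deriv L) z * h * c))) (at z)"
      by (auto intro!: derivative_eq_intros dg'[OF that])
    ultimately have "((\<lambda>z. N c z / D z + Re (deriv L z * c)) has_derivative
       (\<lambda>h. (- N c z * (inverse (D z) * N h z * inverse (D z)) + N' c h z / D z) + Re (deriv (deriv L) z * h * c))) (at z)"
      by (rule has_derivative_add)
    moreover have "- N c z * (inverse (D z) * N h z * inverse (D z)) + N' c h z / D z = (N' c h z * D z - N c z * N h z) / (D z)\<^sup>2" for h
      using Dpos[of z] by (simp add: field_simps power2_eq_square)
    ultimately show ?thesis by (simp add: qd_def[abs_def] N_def)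
  qed
  have "pdu (pdu q) z0 = pdu (qd 1) z0" by (rule partials_cong(1)[OF S]) (rule pq(1))
  moreover have "pdv (pdv q) z0 = pdv (qd \<i>) z0" by (rule partials_cong(2)[OF S]) (rule pq(2))
  ultimately have "laplacian q z0 = ((N' 1 1 z0 + N' \<i> \<i> z0) * D z0 - ((N 1 z0)\<^sup>2 + (N \<i> z0)\<^sup>2)) / (D z0)\<^sup>2"
    using pdu_pdv_from_derivative[OF dqd[OF S(2)]] unfolding laplacian_def
    by (simp add: diff_divide_distrib add_divide_distrib power2_eq_square algebra_simps)
  also have "N' 1 1 z0 + N' \<i> \<i> z0 = 4 * (cmod (deriv g z0))\<^sup>2"
    unfolding N'_def cmod_power2 by (simp add: power2_eq_square algebra_simps)
  also have "(N 1 z0)\<^sup>2 + (N \<i> z0)\<^sup>2 = 4 * (cmod (deriv g z0))\<^sup>2 * (D z0 - 1)"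
    unfolding N_def D_def cmod_power2 by (simp add: power2_eq_square algebra_simps)
  also have "4 * (cmod (deriv g z0))\<^sup>2 * D z0 - 4 * (cmod (deriv g z0))\<^sup>2 * (D z0 - 1) = 4 * (cmod (deriv g z0))\<^sup>2"
    by (simp add: algebra_simps)
  finally show ?thesis unfolding D q_def .
qed

section \<open>The minimal Moebius band\<close>

text \<open>
  The properties of the data of \<open>annulus_weierstrass_data\<close> from which everything about the surface is derived.
\<close>

locale weierstrass_band = band b for b :: real +
  fixes c :: real and F1 F2 F4 g \<eta> :: "complex \<Rightarrow> complex"
  assumes c_pos: "c > 0"
    and hol: "g holomorphic_on annulus b" "\<eta> holomorphic_on annulus b"
    and nz: "\<And>w. w \<in> annulus b \<Longrightarrow> \<eta> w \<noteq> 0 \<and> g w \<noteq> 0 \<and> (g w)\<^sup>2 \<noteq> 1"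
    and der1: "\<And>w. w \<in> annulus b \<Longrightarrow> (F1 has_field_derivative (1 + (g w)\<^sup>2) * \<eta> w) (at w)"
    and der2: "\<And>w. w \<in> annulus b \<Longrightarrow> (F2 has_field_derivative \<i> * (1 - (g w)\<^sup>2) * \<eta> w) (at w)"
    and der4: "\<And>w. w \<in> annulus b \<Longrightarrow> (F4 has_field_derivative - 2 * \<i> * g w * \<eta> w) (at w)"
    and Re_glide: "\<And>w. w \<in> annulus b \<Longrightarrow> Re (F1 (glide w)) = Re (F1 w) \<and> Re (F2 (glide w)) = Re (F2 w) \<and> Re (F4 (glide w)) = Re (F4 w)"
    and g_glide: "\<And>w. w \<in> annulus b \<Longrightarrow> g (glide w) = glide (g w)"
    and growth: "\<And>w. w \<in> annulus b \<Longrightarrow> c / (b - \<bar>ln (cmod w)\<bar>) \<le> (1 + (cmod (g w))\<^sup>2) * cmod (\<eta> w)"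
begin

definition primitive :: "4 \<Rightarrow> complex \<Rightarrow> complex" where
  "primitive i = (if i = 1 then F1 else if i = 2 then F2 else if i = 3 then (\<lambda>_. 0) else F4)"

definition immersion :: "complex set \<Rightarrow> real ^ 4" where
  "immersion s = Re_vec primitive (SOME w. w \<in> s)"

definition gauss_map :: "complex set \<Rightarrow> csphere set" where
  "gauss_map s = RP2_proj (Fin (g (SOME w. w \<in> s)))"

lemma primitive_derivative:
  assumes "w \<in> U"
  shows "(primitive i has_field_derivative null_vector (g w) (\<eta> w) i) (at w)"
  using exhaust_4[of i] der1[OF assms] der2[OF assms] der4[OF assms] by (auto simp: primitive_def)

text \<open>
  Functions on the quotient are defined by evaluation at an arbitrarily chosen point of the orbit; for an invariant function the
  choice does not matter.
\<close>

lemma invariant_at_representative: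
  assumes "w \<in> U" "f (glide w) = f w"
  shows "f (SOME v. v \<in> moebius_point w) = f w"
proof -
  have "(SOME v. v \<in> moebius_point w) \<in> moebius_point w" by (rule someI[of _ w]) (simp add: moebius_point_def)
  then show ?thesis using assms(2) by (auto simp: moebius_point_def)
qed

lemma immersion_moebius_point: "w \<in> U \<Longrightarrow> immersion (moebius_point w) = Re_vec primitive w"
  unfolding immersion_def
  by (rule invariant_at_representative[where f = "Re_vec primitive"]) (use Re_glide in \<open>auto simp: Re_vec_def vec_eq_iff primitive_def\<close>)

lemma immersion_in_chart:
  assumes "V \<subseteq> U" "inj_on moebius_point V" "w \<in> V"
  shows "(immersion \<circ> chart_inv (orbit_chart moebius_point V)) w = Re_vec primitive w"
  using moebius.chart_simps(4)[OF assms(2,3)] immersion_moebius_point assms by auto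

lemma immersion_in_chart_minimal:
  assumes "open V" "V \<subseteq> U" "inj_on moebius_point V"
  defines "F \<equiv> immersion \<circ> chart_inv (orbit_chart moebius_point V)"
  shows "conformal_immersion_on F V" "\<And>z. z \<in> V \<Longrightarrow> mean_curvature_vector F z = 0"
    "\<And>z. z \<in> V \<Longrightarrow> conformal_factor F z = (1 + (cmod (g z))\<^sup>2) * cmod (\<eta> z)"
proof -
  have d: "(primitive i has_field_derivative null_vector (g z) (\<eta> z) i) (at z)" if "z \<in> V" for i z
    using primitive_derivative that assms(2) by blast
  have n: "\<eta> z \<noteq> 0" if "z \<in> V" for z using nz that assms(2) by blast
  have e: "F z = Re_vec primitive z" if "z \<in> V" for z
    unfolding F_def by (rule immersion_in_chart[OF assms(2,3) that])
  note m = minimal_immersion_of_null_curve[of V g \<eta> primitive F, OF assms(1) holomorphic_on_subset[OF hol(1) assms(2)] holomorphic_on_subset[OF hol(2) assms(2)] d n e]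
  show "conformal_immersion_on F V" by (rule m(1))
  show "mean_curvature_vector F z = 0" if "z \<in> V" for z by (rule m(2)) (use that in auto)
  show "conformal_factor F z = (1 + (cmod (g z))\<^sup>2) * cmod (\<eta> z)" if "z \<in> V" for z by (rule m(3)) (use that in auto)
qed

lemma conformal_minimal_immersion_band: "conformal_minimal_immersion AM immersion"
  unfolding conformal_minimal_immersion_def
proof (intro ballI conjI)
  fix c assume "c \<in> AM"
  then obtain V where c: "c = orbit_chart moebius_point V" and V: "open V" "V \<subseteq> U" "inj_on moebius_point V"
    by (rule moebius.orbit_atlasE)
  have i: "snd c ` fst c = V" unfolding c by (rule moebius.chart_simps(3)[OF V(3)])
  show "conformal_immersion_on (immersion \<circ> chart_inv c) (snd c ` fst c)"
    unfolding i unfolding c by (rule immersion_in_chart_minimal(1)[OF V])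
  show "mean_curvature_vector (immersion \<circ> chart_inv c) z = 0" if "z \<in> snd c ` fst c" for z
    using that unfolding i unfolding c by (rule immersion_in_chart_minimal(2)[OF V])
qed

text \<open>
  No complex number is its own antipode.
\<close>

lemma g_not_constant: "\<not> g constant_on U"
proof
  assume "g constant_on U"
  then obtain k where k: "\<And>w. w \<in> U \<Longrightarrow> g w = k" by (auto simp: constant_on_def)
  have "k \<noteq> 0" using nz[OF one_in_annulus] k[OF one_in_annulus] by auto
  moreover have "glide k = k" using g_glide[OF one_in_annulus] k[OF one_in_annulus] k[OF glide_annulus[OF one_in_annulus]] by simp
  ultimately show False using glide_neq by blast
qed

text \<open>
  The curvature is the negative of the Laplacian of the logarithm of the conformal factor, divided by the square of that factor. Locally \<open>ln |\<eta>|\<close> is the real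
  part of a holomorphic function, so \<open>laplacian_log_metric\<close> shows that the curvature vanishes only at the zeros of \<open>g'\<close>.
\<close>

lemma nonflat_band: "nonflat AM immersion"
proof -
  obtain z0 where z0: "z0 \<in> U" "deriv g z0 \<noteq> 0"
  proof (rule ccontr)
    assume neg: "\<not> thesis"
    have "(g has_field_derivative 0) (at z)" if "z \<in> U" for z
    proof -
      have "deriv g z = 0" using neg that \<open>\<And>z0. z0 \<in> U \<Longrightarrow> deriv g z0 \<noteq> 0 \<Longrightarrow> thesis\<close> by blast
      then show ?thesis using holomorphic_derivI[OF hol(1) open_annulus that] by simp
    qed
    then have "g constant_on U" by (rule has_field_derivative_0_imp_constant_on) (auto simp: connected_annulus open_annulus)
    then show False using g_not_constant by blast
  qed
  obtain V where V: "open V" "z0 \<in> V" "V \<subseteq> U" "inj_on moebius_point V" using separated_neighbourhood[OF z0(1)] by metis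
  obtain r where r: "r > 0" "ball z0 r \<subseteq> V" using openE[OF V(1,2)] by blast
  let ?B = "ball z0 r"
  have BU: "?B \<subseteq> U" using r(2) V(3) by blast
  have "\<eta> z \<noteq> 0" if "z \<in> ?B" for z using nz that BU by blast
  then obtain L where L: "L holomorphic_on ?B" "\<And>z. z \<in> ?B \<Longrightarrow> \<eta> z = exp (L z)"
    using contractible_imp_holomorphic_log[OF holomorphic_on_subset[OF hol(2) BU] convex_imp_contractible[OF convex_ball]] by metis
  define F where "F = immersion \<circ> chart_inv (orbit_chart moebius_point V)"
  have cf: "conformal_factor F z = (1 + (cmod (g z))\<^sup>2) * cmod (\<eta> z)" if "z \<in> V" for z
    unfolding F_def by (rule immersion_in_chart_minimal(3)[OF V(1,3,4) that])
  have zB: "z0 \<in> ?B" using r(1) by simp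
  have pos: "1 + (cmod x)\<^sup>2 > 0" for x :: complex by (intro add_pos_nonneg) auto
  have "laplacian (\<lambda>w. ln (conformal_factor F w)) z0 = laplacian (\<lambda>w. ln (1 + (cmod (g w))\<^sup>2) + Re (L w)) z0"
  proof (rule laplacian_cong[OF open_ball zB])
    fix w assume w: "w \<in> ?B"
    have e: "conformal_factor F w = (1 + (cmod (g w))\<^sup>2) * exp (Re (L w))" using cf[of w] L(2)[OF w] r(2) w by auto
    show "ln (conformal_factor F w) = ln (1 + (cmod (g w))\<^sup>2) + Re (L w)"
      unfolding e using pos[of "g w"] by (subst ln_mult) auto
  qed
  also have "\<dots> = 4 * (cmod (deriv g z0))\<^sup>2 / (1 + (cmod (g z0))\<^sup>2)\<^sup>2"
    by (rule laplacian_log_metric[OF open_ball zB L(1) holomorphic_on_subset[OF hol(1) BU]])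
  finally have lap: "laplacian (\<lambda>w. ln (conformal_factor F w)) z0 = 4 * (cmod (deriv g z0))\<^sup>2 / (1 + (cmod (g z0))\<^sup>2)\<^sup>2" .
  have "conformal_factor F z0 > 0" using cf[OF V(2)] pos[of "g z0"] nz[OF z0(1)] by simp
  then have "Gaussian_curvature F z0 \<noteq> 0"
    unfolding Gaussian_curvature_def lap using z0(2) pos[of "g z0"] by simp
  moreover have "orbit_chart moebius_point V \<in> AM" using V by (auto simp: orbit_atlas_def)
  moreover have "z0 \<in> snd (orbit_chart moebius_point V) ` fst (orbit_chart moebius_point V)"
    unfolding moebius.chart_simps(3)[OF V(4)] by (rule V(2))
  ultimately show ?thesis unfolding nonflat_def F_def by blast
qed

lemma gauss_map_moebius_point:
  assumes "w \<in> U"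
  shows "gauss_map (moebius_point w) = RP2_proj (Fin (g w))"
  unfolding gauss_map_def
proof (rule invariant_at_representative[where f = "\<lambda>w. RP2_proj (Fin (g w))", OF assms])
  have "g w \<noteq> 0" using nz[OF assms] by simp
  then show "RP2_proj (Fin (g (glide w))) = RP2_proj (Fin (g w))"
    unfolding g_glide[OF assms] RP2_proj_def by (auto simp: glide_def)
qed

lemma sphere_value_holomorphic:
  assumes "open V" "w \<in> V" "f holomorphic_on V"
  shows "sphere_value f w = Fin (f w)"
  using not_is_pole_holomorphic[OF assms] holomorphic_on_imp_analytic_at[OF assms(3,1,2)] by (simp add: sphere_value_def)

lemma phi_cover_chart:
  assumes V: "open V" "V \<subseteq> U" and z: "z \<in> V"
  shows "phi (immersion \<circ> cover_projection) (orbit_chart cover_point V) i z = null_vector (g z) (\<eta> z) i / 2"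
proof -
  let ?F = "\<lambda>w. (immersion \<circ> cover_projection) (chart_inv (orbit_chart cover_point V) w) $ i"
  have inj: "inj_on cover_point V" by (simp add: inj_on_def)
  have e: "?F w = Re (primitive i w)" if "w \<in> V" for w
    using cover.chart_simps(4)[OF inj that] immersion_moebius_point that V(2) by (auto simp: Re_vec_def)
  have zU: "z \<in> U" using z V(2) by blast
  have "((\<lambda>w. Re (primitive i w)) has_derivative (\<lambda>h. Re (null_vector (g z) (\<eta> z) i * h))) (at z)"
    using primitive_derivative[OF zU, of i] unfolding has_field_derivative_def by (rule bounded_linear.has_derivative[OF bounded_linear_Re])
  note p = pdu_pdv_from_derivative[OF this]
  have "pdu ?F z = pdu (\<lambda>w. Re (primitive i w)) z" by (rule partials_cong(1)[OF V(1) z]) (rule e)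
  moreover have "pdv ?F z = pdv (\<lambda>w. Re (primitive i w)) z" by (rule partials_cong(2)[OF V(1) z]) (rule e)
  ultimately show ?thesis unfolding phi_def using p by (simp add: complex_eq_iff)
qed

text \<open>
  Here \<open>\<phi>_1 - \<i> \<phi>_2 = \<eta>\<close> and \<open>\<i> \<phi>_4 = g \<eta>\<close>, and \<open>\<phi>_3 = 0\<close> makes the two quotients equal.
\<close>

lemma generalized_Gauss_map_band: "generalized_Gauss_map AC cover_projection immersion (gauss_map, gauss_map)"
  unfolding generalized_Gauss_map_def
proof (intro ballI)
  fix c p assume "c \<in> AC" and p: "p \<in> fst c"
  then obtain V where c: "c = orbit_chart cover_point V" and V: "open V" "V \<subseteq> U" "inj_on cover_point V"
    by (metis cover.orbit_atlasE)
  obtain w where w: "w \<in> V" "p = cover_point w" using p unfolding c cover.chart_simps(1)[OF V(3)] by blast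
  have sw: "snd c p = w" unfolding c w(2) by (rule cover.chart_simps(2)[OF V(3) w(1)])
  have wU: "w \<in> U" using w(1) V(2) by blast
  have holV: "g holomorphic_on V" using hol(1) V(2) by (rule holomorphic_on_subset)
  let ?X = "immersion \<circ> cover_projection"
  have ph: "phi ?X c i z = null_vector (g z) (\<eta> z) i / 2" if "z \<in> V" for i z
    unfolding c by (rule phi_cover_chart[OF V(1,2) that])
  have den: "phi ?X c 1 z - \<i> * phi ?X c 2 z = \<eta> z" if "z \<in> V" for z
    unfolding ph[OF that] by (simp add: field_simps)
  have num: "phi ?X c 3 z + \<i> * phi ?X c 4 z = g z * \<eta> z" "- phi ?X c 3 z + \<i> * phi ?X c 4 z = g z * \<eta> z" if "z \<in> V" for z
    unfolding ph[OF that] by (simp_all add: field_simps)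
  have nzV: "\<eta> z \<noteq> 0" if "z \<in> V" for z using nz that V(2) by blast
  have q1: "g z = (phi ?X c 3 z + \<i> * phi ?X c 4 z) / (phi ?X c 1 z - \<i> * phi ?X c 2 z)" if "z \<in> V" for z
    unfolding den[OF that] num(1)[OF that] using nzV[OF that] by simp
  have q2: "g z = (- phi ?X c 3 z + \<i> * phi ?X c 4 z) / (phi ?X c 1 z - \<i> * phi ?X c 2 z)" if "z \<in> V" for z
    unfolding den[OF that] num(2)[OF that] using nzV[OF that] by simp
  have g1: "gauss1 ?X c p = Fin (g w)"
    unfolding gauss1_def sw
    by (subst sphere_value_holomorphic[OF V(1) w(1) holomorphic_transform[OF holV q1]]) (simp_all only: q1[OF w(1), symmetric])
  have g2: "gauss2 ?X c p = Fin (g w)"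
    unfolding gauss2_def sw
    by (subst sphere_value_holomorphic[OF V(1) w(1) holomorphic_transform[OF holV q2]]) (simp_all only: q2[OF w(1), symmetric])
  have e: "gauss_map (cover_projection p) = RP2_proj (Fin (g w))"
    unfolding w(2) cover_maps by (rule gauss_map_moebius_point[OF wU])
  show "fst (gauss_map, gauss_map) (cover_projection p) = RP2_proj (gauss1 ?X c p) \<and>
      snd (gauss_map, gauss_map) (cover_projection p) = RP2_proj (gauss2 ?X c p)"
    unfolding fst_conv snd_conv e g1 g2 by simp
qed

text \<open>
  If the class of \<open>g w\<close> were constant, \<open>g\<close> would take at most two values on a connected set.
\<close>

lemma gauss_map_not_constant: "\<not> gauss_map constant_on topspace TM"
proof
  assume "gauss_map constant_on topspace TM"
  then obtain y where y: "\<And>x. x \<in> moebius_point ` U \<Longrightarrow> gauss_map x = y"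
    unfolding constant_on_def moebius.topspace_orbit by blast
  have "Fin (g w) \<in> RP2_proj (Fin (g 1))" if "w \<in> U" for w
  proof -
    have "RP2_proj (Fin (g w)) = RP2_proj (Fin (g 1))"
      using y[OF imageI[OF that]] y[OF imageI[OF one_in_annulus]]
      unfolding gauss_map_moebius_point[OF that] gauss_map_moebius_point[OF one_in_annulus] by simp
    then show ?thesis unfolding RP2_proj_def by blast
  qed
  then have "Fin ` g ` U \<subseteq> RP2_proj (Fin (g 1))" by blast
  then have "finite (Fin ` g ` U)" by (rule finite_subset) (simp add: RP2_proj_def)
  then have "finite (g ` U)" by (rule finite_imageD) (simp add: inj_on_def)
  then have "g constant_on U"
    by (rule continuous_finite_range_constant[OF connected_annulus holomorphic_on_imp_continuous_on[OF hol(1)]])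
  then show False using g_not_constant by blast
qed

text \<open>
  The omitted points are the antipodal pairs of \<open>0\<close> and \<open>\<infinity>\<close> and of \<open>1\<close> and \<open>-1\<close>.
\<close>

lemma gauss_map_omits: "omits_two_points TM gauss_map"
  unfolding omits_two_points_def moebius.topspace_orbit
proof (rule bexI[of _ "RP2_proj (Fin 0)"], rule bexI[of _ "RP2_proj (Fin 1)"], intro conjI)
  show "RP2_proj (Fin 0) \<in> RP2" "RP2_proj (Fin 1) \<in> RP2" by (simp_all add: RP2_def)
  show "RP2_proj (Fin 0) \<noteq> RP2_proj (Fin 1)" by (auto simp: RP2_proj_def)
  have ne: "RP2_proj (Fin k) \<noteq> gauss_map (moebius_point w)" if "w \<in> U" "k = 0 \<or> k\<^sup>2 = 1" for w k
  proof
    assume "RP2_proj (Fin k) = gauss_map (moebius_point w)"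
    then have "Fin (g w) \<in> RP2_proj (Fin k)" unfolding gauss_map_moebius_point[OF that(1)] by (simp add: RP2_proj_def)
    then show False using nz[OF that(1)] that(2) by (auto simp: RP2_proj_def power2_eq_1_iff split: if_splits)
  qed
  show "RP2_proj (Fin 0) \<notin> gauss_map ` moebius_point ` U" "RP2_proj (Fin 1) \<notin> gauss_map ` moebius_point ` U"
    using ne[of _ 0] ne[of _ 1] by auto
qed

end

section \<open>Completeness\<close>

lemma C1_differentiable_on_open_Un:
  assumes "open A" "open B" "f C1_differentiable_on A" "f C1_differentiable_on B"
  shows "f C1_differentiable_on (A \<union> B)"
  using assms(3,4) continuous_on_open_Un[OF assms(1,2)] unfolding C1_differentiable_on_eq by blast

lemma C1_differentiable_on_open_by_derivative:
  assumes "\<And>t. t \<in> A \<Longrightarrow> (f has_vector_derivative f' t) (at t)" "continuous_on A f'"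
  shows "f C1_differentiable_on A"
  using assms unfolding C1_differentiable_on_def by blast

lemma has_derivative_chain_vector:
  assumes "(z has_vector_derivative d) (at t)" "(f has_derivative f') (at (z t))"
  shows "((\<lambda>t. f (z t)) has_vector_derivative f' d) (at t)"
proof -
  interpret bounded_linear f' using assms(2) by (rule has_derivative_bounded_linear)
  have "((\<lambda>t. f (z t)) has_derivative (\<lambda>x. f' (x *\<^sub>R d))) (at t)"
    using assms(1)[unfolded has_vector_derivative_def] assms(2) by (rule has_derivative_compose)
  then show ?thesis unfolding has_vector_derivative_def scaleR .
qed

lemma glide_has_derivative:
  assumes "w \<noteq> 0"
  shows "(glide has_derivative (\<lambda>h. inverse (cnj w) * cnj h * inverse (cnj w))) (at w)"
proof -
  have "(cnj has_derivative cnj) (at w)" by (rule bounded_linear_imp_has_derivative[OF bounded_linear_cnj])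
  from has_derivative_minus[OF Deriv.has_derivative_inverse[OF _ this]] assms show ?thesis
    by (simp add: glide_def[abs_def] divide_inverse)
qed

context weierstrass_band
begin

text \<open>
  The induced metric is \<open>density w |dw|\<close>.
\<close>

definition density :: "complex \<Rightarrow> real" where
  "density w = (1 + (cmod (g w))\<^sup>2) * cmod (\<eta> w)"

lemma continuous_density: "continuous_on U density"
  unfolding density_def using hol[THEN holomorphic_on_imp_continuous_on] by (intro continuous_intros)

lemma primitive_has_derivative:
  assumes "w \<in> U"
  shows "(Re_vec primitive has_derivative (\<lambda>h. \<chi> i. Re (null_vector (g w) (\<eta> w) i * h))) (at w)"
  by (rule has_derivative_Re_vec) (rule primitive_derivative[OF assms])

lemma norm_primitive_derivative:
  "norm (\<chi> i. Re (null_vector (g w) (\<eta> w) i * h)) = density w * cmod h"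
proof -
  have "null_vector (g w) (\<eta> w) i * h = null_vector (g w) (\<eta> w * h) i" for i by (simp add: null_vector_def)
  then show ?thesis using metric_factor[of "g w" "\<eta> w * h"] by (simp add: density_def norm_mult)
qed

text \<open>
  In a chart the curve is lifted to the annulus, where a function on the quotient becomes \<open>f\<close>.
\<close>

lemma derivative_along_curve:
  assumes ch: "ch = orbit_chart moebius_point V" and V: "V \<subseteq> U" "inj_on moebius_point V"
    and A: "open A" "t \<in> A" "\<And>s. s \<in> A \<Longrightarrow> \<gamma> s \<in> fst ch"
    and d: "(snd ch \<circ> \<gamma> has_vector_derivative d) (at t)"
    and f: "\<And>w. w \<in> U \<Longrightarrow> F (moebius_point w) = f w" "(f has_derivative f') (at ((snd ch \<circ> \<gamma>) t))"
  shows "(F \<circ> \<gamma> has_vector_derivative f' d) (at t)"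
proof (rule has_vector_derivative_transform_within_open[OF has_derivative_chain_vector[OF d f(2)] A(1,2)])
  fix s assume "s \<in> A"
  then have "\<gamma> s \<in> moebius_point ` V" using A(3) unfolding ch moebius.chart_simps(1)[OF V(2)] by blast
  then obtain v where v: "v \<in> V" "\<gamma> s = moebius_point v" by blast
  have "snd ch (\<gamma> s) = v" unfolding ch v(2) by (rule moebius.chart_simps(2)[OF V(2) v(1)])
  then show "f ((snd ch \<circ> \<gamma>) s) = (F \<circ> \<gamma>) s" using f(1)[of v] v V(1) by auto
qed

lemma continuous_map_invariant:
  fixes f :: "complex \<Rightarrow> complex"
  assumes "continuous_on U f" "\<And>w. w \<in> U \<Longrightarrow> F (moebius_point w) = f w"
  shows "continuous_map TM euclidean F"
  unfolding continuous_map moebius.topspace_orbit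
proof (intro conjI allI impI)
  fix O' :: "complex set" assume "openin euclidean O'"
  then have "open O'" by simp
  have "U \<inter> moebius_point -` {x \<in> moebius_point ` U. F x \<in> O'} = U \<inter> f -` O'" using assms(2) by auto
  moreover have "open (U \<inter> f -` O')" using continuous_open_preimage[OF assms(1) open_annulus \<open>open O'\<close>] .
  ultimately show "openin TM {x \<in> moebius_point ` U. F x \<in> O'}" by (auto simp: moebius.openin_orbit)
qed simp

text \<open>
  The fundamental theorem of calculus along the curve. The length is a Lebesgue integral and the change of \<open>F\<close> a gauge integral. Away from finitely
  many parameters the speed is continuous, hence measurable, so that the one can be compared with the other.
\<close>

lemma invariant_change_le_length:
  fixes f :: "complex \<Rightarrow> complex"
  assumes \<gamma>: "piecewise_C1_curve TM AM \<gamma>"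
    and F: "\<And>w. w \<in> U \<Longrightarrow> F (moebius_point w) = f w"
    and f: "\<And>w. w \<in> U \<Longrightarrow> (f has_derivative f' w) (at w)"
    and bound: "\<And>w h. w \<in> U \<Longrightarrow> cmod (f' w h) \<le> C * density w * cmod h"
    and C: "C \<ge> 0" and len: "induced_length immersion \<gamma> < ennreal e"
  shows "cmod (F (\<gamma> 1) - F (\<gamma> 0)) \<le> C * e"
proof -
  have path: "continuous_map (top_of_set {0..1}) TM \<gamma>" using \<gamma> by (simp add: piecewise_C1_curve_def pathin_def)
  obtain S where S: "finite S" "\<And>c. c \<in> AM \<Longrightarrow> (snd c \<circ> \<gamma>) C1_differentiable_on ({t \<in> {0..1}. \<gamma> t \<in> fst c} - S)"
    using \<gamma> unfolding piecewise_C1_curve_def by blast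
  define A where "A c = {t \<in> {0<..<1}. \<gamma> t \<in> fst c} - S" for c :: "complex set chart"
  define D where "D = {0<..<1} - S"
  define \<phi> where "\<phi> t = norm (vector_derivative (immersion \<circ> \<gamma>) (at t))" for t
  have openD: "open D" unfolding D_def using S(1) by (intro open_Diff finite_imp_closed) auto
  have openA: "open (A c)" if "c \<in> AM" for c
  proof -
    obtain V where c: "c = orbit_chart moebius_point V" and V: "open V" "V \<subseteq> U" "inj_on moebius_point V"
      using \<open>c \<in> AM\<close> by (rule moebius.orbit_atlasE)
    have "openin TM (fst c)" unfolding c moebius.chart_simps(1)[OF V(3)] by (rule moebius.openin_image[OF V(1,2)])
    from openin_continuous_map_preimage[OF path this] have "openin (top_of_set {0..1}) {t \<in> {0..1}. \<gamma> t \<in> fst c}"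
      by (simp only: topspace_euclidean_subtopology)
    then obtain T where T: "open T" "{t \<in> {0..1}. \<gamma> t \<in> fst c} = {0..1} \<inter> T"
      unfolding openin_open by blast
    have "{t \<in> {0<..<1}. \<gamma> t \<in> fst c} = {0<..<1} \<inter> {t \<in> {0..1}. \<gamma> t \<in> fst c}" by auto
    also have "\<dots> = {0<..<1} \<inter> T" unfolding T(2) by auto
    finally have "A c = ({0<..<1} \<inter> T) - S" unfolding A_def by (rule arg_cong)
    moreover have "open (({0<..<1} \<inter> T) - S)" using T(1) S(1) by (intro open_Diff open_Int finite_imp_closed) auto
    ultimately show ?thesis by simp
  qed
  have loc: "(immersion \<circ> \<gamma> has_vector_derivative (\<chi> i. Re (null_vector (g (snd c (\<gamma> t))) (\<eta> (snd c (\<gamma> t))) i * vector_derivative (snd c \<circ> \<gamma>) (at t)))) (at t)"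
      "(F \<circ> \<gamma> has_vector_derivative f' (snd c (\<gamma> t)) (vector_derivative (snd c \<circ> \<gamma>) (at t))) (at t)"
      "snd c (\<gamma> t) \<in> U" "\<phi> t = density (snd c (\<gamma> t)) * cmod (vector_derivative (snd c \<circ> \<gamma>) (at t))"
    if cA: "c \<in> AM" and t: "t \<in> A c" for c t
  proof -
    obtain V where c: "c = orbit_chart moebius_point V" and V: "open V" "V \<subseteq> U" "inj_on moebius_point V"
      using cA by (rule moebius.orbit_atlasE)
    have im: "\<gamma> s \<in> fst c" if "s \<in> A c" for s using that by (simp add: A_def)
    have "(snd c \<circ> \<gamma>) differentiable at t"
    proof -
      have "t \<in> {t \<in> {0..1}. \<gamma> t \<in> fst c} - S" using t by (simp add: A_def)
      then show ?thesis using S(2)[OF cA] unfolding C1_differentiable_on_eq by blast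
    qed
    then have d: "(snd c \<circ> \<gamma> has_vector_derivative vector_derivative (snd c \<circ> \<gamma>) (at t)) (at t)"
      by (simp add: vector_derivative_works)
    have "snd c (\<gamma> t) \<in> snd c ` fst c" using im[OF t] by blast
    then have "snd c (\<gamma> t) \<in> V" unfolding c moebius.chart_simps(3)[OF V(3)] .
    then show zU: "snd c (\<gamma> t) \<in> U" using V(2) by blast
    show d1: "(immersion \<circ> \<gamma> has_vector_derivative (\<chi> i. Re (null_vector (g (snd c (\<gamma> t))) (\<eta> (snd c (\<gamma> t))) i * vector_derivative (snd c \<circ> \<gamma>) (at t)))) (at t)"
      by (rule derivative_along_curve[where f = "Re_vec primitive" and f' = "\<lambda>h. \<chi> i. Re (null_vector (g (snd c (\<gamma> t))) (\<eta> (snd c (\<gamma> t))) i * h)",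
              OF c V(2,3) openA[OF cA] t _ d])
         (erule im, erule immersion_moebius_point, unfold o_apply, rule primitive_has_derivative[OF zU])
    show "(F \<circ> \<gamma> has_vector_derivative f' (snd c (\<gamma> t)) (vector_derivative (snd c \<circ> \<gamma>) (at t))) (at t)"
      by (rule derivative_along_curve[where f = f and f' = "f' (snd c (\<gamma> t))", OF c V(2,3) openA[OF cA] t _ d])
         (erule im, erule F, unfold o_apply, rule f[OF zU])
    show "\<phi> t = density (snd c (\<gamma> t)) * cmod (vector_derivative (snd c \<circ> \<gamma>) (at t))"
      unfolding \<phi>_def vector_derivative_at[OF d1] by (rule norm_primitive_derivative)
  qed
  have DA: "D = (\<Union>c\<in>AM. A c)"
  proof (intro equalityI subsetI)
    fix t assume t: "t \<in> D"
    then have "\<gamma> t \<in> topspace TM" using continuous_map_image_subset_topspace[OF path] by (auto simp: D_def)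
    also have "topspace TM = (\<Union>c\<in>AM. fst c)" using surfaces(2) unfolding surface_def by simp
    finally show "t \<in> (\<Union>c\<in>AM. A c)" using t by (auto simp: A_def D_def)
  qed (auto simp: A_def D_def)
  have cont\<phi>: "continuous_on D \<phi>"
    unfolding DA
  proof (rule continuous_on_open_UN)
    show "open (A c)" if "c \<in> AM" for c using openA that .
    show "continuous_on (A c) \<phi>" if cA: "c \<in> AM" for c
    proof -
      have sub: "A c \<subseteq> {t \<in> {0..1}. \<gamma> t \<in> fst c} - S" by (auto simp: A_def)
      have C1: "(snd c \<circ> \<gamma>) C1_differentiable_on A c" using S(2)[OF cA] sub by (rule C1_differentiable_on_subset)
      then have v: "continuous_on (A c) (\<lambda>t. vector_derivative (snd c \<circ> \<gamma>) (at t))" unfolding C1_differentiable_on_eq by blast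
      have z: "continuous_on (A c) (\<lambda>t. snd c (\<gamma> t))"
        using C1_differentiable_imp_continuous_on[OF C1] by (simp add: o_def)
      have "continuous_on (A c) (\<lambda>t. density (snd c (\<gamma> t)))"
        by (rule continuous_on_compose2[OF continuous_density z]) (use loc(3)[OF cA] in blast)
      then have "continuous_on (A c) (\<lambda>t. density (snd c (\<gamma> t)) * cmod (vector_derivative (snd c \<circ> \<gamma>) (at t)))"
        using v by (intro continuous_intros)
      then show ?thesis by (rule continuous_on_eq) (use loc(4)[OF cA] in simp)
    qed
  qed
  \<comment> \<open>the speed, set to zero at the exceptional parameters, where the curve need not be differentiable\<close>
  define k where "k t = indicator D t *\<^sub>R \<phi> t" for t
  have kb: "k \<in> borel_measurable borel"
    unfolding k_def using openD cont\<phi> by (intro borel_measurable_continuous_on_indicator) auto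
  have k0: "k t \<ge> 0" for t by (simp add: k_def \<phi>_def)
  have "(\<integral>\<^sup>+t. ennreal (k t) \<partial>lborel) \<le> induced_length immersion \<gamma>"
    unfolding induced_length_def
    by (rule nn_integral_mono) (auto simp: k_def \<phi>_def D_def indicator_def)
  then have le: "(\<integral>\<^sup>+t. ennreal (k t) \<partial>lborel) < ennreal e" using len by (rule le_less_trans)
  define r where "r = enn2real (\<integral>\<^sup>+t. ennreal (k t) \<partial>lborel)"
  have r: "(\<integral>\<^sup>+t. ennreal (k t) \<partial>lborel) = ennreal r" "r \<ge> 0"
    using le unfolding r_def by (auto simp: ennreal_enn2real_if less_top[symmetric])
  have re: "r \<le> e" using le unfolding r(1) using r(2) by (metis ennreal_less_iff less_imp_le)
  have "(k has_integral r) UNIV" by (rule nn_integral_has_integral[OF kb k0 r])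
  moreover have "(\<lambda>t. if t \<in> {0..1} then k t else 0) = k" by (auto simp: fun_eq_iff k_def D_def)
  ultimately have kI: "(k has_integral r) {0..1}" using has_integral_restrict_UNIV[of "{0..1}" k r] by simp
  define h' where "h' t = (if t \<in> D then vector_derivative (F \<circ> \<gamma>) (at t) else 0)" for t
  have contF: "continuous_map TM euclidean F"
  proof (rule continuous_map_invariant)
    show "continuous_on U f" using f has_derivative_continuous by (blast intro: continuous_at_imp_continuous_on)
  qed (rule F)
  have hI: "(h' has_integral ((F \<circ> \<gamma>) 1 - (F \<circ> \<gamma>) 0)) {0..1}"
  proof (rule fundamental_theorem_of_calculus_interior_strong[OF S(1)])
    show "continuous_on {0..1} (F \<circ> \<gamma>)" using continuous_map_compose[OF path contF] by simp
    fix t :: real assume "t \<in> {0<..<1} - S"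
    then have t: "t \<in> D" by (simp add: D_def)
    then obtain c where "c \<in> AM" "t \<in> A c" unfolding DA by blast
    from vector_derivative_at[OF loc(2)[OF this]] loc(2)[OF this] t
    show "(F \<circ> \<gamma> has_vector_derivative h' t) (at t)" by (simp add: h'_def)
  qed simp
  have "cmod (h' t) \<le> C * k t" for t
  proof (cases "t \<in> D")
    case True
    then obtain c where c: "c \<in> AM" "t \<in> A c" unfolding DA by blast
    have "cmod (f' (snd c (\<gamma> t)) (vector_derivative (snd c \<circ> \<gamma>) (at t))) \<le> C * \<phi> t"
      using bound[OF loc(3)[OF c]] unfolding loc(4)[OF c] by (simp only: mult.assoc)
    then show ?thesis unfolding h'_def k_def vector_derivative_at[OF loc(2)[OF c]] using True by simp
  qed (simp add: h'_def k_def)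
  then have "norm (integral {0..1} h') \<le> integral {0..1} (\<lambda>t. C * k t)"
    using hI has_integral_mult_right[OF kI, of C] by (intro Henstock_Kurzweil_Integration.integral_norm_bound_integral) auto
  also have "\<dots> = C * r" using has_integral_mult_right[OF kI, of C] by (rule integral_unique)
  also have "\<dots> \<le> C * e" using re C by (rule mult_left_mono)
  finally show ?thesis unfolding integral_unique[OF hI] by simp
qed

text \<open>
  The functions on the annulus that descend to Lipschitz functions on the quotient with the induced metric.
\<close>

definition controlled :: "(complex \<Rightarrow> complex) \<Rightarrow> bool" where
  "controlled f \<longleftrightarrow> (\<forall>w\<in>U. f (glide w) = f w) \<and>
     (\<exists>C\<ge>0. \<exists>f'. \<forall>w\<in>U. (f has_derivative f' w) (at w) \<and> (\<forall>h. cmod (f' w h) \<le> C * density w * cmod h))"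

lemma controlled_Cauchy:
  assumes "controlled f" and w: "\<And>n. w n \<in> U"
    and cau: "\<forall>e>0. \<exists>N. \<forall>m\<ge>N. \<forall>n\<ge>N. induced_dist TM AM immersion (moebius_point (w m)) (moebius_point (w n)) < e"
  shows "Cauchy (\<lambda>n. f (w n))"
proof -
  have inv: "\<And>w. w \<in> U \<Longrightarrow> f (glide w) = f w" using assms(1) unfolding controlled_def by blast
  obtain C f' where C: "C \<ge> 0" and f: "\<And>w. w \<in> U \<Longrightarrow> (f has_derivative f' w) (at w)"
    "\<And>w h. w \<in> U \<Longrightarrow> cmod (f' w h) \<le> C * density w * cmod h"
    using assms(1) unfolding controlled_def by blast
  define F where "F s = f (SOME v. v \<in> s)" for s
  have F: "F (moebius_point v) = f v" if "v \<in> U" for v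
    unfolding F_def by (rule invariant_at_representative[OF that inv[OF that]])
  show ?thesis
  proof (rule metric_CauchyI)
    fix e :: real assume e: "e > 0"
    define \<delta> where "\<delta> = e / (C + 1)"
    have \<delta>: "\<delta> > 0" "C * \<delta> < e" using e C by (auto simp: \<delta>_def field_simps)
    then obtain N where N: "\<And>m n. m \<ge> N \<Longrightarrow> n \<ge> N \<Longrightarrow> induced_dist TM AM immersion (moebius_point (w m)) (moebius_point (w n)) < ennreal \<delta>"
      using cau[rule_format, of "ennreal \<delta>"] by auto
    have "dist (f (w m)) (f (w n)) < e" if mn: "m \<ge> N" "n \<ge> N" for m n
    proof -
      obtain \<gamma> where \<gamma>: "piecewise_C1_curve TM AM \<gamma>" "\<gamma> 0 = moebius_point (w m)" "\<gamma> 1 = moebius_point (w n)"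
        "induced_length immersion \<gamma> < ennreal \<delta>"
        using N[OF mn] unfolding induced_dist_def INF_less_iff by auto
      have "cmod (F (\<gamma> 1) - F (\<gamma> 0)) \<le> C * \<delta>"
        by (rule invariant_change_le_length[OF \<gamma>(1) F f C \<gamma>(4)])
      then show ?thesis using \<delta>(2) unfolding \<gamma>(2,3) F[OF w] by (simp add: dist_norm norm_minus_commute)
    qed
    then show "\<exists>M. \<forall>m\<ge>M. \<forall>n\<ge>M. dist (f (w m)) (f (w n)) < e" by blast
  qed
qed

lemma inverse_modulus_le: "w \<in> U \<Longrightarrow> inverse (cmod w) \<le> exp b"
proof -
  assume w: "w \<in> U"
  then have p: "cmod w > 0" "- b \<le> ln (cmod w)" by (auto simp: annulus_def)
  then have "exp (- b) \<le> cmod w" by (metis exp_le_cancel_iff exp_ln)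
  then show ?thesis using p(1) by (simp add: exp_minus field_simps)
qed

text \<open>
  The growth hypothesis bounds the density below by \<open>c / b\<close>, so a function with bounded derivative is controlled.
\<close>

lemma norm_le_density:
  assumes "w \<in> U"
  shows "cmod h \<le> b / c * density w * cmod h"
proof -
  have "b - \<bar>ln (cmod w)\<bar> > 0" "b - \<bar>ln (cmod w)\<bar> \<le> b" using assms by (auto simp: annulus_def)
  then have "c / b \<le> c / (b - \<bar>ln (cmod w)\<bar>)" using c_pos by (intro divide_left_mono) auto
  then have "c / b \<le> density w" using growth[OF assms] by (simp add: density_def)
  then have "1 \<le> b / c * density w" using b_pos c_pos by (simp add: field_simps)
  then show ?thesis using mult_right_mono[of 1 "b / c * density w" "cmod h"] by simp
qed

lemma controlledI:
  assumes "\<And>w. w \<in> U \<Longrightarrow> f (glide w) = f w" "\<And>w. w \<in> U \<Longrightarrow> (f has_derivative f' w) (at w)"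
    "\<And>w h. w \<in> U \<Longrightarrow> cmod (f' w h) \<le> K * cmod h" "K \<ge> 0"
  shows "controlled f"
  unfolding controlled_def
proof (intro conjI ballI exI[of _ "K * (b / c)"] exI[of _ f'] allI)
  fix w h assume w: "w \<in> U"
  have "cmod (f' w h) \<le> K * (b / c * density w * cmod h)"
    by (rule order_trans[OF assms(3)[OF w] mult_left_mono[OF norm_le_density[OF w] assms(4)]])
  then show "cmod (f' w h) \<le> K * (b / c) * density w * cmod h" by (simp only: mult.assoc)
qed (use assms b_pos c_pos in auto)

text \<open>
  The sum and the product of the two points of an orbit determine the orbit.
\<close>

lemma controlled_orbit_sum: "controlled (\<lambda>w. w + glide w)"
proof (rule controlledI)
  fix w assume w: "w \<in> U"
  note w0 = annulus_nonzero[OF w]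
  show "glide w + glide (glide w) = w + glide w" using glide_glide[OF w0] by simp
  show "((\<lambda>w. w + glide w) has_derivative (\<lambda>h. h + inverse (cnj w) * cnj h * inverse (cnj w))) (at w)"
    by (intro has_derivative_add has_derivative_ident glide_has_derivative w0)
  fix h
  have "cmod (h + inverse (cnj w) * cnj h * inverse (cnj w)) \<le> cmod h + cmod h * (inverse (cmod w))\<^sup>2"
    by (rule order_trans[OF norm_triangle_ineq]) (simp add: norm_mult norm_inverse power2_eq_square)
  also have "\<dots> \<le> cmod h + cmod h * (exp b)\<^sup>2"
    using inverse_modulus_le[OF w] by (intro add_left_mono mult_left_mono power_mono) auto
  finally show "cmod (h + inverse (cnj w) * cnj h * inverse (cnj w)) \<le> (1 + (exp b)\<^sup>2) * cmod h" by (simp add: algebra_simps)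
qed (simp add: add_nonneg_nonneg)

lemma controlled_orbit_product: "controlled (\<lambda>w. w * glide w)"
proof (rule controlledI)
  fix w assume w: "w \<in> U"
  note w0 = annulus_nonzero[OF w]
  show "glide w * glide (glide w) = w * glide w" using glide_glide[OF w0] by simp
  show "((\<lambda>w. w * glide w) has_derivative (\<lambda>h. w * (inverse (cnj w) * cnj h * inverse (cnj w)) + h * glide w)) (at w)"
    by (intro has_derivative_mult has_derivative_ident glide_has_derivative w0)
  fix h
  have "cmod (w * (inverse (cnj w) * cnj h * inverse (cnj w)) + h * glide w) \<le> 2 * (cmod h * inverse (cmod w))"
    by (rule order_trans[OF norm_triangle_ineq]) (use w0 in \<open>simp add: glide_def norm_mult norm_inverse norm_divide field_simps\<close>)
  also have "\<dots> \<le> 2 * (cmod h * exp b)" using inverse_modulus_le[OF w] by (intro mult_left_mono) auto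
  finally show "cmod (w * (inverse (cnj w) * cnj h * inverse (cnj w)) + h * glide w) \<le> 2 * exp b * cmod h" by (simp add: algebra_simps)
qed simp

text \<open>
  This function is bounded on a set only if the set has compact closure in the annulus. Its derivative is of the order of the reciprocal distance to the
  boundary, and so is bounded by the growth hypothesis on the density.
\<close>

lemma controlled_height: "controlled (\<lambda>w. of_real (- ln (b\<^sup>2 - (ln (cmod w))\<^sup>2)))"
  unfolding controlled_def
proof (intro conjI ballI)
  fix w assume "w \<in> U"
  then show "complex_of_real (- ln (b\<^sup>2 - (ln (cmod (glide w)))\<^sup>2)) = of_real (- ln (b\<^sup>2 - (ln (cmod w))\<^sup>2))"
    using annulus_nonzero[of w b] by (simp add: glide_def norm_divide ln_div)
next
  define f' where "f' w h = complex_of_real ((h \<bullet> sgn w) * (2 * ln (cmod w) / cmod w / (b\<^sup>2 - (ln (cmod w))\<^sup>2)))" for w h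
  have "((\<lambda>w. complex_of_real (- ln (b\<^sup>2 - (ln (cmod w))\<^sup>2))) has_derivative f' w) (at w) \<and>
      cmod (f' w h) \<le> 2 * exp b / c * density w * cmod h" if w: "w \<in> U" for w h
  proof
    define u where "u = ln (cmod w)"
    have w0: "w \<noteq> 0" "cmod w > 0" using annulus_nonzero[OF w] by auto
    have u: "\<bar>u\<bar> < b" using w by (simp add: annulus_def u_def)
    have sq: "b\<^sup>2 - u\<^sup>2 = (b - \<bar>u\<bar>) * (b + \<bar>u\<bar>)" by (simp add: power2_eq_square algebra_simps)
    then have pos: "b\<^sup>2 - u\<^sup>2 > 0" using u by (simp add: mult_pos_pos)
    have "((\<lambda>x. - ln (b\<^sup>2 - (ln x)\<^sup>2)) has_field_derivative (2 * u / cmod w / (b\<^sup>2 - u\<^sup>2))) (at (cmod w))"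
      using pos w0 unfolding u_def by (auto intro!: derivative_eq_intros simp: field_simps)
    from DERIV_compose_FDERIV[OF this has_derivative_norm[OF w0(1)]]
    show "((\<lambda>w. complex_of_real (- ln (b\<^sup>2 - (ln (cmod w))\<^sup>2))) has_derivative f' w) (at w)"
      unfolding f'_def u_def by (rule bounded_linear.has_derivative[OF bounded_linear_of_real])
    have "\<bar>h \<bullet> sgn w\<bar> \<le> cmod h" using Cauchy_Schwarz_ineq2[of h "sgn w"] w0 by (simp add: norm_sgn)
    moreover have "\<bar>2 * u / cmod w / (b\<^sup>2 - u\<^sup>2)\<bar> \<le> 2 * exp b / c * density w"
    proof -
      have "\<bar>2 * u / cmod w / (b\<^sup>2 - u\<^sup>2)\<bar> = 2 * inverse (cmod w) * (\<bar>u\<bar> / (b + \<bar>u\<bar>)) * (1 / (b - \<bar>u\<bar>))"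
        using u w0 pos unfolding abs_divide abs_mult sq by (simp add: field_simps abs_mult)
      also have "\<dots> \<le> 2 * exp b * 1 * (1 / (b - \<bar>u\<bar>))"
        using inverse_modulus_le[OF w] u b_pos by (intro mult_mono mult_left_mono) (auto simp: divide_le_eq)
      also have "\<dots> = 2 * exp b / c * (c / (b - \<bar>u\<bar>))" using c_pos by simp
      also have "\<dots> \<le> 2 * exp b / c * density w"
        using growth[OF w] c_pos unfolding u_def density_def by (intro mult_left_mono) auto
      finally show ?thesis .
    qed
    ultimately have "\<bar>(h \<bullet> sgn w) * (2 * u / cmod w / (b\<^sup>2 - u\<^sup>2))\<bar> \<le> cmod h * (2 * exp b / c * density w)"
      unfolding abs_mult[of "h \<bullet> sgn w"] by (intro mult_mono) auto
    then show "cmod (f' w h) \<le> 2 * exp b / c * density w * cmod h"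
      unfolding f'_def u_def[symmetric] norm_of_real by (simp only: mult.commute)
  qed
  then show "\<exists>C\<ge>0. \<exists>f'. \<forall>w\<in>U. ((\<lambda>w. complex_of_real (- ln (b\<^sup>2 - (ln (cmod w))\<^sup>2))) has_derivative f' w) (at w) \<and>
      (\<forall>h. cmod (f' w h) \<le> C * density w * cmod h)"
    using c_pos by (intro exI[of _ "2 * exp b / c"] conjI exI[of _ f']) auto
qed

end

context weierstrass_band
begin

text \<open>
  On a compact disc around \<open>p\<close> the density is bounded, so a Euclidean segment that ends at \<open>p\<close> has small induced length.
\<close>

lemma short_segments:
  assumes p: "p \<in> U" and \<epsilon>: "\<epsilon> > 0"
  obtains r where "r > 0" "\<And>w. cmod (w - p) < r \<Longrightarrow> induced_dist TM AM immersion (moebius_point w) (moebius_point p) \<le> ennreal \<epsilon>"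
proof -
  obtain r0 where r0: "r0 > 0" "cball p r0 \<subseteq> U" using open_annulus p by (meson open_contains_cball)
  have "compact (density ` cball p r0)"
    by (rule compact_continuous_image[OF continuous_on_subset[OF continuous_density r0(2)] compact_cball])
  then obtain B where B: "B > 0" "\<And>x. x \<in> density ` cball p r0 \<Longrightarrow> norm x \<le> B" using bounded_pos compact_imp_bounded by metis
  define r where "r = min r0 (\<epsilon> / B)"
  have r: "r > 0" "r \<le> r0" "B * r \<le> \<epsilon>" using r0 \<epsilon> B(1) by (auto simp: r_def min_def field_simps)
  show ?thesis
  proof (rule that[OF r(1)])
    fix w assume w: "cmod (w - p) < r"
    define l where "l t = w + of_real t * (p - w)" for t :: real
    define \<gamma> where "\<gamma> t = moebius_point (l t)" for t
    have lB: "l t \<in> ball p r0" if "t \<in> {0..1}" for t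
    proof -
      have "l t - p = of_real (1 - t) * (w - p)" by (simp add: l_def algebra_simps)
      then have "cmod (l t - p) = \<bar>1 - t\<bar> * cmod (w - p)" by (simp only: norm_mult norm_of_real)
      also have "\<dots> \<le> 1 * cmod (w - p)" using that by (intro mult_right_mono) auto
      finally show ?thesis using w r(2) by (simp add: dist_norm norm_minus_commute)
    qed
    have lU: "l t \<in> U" if "t \<in> {0..1}" for t using lB[OF that] r0(2) by auto
    have cl: "continuous_on S l" for S unfolding l_def by (intro continuous_intros)
    have dl: "(l has_vector_derivative (p - w)) (at t)" for t
    proof -
      have "(l has_derivative (\<lambda>x. of_real x * (p - w))) (at t)" unfolding l_def by (auto intro!: derivative_eq_intros)
      then show ?thesis by (simp add: has_vector_derivative_def scaleR_conv_of_real)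
    qed
    have "continuous_map (top_of_set {0..1}) (top_of_set U) l"
      using cl[of "{0..1}"] lU by (auto simp: continuous_map_in_subtopology)
    then have "continuous_map (top_of_set {0..1}) TM (moebius_point \<circ> l)"
      by (rule continuous_map_compose[OF _ moebius.continuous_map_projection])
    then have path: "pathin TM \<gamma>" by (simp add: pathin_def \<gamma>_def[abs_def] o_def)
    have C1: "(snd c \<circ> \<gamma>) C1_differentiable_on ({t \<in> {0..1}. \<gamma> t \<in> fst c} - {})" if cA: "c \<in> AM" for c
    proof -
      obtain V where c: "c = orbit_chart moebius_point V" and V: "open V" "V \<subseteq> U" "inj_on moebius_point V"
        using cA by (rule moebius.orbit_atlasE)
      \<comment> \<open>in the chart the segment appears as itself or as its image under the glide\<close>
      define A1 where "A1 = l -` V"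
      define A2 where "A2 = l -` (U \<inter> glide -` V)"
      have o: "open A1" "open A2"
        unfolding A1_def A2_def by (rule open_vimage[OF V(1) cl], rule open_vimage[OF open_vimage_glide[OF V(1)] cl])
      have e1: "l t = (snd c \<circ> \<gamma>) t" if "t \<in> A1" for t
        using moebius.chart_simps(2)[OF V(3), of "l t"] that by (simp add: c \<gamma>_def A1_def)
      have e2: "glide (l t) = (snd c \<circ> \<gamma>) t" if "t \<in> A2" for t
      proof -
        have "l t \<noteq> 0" using that annulus_nonzero by (auto simp: A2_def)
        then have "\<gamma> t = moebius_point (glide (l t))" by (simp add: \<gamma>_def moebius_point_glide)
        then show ?thesis using moebius.chart_simps(2)[OF V(3), of "glide (l t)"] that by (simp add: c A2_def)
      qed
      have "(snd c \<circ> \<gamma>) C1_differentiable_on A1"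
      proof (rule C1_differentiable_on_open_by_derivative)
        show "(snd c \<circ> \<gamma> has_vector_derivative (p - w)) (at t)" if "t \<in> A1" for t
          by (rule has_vector_derivative_transform_within_open[OF dl o(1) that e1])
      qed (rule continuous_on_const)
      moreover have "(snd c \<circ> \<gamma>) C1_differentiable_on A2"
      proof (rule C1_differentiable_on_open_by_derivative)
        have nz: "l t \<noteq> 0" if "t \<in> A2" for t using that annulus_nonzero by (auto simp: A2_def)
        show "(snd c \<circ> \<gamma> has_vector_derivative (inverse (cnj (l t)) * cnj (p - w) * inverse (cnj (l t)))) (at t)" if "t \<in> A2" for t
          by (rule has_vector_derivative_transform_within_open[OF has_derivative_chain_vector[OF dl glide_has_derivative[OF nz[OF that]]] o(2) that e2])
        show "continuous_on A2 (\<lambda>t. inverse (cnj (l t)) * cnj (p - w) * inverse (cnj (l t)))"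
          using cl nz by (intro continuous_intros) auto
      qed
      ultimately have C: "(snd c \<circ> \<gamma>) C1_differentiable_on (A1 \<union> A2)" by (rule C1_differentiable_on_open_Un[OF o])
      have "{t \<in> {0..1}. \<gamma> t \<in> fst c} - {} \<subseteq> A1 \<union> A2"
      proof
        fix t assume t: "t \<in> {t \<in> {0..1}. \<gamma> t \<in> fst c} - {}"
        then have lt: "l t \<in> U" using lU by blast
        from t obtain v where v: "v \<in> V" "moebius_point (l t) = moebius_point v"
          unfolding c moebius.chart_simps(1)[OF V(3)] \<gamma>_def by blast
        have nz: "l t \<noteq> 0" "v \<noteq> 0" using annulus_nonzero lt v(1) V(2) by blast+
        then have "l t = v \<or> l t = glide v" using v(2) by (simp add: moebius_point_eq_iff)
        then show "t \<in> A1 \<union> A2" using v(1) lt glide_glide[OF nz(2)] by (auto simp: A1_def A2_def)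
      qed
      from C1_differentiable_on_subset[OF C this] show ?thesis .
    qed
    have "piecewise_C1_curve TM AM \<gamma>"
      unfolding piecewise_C1_curve_def using path C1 by (intro conjI exI[of _ "{}"]) auto
    moreover have "\<gamma> 0 = moebius_point w" "\<gamma> 1 = moebius_point p" by (simp_all add: \<gamma>_def l_def)
    ultimately have "induced_dist TM AM immersion (moebius_point w) (moebius_point p) \<le> induced_length immersion \<gamma>"
      unfolding induced_dist_def by (intro INF_lower) auto
    also have "\<dots> \<le> (\<integral>\<^sup>+t\<in>{0..1::real}. ennreal \<epsilon> \<partial>lborel)"
      unfolding induced_length_def
    proof (rule nn_integral_mono)
      fix t :: real
      show "ennreal (norm (vector_derivative (immersion \<circ> \<gamma>) (at t))) * indicator {0..1} t \<le> ennreal \<epsilon> * indicator {0..1} t"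
      proof (cases "t \<in> {0..1}")
        case True
        have "(immersion \<circ> \<gamma> has_vector_derivative (\<chi> i. Re (null_vector (g (l t)) (\<eta> (l t)) i * (p - w)))) (at t)"
        proof (rule has_vector_derivative_transform_within_open[OF has_derivative_chain_vector[OF dl primitive_has_derivative[OF lU[OF True]]]])
          show "open (l -` U)" using cl by (intro open_vimage open_annulus)
          show "t \<in> l -` U" using lU[OF True] by simp
          show "Re_vec primitive (l s) = (immersion \<circ> \<gamma>) s" if "s \<in> l -` U" for s
            using immersion_moebius_point that by (simp add: \<gamma>_def)
        qed
        then have "norm (vector_derivative (immersion \<circ> \<gamma>) (at t)) = density (l t) * cmod (p - w)"
          by (simp only: vector_derivative_at norm_primitive_derivative)
        also have "\<dots> \<le> B * r"
        proof (rule mult_mono)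
          have "norm (density (l t)) \<le> B" by (rule B(2)) (use lB[OF True] in auto)
          then show "density (l t) \<le> B" by simp
          show "cmod (p - w) \<le> r" using w by (simp add: norm_minus_commute)
        qed (use B(1) in auto)
        finally show ?thesis using r(3) True by (simp add: ennreal_leI)
      qed simp
    qed
    also have "\<dots> = ennreal \<epsilon>" by (simp add: nn_integral_cmult_indicator)
    finally show "induced_dist TM AM immersion (moebius_point w) (moebius_point p) \<le> ennreal \<epsilon>" .
  qed
qed

text \<open>
  On a Cauchy sequence the controlled functions converge. Boundedness of the height keeps the points \<open>w n\<close> in a compact set, which contains a
  limit point \<open>p\<close>; sum and product of the orbits then converge to those of the orbit of \<open>p\<close>, so the
  orbits converge, and short segments join them to their limit.
\<close>

theorem complete_band: "complete_induced_metric TM AM immersion"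
  unfolding complete_induced_metric_def
proof (intro allI impI, elim conjE)
  fix \<sigma> :: "nat \<Rightarrow> complex set"
  assume ran: "range \<sigma> \<subseteq> topspace TM"
    and cau: "\<forall>e>0. \<exists>N. \<forall>m\<ge>N. \<forall>n\<ge>N. induced_dist TM AM immersion (\<sigma> m) (\<sigma> n) < e"
  have "\<forall>n. \<exists>w. w \<in> U \<and> \<sigma> n = moebius_point w" using ran unfolding moebius.topspace_orbit by blast
  then obtain w where w: "\<And>n. w n \<in> U" "\<And>n. \<sigma> n = moebius_point (w n)" by metis
  have Cau: "Cauchy (\<lambda>n. f (w n))" if "controlled f" for f
    using controlled_Cauchy[of f w, OF that w(1)] cau unfolding w(2) by simp
  let ?u = "\<lambda>n. ln (cmod (w n))"
  obtain M where M: "\<And>n. cmod (of_real (- ln (b\<^sup>2 - (?u n)\<^sup>2))) \<le> M"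
    using BseqE[OF Cauchy_Bseq[OF Cau[OF controlled_height]]] by metis
  define \<rho> where "\<rho> = sqrt (b\<^sup>2 - exp (- M))"
  have uM: "(?u n)\<^sup>2 \<le> b\<^sup>2 - exp (- M)" for n
  proof -
    have "\<bar>?u n\<bar> < \<bar>b\<bar>" using w(1)[of n] b_pos by (simp add: annulus_def)
    then have pos: "b\<^sup>2 - (?u n)\<^sup>2 > 0" using power2_strict_mono[of "?u n" b] by simp
    have "- M \<le> ln (b\<^sup>2 - (?u n)\<^sup>2)" using M[of n] unfolding norm_of_real by linarith
    then have "exp (- M) \<le> b\<^sup>2 - (?u n)\<^sup>2" using pos by (metis exp_le_cancel_iff exp_ln)
    then show ?thesis by linarith
  qed
  have u\<rho>: "\<bar>?u n\<bar> \<le> \<rho>" for n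
    unfolding \<rho>_def using real_sqrt_le_mono[OF uM[of n]] by simp
  have "\<rho> < sqrt (b\<^sup>2)" unfolding \<rho>_def by (rule real_sqrt_less_mono) simp
  then have \<rho>b: "\<rho> < b" using b_pos by simp
  define K where "K = cball (0::complex) (exp \<rho>) - ball 0 (exp (- \<rho>))"
  have Kiff: "z \<in> K \<longleftrightarrow> z \<noteq> 0 \<and> \<bar>ln (cmod z)\<bar> \<le> \<rho>" for z
  proof (cases "z = 0")
    case False
    then have "cmod z \<le> exp \<rho> \<longleftrightarrow> ln (cmod z) \<le> \<rho>" "exp (- \<rho>) \<le> cmod z \<longleftrightarrow> - \<rho> \<le> ln (cmod z)"
      using exp_le_cancel_iff[of "ln (cmod z)" \<rho>] exp_le_cancel_iff[of "- \<rho>" "ln (cmod z)"] by simp_all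
    then show ?thesis using False by (auto simp: K_def not_less)
  qed (simp add: K_def)
  have wK: "w n \<in> K" for n using u\<rho>[of n] annulus_nonzero[OF w(1)] unfolding Kiff by blast
  have KU: "K \<subseteq> U" using \<rho>b by (auto simp: Kiff annulus_def)
  have "seq_compact K" unfolding K_def by (intro compact_imp_seq_compact compact_diff) auto
  then obtain p k where p: "p \<in> K" "strict_mono k" "(w \<circ> k) \<longlonglongrightarrow> p" using wK by (metis seq_compactE)
  have pU: "p \<in> U" using p(1) KU by blast
  have lim: "(\<lambda>n. f (w n)) \<longlonglongrightarrow> f p" if cf: "controlled f" for f
  proof -
    obtain f' where "(f has_derivative f') (at p)" using cf pU unfolding controlled_def by blast
    then have "isCont f p" by (rule has_derivative_continuous)
    from isCont_tendsto_compose[OF this p(3)] have 1: "(\<lambda>n. f (w (k n))) \<longlonglongrightarrow> f p" by simp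
    obtain y where y: "(\<lambda>n. f (w n)) \<longlonglongrightarrow> y" using Cauchy_convergent[OF Cau[OF cf]] by (auto simp: convergent_def)
    from LIMSEQ_subseq_LIMSEQ[OF this p(2)] have "(\<lambda>n. f (w (k n))) \<longlonglongrightarrow> y" by (simp add: o_def)
    from LIMSEQ_unique[OF this 1] y show ?thesis by simp
  qed
  \<comment> \<open>Each w n is a root of the quadratic polynomial whose coefficients are the sum and the product of its orbit. Comparing with the
    polynomial of p shows that q n is small, so w n is near p or near glide p.\<close>
  define q where "q n = (w n - p) * (w n - glide p)" for n
  have qe: "q n = w n * ((w n + glide (w n)) - (p + glide p)) - (w n * glide (w n) - p * glide p)" for n
    by (simp add: q_def algebra_simps)
  have qle: "cmod (q n) \<le> exp \<rho> * cmod ((w n + glide (w n)) - (p + glide p)) + cmod (w n * glide (w n) - p * glide p)" for n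
    unfolding qe using wK[of n] by (intro order_trans[OF norm_triangle_ineq4] add_right_mono) (simp add: K_def norm_mult mult_right_mono)
  have "(\<lambda>n. exp \<rho> * cmod ((w n + glide (w n)) - (p + glide p)) + cmod (w n * glide (w n) - p * glide p)) \<longlonglongrightarrow>
      exp \<rho> * cmod ((p + glide p) - (p + glide p)) + cmod (p * glide p - p * glide p)"
    by (intro tendsto_intros lim[OF controlled_orbit_sum] lim[OF controlled_orbit_product])
  then have q0: "(\<lambda>n. cmod (q n)) \<longlonglongrightarrow> 0"
    by (intro tendsto_sandwich[OF _ _ tendsto_const, of 0 "\<lambda>n. cmod (q n)"]) (use qle in auto)
  have "(\<lambda>n. induced_dist TM AM immersion (\<sigma> n) (moebius_point p)) \<longlonglongrightarrow> 0"
  proof (rule order_tendstoI)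
    fix a :: ennreal assume a: "0 < a"
    then obtain y where y: "0 < y" "y < a" using dense by metis
    define \<epsilon> where "\<epsilon> = enn2real y"
    have "y < top" using y(2) less_le_trans[OF _ top_greatest] by blast
    then have \<epsilon>: "y = ennreal \<epsilon>" "\<epsilon> > 0" using y(1) by (auto simp: \<epsilon>_def enn2real_positive_iff)
    obtain r1 where r1: "r1 > 0" "\<And>v. cmod (v - p) < r1 \<Longrightarrow> induced_dist TM AM immersion (moebius_point v) (moebius_point p) \<le> ennreal \<epsilon>"
      using short_segments[OF pU \<epsilon>(2)] by metis
    obtain r2 where r2: "r2 > 0" "\<And>v. cmod (v - glide p) < r2 \<Longrightarrow> induced_dist TM AM immersion (moebius_point v) (moebius_point (glide p)) \<le> ennreal \<epsilon>"
      using short_segments[OF glide_annulus[OF pU] \<epsilon>(2)] by metis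
    have gp: "moebius_point (glide p) = moebius_point p" by (rule moebius_point_glide[OF annulus_nonzero[OF pU]])
    have "\<forall>\<^sub>F n in sequentially. cmod (q n) < r1 * r2"
      by (rule order_tendstoD(2)[OF q0]) (use r1(1) r2(1) in simp)
    then show "\<forall>\<^sub>F n in sequentially. induced_dist TM AM immersion (\<sigma> n) (moebius_point p) < a"
    proof eventually_elim
      case (elim n)
      have "cmod (w n - p) < r1 \<or> cmod (w n - glide p) < r2"
      proof (rule ccontr)
        assume "\<not> ?thesis"
        then have "r1 * r2 \<le> cmod (w n - p) * cmod (w n - glide p)" using r1(1) r2(1) by (intro mult_mono) auto
        then show False using elim by (simp add: q_def norm_mult)
      qed
      then have "induced_dist TM AM immersion (\<sigma> n) (moebius_point p) \<le> ennreal \<epsilon>"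
        using r1(2) r2(2) unfolding w(2) gp by blast
      then show ?case using y(2) unfolding \<epsilon>(1) by (rule le_less_trans)
    qed
  qed simp
  then show "\<exists>p\<in>topspace TM. (\<lambda>n. induced_dist TM AM immersion (\<sigma> n) p) \<longlonglongrightarrow> 0"
    unfolding moebius.topspace_orbit using pU by blast
qed

end

section \<open>The surface\<close>

theorem proposition3p5:
  shows "\<exists>(T' :: complex set topology) A' (X :: complex set \<Rightarrow> real ^ 4)
           (T :: complex set topology) A \<pi> I g\<^sub>1 g\<^sub>2.
     nonorientable_minimal_surface T' A' X \<and>
     complete_induced_metric T' A' X \<and>
     nonflat A' X \<and>
     orientable_double_cover T A T' A' \<pi> I \<and>
     generalized_Gauss_map A \<pi> X (g\<^sub>1, g\<^sub>2) \<and>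
     \<not> g\<^sub>1 constant_on topspace T' \<and>
     \<not> g\<^sub>2 constant_on topspace T' \<and>
     omits_two_points T' g\<^sub>1 \<and>
     omits_two_points T' g\<^sub>2"
proof (rule annulus_weierstrass_data)
  fix b c :: real and F1 F2 F4 g \<eta> :: "complex \<Rightarrow> complex"
  assume data: "b > 0" "c > 0" "g holomorphic_on annulus b" "\<eta> holomorphic_on annulus b"
      "\<And>w. w \<in> annulus b \<Longrightarrow> \<eta> w \<noteq> 0 \<and> g w \<noteq> 0 \<and> (g w)\<^sup>2 \<noteq> 1"
      "\<And>w. w \<in> annulus b \<Longrightarrow> (F1 has_field_derivative (1 + (g w)\<^sup>2) * \<eta> w) (at w)"
      "\<And>w. w \<in> annulus b \<Longrightarrow> (F2 has_field_derivative \<i> * (1 - (g w)\<^sup>2) * \<eta> w) (at w)"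
      "\<And>w. w \<in> annulus b \<Longrightarrow> (F4 has_field_derivative - 2 * \<i> * g w * \<eta> w) (at w)"
      "\<And>w. w \<in> annulus b \<Longrightarrow> Re (F1 (glide w)) = Re (F1 w) \<and> Re (F2 (glide w)) = Re (F2 w) \<and> Re (F4 (glide w)) = Re (F4 w)"
      "\<And>w. w \<in> annulus b \<Longrightarrow> g (glide w) = glide (g w)"
      "\<And>w. w \<in> annulus b \<Longrightarrow> c / (b - \<bar>ln (cmod w)\<bar>) \<le> (1 + (cmod (g w))\<^sup>2) * cmod (\<eta> w)"
  interpret weierstrass_band b c F1 F2 F4 g \<eta> by unfold_locales (fact data)+
  have "nonorientable_minimal_surface TM AM immersion"
    unfolding nonorientable_minimal_surface_def using nonorientable_band conformal_minimal_immersion_band by blast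
  then show ?thesis
    using complete_band nonflat_band orientable_double_cover_band generalized_Gauss_map_band gauss_map_not_constant gauss_map_omits
    by (intro exI conjI) assumption+
qed

end
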